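(* Let $g:X\to\mathbb{R}^d$ and $f:X\to\mathbb{R}^p$ be measurable. Suppose that: (i) each $\Pi_k$ ($k=1,\dots,K$) is $\pi$-stationary; (ii) there is a probability measure $\psi$ on $(X,\mathscr{X})$ such that for each $k=1,\dots,K$, each $A\in\mathscr{X}$ with $\psi(A)>0$ and each $x\in X$ there is a positive integer $t$ with $P_k^{Kt}(x,A)>0$; (iii) for $k=1,\dots,K$ there are sets $D_k\in\mathscr{X}$ that are small with respect to $P_k^K$, constants $\lambda_k<1$ and $b_k<\infty$, and functions $W_k:X\to[1,\infty)$ with $P_k^KW_k(x)\le \lambda_kW_k(x)+b_kI_{D_k}(x)$; (iv) each composition kernel $P_k^K$ is aperiodic; (v) $\int\pi(dx)W_k^2(x)<\infty$ for each $k$; (vi) $|a^Tg(x)|\le W_k(x)$ for all $x\in X$, all $k$ and all $a\in\mathbb{R}^d$ with $\|a\|_2\le 1$; (vii) $\int\pi(dx)g(x)=0$; (viii) $\int\pi(dx)f^Tf<\infty$, and $f(x)^Tf(x)<\infty$ for all $x\in X$. Let $C_1,\dots,C_K$ be fixed $p\times d$ matrices of weights, let $\{X_t\}_{t\ge0}$ be the deterministic sweep chain with arbitrary initial law $\nu$, and let $$S_M=\sum_{t=0}^{M-1}\Big[g(X_t)-C_{\sigma^t(1)}^Tf(X_t)+C_{\sigma^{t+1}(1)}^T\Pi_{\sigma^t(1)}f(X_t)\Big].$$ Then, as $M\to\infty$, $M^{-1/2}S_M$ converges in distribution to a random $d$-vector $Z$ with characteristic function $t\mapsto\exp\{-t^T\Sigma_Ct/2\}$,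 where $$\Sigma_C=\int\pi(dx)gg^T+K^{-1}\sum_{k=1}^K\sum_{t=1}^\infty\int\pi(dx)\{g(P_k^tg)^T+(P_k^tg)g^T\}+K^{-1}\sum_{k=1}^K\big\{C_{\sigma(k)}^TU_kC_{\sigma(k)}-C_{\sigma(k)}^TV_k-V_k^TC_{\sigma(k)}\big\}.$$ Moreover $\Sigma_C$ is minimized (in the positive semidefinite order) at $C_{\sigma(k)}=\tilde C_{\sigma(k)}$, where $\tilde C_{\sigma(k)}=U_k^\dagger V_k$, $k=1,\dots,K$.
   Context: $\mathbb{R}$ denotes the extended real line $[-\infty,\infty]$. $X$ is a complete separable metric space with Borel $\sigma$-algebra $\mathscr{X}$, $\pi$ is a probability measure on $(X,\mathscr{X})$, $K\ge1$ is an integer and $\Pi_1,\dots,\Pi_K:X\times\mathscr{X}\to[0,1]$ are probability kernels. A kernel $\Pi$ is $\pi$-stationary if $\pi(A)=\int\pi(dx)\Pi(x,A)$ for all $A\in\mathscr{X}$. For a function $u$, $\Pi u(x)=\int\Pi(x,dy)u(y)$ (elementwise for vector or matrix valued $u$). $I_A$ is the indicator function of $A$. $\sigma:\{1,\dots,K\}\to\{1,\dots,K\}$ is the cyclic permutation $\sigma(k)=k+1$ for $k<K$, $\sigma(K)=1$; $\sigma^t$ is its $t$-fold iterate. $P_k^0u=u$, $P_k^tu=\Pi_{\sigma^0(k)}\Pi_{\sigma^1(k)}\cdots\Pi_{\sigma^{t-1}(k)}u$ for $t\ge1$, and $P_k^t(x,A)=P_k^tI_A(x)$. A set $D\in\mathscr{X}$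 is small with respect to a probability kernel $P$ if there are an $m>0$ and a non-trivial measure $\nu_m$ on $(X,\mathscr{X})$ with $P^m(x,B)\ge\nu_m(B)$ for all $x\in D$, $B\in\mathscr{X}$. The kernel $P_k^K$ is aperiodic if $n=1$ is the largest integer for which there exist disjoint sets $E_1,\dots,E_n\in\mathscr{X}$ with $P_k^K(x,E_{i+1})=1$ for $x\in E_i$ (indices mod $n$) and $\psi\{(\cup_iE_i)^c\}=0$, where $\psi$ is the irreducibility measure. The deterministic sweep chain with initial law $\nu$ is the Markov chain with $X_0\sim\nu$ and, given $X_0,\dots,X_t$, $X_{t+1}\sim\Pi_{\sigma^t(1)}(X_t,\cdot)$. Under hypotheses (i)–(vii), the functions $\hat g_k=\sum_{t=0}^\infty P_k^tg$ are well defined $\pi$-a.e. and square integrable with respect to $\pi$. Define $$U_k=\int\pi(dx)\{ff^T-(\Pi_kf)(\Pi_kf)^T\},\qquad V_k=\int\pi(dx)\{f\hat g_{\sigma(k)}^T-(\Pi_kf)(\Pi_k\hat g_{\sigma(k)})^T\}.$$ $A^\dagger$ is the pseudoinverse of $A$. For positive semidefinite matrices, $A\ge B$ means $A-B$ is positive semidefinite. *)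

theory Defs
  imports "HOL-Probability.Probability"
begin

section \<open>Kernels\<close>

text \<open>A probability kernel on \<open>'a\<close> is an element of \<open>borel \<rightarrow>\<^sub>M prob_algebra borel\<close>.\<close>

definition stationary_kernel ::
  "'a::topological_space measure \<Rightarrow> ('a \<Rightarrow> 'a measure) \<Rightarrow> bool" where
  "stationary_kernel \<pi> P \<longleftrightarrow>
     (\<forall>A\<in>sets borel. emeasure \<pi> A = (\<integral>\<^sup>+ x. emeasure (P x) A \<partial>\<pi>))"

text \<open>The Bochner integral is \<open>0\<close> at points \<open>x\<close> where \<open>u\<close> is not \<open>P x\<close>-integrable.\<close>

definition kernel_app :: "('a \<Rightarrow> 'a measure) \<Rightarrow> ('a \<Rightarrow> 'b::{banach, second_countable_topology}) \<Rightarrow> 'a \<Rightarrow> 'b" where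
  "kernel_app P u x = (\<integral>y. u y \<partial>(P x))"

primrec kernel_prod ::
  "('a::topological_space \<Rightarrow> 'a measure) list \<Rightarrow> 'a \<Rightarrow> 'a measure" where
  "kernel_prod [] = return borel"
| "kernel_prod (P # Ps) = (\<lambda>x. P x \<bind> kernel_prod Ps)"

definition kernel_pow :: "('a::topological_space \<Rightarrow> 'a measure) \<Rightarrow> nat \<Rightarrow> 'a \<Rightarrow> 'a measure" where
  "kernel_pow P m = kernel_prod (replicate m P)"

lemma kernel_prod_measurable:
  assumes "\<And>P. P \<in> set Ps \<Longrightarrow> P \<in> borel \<rightarrow>\<^sub>M prob_algebra borel"
  shows "kernel_prod Ps \<in> borel \<rightarrow>\<^sub>M prob_algebra (borel :: 'a::topological_space measure)"
  using assms
proof (induction Ps)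
  case Nil
  show ?case by (simp add: measurable_return_prob_space)
next
  case (Cons P Ps)
  have "P \<in> borel \<rightarrow>\<^sub>M prob_algebra borel" "kernel_prod Ps \<in> borel \<rightarrow>\<^sub>M prob_algebra borel"
    using Cons by auto
  then show ?case by (simp add: measurable_bind_prob_space)
qed

text \<open>The product kernel acts on functions as the composition of the operators.\<close>

lemma nn_integral_kernel_prod_Cons:
  fixes u :: "'a::topological_space \<Rightarrow> ennreal"
  assumes P: "P \<in> borel \<rightarrow>\<^sub>M prob_algebra borel"
    and Ps: "\<And>P. P \<in> set Ps \<Longrightarrow> P \<in> borel \<rightarrow>\<^sub>M prob_algebra borel"
    and u: "u \<in> borel_measurable borel"
  shows "(\<integral>\<^sup>+ z. u z \<partial>(kernel_prod (P # Ps) x)) =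
         (\<integral>\<^sup>+ y. (\<integral>\<^sup>+ z. u z \<partial>(kernel_prod Ps y)) \<partial>(P x))"
proof -
  have "P x \<in> space (prob_algebra borel)"
    using P by (auto dest: measurable_space)
  then have "sets (P x) = sets borel" by (simp add: space_prob_algebra)
  then have "kernel_prod Ps \<in> P x \<rightarrow>\<^sub>M subprob_algebra borel"
    using measurable_prob_algebraD[OF kernel_prod_measurable[OF Ps]]
    by (simp cong: measurable_cong_sets)
  then show ?thesis using u by (simp add: nn_integral_bind)
qed

definition small_set :: "('a::topological_space \<Rightarrow> 'a measure) \<Rightarrow> 'a set \<Rightarrow> bool" where
  "small_set P D \<longleftrightarrow> D \<in> sets borel \<and>
     (\<exists>m>0. \<exists>\<nu>. sets \<nu> = sets borel \<and> emeasure \<nu> UNIV \<noteq> 0 \<and>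
        (\<forall>x\<in>D. \<forall>B\<in>sets borel. emeasure (kernel_pow P m x) B \<ge> emeasure \<nu> B))"

definition kernel_cycle ::
  "('a::topological_space \<Rightarrow> 'a measure) \<Rightarrow> 'a measure \<Rightarrow> nat \<Rightarrow> (nat \<Rightarrow> 'a set) \<Rightarrow> bool" where
  "kernel_cycle P \<psi> n E \<longleftrightarrow> n \<ge> 1 \<and>
     (\<forall>i<n. E i \<in> sets borel) \<and> disjoint_family_on E {..<n} \<and>
     (\<forall>i<n. \<forall>x\<in>E i. emeasure (P x) (E (Suc i mod n)) = 1) \<and>
     emeasure \<psi> (- (\<Union>i<n. E i)) = 0"

definition aperiodic_kernel :: "('a::topological_space \<Rightarrow> 'a measure) \<Rightarrow> 'a measure \<Rightarrow> bool" where
  "aperiodic_kernel P \<psi> \<longleftrightarrow>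
     (\<exists>E. kernel_cycle P \<psi> 1 E) \<and> (\<forall>n. (\<exists>E. kernel_cycle P \<psi> n E) \<longrightarrow> n \<le> 1)"

section \<open>Deterministic sweeps\<close>

definition sweep_next :: "nat \<Rightarrow> nat \<Rightarrow> nat" where
  "sweep_next K k = (if k < K then k + 1 else 1)"

definition sweep_kernel ::
  "nat \<Rightarrow> (nat \<Rightarrow> 'a::topological_space \<Rightarrow> 'a measure) \<Rightarrow> nat \<Rightarrow> nat \<Rightarrow> 'a \<Rightarrow> 'a measure" where
  "sweep_kernel K Q k t = kernel_prod (map (\<lambda>s. Q ((sweep_next K ^^ s) k)) [0..<t])"

text \<open>The sub-\<open>\<sigma>\<close>-algebra generated by \<open>X 0, \<dots>, X t\<close>.\<close>

definition history :: "'w measure \<Rightarrow> (nat \<Rightarrow> 'w \<Rightarrow> 'a::topological_space) \<Rightarrow> nat \<Rightarrow> 'w measure" where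
  "history M X t =
     vimage_algebra (space M) (\<lambda>w. \<lambda>i\<in>{..t}. X i w) (Pi\<^sub>M {..t} (\<lambda>_. borel))"

definition sweep_chain ::
  "'w measure \<Rightarrow> nat \<Rightarrow> (nat \<Rightarrow> 'a::topological_space \<Rightarrow> 'a measure) \<Rightarrow> 'a measure
    \<Rightarrow> (nat \<Rightarrow> 'w \<Rightarrow> 'a) \<Rightarrow> bool" where
  "sweep_chain M K Q \<nu> X \<longleftrightarrow> prob_space M \<and>
     (\<forall>t. X t \<in> borel_measurable M) \<and>
     distr M borel (X 0) = \<nu> \<and>
     (\<forall>t. \<forall>B\<in>sets borel. AE w in M.
        real_cond_exp M (history M X t) (\<lambda>w. indicator B (X (Suc t) w)) w
          = measure (Q ((sweep_next K ^^ t) 1) (X t w)) B)"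

section \<open>Matrices\<close>

definition outer :: "real^'n \<Rightarrow> real^'m \<Rightarrow> real^'m^'n" where
  "outer u v = (\<chi> i j. u $ i * v $ j)"

definition is_pseudoinverse :: "real^'n^'m \<Rightarrow> real^'m^'n \<Rightarrow> bool" where
  "is_pseudoinverse A B \<longleftrightarrow>
     A ** B ** A = A \<and> B ** A ** B = B \<and>
     transpose (A ** B) = A ** B \<and> transpose (B ** A) = B ** A"

definition pseudoinverse :: "real^'n^'m \<Rightarrow> real^'m^'n" where
  "pseudoinverse A = (THE B. is_pseudoinverse A B)"

definition pos_semidef :: "real^'n^'n \<Rightarrow> bool" where
  "pos_semidef A \<longleftrightarrow> transpose A = A \<and> (\<forall>x. 0 \<le> x \<bullet> (A *v x))"

definition loewner_le :: "real^'n^'n \<Rightarrow> real^'n^'n \<Rightarrow> bool" where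
  "loewner_le B A \<longleftrightarrow> pos_semidef (A - B)"

section \<open>Convergence in distribution of random vectors\<close>

definition weakly_converges ::
  "(nat \<Rightarrow> 'b::topological_space measure) \<Rightarrow> 'b measure \<Rightarrow> bool" where
  "weakly_converges \<mu>s \<mu> \<longleftrightarrow>
     (\<forall>h :: 'b \<Rightarrow> real. continuous_on UNIV h \<and> bounded (range h) \<longrightarrow>
        (\<lambda>n. \<integral>z. h z \<partial>(\<mu>s n)) \<longlonglongrightarrow> (\<integral>z. h z \<partial>\<mu>))"

definition vec_char :: "'b::euclidean_space measure \<Rightarrow> 'b \<Rightarrow> complex" where
  "vec_char \<mu> t = (CLINT z|\<mu>. iexp (t \<bullet> z))"

section \<open>Control variates for deterministic sweeps\<close>

definition ghat ::
  "nat \<Rightarrow> (nat \<Rightarrow> 'a::topological_space \<Rightarrow> 'a measure) \<Rightarrow> ('a \<Rightarrow> real^'d) \<Rightarrow> nat \<Rightarrow> 'a \<Rightarrow> real^'d" where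
  "ghat K Q g k x = (\<Sum>t. kernel_app (sweep_kernel K Q k t) g x)"

definition U_mat ::
  "'a::topological_space measure \<Rightarrow> (nat \<Rightarrow> 'a \<Rightarrow> 'a measure) \<Rightarrow> ('a \<Rightarrow> real^'p) \<Rightarrow> nat \<Rightarrow> real^'p^'p" where
  "U_mat \<pi> Q f k =
     (\<integral>x. (outer (f x) (f x) - outer (kernel_app (Q k) f x) (kernel_app (Q k) f x)) \<partial>\<pi>)"

definition V_mat ::
  "'a::topological_space measure \<Rightarrow> nat \<Rightarrow> (nat \<Rightarrow> 'a \<Rightarrow> 'a measure) \<Rightarrow> ('a \<Rightarrow> real^'d) \<Rightarrow>
    ('a \<Rightarrow> real^'p) \<Rightarrow> nat \<Rightarrow> real^'d^'p" where
  "V_mat \<pi> K Q g f k =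
     (\<integral>x. (outer (f x) (ghat K Q g (sweep_next K k) x)
        - outer (kernel_app (Q k) f x) (kernel_app (Q k) (ghat K Q g (sweep_next K k)) x)) \<partial>\<pi>)"

definition autocov ::
  "'a::topological_space measure \<Rightarrow> nat \<Rightarrow> (nat \<Rightarrow> 'a \<Rightarrow> 'a measure) \<Rightarrow> ('a \<Rightarrow> real^'d) \<Rightarrow>
    nat \<Rightarrow> nat \<Rightarrow> real^'d^'d" where
  "autocov \<pi> K Q g k t =
     (\<integral>x. (outer (g x) (kernel_app (sweep_kernel K Q k t) g x)
        + outer (kernel_app (sweep_kernel K Q k t) g x) (g x)) \<partial>\<pi>)"

definition asymp_cov ::
  "'a::topological_space measure \<Rightarrow> nat \<Rightarrow> (nat \<Rightarrow> 'a \<Rightarrow> 'a measure) \<Rightarrow> ('a \<Rightarrow> real^'d) \<Rightarrow>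
    ('a \<Rightarrow> real^'p) \<Rightarrow> (nat \<Rightarrow> real^'d^'p) \<Rightarrow> real^'d^'d" where
  "asymp_cov \<pi> K Q g f C =
     (\<integral>x. outer (g x) (g x) \<partial>\<pi>)
     + (1 / real K) *\<^sub>R (\<Sum>k=1..K. \<Sum>t. autocov \<pi> K Q g k (Suc t))
     + (1 / real K) *\<^sub>R (\<Sum>k=1..K.
          transpose (C (sweep_next K k)) ** U_mat \<pi> Q f k ** C (sweep_next K k)
          - transpose (C (sweep_next K k)) ** V_mat \<pi> K Q g f k
          - transpose (V_mat \<pi> K Q g f k) ** C (sweep_next K k))"

definition cv_sum ::
  "nat \<Rightarrow> (nat \<Rightarrow> 'a \<Rightarrow> 'a measure) \<Rightarrow> ('a \<Rightarrow> real^'d) \<Rightarrow> ('a \<Rightarrow> real^'p) \<Rightarrow>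
    (nat \<Rightarrow> real^'d^'p) \<Rightarrow> (nat \<Rightarrow> 'w \<Rightarrow> 'a) \<Rightarrow> nat \<Rightarrow> 'w \<Rightarrow> real^'d" where
  "cv_sum K Q g f C X n w =
     (\<Sum>t<n. g (X t w)
        - transpose (C ((sweep_next K ^^ t) 1)) *v f (X t w)
        + transpose (C ((sweep_next K ^^ (t + 1)) 1))
            *v kernel_app (Q ((sweep_next K ^^ t) 1)) f (X t w))"

end

theory Submission
  imports Defs
begin

text \<open>
  Let \<open>P\<close> be the kernel of a full sweep. Aperiodicity makes the small set small for all large powers
  of \<open>P\<close>, the drift condition turns this into a minorization on every sublevel set of \<open>W\<close>, and the
  weighted contraction argument of Hairer and Mattingly yields a geometric bound, proportional to \<open>W\<close>, for
  the distance of \<open>P\<^sup>n u\<close> to its \<open>\<pi>\<close>-mean, uniformly in \<open>\<bar>u\<bar> \<le> W\<close>. Hence \<open>ghat\<close> solves the Poisson equation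
  in \<open>L\<^sup>2\<close> of \<open>\<pi>\<close>, and up to telescoping the summands are martingale increments of the functions
  \<open>h\<^sub>k = ghat\<^sub>k - C\<^sub>k\<^sup>T f\<close>.

  The central limit theorem is first proved under \<open>\<pi>\<close> for scalar projections, without a path space: the
  characteristic function of the martingale is \<open>\<integral> T\<^sub>0 (T\<^sub>1 (\<dots> 1)) d\<pi>\<close> for twisted kernel operators \<open>T\<^sub>j\<close> that
  contract \<open>L\<^sup>1\<close> of \<open>\<pi>\<close>. Lindeberg's replacement argument applies to them because, by mixing, the
  conditional variance at time \<open>j\<close> is nearly independent of the path up to time \<open>j - m\<close>. An arbitrary
  initial law is handled by discarding finitely many summands and using convergence in total variation.

  All covariances are forms \<open>\<integral> (u w - (Q u) (Q w)) d\<pi>\<close>. These are positive semidefinite, so the Cauchy-Schwarz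
  inequality puts the range of \<open>V\<^sub>k\<close> inside that of \<open>U\<^sub>k\<close>, and completing the square gives the minimum.
\<close>

section \<open>Probability kernels\<close>

text \<open>The Poisson equation, and with it the martingale decomposition, holds only outside a
  \<open>\<pi>\<close>-null set, since the iterates of \<open>g\<close> are bounded through means of
  \<open>W\<close> over incomplete sweeps, which exist only almost everywhere. An arbitrary initial
  law may charge that null set, and \<open>f\<close> need not be integrable under it.

  The functions \<open>h\<close> are merely square integrable, so conditional variances are merely
  integrable, whereas mixing is available for bounded functions; truncation bridges the gap. Mixing
  also concerns the plain kernels, so the last \<open>m\<close> twists are first removed at a cost
  of order \<open>m * \<bar>e\<bar>\<close>. This error enters each step multiplied by
  \<open>e\<^sup>2\<close> and vanishes after summation over about \<open>1 / e\<^sup>2\<close>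
  steps.

  The measure attached to a small set need not charge that set. Since every point reaches the set, a
  push-forward under a power of the kernel repairs this, and only then do return times make
  sense.\<close>

abbreviation (input) pkernel :: "('a::topological_space \<Rightarrow> 'a measure) \<Rightarrow> bool" where
  "pkernel P \<equiv> P \<in> borel \<rightarrow>\<^sub>M prob_algebra borel"

lemma pkernel_prob_space: "pkernel P \<Longrightarrow> prob_space (P x)"
  by (drule measurable_space[where x=x]) (auto simp: space_prob_algebra)

lemma pkernel_sets: "pkernel P \<Longrightarrow> sets (P x) = sets borel"
  by (drule measurable_space[where x=x]) (auto simp: space_prob_algebra)

lemma pkernel_borel_measurable:
  "pkernel P \<Longrightarrow> u \<in> borel_measurable borel \<Longrightarrow> u \<in> borel_measurable (P x)"
  using pkernel_sets[of P x] by (simp cong: measurable_cong_sets)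

lemma pkernel_nn_integral_measurable:
  "pkernel P \<Longrightarrow> u \<in> borel_measurable borel \<Longrightarrow> (\<lambda>x. \<integral>\<^sup>+y. u y \<partial>P x) \<in> borel_measurable borel"
  by (drule measurable_prob_algebraD)
     (rule measurable_compose[OF _ nn_integral_measurable_subprob_algebra])

lemma pkernel_emeasure_measurable:
  "pkernel P \<Longrightarrow> A \<in> sets borel \<Longrightarrow> (\<lambda>x. emeasure (P x) A) \<in> borel_measurable borel"
  by (drule measurable_prob_algebraD)
     (rule measurable_compose[OF _ measurable_emeasure_subprob_algebra])

lemma kernel_app_measurable:
  fixes u :: "'a::topological_space \<Rightarrow> 'b::{banach, second_countable_topology}"
  shows "pkernel P \<Longrightarrow> u \<in> borel_measurable borel \<Longrightarrow> kernel_app P u \<in> borel_measurable borel"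
  unfolding kernel_app_def
  by (drule measurable_prob_algebraD)
     (rule measurable_compose[OF _ integral_measurable_subprob_algebra])

text \<open>Holds at every point, since where \<open>u\<close> fails to be integrable the left side
  is the default value 0.\<close>

lemma norm_kernel_app_le:
  "ennreal (norm (kernel_app P u x)) \<le> (\<integral>\<^sup>+y. ennreal (norm (u y)) \<partial>P x)"
proof (cases "integrable (P x) u")
  case True
  then show ?thesis unfolding kernel_app_def by (rule integral_norm_bound_ennreal)
qed (simp add: kernel_app_def not_integrable_integral_eq)

lemma norm_kernel_app_bound:
  assumes P: "pkernel P" and u: "\<And>y. norm (u y) \<le> B"
  shows "norm (kernel_app P u x) \<le> B"
proof -
  interpret prob_space "P x" using P by (rule pkernel_prob_space)
  have B: "0 \<le> B" using norm_ge_zero u order_trans by blast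
  have "ennreal (norm (kernel_app P u x)) \<le> (\<integral>\<^sup>+y. ennreal B \<partial>P x)"
    by (rule order_trans[OF norm_kernel_app_le]) (intro nn_integral_mono ennreal_leI u)
  then show ?thesis using B by (simp add: emeasure_space_1)
qed

lemma pkernel_bounded_integrable:
  fixes u :: "'a::topological_space \<Rightarrow> 'b::{banach, second_countable_topology}"
  assumes P: "pkernel P" and "u \<in> borel_measurable borel" "\<And>y. norm (u y) \<le> B"
  shows "integrable (P x) u"
proof -
  interpret prob_space "P x" using P by (rule pkernel_prob_space)
  show ?thesis
    by (rule integrable_const_bound[where B=B]) (simp_all add: assms(3) pkernel_borel_measurable[OF P assms(2)])
qed

text \<open>\<open>N\<close> will be the stationary law, a row \<open>P x\<close> of a kernel, a law
  of the chain or a minorizing measure, so only its measurable sets are fixed.\<close>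

locale kernel_bind =
  fixes N :: "'a::topological_space measure" and R :: "'a \<Rightarrow> 'a measure"
  assumes sets_N: "sets N = sets borel" and R: "pkernel R"
begin

lemma borel_N: "u \<in> borel_measurable borel \<longleftrightarrow> u \<in> borel_measurable N"
  using sets_N by (simp cong: measurable_cong_sets)

lemmas meas_N = borel_N[THEN iffD1]

lemma R_subprob: "R \<in> N \<rightarrow>\<^sub>M subprob_algebra borel"
  using measurable_prob_algebraD[OF R] sets_N by (simp cong: measurable_cong_sets)

lemma sets_bind_N: "sets (N \<bind> R) = sets borel"
proof -
  have "space N \<noteq> {}" using sets_eq_imp_space_eq[OF sets_N] by simp
  then show ?thesis by (intro sets_bind) (auto simp: pkernel_sets[OF R])
qed

lemma R_meas: "u \<in> borel_measurable borel \<Longrightarrow> u \<in> borel_measurable (R x)"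
  by (rule pkernel_borel_measurable[OF R])

lemma nn_integral_bind_N:
  "u \<in> borel_measurable borel \<Longrightarrow> (\<integral>\<^sup>+y. u y \<partial>(N \<bind> R)) = (\<integral>\<^sup>+x. \<integral>\<^sup>+y. u y \<partial>R x \<partial>N)"
  by (rule nn_integral_bind[OF _ R_subprob])

text \<open>Tonelli for \<open>norm u\<close>: a finite double integral forces the inner one to be
  finite almost everywhere.\<close>

lemma AE_integrable_bind:
  fixes u :: "'a \<Rightarrow> 'b::{banach, second_countable_topology}"
  assumes "integrable (N \<bind> R) u"
  shows "AE x in N. integrable (R x) u"
proof -
  have u: "u \<in> borel_measurable borel"
    using borel_measurable_integrable[OF assms] sets_bind_N by (simp cong: measurable_cong_sets)
  have "(\<integral>\<^sup>+x. \<integral>\<^sup>+y. norm (u y) \<partial>R x \<partial>N) < \<infinity>"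
    using assms u by (simp add: integrable_iff_bounded nn_integral_bind_N)
  then have "AE x in N. (\<integral>\<^sup>+y. norm (u y) \<partial>R x) \<noteq> \<infinity>"
    using u R by (intro nn_integral_PInf_AE)
      (auto intro!: pkernel_nn_integral_measurable[THEN borel_N[THEN iffD1]])
  then show ?thesis
    by eventually_elim
       (use u in \<open>auto simp: integrable_iff_bounded top.not_eq_extremum intro: R_meas\<close>)
qed

text \<open>Fubini for kernels, by induction over integrable functions. Points where the inner
  integral does not exist, and \<open>kernel_app\<close> is 0 by default, are negligible by the
  preceding lemma.\<close>

lemma integral_bind_N:
  fixes u :: "'a \<Rightarrow> 'b::{banach, second_countable_topology}"
  assumes "integrable (N \<bind> R) u"
  shows "integrable N (kernel_app R u) \<and> (\<integral>x. u x \<partial>(N \<bind> R)) = (\<integral>x. kernel_app R u x \<partial>N)"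
  using assms
proof (induction rule: integrable_induct)
  case (base A c)
  then have A: "A \<in> sets borel" by (simp add: sets_bind_N)
  have fin: "(\<integral>\<^sup>+x. emeasure (R x) A \<partial>N) < \<infinity>"
    using base A nn_integral_bind_N[of "indicator A"] by (simp add: sets_bind_N pkernel_sets[OF R])
  have m: "(\<lambda>x. measure (R x) A) \<in> borel_measurable N"
    using pkernel_emeasure_measurable[OF R A] by (simp add: borel_N measure_def)
  have e: "ennreal (measure (R x) A) = emeasure (R x) A" for x
    using prob_space.finite_measure[OF pkernel_prob_space[OF R]]
    by (simp add: finite_measure.emeasure_eq_measure)
  have int: "integrable N (\<lambda>x. measure (R x) A)"
    using m fin by (intro integrableI_bounded) (simp_all add: e)
  have k: "kernel_app R (\<lambda>x. indicat_real A x *\<^sub>R c) = (\<lambda>x. measure (R x) A *\<^sub>R c)"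
  proof
    fix x
    interpret prob_space "R x" using R by (rule pkernel_prob_space)
    show "kernel_app R (\<lambda>x. indicat_real A x *\<^sub>R c) x = measure (R x) A *\<^sub>R c"
      using A unfolding kernel_app_def by (subst integral_scaleR_left) (auto simp: pkernel_sets[OF R] emeasure_finite less_top[symmetric])
  qed
  have "ennreal (measure (N \<bind> R) A) = (\<integral>\<^sup>+x. emeasure (R x) A \<partial>N)"
    using base A nn_integral_bind_N[of "indicator A"]
    by (simp add: sets_bind_N pkernel_sets[OF R] measure_def)
  also have "\<dots> = ennreal (\<integral>x. measure (R x) A \<partial>N)"
    using int by (subst nn_integral_eq_integral[symmetric]) (auto simp: e)
  finally have "measure (N \<bind> R) A = (\<integral>x. measure (R x) A \<partial>N)" by simp
  then show ?case using int base unfolding k by (auto simp: sets_bind_N)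
next
  case (add f g)
  have ae: "AE x in N. kernel_app R f x + kernel_app R g x = kernel_app R (\<lambda>x. f x + g x) x"
    using AE_integrable_bind[OF add(1)] AE_integrable_bind[OF add(2)]
    by eventually_elim (simp add: kernel_app_def)
  have m: "kernel_app R (\<lambda>x. f x + g x) \<in> borel_measurable N"
    using borel_measurable_integrable[OF add(1)] borel_measurable_integrable[OF add(2)] sets_bind_N
    by (subst borel_N[symmetric], intro kernel_app_measurable[OF R]) (simp cong: measurable_cong_sets)
  have m': "(\<lambda>x. kernel_app R f x + kernel_app R g x) \<in> borel_measurable N"
    using add by (intro borel_measurable_add borel_measurable_integrable) auto
  have "integrable N (\<lambda>x. kernel_app R f x + kernel_app R g x)" using add by auto
  then show ?case
    using add integrable_cong_AE[OF m' m ae] integral_cong_AE[OF m' m ae] by simp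
next
  case (lim f s)
  have sm: "s i \<in> borel_measurable borel" for i
    using borel_measurable_integrable[OF lim(1)] sets_bind_N by (simp cong: measurable_cong_sets)
  have fm: "f \<in> borel_measurable borel"
    using borel_measurable_integrable[OF lim(4)] sets_bind_N by (simp cong: measurable_cong_sets)
  have sp: "space (N \<bind> R) = UNIV" using sets_eq_imp_space_eq[OF sets_bind_N] by simp
  have aef: "AE x in N. integrable (R x) f" using AE_integrable_bind[OF lim(4)] .
  have conv: "AE x in N. (\<lambda>i. kernel_app R (s i) x) \<longlonglongrightarrow> kernel_app R f x"
    using aef
  proof eventually_elim
    case (elim x)
    show ?case unfolding kernel_app_def
      using lim(2,3) elim
      by (intro integral_dominated_convergence[where w="\<lambda>y. 2 * norm (f y)"])
         (auto simp: sp intro!: R_meas sm fm)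
  qed
  \<comment> \<open>The induction principle supplies \<open>norm (s i) \<le> 2 * norm f\<close>.
    Inside \<open>R x\<close> this dominates for almost every \<open>x\<close>; its kernel average
    \<open>w\<close> dominates the outer integrals.\<close>
  define w where "w x = (\<integral>y. 2 * norm (f y) \<partial>R x)" for x
  have fin: "(\<integral>\<^sup>+x. \<integral>\<^sup>+y. norm (f y) \<partial>R x \<partial>N) < \<infinity>"
    using lim(4) fm by (simp add: integrable_iff_bounded nn_integral_bind_N)
  have wm: "w \<in> borel_measurable N"
    using meas_N[OF kernel_app_measurable[OF R, of "\<lambda>y. 2 * norm (f y)"]] fm
    unfolding w_def kernel_app_def by simp
  have w0: "w x \<ge> 0" for x unfolding w_def by (intro integral_nonneg_AE) auto
  have wi: "integrable N w"
  proof (rule integrableI_bounded[OF wm])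
    have "(\<integral>\<^sup>+x. ennreal (norm (w x)) \<partial>N) \<le> (\<integral>\<^sup>+x. 2 * (\<integral>\<^sup>+y. norm (f y) \<partial>R x) \<partial>N)"
    proof (intro nn_integral_mono)
      fix x
      have "ennreal (norm (w x)) \<le> (\<integral>\<^sup>+y. ennreal (norm (2 * norm (f y))) \<partial>R x)"
        using norm_kernel_app_le[of R "\<lambda>y. 2 * norm (f y)" x] by (simp add: w_def kernel_app_def)
      also have "\<dots> = 2 * (\<integral>\<^sup>+y. norm (f y) \<partial>R x)"
        using fm R by (subst nn_integral_cmult[symmetric])
          (auto simp: ennreal_mult' intro!: R_meas)
      finally show "ennreal (norm (w x)) \<le> 2 * (\<integral>\<^sup>+y. norm (f y) \<partial>R x)" .
    qed
    also have "\<dots> = 2 * (\<integral>\<^sup>+x. (\<integral>\<^sup>+y. norm (f y) \<partial>R x) \<partial>N)"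
      by (intro nn_integral_cmult borel_N[THEN iffD1] pkernel_nn_integral_measurable[OF R]) (use fm in auto)
    also have "\<dots> < \<infinity>" using fin by (simp add: ennreal_mult_less_top)
    finally show "(\<integral>\<^sup>+x. ennreal (norm (w x)) \<partial>N) < \<infinity>" .
  qed
  have dom: "AE x in N. norm (kernel_app R (s i) x) \<le> w x" for i
    using aef
  proof eventually_elim
    case (elim x)
    have i: "integrable (R x) (s i)"
    proof (rule Bochner_Integration.integrable_bound)
      show "integrable (R x) (\<lambda>y. 2 * norm (f y))" using elim by simp
      show "AE y in R x. norm (s i y) \<le> norm (2 * norm (f y))"
        using lim(3)[of _ i] by (intro AE_I2) (simp add: sp)
    qed (rule R_meas[OF sm])
    have "norm (kernel_app R (s i) x) \<le> (\<integral>y. norm (s i y) \<partial>R x)"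
      unfolding kernel_app_def by (rule integral_norm_bound)
    also have "\<dots> \<le> w x" unfolding w_def using i elim lim(3) by (intro integral_mono) (auto simp: sp)
    finally show ?case .
  qed
  have km: "kernel_app R f \<in> borel_measurable N" "\<And>i. kernel_app R (s i) \<in> borel_measurable N"
    by (intro meas_N kernel_app_measurable[OF R] fm sm)+
  have 1: "integrable N (kernel_app R f)"
    by (rule integrable_dominated_convergence[OF km wi conv dom])
  have "(\<lambda>i. \<integral>x. kernel_app R (s i) x \<partial>N) \<longlonglongrightarrow> (\<integral>x. kernel_app R f x \<partial>N)"
    by (rule integral_dominated_convergence[OF km wi conv dom])
  moreover have "(\<lambda>i. \<integral>x. s i x \<partial>(N \<bind> R)) \<longlonglongrightarrow> (\<integral>x. f x \<partial>(N \<bind> R))"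
    using lim by (intro integral_dominated_convergence[where w="\<lambda>y. 2 * norm (f y)"]) auto
  ultimately have "(\<integral>x. f x \<partial>(N \<bind> R)) = (\<integral>x. kernel_app R f x \<partial>N)"
    using lim(5) by (auto intro: LIMSEQ_unique)
  with 1 show ?case by simp
qed

end

lemma kernel_app_bind:
  fixes u :: "'a::topological_space \<Rightarrow> 'b::{banach, second_countable_topology}"
  assumes "pkernel P" "pkernel R" "integrable (P x \<bind> R) u"
  shows "kernel_app (\<lambda>x. P x \<bind> R) u x = kernel_app P (kernel_app R u) x"
    and "integrable (P x) (kernel_app R u)"
proof -
  interpret kernel_bind "P x" R using assms by unfold_locales (auto simp: pkernel_sets)
  show "kernel_app (\<lambda>x. P x \<bind> R) u x = kernel_app P (kernel_app R u) x"
    "integrable (P x) (kernel_app R u)"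
    using integral_bind_N[OF assms(3)] by (auto simp: kernel_app_def)
qed

section \<open>Kernels that preserve a probability law\<close>

locale stationary =
  fixes \<pi> :: "'a::topological_space measure" and P :: "'a \<Rightarrow> 'a measure"
  assumes prob_pi: "prob_space \<pi>" and sets_pi: "sets \<pi> = sets borel" and P: "pkernel P"
    and stat: "stationary_kernel \<pi> P"
begin

sublocale kernel_bind \<pi> P using sets_pi P by unfold_locales

sublocale pi: prob_space \<pi> by (rule prob_pi)

text \<open>In this form stationarity turns the general facts on \<open>N \<bind> R\<close> into
  facts about \<open>\<pi>\<close> alone; the lemma collections below are read off this way.\<close>

lemma bind_eq: "\<pi> \<bind> P = \<pi>"
proof (rule measure_eqI)
  show "sets (\<pi> \<bind> P) = sets \<pi>" by (simp add: sets_bind_N sets_pi)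
  fix A assume "A \<in> sets (\<pi> \<bind> P)"
  then have A: "A \<in> sets borel" by (simp add: sets_bind_N)
  have "emeasure (\<pi> \<bind> P) A = (\<integral>\<^sup>+x. emeasure (P x) A \<partial>\<pi>)"
    by (rule emeasure_bind[OF pi.not_empty R_subprob A])
  also have "\<dots> = emeasure \<pi> A" using stat A by (simp add: stationary_kernel_def)
  finally show "emeasure (\<pi> \<bind> P) A = emeasure \<pi> A" .
qed

lemmas nn_integral_stationary = nn_integral_bind_N[unfolded bind_eq, symmetric]

lemmas AE_integrable_kernel = AE_integrable_bind[unfolded bind_eq]

lemma integrable_kernel_app:
  fixes u :: "'a \<Rightarrow> 'b::{banach, second_countable_topology}"
  assumes "integrable \<pi> u"
  shows "integrable \<pi> (kernel_app P u)"
    and "(\<integral>x. kernel_app P u x \<partial>\<pi>) = (\<integral>x. u x \<partial>\<pi>)"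
  using integral_bind_N[of u] assms by (auto simp: bind_eq)

text \<open>A \<open>\<pi>\<close>-null set is null for almost every row of a stationary kernel.
  This keeps functions known only up to null sets, such as the Poisson solution, usable under
  further kernels.\<close>

lemma AE_kernel:
  assumes "Measurable.pred borel A" "AE y in \<pi>. A y"
  shows "AE x in \<pi>. AE y in P x. A y"
  using AE_bind[OF R_subprob assms(1), unfolded bind_eq] assms(2) by blast

lemma AE_kernel_app_cong:
  fixes u :: "'a \<Rightarrow> 'b::{banach, second_countable_topology}"
  assumes u: "u \<in> borel_measurable borel" and w: "w \<in> borel_measurable borel"
    and "AE x in \<pi>. u x = w x"
  shows "AE x in \<pi>. kernel_app P u x = kernel_app P w x"
proof -
  note [measurable] = u w
  have "AE x in \<pi>. AE y in P x. u y = w y"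
    by (rule AE_kernel[OF _ assms(3)]) measurable
  then show ?thesis unfolding kernel_app_def
    by eventually_elim (intro integral_cong_AE pkernel_borel_measurable[OF P] u w)
qed

lemma norm_kernel_app_le_kernel_app:
  fixes u :: "'a \<Rightarrow> 'b::{banach, second_countable_topology}"
  shows "norm (kernel_app P u x) \<le> kernel_app P (\<lambda>y. norm (u y)) x"
  unfolding kernel_app_def by (rule integral_norm_bound)

lemma integral_norm_kernel_app:
  fixes u :: "'a \<Rightarrow> 'b::{banach, second_countable_topology}"
  assumes "integrable \<pi> u"
  shows "(\<integral>x. norm (kernel_app P u x) \<partial>\<pi>) \<le> (\<integral>x. norm (u x) \<partial>\<pi>)"
proof -
  have "(\<integral>x. norm (kernel_app P u x) \<partial>\<pi>) \<le> (\<integral>x. kernel_app P (\<lambda>y. norm (u y)) x \<partial>\<pi>)"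
    using assms by (intro integral_mono integrable_norm integrable_kernel_app norm_kernel_app_le_kernel_app)
  then show ?thesis using assms by (simp add: integrable_kernel_app)
qed

text \<open>Jensen's inequality at almost every point, read off from the nonnegativity of the
  variance under \<open>P x\<close>; integration and stationarity then give the contraction of
  \<open>L\<^sup>2\<close>.\<close>

lemma kernel_app_square:
  fixes u :: "'a \<Rightarrow> real"
  assumes u: "u \<in> borel_measurable borel" and u2: "integrable \<pi> (\<lambda>x. (u x)\<^sup>2)"
  shows "integrable \<pi> u" "integrable \<pi> (\<lambda>x. (kernel_app P u x)\<^sup>2)"
    "AE x in \<pi>. integrable (P x) u \<and> integrable (P x) (\<lambda>y. (u y)\<^sup>2) \<and>
       (kernel_app P u x)\<^sup>2 \<le> kernel_app P (\<lambda>y. (u y)\<^sup>2) x"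
    "(\<integral>x. (kernel_app P u x)\<^sup>2 \<partial>\<pi>) \<le> (\<integral>x. (u x)\<^sup>2 \<partial>\<pi>)"
proof -
  show 1: "integrable \<pi> u"
    by (rule pi.square_integrable_imp_integrable[OF meas_N[OF u] u2])
  show 2: "AE x in \<pi>. integrable (P x) u \<and> integrable (P x) (\<lambda>y. (u y)\<^sup>2) \<and>
       (kernel_app P u x)\<^sup>2 \<le> kernel_app P (\<lambda>y. (u y)\<^sup>2) x"
    using AE_integrable_kernel[OF 1] AE_integrable_kernel[OF u2]
  proof eventually_elim
    case (elim x)
    interpret p: prob_space "P x" using P by (rule pkernel_prob_space)
    have "(kernel_app P u x)\<^sup>2 \<le> kernel_app P (\<lambda>y. (u y)\<^sup>2) x"
      using p.variance_eq[of u] elim p.variance_positive[of u] by (simp add: kernel_app_def)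
    then show ?case using elim by simp
  qed
  show 3: "integrable \<pi> (\<lambda>x. (kernel_app P u x)\<^sup>2)"
  proof (rule Bochner_Integration.integrable_bound[OF integrable_kernel_app(1)[OF u2]])
    show "(\<lambda>x. (kernel_app P u x)\<^sup>2) \<in> borel_measurable \<pi>"
      by (intro borel_measurable_power meas_N kernel_app_measurable[OF P u])
    show "AE x in \<pi>. norm ((kernel_app P u x)\<^sup>2) \<le> norm (kernel_app P (\<lambda>y. (u y)\<^sup>2) x)"
      using 2 by eventually_elim (metis abs_ge_self norm_power order_trans power2_abs real_norm_def)
  qed
  have "(\<integral>x. (kernel_app P u x)\<^sup>2 \<partial>\<pi>) \<le> (\<integral>x. kernel_app P (\<lambda>y. (u y)\<^sup>2) x \<partial>\<pi>)"
    using 2 by (intro integral_mono_AE 3 integrable_kernel_app u2) auto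
  then show "(\<integral>x. (kernel_app P u x)\<^sup>2 \<partial>\<pi>) \<le> (\<integral>x. (u x)\<^sup>2 \<partial>\<pi>)"
    using integrable_kernel_app(2)[OF u2] by simp
qed

end

section \<open>Minorization from irreducibility and aperiodicity\<close>

lemma kernel_prod_append:
  assumes Ps: "\<And>P. P \<in> set Ps \<Longrightarrow> pkernel P" and Qs: "\<And>P. P \<in> set Qs \<Longrightarrow> pkernel P"
  shows "kernel_prod (Ps @ Qs) x = kernel_prod Ps x \<bind> kernel_prod Qs"
  using Ps
proof (induction Ps arbitrary: x)
  case Nil
  have "kernel_prod Qs \<in> borel \<rightarrow>\<^sub>M subprob_algebra borel"
    by (intro measurable_prob_algebraD kernel_prod_measurable Qs)
  then show ?case by (simp add: bind_return[where N=borel])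
next
  case (Cons P Ps)
  have P: "pkernel P" using Cons by auto
  have m: "kernel_prod Ps \<in> borel \<rightarrow>\<^sub>M subprob_algebra borel" "kernel_prod Qs \<in> borel \<rightarrow>\<^sub>M subprob_algebra borel"
    using Cons.prems Qs by (auto intro!: measurable_prob_algebraD kernel_prod_measurable)
  have "kernel_prod Ps \<in> P x \<rightarrow>\<^sub>M subprob_algebra borel"
    using m(1) pkernel_sets[OF P, of x] by (simp cong: measurable_cong_sets)
  then have "P x \<bind> kernel_prod Ps \<bind> kernel_prod Qs = P x \<bind> (\<lambda>y. kernel_prod Ps y \<bind> kernel_prod Qs)"
    by (rule bind_assoc[OF _ m(2)])
  moreover have "kernel_prod (Ps @ Qs) = (\<lambda>y. kernel_prod Ps y \<bind> kernel_prod Qs)"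
    using Cons by auto
  ultimately show ?case by simp
qed

lemma kernel_pow_pkernel: "pkernel P \<Longrightarrow> pkernel (kernel_pow P n)"
  unfolding kernel_pow_def by (rule kernel_prod_measurable) auto

lemma kernel_pow_add:
  "pkernel P \<Longrightarrow> kernel_pow P (m + n) x = kernel_pow P m x \<bind> kernel_pow P n"
  unfolding kernel_pow_def replicate_add by (rule kernel_prod_append) auto

lemma kernel_pow_0: "kernel_pow P 0 = return borel"
  by (simp add: kernel_pow_def)

lemma kernel_pow_1: "pkernel P \<Longrightarrow> kernel_pow P 1 = P"
  using pkernel_sets[of P] by (auto simp: kernel_pow_def fun_eq_iff intro!: bind_return'' )

lemma nn_integral_kernel_pow_add:
  assumes P: "pkernel P" and u: "u \<in> borel_measurable borel"
  shows "(\<integral>\<^sup>+y. u y \<partial>kernel_pow P (m + n) x)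
    = (\<integral>\<^sup>+y. \<integral>\<^sup>+z. u z \<partial>kernel_pow P n y \<partial>kernel_pow P m x)"
proof -
  interpret kernel_bind "kernel_pow P m x" "kernel_pow P n"
    using P by unfold_locales (auto intro!: kernel_pow_pkernel pkernel_sets)
  show ?thesis using nn_integral_bind_N[OF u] by (simp add: kernel_pow_add[OF P])
qed

lemma emeasure_kernel_pow_add:
  assumes P: "pkernel P" and A: "A \<in> sets borel"
  shows "emeasure (kernel_pow P (m + n) x) A = (\<integral>\<^sup>+y. emeasure (kernel_pow P n y) A \<partial>kernel_pow P m x)"
  using nn_integral_kernel_pow_add[OF P, of "indicator A" m n x] A
  by (simp add: pkernel_sets[OF kernel_pow_pkernel[OF P]])

lemma emeasure_kernel_pow_Suc:
  assumes P: "pkernel P" and A: "A \<in> sets borel"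
  shows "emeasure (kernel_pow P (Suc n) x) A = (\<integral>\<^sup>+y. emeasure (kernel_pow P n y) A \<partial>P x)"
  using emeasure_kernel_pow_add[OF P A, of 1 n x] kernel_pow_1[OF P] by simp

lemma kernel_AE_zero:
  assumes P: "pkernel P" and u: "u \<in> borel_measurable borel" and "(\<integral>\<^sup>+y. u y \<partial>P x) = 0"
  shows "AE y in P x. u y = 0"
  using assms nn_integral_0_iff_AE[OF pkernel_borel_measurable[OF P u, of x]] by simp

text \<open>With \<open>n = q * b + r\<close> and \<open>r < b\<close> one has
  \<open>n = (q - r) * b + r * (b + 1)\<close>; the lower bound on \<open>n\<close> makes
  \<open>q\<close> exceed \<open>r\<close>, so both multiples lie in \<open>S\<close>.\<close>

lemma closed_add_eventually_all:
  fixes S :: "nat set"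
  assumes add: "\<And>m n. m \<in> S \<Longrightarrow> n \<in> S \<Longrightarrow> m + n \<in> S" and b: "b \<in> S" "Suc b \<in> S" and n: "Suc b * Suc b \<le> n"
  shows "n \<in> S"
proof -
  have mult: "Suc k * m \<in> S" if "m \<in> S" for k m
    using that by (induction k) (auto intro: add)
  show ?thesis
  proof (cases "b = 0")
    case True
    then show ?thesis using mult[of 1 "n - 1"] b n by (cases n) auto
  next
    case False
    define q r where "q = n div b" and "r = n mod b"
    have qr: "n = q * b + r" by (simp add: q_def r_def)
    have r: "r < b" using False by (simp add: r_def)
    have "b < q"
    proof (rule ccontr)
      assume "\<not> b < q"
      then have "q * b \<le> b * b" by (metis mult_le_mono1 not_less)
      moreover have "b * b + b + b + 1 \<le> n" using n by simp
      ultimately show False using qr r by linarith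
    qed
    then obtain k where k: "q = r + Suc k" using r less_iff_Suc_add[of r q] by auto
    have n_eq: "n = Suc k * b + r * Suc b" using qr k by (simp add: algebra_simps)
    show ?thesis
    proof (cases r)
      case 0
      then show ?thesis using n_eq mult[OF b(1), of k] by simp
    next
      case (Suc r')
      then show ?thesis using n_eq add[OF mult[OF b(1), of k] mult[OF b(2), of r']] by simp
    qed
  qed
qed

text \<open>Closure under addition makes the differences of members a subgroup of the integers. It
  contains \<open>m = (m + m) - m\<close>, hence is nontrivial, and \<open>d\<close> is its least
  positive element; division with remainder gives divisibility.\<close>

lemma least_difference_dvd:
  fixes S :: "nat set"
  assumes add: "\<And>m n. m \<in> S \<Longrightarrow> n \<in> S \<Longrightarrow> m + n \<in> S" and m: "m \<in> S" "0 < m"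
  obtains d where "0 < d" "\<And>a b. a \<in> S \<Longrightarrow> b \<in> S \<Longrightarrow> int d dvd int a - int b"
    "\<exists>a\<in>S. \<exists>b\<in>S. a = b + d"
proof -
  define H where "H = {int a - int b | a b. a \<in> S \<and> b \<in> S}"
  have diff: "x - y \<in> H" if h: "x \<in> H" "y \<in> H" for x y
  proof -
    obtain a b where "x = int a - int b" "a \<in> S" "b \<in> S" using h(1) by (auto simp: H_def)
    moreover obtain a' b' where "y = int a' - int b'" "a' \<in> S" "b' \<in> S"
      using h(2) by (auto simp: H_def)
    ultimately have "x - y = int (a + b') - int (b + a')" "a + b' \<in> S" "b + a' \<in> S"
      by (auto intro: add)
    then show ?thesis unfolding H_def by blast
  qed
  have H0: "0 \<in> H" unfolding H_def using m by force
  have neg: "- x \<in> H" if "x \<in> H" for x using diff[OF H0 that] by simp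
  have plus: "x + y \<in> H" if "x \<in> H" "y \<in> H" for x y using diff[OF that(1) neg[OF that(2)]] by simp
  have "int (m + m) - int m \<in> H" unfolding H_def using m(1) add[OF m(1) m(1)] by blast
  then have ex: "\<exists>d. 0 < d \<and> int d \<in> H" using m(2) by (intro exI[of _ m]) simp
  define d where "d = (LEAST d. 0 < d \<and> int d \<in> H)"
  have d: "0 < d" "int d \<in> H" using LeastI_ex[OF ex] by (auto simp: d_def)
  have mult: "int k * int d \<in> H" for k
  proof (induction k)
    case (Suc k) then show ?case using plus[OF Suc d(2)] by (simp add: algebra_simps)
  qed (simp add: H0)
  have imult: "k * int d \<in> H" for k
    using mult[of "nat k"] neg[OF mult[of "nat (- k)"]] by (cases "0 \<le> k") auto
  have dvd: "int d dvd h" if "h \<in> H" for h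
  proof (rule ccontr)
    assume nd: "\<not> int d dvd h"
    have "h mod int d = h - (h div int d) * int d" by (simp add: minus_div_mult_eq_mod)
    then have "h mod int d \<in> H" using diff[OF that imult[of "h div int d"]] by simp
    moreover have "0 < h mod int d" "h mod int d < int d"
      using nd d(1) pos_mod_sign[of "int d" h] pos_mod_bound[of "int d" h]
      unfolding dvd_eq_mod_eq_0 by linarith+
    ultimately show False
      using not_less_Least[of "nat (h mod int d)" "\<lambda>d. 0 < d \<and> int d \<in> H", folded d_def]
      by (simp add: nat_less_iff)
  qed
  show ?thesis
  proof (rule that[OF d(1)])
    show "int d dvd int a - int b" if "a \<in> S" "b \<in> S" for a b
      using dvd[of "int a - int b"] that unfolding H_def by blast
    obtain a b where "int d = int a - int b" "a \<in> S" "b \<in> S" using d(2) by (auto simp: H_def)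
    then show "\<exists>a\<in>S. \<exists>b\<in>S. a = b + d" by (intro bexI[of _ a] bexI[of _ b]) auto
  qed
qed

text \<open>The hypothesis \<open>nuD\<close> goes beyond \<open>small_set\<close>: the minorizing
  measure has to charge \<open>D\<close>, so that a return to \<open>D\<close> can regenerate it.
  \<open>minor_sublevel\<close> arranges this by a push-forward.\<close>

locale accessible_small =
  fixes P :: "'a::topological_space \<Rightarrow> 'a measure" and \<psi> \<nu> :: "'a measure" and D :: "'a set" and m :: nat
  assumes P: "pkernel P" and D: "D \<in> sets borel"
    and irr: "\<And>A x. A \<in> sets borel \<Longrightarrow> emeasure \<psi> A > 0 \<Longrightarrow> \<exists>t>0. emeasure (kernel_pow P t x) A > 0"
    and hit: "\<And>x. \<exists>n. emeasure (kernel_pow P n x) D > 0"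
    and sets_nu: "sets \<nu> = sets borel"
    and nuD: "emeasure \<nu> D > 0" and m: "m > 0"
    and minor: "\<And>x B. x \<in> D \<Longrightarrow> B \<in> sets borel \<Longrightarrow> emeasure \<nu> B \<le> emeasure (kernel_pow P m x) B"
    and aper: "\<And>n. (\<exists>E. kernel_cycle P \<psi> n E) \<Longrightarrow> n \<le> 1"
begin

abbreviation p where "p n x A \<equiv> emeasure (kernel_pow P n x) A"

lemma p_measurable: "A \<in> sets borel \<Longrightarrow> (\<lambda>x. p n x A) \<in> borel_measurable borel"
  by (rule pkernel_emeasure_measurable[OF kernel_pow_pkernel[OF P]])

lemma sets_pow: "sets (kernel_pow P n x) = sets borel"
  by (rule pkernel_sets[OF kernel_pow_pkernel[OF P]])

text \<open>The measure is the same for all \<open>n\<close> while its scale may shrink with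
  \<open>n\<close>; this is what makes the set closed under addition.\<close>

definition minors :: "nat set" where
  "minors = {n. \<exists>\<delta>>0. \<forall>x\<in>D. scale_measure \<delta> \<nu> \<le> kernel_pow P n x}"

lemma minors_iff: "n \<in> minors \<longleftrightarrow> (\<exists>\<delta>>0. \<forall>x\<in>D. \<forall>B\<in>sets borel. \<delta> * emeasure \<nu> B \<le> p n x B)"
  unfolding minors_def by (simp add: le_measure sets_pow sets_nu)

lemma m_minors: "m \<in> minors"
  unfolding minors_iff using minor by (intro exI[of _ 1]) auto

definition returns :: "nat \<Rightarrow> ennreal" where
  "returns t = (\<integral>\<^sup>+y. p t y D \<partial>\<nu>)"

text \<open>Three stages: from \<open>D\<close>, \<open>n\<close> steps leave mass at least
  \<open>\<delta> * \<nu>\<close>; \<open>t\<close> further steps bring the part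
  \<open>\<delta> * returns t\<close> back to \<open>D\<close>; from there \<open>n'\<close> steps
  regenerate \<open>\<delta>' * \<nu>\<close>.\<close>

lemma minors_add_returns:
  assumes n: "n \<in> minors" "n' \<in> minors" and t: "returns t > 0"
  shows "n + t + n' \<in> minors"
proof -
  obtain \<delta> where \<delta>: "\<delta> > 0" "\<And>x. x \<in> D \<Longrightarrow> scale_measure \<delta> \<nu> \<le> kernel_pow P n x"
    using n unfolding minors_def by auto
  obtain \<delta>' where \<delta>': "\<delta>' > 0" "\<And>x B. x \<in> D \<Longrightarrow> B \<in> sets borel \<Longrightarrow> \<delta>' * emeasure \<nu> B \<le> p n' x B"
    using n unfolding minors_iff by auto
  have "(\<delta> * returns t * \<delta>') * emeasure \<nu> B \<le> p (n + t + n') x B" if x: "x \<in> D" and B: "B \<in> sets borel" for x B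
  proof -
    let ?c = "\<delta>' * emeasure \<nu> B"
    have "?c * (\<delta> * returns t) = ?c * (\<integral>\<^sup>+y. p t y D \<partial>scale_measure \<delta> \<nu>)"
      using p_measurable[OF D] sets_nu by (simp add: returns_def nn_integral_scale_measure cong: measurable_cong_sets)
    also have "\<dots> \<le> ?c * (\<integral>\<^sup>+y. p t y D \<partial>kernel_pow P n x)"
      by (intro mult_left_mono nn_integral_mono_measure \<delta>(2) x) (auto simp: sets_pow sets_nu)
    also have "\<dots> = ?c * p (n + t) x D"
      by (simp add: emeasure_kernel_pow_add[OF P D])
    also have "\<dots> = (\<integral>\<^sup>+y. ?c * indicator D y \<partial>kernel_pow P (n + t) x)"
      using D by (simp add: nn_integral_cmult_indicator sets_pow)
    also have "\<dots> \<le> (\<integral>\<^sup>+y. p n' y B \<partial>kernel_pow P (n + t) x)"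
      using \<delta>'(2) B by (intro nn_integral_mono) (auto simp: indicator_def)
    also have "\<dots> = p (n + t + n') x B" by (simp add: emeasure_kernel_pow_add[OF P B])
    finally show ?thesis by (simp add: mult_ac)
  qed
  moreover have "0 < \<delta> * returns t * \<delta>'" using \<delta>(1) \<delta>'(1) t by (simp add: ennreal_zero_less_mult_iff)
  ultimately show ?thesis unfolding minors_iff by blast
qed

lemma returns_0: "returns 0 > 0"
proof -
  have "returns 0 = (\<integral>\<^sup>+y. indicator D y \<partial>\<nu>)"
    using D by (simp add: returns_def kernel_pow_0)
  also have "\<dots> = emeasure \<nu> D" using D sets_nu by simp
  finally show ?thesis using nuD by simp
qed

lemma minors_add: "n \<in> minors \<Longrightarrow> n' \<in> minors \<Longrightarrow> n + n' \<in> minors"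
  using minors_add_returns[OF _ _ returns_0] by simp

text \<open>The possible return times to \<open>D\<close> modulo the period of \<open>minors\<close> split an absorbing set into a cycle.\<close>

lemma cycle_ex:
  assumes d: "0 < d" and dvd: "\<And>a b. a \<in> minors \<Longrightarrow> b \<in> minors \<Longrightarrow> int d dvd int a - int b"
  shows "\<exists>E. kernel_cycle P \<psi> d E"
proof -
  \<comment> \<open>\<open>B\<close> collects the points that can reach \<open>D\<close> at two
    times incongruent modulo \<open>d\<close>, and \<open>G\<close> the points that can never reach
    \<open>B\<close>. On \<open>G\<close> the residue of a possible hitting time is thus
    unique.\<close>
  define B where "B = (\<Union>z\<in>{z. \<not> int d dvd int (fst z) - int (snd z)}.
    {x. p (fst z) x D > 0} \<inter> {x. p (snd z) x D > 0})"
  define G where "G = {x. \<forall>r. p r x B = 0}"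
  \<comment> \<open>The residue is recorded with a negative sign: one step shortens the time to
    \<open>D\<close> by one and so raises the index by one, as a cycle requires.\<close>
  define E where "E i = {x \<in> G. \<exists>n. p n x D > 0 \<and> d dvd n + i}" for i
  have pos: "{x. p n x A > 0} \<in> sets borel" if "A \<in> sets borel" for n A
    using borel_measurable_less[OF borel_measurable_const p_measurable[OF that], of 0 n] by simp
  have zero: "{x. p n x A = 0} \<in> sets borel" if "A \<in> sets borel" for n A
    using borel_measurable_eq[OF p_measurable[OF that] borel_measurable_const, of n 0] by simp
  have B: "B \<in> sets borel" unfolding B_def
    by (intro sets.countable_UN' sets.Int) (auto intro: pos[OF D])
  have G: "G \<in> sets borel"
  proof -
    have "G = (\<Inter>r. {x. p r x B = 0})" by (auto simp: G_def)
    then show ?thesis using zero[OF B] by (simp add: sets.countable_INT'')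
  qed
  have E: "E i \<in> sets borel" for i
  proof -
    have "E i = G \<inter> (\<Union>n\<in>{n. d dvd n + i}. {x. p n x D > 0})" by (auto simp: E_def)
    then show ?thesis using G by (auto intro!: sets.countable_UN' pos D)
  qed
  have GB: "G \<inter> B = {}"
  proof -
    have "x \<notin> B" if "p 0 x B = 0" for x using that B by (auto simp: kernel_pow_0)
    then show ?thesis by (auto simp: G_def)
  qed
  have uniq: "int d dvd int n - int n'" if "x \<in> G" "p n x D > 0" "p n' x D > 0" for x n n'
  proof (rule ccontr)
    assume "\<not> int d dvd int n - int n'"
    then have "x \<in> B" unfolding B_def using that by (intro UN_I[of "(n, n')"]) auto
    then show False using GB that(1) by auto
  qed
  have G_step: "AE y in P x. y \<in> G" if "x \<in> G" for x
  proof -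
    have "AE y in P x. p r y B = 0" for r
    proof (rule kernel_AE_zero[OF P p_measurable[OF B]])
      show "(\<integral>\<^sup>+y. p r y B \<partial>P x) = 0"
        using that emeasure_kernel_pow_Suc[OF P B, of r x] by (simp add: G_def)
    qed
    then show ?thesis by (simp add: G_def AE_all_countable)
  qed
  \<comment> \<open>If \<open>\<nu>\<close> could enter \<open>B\<close> after \<open>r\<close>
    steps, both \<open>r + n\<close> and \<open>r + n'\<close> would be return times, and
    \<open>minors_add_returns\<close> would put two numbers with difference \<open>n - n'\<close>
    into \<open>minors\<close>, against \<open>dvd\<close>.\<close>
  have nuB: "AE x in \<nu>. p r x B = 0" for r
  proof -
    have *: "(\<integral>\<^sup>+y. p r y ({x. p n x D > 0} \<inter> {x. p n' x D > 0}) \<partial>\<nu>) = 0"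
      if nd: "\<not> int d dvd int n - int n'" for n n'
    proof (rule ccontr)
      let ?A = "{x. p n x D > 0} \<inter> {x. p n' x D > 0}"
      assume nz: "(\<integral>\<^sup>+y. p r y ?A \<partial>\<nu>) \<noteq> 0"
      have A: "?A \<in> sets borel" using pos D by auto
      have ret: "returns (r + k) > 0" if k: "\<And>x. x \<in> ?A \<Longrightarrow> p k x D > 0" for k
      proof (rule ccontr)
        assume "\<not> returns (r + k) > 0"
        then have "(\<integral>\<^sup>+y. p (r + k) y D \<partial>\<nu>) = 0" by (simp add: returns_def)
        then have "AE y in \<nu>. p (r + k) y D = 0"
          using p_measurable[OF D, of "r + k"] sets_nu
          by (subst (asm) nn_integral_0_iff_AE) (simp_all cong: measurable_cong_sets)
        then have "AE y in \<nu>. p r y ?A = 0"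
        proof eventually_elim
          case (elim y)
          then have "AE z in kernel_pow P r y. p k z D = 0"
            by (intro kernel_AE_zero kernel_pow_pkernel P p_measurable D)
               (simp add: emeasure_kernel_pow_add[OF P D])
          then have "AE z in kernel_pow P r y. z \<notin> ?A"
            by eventually_elim (use k in fastforce)
          then show ?case using A AE_iff_null_sets[of ?A "kernel_pow P r y"]
            by (simp add: sets_pow null_setsD1)
        qed
        then show False using nz p_measurable[OF A, of r] sets_nu
          by (subst (asm) nn_integral_0_iff_AE) (simp_all cong: measurable_cong_sets)
      qed
      have "int d dvd int (m + (r + n) + m) - int (m + (r + n') + m)"
        using ret[of n] ret[of n'] by (intro dvd minors_add_returns m_minors) simp_all
      then show False using nd by simp
    qed
    have "(\<integral>\<^sup>+y. p r y B \<partial>\<nu>) = 0"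
    proof -
      interpret kernel_bind \<nu> "kernel_pow P r"
        by unfold_locales (simp_all add: sets_nu kernel_pow_pkernel P)
      have em: "emeasure (\<nu> \<bind> kernel_pow P r) A = (\<integral>\<^sup>+y. p r y A \<partial>\<nu>)" if "A \<in> sets borel" for A
        using nn_integral_bind_N[of "indicator A"] that by (simp add: sets_bind_N sets_pow)
      have "B \<in> null_sets (\<nu> \<bind> kernel_pow P r)"
        unfolding B_def
        by (intro null_sets_UN' null_setsI) (use * pos D in \<open>auto simp: em sets_bind_N\<close>)
      then show ?thesis using em[OF B] by (simp add: null_setsD1)
    qed
    then show ?thesis
      using p_measurable[OF B, of r] sets_nu
      by (subst (asm) nn_integral_0_iff_AE) (simp_all cong: measurable_cong_sets)
  qed
  have "G \<noteq> {}"
  proof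
    assume "G = {}"
    moreover have "AE x in \<nu>. x \<in> G" using nuB by (simp add: G_def AE_all_countable)
    ultimately have "AE x in \<nu>. False" by simp
    then have "emeasure \<nu> D = 0"
      by (metis (mono_tags, lifting) AE_iff_null_sets D UNIV_I emeasure_eq_0_AE eventually_mono null_setsD1 sets_nu)
    then show False using nuD by simp
  qed
  then obtain x0 where x0: "x0 \<in> G" by auto
  have G_pow: "p t x (- G) = 0" if "x \<in> G" for t x
    using that
  proof (induction t arbitrary: x)
    case 0 then show ?case using G by (simp add: kernel_pow_0)
  next
    case (Suc t)
    have "AE y in P x. p t y (- G) = 0" using G_step[OF Suc.prems] by eventually_elim (rule Suc.IH)
    then have "(\<integral>\<^sup>+y. p t y (- G) \<partial>P x) = (\<integral>\<^sup>+y. 0 \<partial>P x)" by (intro nn_integral_cong_AE)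
    then show ?case using G by (simp add: emeasure_kernel_pow_Suc[OF P] borel_comp)
  qed
  have cover: "(\<Union>i<d. E i) = G"
  proof
    show "G \<subseteq> (\<Union>i<d. E i)"
    proof
      fix x assume x: "x \<in> G"
      obtain n where n: "p n x D > 0" using hit by blast
      have "n + (d - n mod d) = (n div d + 1) * d"
      proof -
        have "n = (n div d) * d + n mod d" "n mod d < d" using d by simp_all
        then show ?thesis by (simp only: distrib_right)
      qed
      then have "d dvd n + (d - n mod d) mod d"
        by (metis dvd_eq_mod_eq_0 dvd_triv_right mod_add_right_eq)
      then have "x \<in> E ((d - n mod d) mod d)" using x n by (auto simp: E_def)
      then show "x \<in> (\<Union>i<d. E i)" using d by auto
    qed
  qed (auto simp: E_def)
  have disj: "i = j" if "x \<in> E i" "x \<in> E j" "i < d" "j < d" for x i j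
  proof -
    obtain n n' where n: "p n x D > 0" "d dvd n + i" "p n' x D > 0" "d dvd n' + j" "x \<in> G"
      using \<open>x \<in> E i\<close> \<open>x \<in> E j\<close> by (auto simp: E_def)
    have 1: "int d dvd int n - int n'" by (rule uniq[OF n(5,1,3)])
    have 2: "int d dvd int (n + i)" "int d dvd int (n' + j)" using n by (simp_all only: int_dvd_int_iff)
    have "int d dvd (int (n + i) - int (n' + j)) - (int n - int n')" by (rule dvd_diff[OF dvd_diff[OF 2] 1])
    then have "int d dvd int i - int j" by simp
    then have "int i mod int d = int j mod int d" by (simp add: mod_eq_dvd_iff)
    then show ?thesis using that by simp
  qed
  have step: "emeasure (P x) (E (Suc i mod d)) = 1" if x: "x \<in> E i" for x i
  proof -
    interpret prob_space "P x" using P by (rule pkernel_prob_space)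
    obtain n0 where n0: "p n0 x D > 0" "d dvd n0 + i" and xG: "x \<in> G" using x by (auto simp: E_def)
    \<comment> \<open>A successor able to hit \<open>D\<close> at a time of the wrong residue would
      give \<open>x\<close> itself, with one more step, a hitting time incompatible with
      \<open>n0\<close>.\<close>
    have "AE y in P x. p n y D > 0 \<longrightarrow> d dvd n + Suc i" for n
    proof (cases "d dvd n + Suc i")
      case False
      have "p (Suc n) x D = 0"
      proof (rule ccontr)
        assume "p (Suc n) x D \<noteq> 0"
        then have "int d dvd int (Suc n) - int n0"
          using uniq[OF xG _ n0(1), of "Suc n"] by (simp add: zero_less_iff_neq_zero)
        moreover have "int d dvd int (n0 + i)" using n0(2) by (simp only: int_dvd_int_iff)
        ultimately have "int d dvd (int (Suc n) - int n0) + int (n0 + i)" by (rule dvd_add)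
        then have "int d dvd int (n + Suc i)" by (simp add: algebra_simps)
        then show False using False by (simp only: int_dvd_int_iff)
      qed
      then have "AE y in P x. p n y D = 0"
        by (intro kernel_AE_zero P p_measurable D) (simp add: emeasure_kernel_pow_Suc[OF P D])
      then show ?thesis by eventually_elim simp
    qed simp
    then have "AE y in P x. \<forall>n. p n y D > 0 \<longrightarrow> d dvd n + Suc i" by (simp add: AE_all_countable)
    with G_step[OF xG] have "AE y in P x. y \<in> E (Suc i mod d)"
    proof eventually_elim
      case (elim y)
      obtain n where n: "p n y D > 0" using hit by blast
      then have "d dvd n + Suc i" using elim by blast
      then have "d dvd n + (Suc i mod d)" by (simp add: dvd_eq_mod_eq_0 mod_simps)
      then show ?case using elim n by (auto simp: E_def)
    qed
    then show ?thesis using E[of "Suc i mod d"]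
      by (simp add: emeasure_eq_1_AE pkernel_sets[OF P])
  qed
  \<comment> \<open>\<open>G\<close> is absorbing, so its complement is never reached from
    \<open>x0\<close>; irreducibility then forbids \<open>\<psi>\<close> to charge the
    complement.\<close>
  have psi: "emeasure \<psi> (- G) = 0"
  proof (rule ccontr)
    assume "emeasure \<psi> (- G) \<noteq> 0"
    then have "emeasure \<psi> (- G) > 0" using zero_less_iff_neq_zero by blast
    then obtain t where "p t x0 (- G) > 0" using irr[OF borel_comp[OF G]] by blast
    then show False using G_pow[OF x0, of t] by simp
  qed
  have "disjoint_family_on E {..<d}"
    unfolding disjoint_family_on_def using disj by blast
  then have "kernel_cycle P \<psi> d E"
    unfolding kernel_cycle_def cover using d E psi step by (simp add: Suc_le_eq)
  then show ?thesis by (rule exI[of _ E])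
qed

text \<open>The generator \<open>d\<close> of the differences yields a cycle of length
  \<open>d\<close>, so aperiodicity leaves only \<open>d = 1\<close>. Then two members are
  consecutive, and these generate all large numbers.\<close>

lemma eventually_minors: "\<exists>n0. \<forall>n\<ge>n0. n \<in> minors"
proof -
  obtain d where d: "0 < d" "\<And>a b. a \<in> minors \<Longrightarrow> b \<in> minors \<Longrightarrow> int d dvd int a - int b"
    "\<exists>a\<in>minors. \<exists>b\<in>minors. a = b + d"
    using least_difference_dvd[OF minors_add m_minors m] by blast
  have "d \<le> 1" using aper cycle_ex[OF d(1,2)] by blast
  with d(1) have "d = 1" by simp
  with d(3) obtain b where "b \<in> minors" "Suc b \<in> minors" by auto
  then show ?thesis using closed_add_eventually_all[OF minors_add] by metis
qed

end

section \<open>Drift and geometric ergodicity\<close>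

locale geometric_drift =
  fixes P :: "'a::topological_space \<Rightarrow> 'a measure" and D :: "'a set" and \<rho> b :: real and W :: "'a \<Rightarrow> real"
  assumes P: "pkernel P" and D: "D \<in> sets borel"
    and lam: "0 \<le> \<rho>" "\<rho> < 1" and b: "0 \<le> b"
    and W: "W \<in> borel_measurable borel" and W1: "\<And>x. 1 \<le> W x"
    and drift: "\<And>x. (\<integral>\<^sup>+y. ennreal (W y) \<partial>P x) \<le> ennreal (\<rho> * W x + b * indicator D x)"
begin

lemma W0: "0 \<le> W x" using W1[of x] by simp

lemma sets_pow: "sets (kernel_pow P n x) = sets borel"
  by (rule pkernel_sets[OF kernel_pow_pkernel[OF P]])

lemma pow_meas: "u \<in> borel_measurable borel \<Longrightarrow> u \<in> borel_measurable (kernel_pow P n x)"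
  by (rule pkernel_borel_measurable[OF kernel_pow_pkernel[OF P]])

lemma P_meas: "u \<in> borel_measurable borel \<Longrightarrow> u \<in> borel_measurable (P x)"
  by (rule pkernel_borel_measurable[OF P])

lemma W_enn: "(\<lambda>x. ennreal (W x)) \<in> borel_measurable borel" using W by simp

text \<open>The probability, from \<open>x\<close>, of staying outside \<open>D\<close> at all times
  \<open>0\<close> to \<open>n\<close>; index \<open>n\<close> thus stands for \<open>n + 1\<close>
  observations.\<close>

fun avoid :: "nat \<Rightarrow> 'a \<Rightarrow> ennreal" where
  "avoid 0 = indicator (- D)"
| "avoid (Suc n) = (\<lambda>x. indicator (- D) x * (\<integral>\<^sup>+y. avoid n y \<partial>P x))"

lemma avoid_measurable: "avoid n \<in> borel_measurable borel"
proof (induction n)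
  case 0 then show ?case using D by (auto intro!: borel_measurable_indicator borel_comp)
next
  case (Suc n)
  then show ?case using D
    by (auto intro!: borel_measurable_times_ennreal borel_measurable_indicator borel_comp pkernel_nn_integral_measurable[OF P])
qed

text \<open>Outside \<open>D\<close> the drift inequality loses its additive term, so each further
  step spent there contributes a factor \<open>\<rho>\<close>; \<open>W \<ge> 1\<close> starts the
  induction.\<close>

lemma avoid_le: "avoid n x \<le> ennreal (\<rho> ^ n * W x)"
proof (induction n arbitrary: x)
  case 0
  have "indicator (- D) x \<le> (1::ennreal)" by (auto simp: indicator_def)
  also have "\<dots> \<le> ennreal (W x)" using W1 by simp
  finally show ?case by simp
next
  case (Suc n)
  show ?case
  proof (cases "x \<in> D")
    case False
    have "avoid (Suc n) x \<le> (\<integral>\<^sup>+y. ennreal (\<rho> ^ n) * ennreal (W y) \<partial>P x)"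
      using False lam W0 Suc by (auto simp: ennreal_mult intro!: nn_integral_mono)
    also have "\<dots> = ennreal (\<rho> ^ n) * (\<integral>\<^sup>+y. ennreal (W y) \<partial>P x)"
      by (rule nn_integral_cmult[OF P_meas[OF W_enn]])
    also have "\<dots> \<le> ennreal (\<rho> ^ n) * ennreal (\<rho> * W x)"
      using drift[of x] False by (intro mult_left_mono) auto
    also have "\<dots> = ennreal (\<rho> ^ Suc n * W x)"
      using lam W0 by (simp add: ennreal_mult[symmetric] mult_ac)
    finally show ?thesis .
  qed simp
qed

lemma avoid_small: "0 < e \<Longrightarrow> \<exists>n. \<rho> ^ n * c < (e::real)"
proof -
  assume "0 < e"
  have "(\<lambda>n. \<rho> ^ n * c) \<longlonglongrightarrow> 0 * c" using lam by (intro tendsto_mult LIMSEQ_realpow_zero tendsto_const) auto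
  then have "eventually (\<lambda>n. \<rho> ^ n * c < e) sequentially" using \<open>0 < e\<close> by (simp add: order_tendsto_iff)
  then show ?thesis by (auto simp: eventually_sequentially)
qed

text \<open>Otherwise the chain from \<open>x\<close> would almost surely avoid \<open>D\<close>
  forever, whereas the avoidance probabilities decay geometrically.\<close>

lemma hit: "\<exists>n. emeasure (kernel_pow P n x) D > 0"
proof (rule ccontr)
  assume "\<not> ?thesis"
  then have z: "emeasure (kernel_pow P n x) D = 0" for n by (simp add: zero_less_iff_neq_zero)
  have av: "avoid n x = 1" if "\<forall>k\<le>n. emeasure (kernel_pow P k x) D = 0" for n x
    using that
  proof (induction n arbitrary: x)
    case 0
    then show ?case using D by (auto simp: kernel_pow_0 indicator_def)
  next
    case (Suc n)
    have xD: "x \<notin> D" using Suc.prems[rule_format, of 0] D by (auto simp: kernel_pow_0)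
    have "AE y in P x. emeasure (kernel_pow P k y) D = 0" if "k \<le> n" for k
      using Suc.prems[rule_format, of "Suc k"] that
      by (intro kernel_AE_zero P pkernel_emeasure_measurable kernel_pow_pkernel D)
         (simp add: emeasure_kernel_pow_Suc[OF P D])
    then have "AE y in P x. \<forall>k. k \<le> n \<longrightarrow> emeasure (kernel_pow P k y) D = 0"
      unfolding AE_all_countable by auto
    then have "AE y in P x. avoid n y = 1" by eventually_elim (auto intro: Suc.IH)
    then have "(\<integral>\<^sup>+y. avoid n y \<partial>P x) = (\<integral>\<^sup>+y. 1 \<partial>P x)" by (rule nn_integral_cong_AE)
    then show ?case using xD prob_space.emeasure_space_1[OF pkernel_prob_space[OF P, of x]] by simp
  qed
  obtain n where "\<rho> ^ n * W x < 1" using avoid_small[of 1 "W x"] by auto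
  moreover have "1 \<le> ennreal (\<rho> ^ n * W x)" using avoid_le[of n x] av[of n x] z by simp
  ultimately show False by (simp add: ennreal_ge_1)
qed

text \<open>From a sublevel set of \<open>W\<close> the chain enters \<open>D\<close> by time
  \<open>N\<close> with probability at least one half. Entry at time \<open>k\<close> leaves
  \<open>n0 + N - k \<ge> n0\<close> steps, and every such number of steps minorizes from
  \<open>D\<close>; so the common time \<open>n0 + N\<close> serves all starting points.\<close>

lemma minor_sublevel:
  fixes \<psi> :: "'a measure"
  assumes irr: "\<And>A x. A \<in> sets borel \<Longrightarrow> emeasure \<psi> A > 0 \<Longrightarrow> \<exists>t>0. emeasure (kernel_pow P t x) A > 0"
    and aper: "aperiodic_kernel P \<psi>" and small: "small_set P D"
  shows "\<exists>N>0. \<exists>\<mu>. sets \<mu> = sets borel \<and> emeasure \<mu> UNIV \<noteq> 0 \<and>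
    (\<forall>x. W x \<le> r \<longrightarrow> \<mu> \<le> kernel_pow P N x)"
proof -
  obtain m \<nu>0 where m: "m > 0" and nu0: "sets \<nu>0 = sets borel" "emeasure \<nu>0 UNIV \<noteq> 0"
    and min0: "\<And>x B. x \<in> D \<Longrightarrow> B \<in> sets borel \<Longrightarrow> emeasure \<nu>0 B \<le> emeasure (kernel_pow P m x) B"
    using small unfolding small_set_def by auto
  have pm: "(\<lambda>x. emeasure (kernel_pow P s x) A) \<in> borel_measurable borel" if "A \<in> sets borel" for s A
    by (rule pkernel_emeasure_measurable[OF kernel_pow_pkernel[OF P] that])
  \<comment> \<open>The measure of the small set may give \<open>D\<close> no mass. Since each point
    reaches \<open>D\<close> in some number of steps, a single \<open>s\<close> must work for a set
    of points of positive measure.\<close>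
  have "\<exists>s. (\<integral>\<^sup>+x. emeasure (kernel_pow P s x) D \<partial>\<nu>0) \<noteq> 0"
  proof (rule ccontr)
    assume "\<not> ?thesis"
    then have z: "(\<integral>\<^sup>+x. emeasure (kernel_pow P s x) D \<partial>\<nu>0) = 0" for s by blast
    have "(\<lambda>x. emeasure (kernel_pow P s x) D) \<in> borel_measurable \<nu>0" for s
      using pm[OF D, of s] nu0(1) by (simp cong: measurable_cong_sets)
    from nn_integral_0_iff_AE[OF this] z
    have "AE x in \<nu>0. emeasure (kernel_pow P s x) D = 0" for s by simp
    then have "AE x in \<nu>0. \<forall>s. emeasure (kernel_pow P s x) D = 0" by (simp add: AE_all_countable)
    then have "AE x in \<nu>0. x \<notin> UNIV"
    proof eventually_elim
      case (elim x)
      then show ?case using hit[of x] by auto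
    qed
    then have "UNIV \<in> null_sets \<nu>0" using nu0(1) by (subst AE_iff_null_sets) auto
    then show False using nu0(2) by auto
  qed
  then obtain s where s: "(\<integral>\<^sup>+x. emeasure (kernel_pow P s x) D \<partial>\<nu>0) \<noteq> 0" by blast
  define \<nu> where "\<nu> = \<nu>0 \<bind> kernel_pow P s"
  interpret kb: kernel_bind \<nu>0 "kernel_pow P s"
    by unfold_locales (simp_all add: nu0 kernel_pow_pkernel P)
  have em: "emeasure \<nu> A = (\<integral>\<^sup>+x. emeasure (kernel_pow P s x) A \<partial>\<nu>0)" if "A \<in> sets borel" for A
    using kb.nn_integral_bind_N[of "indicator A"] that by (simp add: kb.sets_bind_N sets_pow \<nu>_def)
  interpret accessible_small P \<psi> \<nu> D "m + s"
  proof unfold_locales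
    show "emeasure \<nu> D > 0" using s em[OF D] by (simp add: zero_less_iff_neq_zero)
    fix x B assume x: "x \<in> D" and B: "B \<in> sets (borel :: 'a measure)"
    have "\<nu>0 \<le> kernel_pow P m x" using min0[OF x] by (simp add: le_measure nu0 sets_pow)
    then have "(\<integral>\<^sup>+y. emeasure (kernel_pow P s y) B \<partial>\<nu>0) \<le> (\<integral>\<^sup>+y. emeasure (kernel_pow P s y) B \<partial>kernel_pow P m x)"
      by (intro nn_integral_mono_measure) (simp_all add: nu0 sets_pow)
    then show "emeasure \<nu> B \<le> emeasure (kernel_pow P (m + s) x) B"
      by (simp add: em[OF B] emeasure_kernel_pow_add[OF P B])
  qed (use m irr aper P D hit in \<open>auto simp: \<nu>_def kb.sets_bind_N aperiodic_kernel_def\<close>)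
  obtain n0 where n0: "\<And>n. n \<ge> n0 \<Longrightarrow> n \<in> minors" using eventually_minors by blast
  \<comment> \<open>\<open>\<rho> ^ N0 * r\<close> bounds the probability of avoiding
    \<open>D\<close>, uniformly on the sublevel set.\<close>
  obtain N0 where N0: "\<rho> ^ N0 * r < 1/2" using avoid_small[of "1/2" r] by auto
  define N where "N = Suc N0"
  have "\<exists>\<delta>>0. \<forall>x\<in>D. \<forall>B\<in>sets borel. \<delta> * emeasure \<nu> B \<le> emeasure (kernel_pow P n x) B" if "n \<ge> n0" for n
    using n0[OF that] unfolding minors_iff .
  then obtain \<delta>' where \<delta>': "\<And>n. n \<ge> n0 \<Longrightarrow> \<delta>' n > 0"
     "\<And>n x B. n \<ge> n0 \<Longrightarrow> x \<in> D \<Longrightarrow> B \<in> sets borel \<Longrightarrow> \<delta>' n * emeasure \<nu> B \<le> emeasure (kernel_pow P n x) B"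
    by metis
  \<comment> \<open>The scale depends on the number of steps left after entering \<open>D\<close>,
    which varies in a window of length \<open>N\<close>; the minimum serves them all.\<close>
  define \<delta> where "\<delta> = Min (\<delta>' ` {n0..n0+N})"
  have \<delta>: "\<delta> > 0" unfolding \<delta>_def using \<delta>'(1) by (subst Min_gr_iff) auto
  have \<delta>D: "\<delta> * emeasure \<nu> B \<le> emeasure (kernel_pow P (n0 + n) x) B" if "x \<in> D" "B \<in> sets borel" "n \<le> N" for x B n
  proof -
    have "\<delta> \<le> \<delta>' (n0 + n)" unfolding \<delta>_def using that by (intro Min_le) auto
    then have "\<delta> * emeasure \<nu> B \<le> \<delta>' (n0 + n) * emeasure \<nu> B" by (rule mult_right_mono) simp
    also have "\<dots> \<le> emeasure (kernel_pow P (n0 + n) x) B" by (rule \<delta>'(2)) (use that in auto)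
    finally show ?thesis .
  qed
  \<comment> \<open>Decomposition by the first entry into \<open>D\<close>, proved by conditioning
    on the first step. The deficit is kept as an added term because subtraction on
    \<open>ennreal\<close> is truncated.\<close>
  have entry: "\<delta> * emeasure \<nu> B \<le> emeasure (kernel_pow P (n0 + n) x) B + \<delta> * emeasure \<nu> B * avoid n x"
    if B: "B \<in> sets borel" and n: "n \<le> N" for n x B
    using n
  proof (induction n arbitrary: x)
    case 0
    then show ?case using \<delta>D[OF _ B, of x 0] by (cases "x \<in> D") auto
  next
    case (Suc n)
    let ?c = "\<delta> * emeasure \<nu> B"
    show ?case
    proof (cases "x \<in> D")
      case True
      then show ?thesis using \<delta>D[OF True B Suc.prems] by simp
    next
      case False
      interpret px: prob_space "P x" using P by (rule pkernel_prob_space)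
      have "?c = (\<integral>\<^sup>+y. ?c \<partial>P x)" by (simp add: px.emeasure_space_1)
      also have "\<dots> \<le> (\<integral>\<^sup>+y. emeasure (kernel_pow P (n0 + n) y) B + ?c * avoid n y \<partial>P x)"
        using Suc by (intro nn_integral_mono) auto
      also have "\<dots> = (\<integral>\<^sup>+y. emeasure (kernel_pow P (n0 + n) y) B \<partial>P x) + (\<integral>\<^sup>+y. ?c * avoid n y \<partial>P x)"
        by (intro nn_integral_add P_meas pm[OF B] borel_measurable_times_ennreal borel_measurable_const avoid_measurable)
      also have "\<dots> = emeasure (kernel_pow P (n0 + Suc n) x) B + ?c * avoid (Suc n) x"
        using False nn_integral_cmult[where c = ?c, OF P_meas[OF avoid_measurable[of n]]]
        by (simp add: emeasure_kernel_pow_Suc[OF P B])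
      finally show ?thesis .
    qed
  qed
  obtain xD where xD: "xD \<in> D"
  proof -
    have "D \<noteq> {}" using hit by fastforce
    then show ?thesis using that by auto
  qed
  \<comment> \<open>\<open>\<nu>\<close> is not known to be finite; the minorization at one point of
    \<open>D\<close> bounds \<open>\<delta> * emeasure \<nu> B\<close> by one, which permits the
    cancellation below.\<close>
  have fin: "\<delta> * emeasure \<nu> B \<le> 1" if "B \<in> sets borel" for B
    using \<delta>D[OF xD that, of 0] prob_space.measure_le_1[OF pkernel_prob_space[OF kernel_pow_pkernel[OF P]], of n0 xD B]
      order_trans by (auto intro: order_trans)
  have le: "\<delta> / 2 * emeasure \<nu> B \<le> emeasure (kernel_pow P (n0 + N) x) B" if x: "W x \<le> r" and B: "B \<in> sets borel" for x B
  proof -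
    have "avoid N x \<le> ennreal (1/2)"
    proof (rule order_trans[OF avoid_le ennreal_leI])
      have "\<rho> ^ N * W x \<le> \<rho> ^ N0 * W x" unfolding N_def using lam W0[of x]
        by (intro mult_right_mono power_decreasing) auto
      also have "\<dots> \<le> \<rho> ^ N0 * r" using lam x by (intro mult_left_mono) auto
      finally show "\<rho> ^ N * W x \<le> 1/2" using N0 by simp
    qed
    then have "\<delta> * emeasure \<nu> B \<le> emeasure (kernel_pow P (n0 + N) x) B + \<delta> * emeasure \<nu> B * ennreal (1/2)"
      using entry[OF B order_refl, of x] by (meson add_left_mono mult_left_mono order_trans zero_le)
    moreover obtain c where c: "0 \<le> c" "\<delta> * emeasure \<nu> B = ennreal c"
      using fin[OF B] by (cases "\<delta> * emeasure \<nu> B") (auto simp: top_unique)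
    moreover obtain q where q: "0 \<le> q" "emeasure (kernel_pow P (n0 + N) x) B = ennreal q"
      using prob_space.finite_measure[OF pkernel_prob_space[OF kernel_pow_pkernel[OF P]], of "n0 + N" x]
      by (metis finite_measure.emeasure_eq_measure measure_nonneg)
    moreover have "ennreal (q + c * (1/2)) = ennreal q + ennreal c * ennreal (1/2)"
      using q(1) c(1) ennreal_plus[of q "c * (1/2)"] ennreal_mult[of c "1/2"] by simp
    ultimately have "ennreal c \<le> ennreal (q + c * (1/2))" by simp
    then have "c \<le> q + c * (1/2)" by (subst (asm) ennreal_le_iff) (use q c in auto)
    then have "c / 2 \<le> q" by simp
    have "\<delta> / 2 * emeasure \<nu> B = \<delta> * emeasure \<nu> B / 2" by (simp add: divide_ennreal_def mult_ac)
    also have "\<dots> = ennreal (c / 2)" using c by (simp add: divide_ennreal[symmetric])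
    also have "\<dots> \<le> ennreal q" by (rule ennreal_leI) fact
    finally show ?thesis using q by simp
  qed
  show ?thesis
  proof (intro exI[of _ "n0 + N"] conjI exI[of _ "scale_measure (\<delta> / 2) \<nu>"] allI impI)
    show "0 < n0 + N" by (simp add: N_def)
    have "emeasure \<nu> D \<le> emeasure \<nu> UNIV" using sets_nu by (intro emeasure_mono) auto
    then have "emeasure \<nu> UNIV \<noteq> 0" using nuD by auto
    then show "emeasure (scale_measure (\<delta> / 2) \<nu>) UNIV \<noteq> 0" using \<delta> by (simp add: ennreal_divide_eq_0_iff)
    show "scale_measure (\<delta> / 2) \<nu> \<le> kernel_pow P (n0 + N) x" if "W x \<le> r" for x
      using le[OF that] by (simp add: le_measure sets_nu sets_pow)
  qed (simp add: sets_nu)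
qed

text \<open>The fixed point of the drift recursion \<open>w = \<rho> * w + b\<close>: the constant
  that remains however often the drift inequality is iterated.\<close>

definition "bound = b / (1 - \<rho>)"

lemma bound_nonneg: "0 \<le> bound" using lam b by (simp add: bound_def)

lemma nn_pow_W: "(\<integral>\<^sup>+y. ennreal (W y) \<partial>kernel_pow P n x) \<le> ennreal (\<rho> ^ n * W x + bound)"
proof (induction n)
  case 0
  have "(\<integral>\<^sup>+y. ennreal (W y) \<partial>kernel_pow P 0 x) = ennreal (W x)"
    unfolding kernel_pow_0 by (rule nn_integral_return) (use W_enn in auto)
  then show ?case using bound_nonneg by (simp add: ennreal_leI)
next
  case (Suc n)
  interpret pn: prob_space "kernel_pow P n x" using P by (intro pkernel_prob_space kernel_pow_pkernel)
  have "(\<integral>\<^sup>+y. ennreal (W y) \<partial>kernel_pow P (Suc n) x) = (\<integral>\<^sup>+y. \<integral>\<^sup>+z. ennreal (W z) \<partial>P y \<partial>kernel_pow P n x)"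
    using nn_integral_kernel_pow_add[OF P W_enn, of n 1 x] kernel_pow_1[OF P] by simp
  also have "\<dots> \<le> (\<integral>\<^sup>+y. ennreal \<rho> * ennreal (W y) + ennreal b \<partial>kernel_pow P n x)"
  proof (intro nn_integral_mono order_trans[OF drift])
    fix y
    have "\<rho> * W y + b * indicator D y \<le> \<rho> * W y + b" using b by (auto simp: indicator_def)
    then have "ennreal (\<rho> * W y + b * indicator D y) \<le> ennreal (\<rho> * W y + b)" by (rule ennreal_leI)
    also have "\<dots> = ennreal \<rho> * ennreal (W y) + ennreal b"
      using lam b W0[of y] by (simp add: ennreal_plus ennreal_mult)
    finally show "ennreal (\<rho> * W y + b * indicator D y) \<le> ennreal \<rho> * ennreal (W y) + ennreal b" .
  qed
  also have "\<dots> = ennreal \<rho> * (\<integral>\<^sup>+y. ennreal (W y) \<partial>kernel_pow P n x) + ennreal b"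
    using pow_meas[OF W_enn, of n x] by (simp add: nn_integral_add nn_integral_cmult pn.emeasure_space_1)
  also have "\<dots> \<le> ennreal \<rho> * ennreal (\<rho> ^ n * W x + bound) + ennreal b"
    by (intro add_right_mono mult_left_mono Suc) simp
  also have "\<dots> = ennreal (\<rho> * (\<rho> ^ n * W x + bound) + b)"
    using lam b W0[of x] bound_nonneg by (simp add: ennreal_plus ennreal_mult)
  also have "\<rho> * (\<rho> ^ n * W x + bound) + b = \<rho> ^ Suc n * W x + bound"
    using lam by (simp add: bound_def field_simps)
  finally show ?case .
qed

lemma integrable_pow:
  assumes u: "u \<in> borel_measurable borel" and "\<And>x. \<bar>u x\<bar> \<le> c * W x"
  shows "integrable (kernel_pow P n x) (u :: 'a \<Rightarrow> real)"
proof (rule Bochner_Integration.integrable_bound[OF _ pow_meas[OF u]])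
  have "(\<integral>\<^sup>+y. ennreal (norm (W y)) \<partial>kernel_pow P n x) < \<infinity>"
    using le_less_trans[OF nn_pow_W] W0 by simp
  then show "integrable (kernel_pow P n x) (\<lambda>y. c * W y)"
    by (intro integrable_mult_right integrableI_bounded pow_meas W)
  show "AE y in kernel_pow P n x. norm (u y) \<le> norm (c * W y)"
    using assms(2) by (intro AE_I2) (metis abs_ge_self order_trans real_norm_def)
qed

lemma pow_W: "kernel_app (kernel_pow P n) W x \<le> \<rho> ^ n * W x + bound"
proof -
  have "ennreal (kernel_app (kernel_pow P n) W x) = (\<integral>\<^sup>+y. ennreal (W y) \<partial>kernel_pow P n x)"
    unfolding kernel_app_def using integrable_pow[OF W, of 1] W0
    by (intro nn_integral_eq_integral[symmetric]) auto
  also note nn_pow_W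
  finally show ?thesis
    by (subst (asm) ennreal_le_iff) (use lam W0 bound_nonneg in auto)
qed

text \<open>\<open>osc \<beta> c\<close> says that the seminorm contracted in the argument of Hairer and Mattingly is at most \<open>c\<close>.\<close>

definition osc :: "real \<Rightarrow> real \<Rightarrow> ('a \<Rightarrow> real) \<Rightarrow> bool" where
  "osc \<beta> c u \<longleftrightarrow> u \<in> borel_measurable borel \<and> (\<forall>x y. u x - u y \<le> c * (2 + \<beta> * (W x + W y)))"

text \<open>The hypothesis says that every \<open>u x - c * (1 + \<beta> * W x)\<close> lies below
  every \<open>u y + c * (1 + \<beta> * W y)\<close>; the supremum of the first family separates the
  two.\<close>

lemma osc_centre:
  assumes "osc \<beta> c u"
  obtains s where "\<And>x. \<bar>u x - s\<bar> \<le> c * (1 + \<beta> * W x)"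
proof -
  let ?s = "SUP x. u x - c * (1 + \<beta> * W x)"
  have le: "u x - c * (1 + \<beta> * W x) \<le> u y + c * (1 + \<beta> * W y)" for x y
    using assms unfolding osc_def by (auto simp: algebra_simps dest!: spec[of _ x] spec[of _ y])
  have bdd: "bdd_above (range (\<lambda>x. u x - c * (1 + \<beta> * W x)))"
    using le by (intro bdd_aboveI2) auto
  have "u x - c * (1 + \<beta> * W x) \<le> ?s" for x by (intro cSUP_upper bdd) auto
  moreover have "?s \<le> u y + c * (1 + \<beta> * W y)" for y by (intro cSUP_least le) auto
  ultimately have "\<bar>u x - ?s\<bar> \<le> c * (1 + \<beta> * W x)" for x by (smt (verit))
  then show ?thesis by (rule that)
qed

text \<open>Two regimes. If \<open>W x + W y\<close> is small, both rows contain the measure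
  \<open>\<mu>\<close>, and its mass \<open>a\<close> is gained on each side. If it is large, the
  drift alone contracts, because the gain \<open>(1 - \<rho>) * W\<close> outweighs the additive
  constant. The weight \<open>\<beta>\<close> must be small for the first regime and positive for
  the second.\<close>

lemma osc_contract:
  assumes N: "N > 0" and \<mu>: "sets \<mu> = sets borel" "emeasure \<mu> UNIV \<noteq> 0"
    and min: "\<And>x. W x \<le> 8 * (bound + 1) / (1 - \<rho>) \<Longrightarrow> \<mu> \<le> kernel_pow P N x"
  obtains \<alpha> \<beta> where "0 < \<alpha>" "\<alpha> < 1" "0 < \<beta>"
    "\<And>c u. 0 \<le> c \<Longrightarrow> osc \<beta> c u \<Longrightarrow> osc \<beta> (\<alpha> * c) (kernel_app (kernel_pow P N) u)"
proof -
  let ?R = "kernel_pow P N" and ?r = "8 * (bound + 1) / (1 - \<rho>)"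
  \<comment> \<open>If the sublevel set is empty, the first regime never occurs; the value 1 then
    merely keeps \<open>0 < a \<le> 1\<close>.\<close>
  define a where "a = (if \<exists>x. W x \<le> ?r then measure \<mu> UNIV else 1)"
  have mono: "measure \<mu> UNIV > 0 \<and> measure \<mu> UNIV \<le> 1 \<and> finite_measure \<mu>" if "W x \<le> ?r" for x
  proof -
    interpret p: prob_space "?R x" by (intro pkernel_prob_space kernel_pow_pkernel P)
    have sp: "space \<mu> = UNIV" using sets_eq_imp_space_eq[OF \<mu>(1)] by simp
    have "emeasure \<mu> UNIV \<le> emeasure (?R x) UNIV"
      using min[OF that] \<mu>(1) by (subst (asm) le_measure) (auto simp: sets_pow)
    also have "\<dots> \<le> 1" by (rule p.measure_le_1)
    finally have le1: "emeasure \<mu> UNIV \<le> 1" .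
    then have "finite_measure \<mu>" using sp by (intro finite_measureI) (auto simp: top_unique)
    then interpret finite_measure \<mu> .
    show ?thesis using le1 \<mu>(2) \<open>finite_measure \<mu>\<close> by (simp add: emeasure_eq_measure zero_less_measure_iff)
  qed
  have a: "0 < a" "a \<le> 1" unfolding a_def using mono by auto
  \<comment> \<open>\<open>\<beta>\<close> makes the drift constant cost at most \<open>a\<close>,
    half of the \<open>2 * a\<close> gained from the minorization; \<open>\<kappa>\<close> has to
    respect both regimes.\<close>
  define \<beta> where "\<beta> = a / (2 * bound + 1)"
  define \<kappa> where "\<kappa> = min (a / 2) (min ((1 - \<rho>) / 2) \<beta>)"
  have \<beta>: "0 < \<beta>" unfolding \<beta>_def using a bound_nonneg by (intro divide_pos_pos) auto
  have \<beta>A: "2 * \<beta> * bound \<le> a" unfolding \<beta>_def using a bound_nonneg by (simp add: field_simps)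
  have \<kappa>: "0 < \<kappa>" "\<kappa> \<le> a / 2" "\<kappa> \<le> (1 - \<rho>) / 2" "\<kappa> \<le> \<beta>"
    unfolding \<kappa>_def using a lam \<beta> by (auto simp: min_def)
  have contr: "kernel_app ?R u x - kernel_app ?R u y \<le> (1 - \<kappa>) * c * (2 + \<beta> * (W x + W y))"
    if c: "0 \<le> c" and osc: "osc \<beta> c u" for c u x y
  proof -
    obtain s where s: "\<And>x. \<bar>u x - s\<bar> \<le> c * (1 + \<beta> * W x)" using osc_centre[OF osc] by blast
    have u: "u \<in> borel_measurable borel" using osc by (simp add: osc_def)
    define v where "v x = u x - s" for x
    define w where "w x = c * (1 + \<beta> * W x)" for x
    have vm: "v \<in> borel_measurable borel" "w \<in> borel_measurable borel"
      unfolding v_def w_def using u W by auto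
    have vw: "\<bar>v x\<bar> \<le> w x" for x using s by (simp add: v_def w_def)
    have wW: "\<bar>w x\<bar> \<le> (c * (1 + \<beta>)) * W x" for x
    proof -
      have "0 \<le> w x" using vw[of x] by linarith
      moreover have "w x \<le> c * (W x + \<beta> * W x)" unfolding w_def using c W1 by (intro mult_left_mono) auto
      ultimately show ?thesis by (simp add: algebra_simps)
    qed
    have vi: "integrable (?R x) v" "integrable (?R x) w" for x
      by (rule integrable_pow[OF vm(1), of "c * (1 + \<beta>)"]; use vw wW in \<open>meson abs_ge_self order_trans\<close>)
         (rule integrable_pow[OF vm(2) wW])
    have Wi: "integrable (?R x) W" for x using integrable_pow[OF W, of 1] W0 by simp
    interpret p: prob_space "?R z" for z by (intro pkernel_prob_space kernel_pow_pkernel P)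
    have Ru: "kernel_app ?R u x = kernel_app ?R v x + s" for x
    proof -
      have "kernel_app ?R u x = (\<integral>y. v y + s \<partial>?R x)" by (simp add: kernel_app_def v_def)
      also have "\<dots> = kernel_app ?R v x + s" using vi p.prob_space by (simp add: kernel_app_def)
      finally show ?thesis .
    qed
    have Rw: "kernel_app ?R w x \<le> c * (1 + \<beta> * (\<rho> * W x + bound))" for x
    proof -
      have "kernel_app ?R w x = c * (1 + \<beta> * kernel_app ?R W x)"
        using Wi p.prob_space by (simp add: kernel_app_def w_def)
      moreover have "kernel_app ?R W x \<le> \<rho> * W x + bound"
      proof (rule order_trans[OF pow_W])
        have "\<rho> ^ N \<le> \<rho>" using lam N power_decreasing[of 1 N \<rho>] by simp
        then show "\<rho> ^ N * W x + bound \<le> \<rho> * W x + bound" using W0 by (simp add: mult_right_mono)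
      qed
      ultimately show ?thesis using c \<beta> by (simp add: mult_left_mono)
    qed
    have Rv: "\<bar>kernel_app ?R v x\<bar> \<le> kernel_app ?R w x" for x
    proof -
      have "\<bar>kernel_app ?R v x\<bar> \<le> (\<integral>y. \<bar>v y\<bar> \<partial>?R x)" unfolding kernel_app_def by (rule integral_abs_bound)
      also have "\<dots> \<le> kernel_app ?R w x" unfolding kernel_app_def using vi vw by (intro integral_mono) auto
      finally show ?thesis .
    qed
    let ?S = "W x + W y"
    have "kernel_app ?R v x - kernel_app ?R v y \<le> c * ((1 - \<kappa>) * (2 + \<beta> * ?S))"
    proof (cases "?S \<le> ?r")
      case True
      have xy: "W x \<le> ?r" "W y \<le> ?r" using True W0[of x] W0[of y] by linarith+
      have am: "a = measure \<mu> UNIV" using xy by (auto simp: a_def)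
      interpret mu: finite_measure \<mu> using mono[OF xy(1)] by simp
      have mle: "(\<integral>y. h y \<partial>\<mu>) \<le> (\<integral>y. h y \<partial>?R x)"
        if "W x \<le> ?r" "h \<in> borel_measurable borel" "\<And>y. 0 \<le> h y" "integrable (?R x) h" for x and h :: "'a \<Rightarrow> real"
      proof -
        have "ennreal (\<integral>y. h y \<partial>\<mu>) \<le> (\<integral>\<^sup>+y. ennreal (norm (h y)) \<partial>\<mu>)"
          by (cases "integrable \<mu> h") (use that(3) in \<open>auto simp: nn_integral_eq_integral not_integrable_integral_eq\<close>)
        also have "\<dots> \<le> (\<integral>\<^sup>+y. ennreal (norm (h y)) \<partial>?R x)"
          by (intro nn_integral_mono_measure min that) (simp add: \<mu> sets_pow)
        also have "\<dots> = ennreal (\<integral>y. h y \<partial>?R x)" using that by (simp add: nn_integral_eq_integral)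
        finally show ?thesis using that(3) by (simp add: ennreal_le_iff integral_nonneg_AE)
      qed
      have wmi: "integrable \<mu> w"
      proof (rule integrableI_bounded)
        show "w \<in> borel_measurable \<mu>" using vm(2) \<mu>(1) by (simp cong: measurable_cong_sets)
        have "(\<integral>\<^sup>+y. ennreal (norm (w y)) \<partial>\<mu>) \<le> (\<integral>\<^sup>+y. ennreal (norm (w y)) \<partial>?R x)"
          by (intro nn_integral_mono_measure min xy) (simp add: \<mu> sets_pow)
        also have "\<dots> < \<infinity>" using vi(2)[of x] by (simp add: integrable_iff_bounded)
        finally show "(\<integral>\<^sup>+y. ennreal (norm (w y)) \<partial>\<mu>) < \<infinity>" .
      qed
      have vmi: "integrable \<mu> v"
        by (rule Bochner_Integration.integrable_bound[OF wmi])
           (use vm(1) \<mu>(1) vw in \<open>auto simp: order_trans[OF _ abs_ge_self] cong: measurable_cong_sets\<close>)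
      have aw: "c * a \<le> (\<integral>y. w y \<partial>\<mu>)"
      proof -
        have "c * a = (\<integral>y. c \<partial>\<mu>)" using \<mu>(1) sets_eq_imp_space_eq[OF \<mu>(1)] by (simp add: am)
        also have "\<dots> \<le> (\<integral>y. w y \<partial>\<mu>)"
        proof (intro integral_mono wmi)
          show "c \<le> w y" for y using c \<beta> W0[of y] by (simp add: w_def distrib_left)
        qed simp
        finally show ?thesis .
      qed
      \<comment> \<open>The comparison of \<open>\<mu>\<close> with a row applies to nonnegative
        functions: \<open>w - v\<close> at \<open>x\<close> and \<open>w + v\<close> at
        \<open>y\<close>. On adding, the integrals of \<open>v\<close> against \<open>\<mu>\<close>
        cancel and twice the integral of \<open>w\<close> is gained.\<close>
      have "(\<integral>y. w y - v y \<partial>\<mu>) \<le> (\<integral>y. w y - v y \<partial>?R x)"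
        using vi vm vw by (intro mle xy) (auto simp: abs_le_iff)
      then have 1: "kernel_app ?R v x - (\<integral>y. v y \<partial>\<mu>) \<le> kernel_app ?R w x - (\<integral>y. w y \<partial>\<mu>)"
        using vi wmi vmi by (simp add: kernel_app_def)
      have vw': "0 \<le> w z + v z" for z using vw[of z] by linarith
      have "(\<integral>y. w y + v y \<partial>\<mu>) \<le> (\<integral>z. w z + v z \<partial>?R y)"
        using vi vm vw' by (intro mle xy) auto
      then have 2: "(\<integral>y. v y \<partial>\<mu>) - kernel_app ?R v y \<le> kernel_app ?R w y - (\<integral>y. w y \<partial>\<mu>)"
        using vi wmi vmi by (simp add: kernel_app_def)
      have "kernel_app ?R v x - kernel_app ?R v y \<le> c * (1 + \<beta> * (\<rho> * W x + bound)) + c * (1 + \<beta> * (\<rho> * W y + bound)) - 2 * (c * a)"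
        using 1 2 aw Rw[of x] Rw[of y] by linarith
      also have "\<dots> = c * (2 - 2 * a + 2 * \<beta> * bound + \<rho> * (\<beta> * ?S))" by (simp add: algebra_simps)
      also have "\<dots> \<le> c * ((1 - \<kappa>) * (2 + \<beta> * ?S))"
      proof (rule mult_left_mono[OF _ c])
        have "\<rho> * (\<beta> * ?S) \<le> (1 - \<kappa>) * (\<beta> * ?S)" using \<kappa> lam \<beta> W0[of x] W0[of y] by (intro mult_right_mono) auto
        moreover have "2 - 2 * a + 2 * \<beta> * bound \<le> (1 - \<kappa>) * 2" using \<beta>A \<kappa>(2) by simp
        ultimately show "2 - 2 * a + 2 * \<beta> * bound + \<rho> * (\<beta> * ?S) \<le> (1 - \<kappa>) * (2 + \<beta> * ?S)"
          by (simp add: distrib_left)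
      qed
      finally show ?thesis .
    next
      case False
      have "kernel_app ?R v x - kernel_app ?R v y \<le> c * (1 + \<beta> * (\<rho> * W x + bound)) + c * (1 + \<beta> * (\<rho> * W y + bound))"
        using Rv[of x] Rv[of y] Rw[of x] Rw[of y] by linarith
      also have "\<dots> = c * (2 + 2 * \<beta> * bound + \<rho> * (\<beta> * ?S))" by (simp add: algebra_simps)
      also have "\<dots> \<le> c * ((1 - \<kappa>) * (2 + \<beta> * ?S))"
      proof (rule mult_left_mono[OF _ c])
        define T where "T = \<beta> * ?S"
        have T0: "0 \<le> T" unfolding T_def using \<beta> W0[of x] W0[of y] by simp
        \<comment> \<open>Half of \<open>T - \<rho> * T\<close> pays for
          \<open>2 * \<beta> * bound + 2 * \<kappa>\<close>, the other half for
          \<open>\<kappa> * T\<close>; this is where the threshold on \<open>W x + W y\<close> comes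
          from.\<close>
        have "8 * (bound + 1) \<le> (1 - \<rho>) * ?S" using False lam by (simp add: field_simps)
        then have "\<beta> * (8 * (bound + 1)) \<le> \<beta> * ((1 - \<rho>) * ?S)" using \<beta> by (intro mult_left_mono) auto
        then have 1: "8 * (\<beta> * bound) + 8 * \<beta> \<le> T - \<rho> * T" by (simp add: T_def algebra_simps)
        have "\<kappa> * T \<le> (1 - \<rho>) / 2 * T" using \<kappa> T0 by (intro mult_right_mono) auto
        then have 2: "2 * (\<kappa> * T) \<le> T - \<rho> * T" by (simp add: field_simps)
        have "0 \<le> \<beta> * bound" using \<beta> bound_nonneg by simp
        then have "2 + 2 * (\<beta> * bound) + \<rho> * T \<le> 2 - 2 * \<kappa> + T - \<kappa> * T"
          using 1 2 \<kappa>(1,4) by linarith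
        then show "2 + 2 * \<beta> * bound + \<rho> * (\<beta> * ?S) \<le> (1 - \<kappa>) * (2 + \<beta> * ?S)"
          unfolding T_def[symmetric] by (simp add: algebra_simps)
      qed
      finally show ?thesis .
    qed
    then show ?thesis by (simp add: Ru mult_ac)
  qed
  show ?thesis
  proof (rule that[of "1 - \<kappa>" \<beta>])
    show "0 < 1 - \<kappa>" using \<kappa>(3) lam by (simp add: field_simps)
    show "1 - \<kappa> < 1" "0 < \<beta>" using \<kappa> \<beta> by auto
    show "osc \<beta> ((1 - \<kappa>) * c) (kernel_app ?R u)" if "0 \<le> c" "osc \<beta> c u" for c u
      using contr[OF that] that(2) unfolding osc_def
      by (auto intro: kernel_app_measurable[OF kernel_pow_pkernel[OF P]])
  qed
qed

lemma kernel_app_pow_0: "u \<in> borel_measurable borel \<Longrightarrow> kernel_app (kernel_pow P 0) u x = (u x :: real)"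
  unfolding kernel_app_def kernel_pow_0 by (rule integral_return) auto

lemma kernel_app_pow_add:
  assumes "integrable (kernel_pow P (m + n) x) (u :: 'a \<Rightarrow> real)"
  shows "kernel_app (kernel_pow P (m + n)) u x = kernel_app (kernel_pow P m) (kernel_app (kernel_pow P n) u) x"
  using kernel_app_bind(1)[of "kernel_pow P m" "kernel_pow P n" x u] assms
  by (simp add: kernel_pow_add[OF P] kernel_pow_pkernel[OF P] kernel_app_def)

lemma osc_iterate:
  assumes c: "0 \<le> c" "osc \<beta> c u" and \<alpha>: "0 \<le> \<alpha>" and \<beta>: "0 \<le> \<beta>"
    and contr: "\<And>c u. 0 \<le> c \<Longrightarrow> osc \<beta> c u \<Longrightarrow> osc \<beta> (\<alpha> * c) (kernel_app (kernel_pow P N) u)"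
  shows "osc \<beta> (\<alpha> ^ n * c) (kernel_app (kernel_pow P (N * n)) u)"
proof (induction n)
  case 0
  have "kernel_app (kernel_pow P 0) u = u" using c(2) by (auto simp: osc_def fun_eq_iff kernel_app_pow_0)
  then show ?case using c by simp
next
  case (Suc n)
  have u: "u \<in> borel_measurable borel" using c(2) by (simp add: osc_def)
  obtain s where s: "\<And>x. \<bar>u x - s\<bar> \<le> c * (1 + \<beta> * W x)" using osc_centre[OF c(2)] by blast
  \<comment> \<open>Composing kernels on \<open>u\<close> needs integrability; the centre
    \<open>s\<close> provides it through a bound by a multiple of \<open>W\<close>.\<close>
  have "\<bar>u x\<bar> \<le> (\<bar>s\<bar> + c * (1 + \<beta>)) * W x" for x
  proof -
    have "\<bar>u x\<bar> \<le> \<bar>s\<bar> * 1 + c * (1 + \<beta> * W x)" using s[of x] by linarith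
    also have "\<dots> \<le> \<bar>s\<bar> * W x + c * (W x + \<beta> * W x)"
      by (rule add_mono; rule mult_left_mono) (use W1[of x] c(1) in auto)
    finally show ?thesis by (simp add: algebra_simps)
  qed
  then have "integrable (kernel_pow P (N + N * n) x) u" for x by (rule integrable_pow[OF u])
  then have "kernel_app (kernel_pow P (N * Suc n)) u = kernel_app (kernel_pow P N) (kernel_app (kernel_pow P (N * n)) u)"
    by (simp add: fun_eq_iff kernel_app_pow_add)
  then show ?case using contr[OF _ Suc] c \<alpha> by (simp add: mult.assoc)
qed

end

section \<open>From the contraction to summable rates\<close>

lemma stationary_kernel_prod:
  assumes \<pi>: "prob_space \<pi>" "sets \<pi> = sets borel"
    and Ps: "\<And>P. P \<in> set Ps \<Longrightarrow> pkernel P \<and> stationary_kernel \<pi> P"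
  shows "stationary_kernel \<pi> (kernel_prod Ps)"
  using Ps
proof (induction Ps)
  case Nil
  have "(\<integral>\<^sup>+x. indicator A x \<partial>\<pi>) = emeasure \<pi> A" if "A \<in> sets borel" for A
    using that \<pi>(2) by simp
  then show ?case by (simp add: stationary_kernel_def)
next
  case (Cons P Ps)
  have P: "pkernel P" "stationary_kernel \<pi> P" using Cons.prems[of P] by simp_all
  interpret stationary \<pi> P by (rule stationary.intro[OF \<pi> P])
  have k: "pkernel (kernel_prod Ps)" using Cons.prems by (intro kernel_prod_measurable) auto
  show ?case unfolding stationary_kernel_def
  proof
    fix A assume A: "A \<in> sets (borel :: 'a measure)"
    have "emeasure (kernel_prod (P # Ps) x) A = (\<integral>\<^sup>+y. emeasure (kernel_prod Ps y) A \<partial>P x)" for x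
    proof -
      interpret b: kernel_bind "P x" "kernel_prod Ps" using k pkernel_sets[OF P] by unfold_locales auto
      show ?thesis using b.nn_integral_bind_N[of "indicator A"] A
        by (simp add: b.sets_bind_N pkernel_sets[OF k])
    qed
    then show "emeasure \<pi> A = (\<integral>\<^sup>+x. emeasure (kernel_prod (P # Ps) x) A \<partial>\<pi>)"
      using Cons A nn_integral_stationary[OF pkernel_emeasure_measurable[OF k A]]
      by (simp add: stationary_kernel_def)
  qed
qed

text \<open>With \<open>r\<close> the \<open>N\<close>-th root of \<open>\<alpha>\<close>,
  \<open>\<alpha> ^ (n div N)\<close> is at most \<open>r ^ n / r ^ N\<close>, since
  \<open>n mod N\<close> is below \<open>N\<close>.\<close>

lemma summable_power_div:
  fixes \<alpha> :: real
  assumes \<alpha>: "0 < \<alpha>" "\<alpha> < 1" and N: "0 < N"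
  shows "summable (\<lambda>n. \<alpha> ^ (n div N))"
proof -
  define r where "r = root N \<alpha>"
  have r: "0 < r" "r < 1" "r ^ N = \<alpha>"
    unfolding r_def using \<alpha> N by (auto simp: real_root_pow_pos)
  have "\<alpha> ^ (n div N) \<le> (1 / r ^ N) * r ^ n" for n
  proof -
    have "n \<le> N * (n div N) + N"
    proof -
      have "n = N * (n div N) + n mod N" "n mod N < N" using N by simp_all
      then show ?thesis by linarith
    qed
    then have "r ^ (N * (n div N) + N) \<le> r ^ n" using r by (intro power_decreasing) auto
    then have "\<alpha> ^ (n div N) * r ^ N \<le> r ^ n" by (simp add: power_add power_mult r(3))
    then have "\<alpha> ^ (n div N) \<le> r ^ n / r ^ N" using r(1) by (simp add: pos_le_divide_eq)
    then show ?thesis by simp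
  qed
  then have le: "norm (\<alpha> ^ (n div N)) \<le> (1 / r ^ N) * r ^ n" for n using \<alpha> by simp
  have "summable (\<lambda>n. (1 / r ^ N) * r ^ n)" by (intro summable_mult summable_geometric) (use r in simp)
  then show ?thesis by (rule summable_comparison_test'[of _ 0]) (rule le)
qed

context geometric_drift
begin

text \<open>The contraction concerns \<open>N\<close> steps at once: the \<open>n div N\<close>
  blocks contract, and the remaining \<open>n mod N\<close> steps cost the factor
  \<open>1 + bound\<close>. Averaging the second point of the oscillation over \<open>\<pi>\<close>
  replaces its value by the stationary mean.\<close>

lemma geometric_ergodicity:
  fixes \<pi> \<psi> :: "'a measure"
  assumes irr: "\<And>A x. A \<in> sets borel \<Longrightarrow> emeasure \<psi> A > 0 \<Longrightarrow> \<exists>t>0. emeasure (kernel_pow P t x) A > 0"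
    and aper: "aperiodic_kernel P \<psi>" and small: "small_set P D"
    and \<pi>: "prob_space \<pi>" "sets \<pi> = sets borel" "stationary_kernel \<pi> P" and W\<pi>: "integrable \<pi> W"
  shows "\<exists>c. summable c \<and> (\<forall>n. 0 \<le> c n) \<and> (\<forall>n u x. u \<in> borel_measurable borel \<longrightarrow>
    (\<forall>y. \<bar>u y\<bar> \<le> W y) \<longrightarrow> \<bar>kernel_app (kernel_pow P n) u x - (\<integral>y. u y \<partial>\<pi>)\<bar> \<le> c n * W x)"
proof -
  obtain N \<mu> where N: "N > 0" and \<mu>: "sets \<mu> = sets borel" "emeasure \<mu> UNIV \<noteq> 0"
    "\<And>x. W x \<le> 8 * (bound + 1) / (1 - \<rho>) \<Longrightarrow> \<mu> \<le> kernel_pow P N x"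
    using minor_sublevel[OF irr aper small, of "8 * (bound + 1) / (1 - \<rho>)"] by blast
  obtain \<alpha> \<beta> where \<alpha>: "0 < \<alpha>" "\<alpha> < 1" and \<beta>: "0 < \<beta>"
    and contr: "\<And>c u. 0 \<le> c \<Longrightarrow> osc \<beta> c u \<Longrightarrow> osc \<beta> (\<alpha> * c) (kernel_app (kernel_pow P N) u)"
    using osc_contract[OF N \<mu>] by blast
  interpret pi: prob_space \<pi> by fact
  define w where "w = (\<integral>y. W y \<partial>\<pi>)"
  have w: "0 \<le> w" unfolding w_def using W0 by (intro integral_nonneg_AE) auto
  \<comment> \<open>Collects the constant \<open>2\<close>, the stationary mean \<open>w\<close> and
    \<open>W x\<close> itself into a multiple of \<open>W x\<close>, using \<open>W \<ge> 1\<close>;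
    the division by \<open>\<beta>\<close> stems from the initial oscillation of
    \<open>v\<close>.\<close>
  define C where "C = (2 + \<beta> * w) / \<beta> + 1"
  define c where "c n = (1 + bound) * C * \<alpha> ^ (n div N)" for n
  have C: "0 \<le> C" unfolding C_def using \<beta> w by auto
  have step: "\<bar>kernel_app (kernel_pow P n) u x - (\<integral>y. u y \<partial>\<pi>)\<bar> \<le> c n * W x"
    if u: "u \<in> borel_measurable borel" and uW: "\<And>y. \<bar>u y\<bar> \<le> W y" for n u x
  proof -
    define q r where "q = n div N" and "r = n mod N"
    have n: "n = N * q + r" by (simp add: q_def r_def)
    define v where "v = kernel_app (kernel_pow P r) u"
    have v: "v \<in> borel_measurable borel"
      unfolding v_def by (rule kernel_app_measurable[OF kernel_pow_pkernel[OF P] u])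
    have iu: "integrable (kernel_pow P k y) u" for k y using integrable_pow[OF u, of 1] uW by simp
    have vW: "\<bar>v y\<bar> \<le> (1 + bound) * W y" for y
    proof -
      have "\<bar>v y\<bar> \<le> (\<integral>z. \<bar>u z\<bar> \<partial>kernel_pow P r y)" unfolding v_def kernel_app_def by (rule integral_abs_bound)
      also have "\<dots> \<le> kernel_app (kernel_pow P r) W y" unfolding kernel_app_def
        using integrable_pow[OF W, of 1] W0 iu uW by (intro integral_mono integrable_abs) auto
      also have "\<dots> \<le> \<rho> ^ r * W y + bound" by (rule pow_W)
      also have "\<dots> \<le> 1 * W y + bound * W y"
        using lam W0[of y] W1[of y] bound_nonneg mult_left_mono[of 1 "W y" bound]
        by (intro add_mono mult_right_mono power_le_one) auto
      finally show ?thesis by (simp add: algebra_simps)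
    qed
    have osc: "osc \<beta> ((1 + bound) / \<beta>) v"
      unfolding osc_def
    proof (intro conjI allI v)
      fix x y
      have "v x - v y \<le> (1 + bound) * (W x + W y)" using vW[of x] vW[of y] by (simp add: distrib_left)
      also have "\<dots> \<le> (1 + bound) * (2 / \<beta> + (W x + W y))" using \<beta> bound_nonneg by (intro mult_left_mono) auto
      finally show "v x - v y \<le> (1 + bound) / \<beta> * (2 + \<beta> * (W x + W y))" using \<beta> by (simp add: field_simps)
    qed
    let ?h = "kernel_app (kernel_pow P (N * q)) v"
    have "osc \<beta> (\<alpha> ^ q * ((1 + bound) / \<beta>)) ?h"
      using \<alpha> \<beta> bound_nonneg by (intro osc_iterate osc contr) auto
    then have hosc: "?h x - ?h y \<le> \<alpha> ^ q * ((1 + bound) / \<beta>) * (2 + \<beta> * (W x + W y))" for x y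
      unfolding osc_def by blast
    have stat: "stationary \<pi> (kernel_pow P k)" for k
    proof (rule stationary.intro[OF \<pi>(1,2) kernel_pow_pkernel[OF P]])
      show "stationary_kernel \<pi> (kernel_pow P k)" unfolding kernel_pow_def
        by (rule stationary_kernel_prod[OF \<pi>(1,2)]) (simp add: \<pi>(3) P)
    qed
    have u\<pi>: "integrable \<pi> u"
    proof (rule Bochner_Integration.integrable_bound[OF W\<pi>])
      show "u \<in> borel_measurable \<pi>" using u \<pi>(2) by (simp cong: measurable_cong_sets)
      show "AE y in \<pi>. norm (u y) \<le> norm (W y)" using uW W0 by simp
    qed
    have v\<pi>: "integrable \<pi> v" "(\<integral>y. v y \<partial>\<pi>) = (\<integral>y. u y \<partial>\<pi>)"
      unfolding v_def using stationary.integrable_kernel_app[OF stat u\<pi>] by auto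
    have h\<pi>: "integrable \<pi> ?h" "(\<integral>y. ?h y \<partial>\<pi>) = (\<integral>y. u y \<partial>\<pi>)"
      using stationary.integrable_kernel_app[OF stat v\<pi>(1)] v\<pi>(2) by auto
    have hx: "?h x = kernel_app (kernel_pow P n) u x"
      unfolding n v_def by (rule kernel_app_pow_add[OF iu, symmetric])
    let ?k = "\<alpha> ^ q * ((1 + bound) / \<beta>)"
    have k: "0 \<le> ?k" using \<alpha> \<beta> bound_nonneg by simp
    have "\<bar>?h x - (\<integral>y. ?h y \<partial>\<pi>)\<bar> = \<bar>\<integral>y. ?h x - ?h y \<partial>\<pi>\<bar>"
      using h\<pi>(1) pi.prob_space by simp
    also have "\<dots> \<le> (\<integral>y. \<bar>?h x - ?h y\<bar> \<partial>\<pi>)" by (rule integral_abs_bound)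
    also have "\<dots> \<le> (\<integral>y. ?k * (2 + \<beta> * (W x + W y)) \<partial>\<pi>)"
    proof (intro integral_mono)
      fix y show "\<bar>?h x - ?h y\<bar> \<le> ?k * (2 + \<beta> * (W x + W y))"
        using hosc[of x y] hosc[of y x] by (simp add: abs_le_iff add.commute)
    qed (use h\<pi> W\<pi> in auto)
    also have "\<dots> = ?k * (\<integral>y. (2 + \<beta> * W x) + \<beta> * W y \<partial>\<pi>)"
      by (subst integral_mult_right_zero[symmetric]) (simp add: algebra_simps)
    also have "(\<integral>y. (2 + \<beta> * W x) + \<beta> * W y \<partial>\<pi>) = 2 + \<beta> * w + \<beta> * W x"
      using W\<pi> pi.prob_space by (simp add: w_def)
    also have "?k * (2 + \<beta> * w + \<beta> * W x) \<le> ?k * ((2 + \<beta> * w) * W x + \<beta> * W x)"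
      using k \<beta> w mult_left_mono[OF W1[of x], of "2 + \<beta> * w"] by (intro mult_left_mono) auto
    also have "\<dots> = c n * W x" unfolding c_def C_def q_def[symmetric] using \<beta> by (simp add: field_simps)
    finally show ?thesis unfolding h\<pi>(2) hx .
  qed
  show ?thesis
  proof (intro exI[of _ c] conjI allI impI)
    show "summable c" unfolding c_def by (intro summable_mult summable_power_div \<alpha> N)
    show "0 \<le> c n" for n unfolding c_def using C bound_nonneg \<alpha> by simp
  qed (use step in blast)
qed

end

section \<open>Martingale increments under the stationary law\<close>

lemma norm_iexp_minus_1: "norm (iexp x - 1) \<le> \<bar>x\<bar>"
  using iexp_approx1[of x 0] by simp

text \<open>The deviation \<open>D n\<close> of the partial sums from linear growth is
  \<open>K\<close>-periodic, hence bounded.\<close>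

lemma periodic_mean_tendsto:
  fixes s :: "nat \<Rightarrow> real"
  assumes K: "0 < K" and per: "\<And>j. s (j + K) = s j"
  shows "(\<lambda>n. (\<Sum>j<n. s j) / real n) \<longlonglongrightarrow> (\<Sum>k<K. s k) / real K"
proof -
  define S where "S = (\<Sum>k<K. s k) / real K"
  define D where "D n = (\<Sum>j<n. s j) - real n * S" for n
  have shift: "(\<Sum>j<K. s (n + j)) = (\<Sum>k<K. s k)" for n
  proof (induction n)
    case (Suc n)
    have "(\<Sum>j<K. s (Suc n + j)) + s n = (\<Sum>j<Suc K. s (n + j))"
      by (subst sum.lessThan_Suc_shift) simp
    also have "\<dots> = (\<Sum>j<K. s (n + j)) + s n" using per[of n] by simp
    finally show ?case using Suc by simp
  qed simp
  have "D (n + K) = D n" for n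
  proof -
    have "(\<Sum>j<n + K. s j) = (\<Sum>j<n. s j) + (\<Sum>j<K. s (n + j))"
      by (induction K) (auto simp: algebra_simps)
    then show ?thesis using K shift[of n] unfolding D_def S_def by (simp add: field_simps)
  qed
  then have Dq: "D (r + K * q) = D r" for r q
    by (induction q) (simp_all add: algebra_simps, metis add.assoc add.commute)
  define C where "C = (\<Sum>r<K. \<bar>D r\<bar>)"
  have "\<bar>D n\<bar> \<le> C" for n
  proof -
    have "D n = D (n mod K)" using Dq[of "n mod K" "n div K"] by simp
    moreover have "\<bar>D (n mod K)\<bar> \<le> C" unfolding C_def by (rule member_le_sum) (use K in auto)
    ultimately show ?thesis by simp
  qed
  then have bound: "norm (D n / real n) \<le> C * inverse (real n)" for n
    by (simp add: divide_inverse mult_right_mono abs_mult)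
  have "(\<lambda>n. C * inverse (real n)) \<longlonglongrightarrow> C * 0"
    by (intro tendsto_mult tendsto_const lim_inverse_n)
  then have "(\<lambda>n. C * inverse (real n)) \<longlonglongrightarrow> 0" by simp
  then have "(\<lambda>n. D n / real n) \<longlonglongrightarrow> 0"
    by (rule Lim_null_comparison[OF always_eventually[OF allI[OF bound]]])
  then have "(\<lambda>n. D n / real n + S) \<longlonglongrightarrow> 0 + S" by (intro tendsto_add tendsto_const)
  moreover have "eventually (\<lambda>n. D n / real n + S = (\<Sum>j<n. s j) / real n) sequentially"
    using eventually_gt_at_top[of 0] by eventually_elim (simp add: D_def field_simps)
  ultimately show ?thesis unfolding S_def by (auto intro: Lim_transform_eventually)
qed

text \<open>The bound in \<open>char_approx3'\<close>, divided by \<open>e\<^sup>2 / 6\<close>.\<close>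

definition lindeberg :: "real \<Rightarrow> real \<Rightarrow> real" where
  "lindeberg e z = min (6 * z\<^sup>2) (\<bar>e\<bar> * \<bar>z\<bar> ^ 3)"

text \<open>The second factor stays bounded and tends to 0 with \<open>e\<close>, the form that
  dominated convergence needs.\<close>

lemma lindeberg_eq: "lindeberg e z = z\<^sup>2 * min 6 (\<bar>e\<bar> * \<bar>z\<bar>)"
  unfolding lindeberg_def by (auto simp: min_def power2_eq_square power3_eq_cube mult_ac abs_mult_self_eq
    mult_le_cancel_left simp flip: abs_mult)

lemma lindeberg_nonneg: "0 \<le> lindeberg e z" by (simp add: lindeberg_def)

lemma lindeberg_le: "lindeberg e z \<le> 6 * z\<^sup>2" by (simp add: lindeberg_def)

lemma lindeberg_mono: "\<bar>z\<bar> \<le> \<bar>z'\<bar> \<Longrightarrow> lindeberg e z \<le> lindeberg e z'"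
  using power_mono[of "\<bar>z\<bar>" "\<bar>z'\<bar>" 2] power_mono[of "\<bar>z\<bar>" "\<bar>z'\<bar>" 3]
  unfolding lindeberg_def by (intro min.mono mult_left_mono) simp_all

text \<open>Separates the two terms of a martingale increment, which live at different times, so
  that each can be integrated against \<open>\<pi>\<close> on its own. The factor 2 comes from
  \<open>\<bar>a - b\<bar> \<le> 2 * max \<bar>a\<bar> \<bar>b\<bar>\<close>.\<close>

lemma lindeberg_diff: "lindeberg e (a - b) \<le> lindeberg e (2 * a) + lindeberg e (2 * b)"
proof (cases "\<bar>a\<bar> \<le> \<bar>b\<bar>")
  case True
  then have "lindeberg e (a - b) \<le> lindeberg e (2 * b)" by (intro lindeberg_mono) auto
  then show ?thesis using lindeberg_nonneg[of e "2 * a"] by linarith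
next
  case False
  then have "lindeberg e (a - b) \<le> lindeberg e (2 * a)" by (intro lindeberg_mono) auto
  then show ?thesis using lindeberg_nonneg[of e "2 * b"] by linarith
qed

lemma lindeberg_measurable: "lindeberg e \<in> borel_measurable borel"
  unfolding lindeberg_def by measurable

lemma lindeberg_integrable:
  assumes "u \<in> borel_measurable M" "integrable M (\<lambda>x. (u x)\<^sup>2)"
  shows "integrable M (\<lambda>x. lindeberg e (u x))"
proof (rule Bochner_Integration.integrable_bound)
  show "integrable M (\<lambda>x. 6 * (u x)\<^sup>2)" using assms by simp
  show "(\<lambda>x. lindeberg e (u x)) \<in> borel_measurable M"
    using measurable_compose[OF assms(1) lindeberg_measurable] .
  show "AE x in M. norm (lindeberg e (u x)) \<le> norm (6 * (u x)\<^sup>2)"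
    using lindeberg_nonneg lindeberg_le by (intro AE_I2) simp
qed

lemma lindeberg_tendsto:
  assumes "u \<in> borel_measurable M" "integrable M (\<lambda>x. (u x)\<^sup>2)" and e: "e \<longlonglongrightarrow> 0"
  shows "(\<lambda>n. \<integral>x. lindeberg (e n) (u x) \<partial>M) \<longlonglongrightarrow> 0"
proof -
  have "(\<lambda>n. \<integral>x. lindeberg (e n) (u x) \<partial>M) \<longlonglongrightarrow> (\<integral>x. 0 \<partial>M)"
  proof (rule integral_dominated_convergence)
    show "integrable M (\<lambda>x. 6 * (u x)\<^sup>2)" using assms by simp
    show "(\<lambda>x. lindeberg (e n) (u x)) \<in> borel_measurable M" for n
      using measurable_compose[OF assms(1) lindeberg_measurable] .
    show "AE x in M. norm (lindeberg (e n) (u x)) \<le> 6 * (u x)\<^sup>2" for n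
      using lindeberg_nonneg lindeberg_le by (intro AE_I2) simp
    show "AE x in M. (\<lambda>n. lindeberg (e n) (u x)) \<longlonglongrightarrow> 0"
    proof (rule AE_I2)
      fix x
      have "(\<lambda>n. (u x)\<^sup>2 * min 6 (\<bar>e n\<bar> * \<bar>u x\<bar>)) \<longlonglongrightarrow> (u x)\<^sup>2 * min 6 (\<bar>0\<bar> * \<bar>u x\<bar>)"
        by (intro tendsto_intros e)
      then show "(\<lambda>n. lindeberg (e n) (u x)) \<longlonglongrightarrow> 0" by (simp add: lindeberg_eq)
    qed
  qed simp
  then show ?thesis by simp
qed

text \<open>Indices are times with period \<open>K\<close> instead of elements of a cyclically
  permuted set; recursions along the path then just increase the index.\<close>

locale periodic_sweep =
  fixes \<pi> :: "'a::topological_space measure" and P :: "nat \<Rightarrow> 'a \<Rightarrow> 'a measure"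
    and h :: "nat \<Rightarrow> 'a \<Rightarrow> real" and K :: nat
  assumes st: "stationary \<pi> (P j)" and K: "0 < K"
    and P_per: "P (j + K) = P j" and h_per: "h (j + K) = h j"
    and h: "h j \<in> borel_measurable borel" and h2: "integrable \<pi> (\<lambda>x. (h j x)\<^sup>2)"
begin

sublocale S: stationary \<pi> "P j" for j by (rule st)

abbreviation Ph where "Ph j \<equiv> kernel_app (P j) (h (Suc j))"

lemma meas_pi: "u \<in> borel_measurable borel \<Longrightarrow> u \<in> borel_measurable \<pi>"
  by (rule S.meas_N)

lemma pi_meas: "integrable \<pi> u \<Longrightarrow> u \<in> borel_measurable borel"
  using S.borel_N borel_measurable_integrable by blast

lemma Ph: "Ph j \<in> borel_measurable borel" by (rule kernel_app_measurable[OF S.P h])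

lemma h1: "integrable \<pi> (h j)" by (rule S.kernel_app_square[OF h h2])

lemma Ph1: "integrable \<pi> (Ph j)" by (rule S.integrable_kernel_app[OF h1])

lemma Ph2: "integrable \<pi> (\<lambda>x. (Ph j x)\<^sup>2)" by (rule S.kernel_app_square[OF h h2])

lemma iexp_meas: "u \<in> borel_measurable borel \<Longrightarrow> (\<lambda>x. iexp (e * u x)) \<in> borel_measurable borel"
  by measurable

text \<open>With the martingale increment \<open>d\<^sub>j (x, y) = h\<^sub>j\<^sub>+\<^sub>1 (y) - Ph j x\<close>,
  \<open>twist e j u x\<close> is the conditional expectation of \<open>iexp (e * d\<^sub>j) * u\<close> at \<open>x\<close>.\<close>

definition twist :: "real \<Rightarrow> nat \<Rightarrow> ('a \<Rightarrow> complex) \<Rightarrow> 'a \<Rightarrow> complex" where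
  "twist e j u x = iexp (- (e * Ph j x)) * kernel_app (P j) (\<lambda>y. iexp (e * h (Suc j) y) * u y) x"

text \<open>The twists act in the order of decreasing time. For general \<open>u\<close> this is the
  stationary expectation of \<open>u\<close> at time \<open>j\<close> times the exponential of the
  first \<open>j\<close> increments; the argument \<open>u\<close> is what allows recursion and
  replacement.\<close>

primrec path_mean :: "real \<Rightarrow> nat \<Rightarrow> ('a \<Rightarrow> complex) \<Rightarrow> complex" where
  "path_mean e 0 u = (\<integral>x. u x \<partial>\<pi>)"
| "path_mean e (Suc j) u = path_mean e j (twist e j u)"

lemma integrable_iexp_mult:
  assumes "integrable \<pi> u" "w \<in> borel_measurable borel"
  shows "integrable \<pi> (\<lambda>y. iexp (e * w y) * u y)"
proof (rule Bochner_Integration.integrable_bound[OF assms(1)])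
  show "(\<lambda>y. iexp (e * w y) * u y) \<in> borel_measurable \<pi>"
    using meas_pi[OF iexp_meas[OF assms(2)]] assms(1) by (intro borel_measurable_times) auto
qed (simp add: norm_mult)

lemma twist_integrable:
  assumes u: "integrable \<pi> u"
  shows "integrable \<pi> (twist e j u)" "(\<integral>x. norm (twist e j u x) \<partial>\<pi>) \<le> (\<integral>x. norm (u x) \<partial>\<pi>)"
proof -
  have "integrable \<pi> (\<lambda>y. iexp (- e * Ph j y) * kernel_app (P j) (\<lambda>y. iexp (e * h (Suc j) y) * u y) y)"
    by (intro integrable_iexp_mult S.integrable_kernel_app u Ph h)
  then show "integrable \<pi> (twist e j u)" unfolding twist_def by simp
  have "(\<integral>x. norm (twist e j u x) \<partial>\<pi>) = (\<integral>x. norm (kernel_app (P j) (\<lambda>y. iexp (e * h (Suc j) y) * u y) x) \<partial>\<pi>)"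
    by (simp add: twist_def norm_mult)
  also have "\<dots> \<le> (\<integral>x. norm (iexp (e * h (Suc j) x) * u x) \<partial>\<pi>)"
    by (intro S.integral_norm_kernel_app integrable_iexp_mult u h)
  finally show "(\<integral>x. norm (twist e j u x) \<partial>\<pi>) \<le> (\<integral>x. norm (u x) \<partial>\<pi>)" by (simp add: norm_mult)
qed

lemma norm_path_mean_le: "integrable \<pi> u \<Longrightarrow> norm (path_mean e j u) \<le> (\<integral>x. norm (u x) \<partial>\<pi>)"
proof (induction j arbitrary: u)
  case (Suc j)
  show ?case using order_trans[OF Suc.IH[OF twist_integrable(1)] twist_integrable(2)] Suc.prems by simp
qed simp

lemma twist_measurable: "u \<in> borel_measurable borel \<Longrightarrow> twist e j u \<in> borel_measurable borel"
  using iexp_meas[OF Ph, of "- e"] kernel_app_measurable[OF S.P, of "\<lambda>y. iexp (e * h (Suc j) y) * u y" j] iexp_meas[OF h, of e]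
  unfolding twist_def by (intro borel_measurable_times) auto

text \<open>Stationarity carries almost everywhere equality through every twist, so identities valid
  up to null sets, as the Poisson equation, can be used underneath \<open>path_mean\<close>.\<close>

lemma path_mean_cong:
  assumes "u \<in> borel_measurable borel" "w \<in> borel_measurable borel" "AE x in \<pi>. u x = w x"
  shows "path_mean e j u = path_mean e j w"
  using assms
proof (induction j arbitrary: u w)
  case 0
  then show ?case by (auto intro!: integral_cong_AE meas_pi)
next
  case (Suc j)
  have m: "(\<lambda>y. iexp (e * h (Suc j) y) * u y) \<in> borel_measurable borel"
    "(\<lambda>y. iexp (e * h (Suc j) y) * w y) \<in> borel_measurable borel"
    using Suc.prems iexp_meas[OF h] by (auto intro!: borel_measurable_times)
  have "AE y in \<pi>. iexp (e * h (Suc j) y) * u y = iexp (e * h (Suc j) y) * w y"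
    using Suc.prems(3) by eventually_elim simp
  from S.AE_kernel_app_cong[OF m this]
  have "AE x in \<pi>. twist e j u x = twist e j w x" by eventually_elim (simp add: twist_def)
  then show ?case using Suc by (simp add: twist_measurable)
qed

lemma path_mean_diff:
  assumes "integrable \<pi> u" "integrable \<pi> w"
  shows "path_mean e j (\<lambda>x. u x - w x) = path_mean e j u - path_mean e j w"
  using assms
proof (induction j arbitrary: u w)
  case (Suc j)
  have "AE x in \<pi>. twist e j (\<lambda>x. u x - w x) x = twist e j u x - twist e j w x"
    using S.AE_integrable_kernel[where j=j, OF integrable_iexp_mult[where e=e, OF Suc.prems(1) h[of "Suc j"]]]
      S.AE_integrable_kernel[where j=j, OF integrable_iexp_mult[where e=e, OF Suc.prems(2) h[of "Suc j"]]]
    by eventually_elim (simp add: twist_def kernel_app_def algebra_simps)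
  then have "path_mean e j (twist e j (\<lambda>x. u x - w x)) = path_mean e j (\<lambda>x. twist e j u x - twist e j w x)"
    using Suc.prems by (intro path_mean_cong twist_measurable borel_measurable_diff pi_meas) auto
  then show ?case using Suc twist_integrable(1) by simp
qed simp

lemma path_mean_cmult: "path_mean e j (\<lambda>x. c * u x) = c * path_mean e j u"
proof (induction j arbitrary: u)
  case (Suc j)
  have "twist e j (\<lambda>x. c * u x) = (\<lambda>x. c * twist e j u x)"
  proof
    fix x
    have "kernel_app (P j) (\<lambda>y. iexp (e * h (Suc j) y) * (c * u y)) x = c * kernel_app (P j) (\<lambda>y. iexp (e * h (Suc j) y) * u y) x"
      unfolding kernel_app_def by (subst integral_mult_right_zero[symmetric]) (simp add: mult_ac)
    then show "twist e j (\<lambda>x. c * u x) x = c * twist e j u x" by (simp add: twist_def)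
  qed
  then show ?case using Suc by simp
qed simp

text \<open>The untwisted counterpart of the operators in \<open>path_mean\<close>, started at time
  \<open>j\<close>. It is polymorphic because mixing speaks of real functions while the twists act
  on complex ones.\<close>

primrec iter :: "nat \<Rightarrow> nat \<Rightarrow> ('a \<Rightarrow> 'b::{banach, second_countable_topology}) \<Rightarrow> 'a \<Rightarrow> 'b" where
  "iter j 0 u = u"
| "iter j (Suc m) u = iter j m (kernel_app (P (j + m)) u)"

lemma iter_bound:
  "u \<in> borel_measurable borel \<Longrightarrow> (\<And>x. norm (u x) \<le> B) \<Longrightarrow>
    iter j m u \<in> borel_measurable borel \<and> (\<forall>x. norm (iter j m u x) \<le> B)"
proof (induction m arbitrary: u)
  case (Suc m)
  show ?case unfolding iter.simps
    by (rule Suc.IH) (auto intro!: kernel_app_measurable norm_kernel_app_bound S.P Suc.prems)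
qed simp

lemma iter_of_real: "iter j m (\<lambda>x. complex_of_real (u x)) = (\<lambda>x. complex_of_real (iter j m u x))"
proof (induction m arbitrary: u)
  case (Suc m)
  have "kernel_app (P (j + m)) (\<lambda>x. complex_of_real (u x)) = (\<lambda>x. complex_of_real (kernel_app (P (j + m)) u x))"
    by (simp add: kernel_app_def fun_eq_iff)
  then show ?case using Suc by simp
qed simp

lemma iter_per: "iter (j + K) m u = iter j m u"
proof (induction m arbitrary: u)
  case (Suc m)
  have "P (j + K + m) = P (j + m)" using P_per[of "j + m"] by (simp add: ac_simps)
  then show ?case using Suc by simp
qed simp

lemma bounded_integrable: "u \<in> borel_measurable borel \<Longrightarrow> (\<And>x. norm (u x) \<le> B) \<Longrightarrow> integrable \<pi> (u :: 'a \<Rightarrow> 'b::{banach, second_countable_topology})"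
  by (rule S.pi.integrable_const_bound[of _ B]) (auto intro: meas_pi)

text \<open>The exponential factors differ from 1 by at most \<open>\<bar>e\<bar>\<close> times
  \<open>\<bar>Ph j\<bar>\<close> and \<open>\<bar>h (Suc j)\<bar>\<close>, and by stationarity the
  former has no larger \<open>L\<^sup>1\<close> norm than the latter.\<close>

lemma twist_near:
  assumes u: "u \<in> borel_measurable borel" "\<And>x. norm (u x) \<le> B"
  shows "(\<integral>x. norm (twist e j u x - kernel_app (P j) u x) \<partial>\<pi>) \<le> B * \<bar>e\<bar> * (2 * (\<integral>x. \<bar>h (Suc j) x\<bar> \<partial>\<pi>))"
proof -
  have B: "0 \<le> B" using order_trans[OF norm_ge_zero u(2)] .
  let ?w = "\<lambda>y. iexp (e * h (Suc j) y) * u y"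
  have w: "?w \<in> borel_measurable borel" "\<And>y. norm (?w y) \<le> B"
    using u iexp_meas[OF h] by (auto intro!: borel_measurable_times simp: norm_mult)
  let ?A = "\<lambda>x. \<bar>e\<bar> * \<bar>Ph j x\<bar> * B" and ?B = "kernel_app (P j) (\<lambda>y. norm (?w y - u y))"
  have b: "norm (?w y - u y) \<le> \<bar>e\<bar> * B * \<bar>h (Suc j) y\<bar>" for y
  proof -
    have "norm (?w y - u y) = norm (iexp (e * h (Suc j) y) - 1) * norm (u y)"
      by (simp add: norm_mult[symmetric] algebra_simps)
    also have "\<dots> \<le> \<bar>e * h (Suc j) y\<bar> * B" by (intro mult_mono norm_iexp_minus_1 u) auto
    finally show ?thesis by (simp add: abs_mult mult_ac)
  qed
  have nb: "norm (norm (?w y - u y)) \<le> B + B" for y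
    using norm_triangle_ineq4[of "?w y" "u y"] u(2)[of y] w(2)[of y] by simp
  have wu: "(\<lambda>y. norm (?w y - u y)) \<in> borel_measurable borel"
  proof -
    note [measurable] = w(1) u(1)
    show ?thesis by measurable
  qed
  have Bi: "integrable \<pi> (\<lambda>y. norm (?w y - u y))" using wu nb by (rule bounded_integrable)
  have pt: "norm (twist e j u x - kernel_app (P j) u x) \<le> ?A x + ?B x" for x
  proof -
    let ?a = "(iexp (- (e * Ph j x)) - 1) * kernel_app (P j) ?w x"
      and ?b = "kernel_app (P j) ?w x - kernel_app (P j) u x"
    have eq: "twist e j u x - kernel_app (P j) u x = ?a + ?b"
      by (simp add: twist_def algebra_simps)
    have "norm ?a \<le> \<bar>- (e * Ph j x)\<bar> * B"
      unfolding norm_mult by (intro mult_mono norm_iexp_minus_1 norm_kernel_app_bound S.P w) auto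
    then have 1: "norm ?a \<le> ?A x" by (simp add: abs_mult)
    have "?b = kernel_app (P j) (\<lambda>y. ?w y - u y) x"
      unfolding kernel_app_def
      using pkernel_bounded_integrable[OF S.P w] pkernel_bounded_integrable[OF S.P u] by simp
    then have 2: "norm ?b \<le> ?B x" using S.norm_kernel_app_le_kernel_app by simp
    show ?thesis unfolding eq by (rule norm_triangle_le[OF add_mono[OF 1 2]])
  qed
  have iu: "integrable \<pi> u" using u by (rule bounded_integrable)
  have i1: "integrable \<pi> (\<lambda>x. norm (twist e j u x - kernel_app (P j) u x))"
    by (intro integrable_norm Bochner_Integration.integrable_diff twist_integrable S.integrable_kernel_app iu)
  have i2: "integrable \<pi> ?A" by (intro integrable_mult_left integrable_mult_right integrable_abs Ph1)
  have i3: "integrable \<pi> ?B" by (rule S.integrable_kernel_app[OF Bi])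
  have "(\<integral>x. norm (twist e j u x - kernel_app (P j) u x) \<partial>\<pi>) \<le> (\<integral>x. ?A x + ?B x \<partial>\<pi>)"
    by (rule integral_mono[OF i1 Bochner_Integration.integrable_add[OF i2 i3] pt])
  also have "\<dots> = (\<integral>x. ?A x \<partial>\<pi>) + (\<integral>x. norm (?w x - u x) \<partial>\<pi>)"
    unfolding Bochner_Integration.integral_add[OF i2 i3] S.integrable_kernel_app(2)[OF Bi] ..
  also have "(\<integral>x. ?A x \<partial>\<pi>) = \<bar>e\<bar> * B * (\<integral>x. \<bar>Ph j x\<bar> \<partial>\<pi>)" by (simp add: mult_ac)
  also have "\<dots> \<le> \<bar>e\<bar> * B * (\<integral>x. \<bar>h (Suc j) x\<bar> \<partial>\<pi>)"
    using S.integral_norm_kernel_app[OF h1] B by (intro mult_left_mono) auto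
  also have "(\<integral>x. norm (?w x - u x) \<partial>\<pi>) \<le> (\<integral>x. \<bar>e\<bar> * B * \<bar>h (Suc j) x\<bar> \<partial>\<pi>)"
    using Bi b h1 by (intro integral_mono) auto
  finally show ?thesis by (simp add: algebra_simps)
qed

text \<open>Frees the last \<open>m\<close> steps of their twists so that mixing can act on them;
  for fixed \<open>m\<close> the price vanishes with \<open>e\<close>.\<close>

lemma path_mean_near:
  assumes H: "\<And>j. (\<integral>x. \<bar>h j x\<bar> \<partial>\<pi>) \<le> H"
  shows "u \<in> borel_measurable borel \<Longrightarrow> (\<And>x. norm (u x) \<le> B) \<Longrightarrow>
    norm (path_mean e (j + m) u - path_mean e j (iter j m u)) \<le> real m * (B * \<bar>e\<bar> * (2 * H))"
proof (induction m arbitrary: u)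
  case (Suc m)
  let ?p = "kernel_app (P (j + m)) u"
  have u: "integrable \<pi> u" using Suc.prems by (rule bounded_integrable)
  have p: "?p \<in> borel_measurable borel" "\<And>x. norm (?p x) \<le> B"
    by (auto intro!: kernel_app_measurable norm_kernel_app_bound S.P Suc.prems)
  have B: "0 \<le> B" using order_trans[OF norm_ge_zero Suc.prems(2)] .
  have "norm (path_mean e (j + m) (twist e (j + m) u) - path_mean e (j + m) ?p)
    = norm (path_mean e (j + m) (\<lambda>x. twist e (j + m) u x - ?p x))"
    using u by (subst path_mean_diff) (auto intro: twist_integrable S.integrable_kernel_app)
  also have "\<dots> \<le> (\<integral>x. norm (twist e (j + m) u x - ?p x) \<partial>\<pi>)"
    using u by (intro norm_path_mean_le Bochner_Integration.integrable_diff twist_integrable S.integrable_kernel_app)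
  also have "\<dots> \<le> B * \<bar>e\<bar> * (2 * (\<integral>x. \<bar>h (Suc (j + m)) x\<bar> \<partial>\<pi>))" by (rule twist_near[OF Suc.prems])
  also have "\<dots> \<le> B * \<bar>e\<bar> * (2 * H)" using B H by (intro mult_left_mono) auto
  finally have 1: "norm (path_mean e (j + m) (twist e (j + m) u) - path_mean e (j + m) ?p) \<le> B * \<bar>e\<bar> * (2 * H)" .
  have "path_mean e (j + Suc m) u - path_mean e j (iter j (Suc m) u)
    = (path_mean e (j + m) (twist e (j + m) u) - path_mean e (j + m) ?p)
      + (path_mean e (j + m) ?p - path_mean e j (iter j m ?p))" by simp
  also have "norm \<dots> \<le> B * \<bar>e\<bar> * (2 * H) + real m * (B * \<bar>e\<bar> * (2 * H))"
    by (intro order_trans[OF norm_triangle_ineq] add_mono 1 Suc.IH p)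
  finally show ?case by (simp add: algebra_simps)
qed simp

text \<open>The conditional variance of the increment \<open>d\<^sub>j\<close> given the present
  point. Where \<open>h (Suc j)\<close> is not square integrable under the kernel the formula
  involves default values, hence \<open>cvar_nonneg\<close> is stated almost everywhere.\<close>

definition cvar :: "nat \<Rightarrow> 'a \<Rightarrow> real" where
  "cvar j x = kernel_app (P j) (\<lambda>y. (h (Suc j) y)\<^sup>2) x - (Ph j x)\<^sup>2"

definition mvar :: "nat \<Rightarrow> real" where
  "mvar j = (\<integral>x. cvar j x \<partial>\<pi>)"

lemma cvar_integrable: "integrable \<pi> (cvar j)"
  unfolding cvar_def by (intro Bochner_Integration.integrable_diff S.integrable_kernel_app h2 Ph2)

lemma cvar_nonneg: "AE x in \<pi>. 0 \<le> cvar j x"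
  using S.kernel_app_square(3)[where j=j, OF h[of "Suc j"] h2] by eventually_elim (simp add: cvar_def)

lemma mvar_nonneg: "0 \<le> mvar j"
  unfolding mvar_def by (rule integral_nonneg_AE[OF cvar_nonneg])

lemma mvar_eq: "mvar j = (\<integral>x. (h (Suc j) x)\<^sup>2 \<partial>\<pi>) - (\<integral>x. (Ph j x)\<^sup>2 \<partial>\<pi>)"
  unfolding mvar_def cvar_def using S.integrable_kernel_app[OF h2] Ph2 by simp

lemma cvar_per: "cvar (j + K) = cvar j"
  by (rule ext) (simp add: cvar_def P_per h_per[of "Suc j", simplified])

lemma mvar_per: "mvar (j + K) = mvar j" by (simp add: mvar_def cvar_per)

text \<open>At almost every \<open>x\<close>, \<open>twist e j (\<lambda>_. 1)\<close> is the
  characteristic function at \<open>e\<close> of the centred variable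
  \<open>h (Suc j) - Ph j x\<close> under \<open>P j x\<close>, so the second order expansion
  applies.\<close>

lemma twist_1_approx:
  "(\<integral>x. norm (twist e j (\<lambda>_. 1) x - of_real (1 - e\<^sup>2 * cvar j x / 2)) \<partial>\<pi>)
    \<le> e\<^sup>2 / 6 * ((\<integral>x. lindeberg e (2 * h (Suc j) x) \<partial>\<pi>) + (\<integral>x. lindeberg e (2 * Ph j x) \<partial>\<pi>))"
proof -
  have L1: "integrable \<pi> (\<lambda>x. lindeberg e (2 * h (Suc j) x))"
    using h2 by (intro lindeberg_integrable meas_pi) (auto simp: power_mult_distrib intro: borel_measurable_times h)
  have L2: "integrable \<pi> (\<lambda>x. lindeberg e (2 * Ph j x))"
    using Ph2 by (intro lindeberg_integrable meas_pi) (auto simp: power_mult_distrib intro: borel_measurable_times Ph)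
  have pt: "AE x in \<pi>. norm (twist e j (\<lambda>_. 1) x - of_real (1 - e\<^sup>2 * cvar j x / 2))
    \<le> e\<^sup>2 / 6 * (kernel_app (P j) (\<lambda>y. lindeberg e (2 * h (Suc j) y)) x + lindeberg e (2 * Ph j x))"
    using S.kernel_app_square(3)[where j=j, OF h[of "Suc j"] h2] S.AE_integrable_kernel[where j=j, OF L1]
  proof eventually_elim
    case (elim x)
    interpret p: prob_space "P j x" by (rule pkernel_prob_space[OF S.P])
    have hi: "integrable (P j x) (h (Suc j))" "integrable (P j x) (\<lambda>y. (h (Suc j) y)\<^sup>2)" using elim by auto
    let ?X = "\<lambda>y. h (Suc j) y - Ph j x"
    have Xm: "?X \<in> borel_measurable (P j x)" using hi by auto
    have X1: "integrable (P j x) ?X" using hi by simp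
    have X0: "p.expectation ?X = 0" using hi p.prob_space by (simp add: kernel_app_def)
    have X2: "integrable (P j x) (\<lambda>y. (?X y)\<^sup>2)" using hi by (simp add: power2_diff)
    have var: "p.variance ?X = cvar j x"
    proof -
      have "p.variance ?X = p.variance (h (Suc j))" unfolding X0 by (simp add: kernel_app_def)
      also have "\<dots> = cvar j x" using p.variance_eq[OF hi] by (simp add: cvar_def kernel_app_def)
      finally show ?thesis .
    qed
    have tw: "twist e j (\<lambda>_. 1) x = char (distr (P j x) borel ?X) e"
    proof -
      have "char (distr (P j x) borel ?X) e = (CLINT y|P j x. iexp (e * ?X y))"
        unfolding char_def using Xm by (subst integral_distr) auto
      also have "\<dots> = (CLINT y|P j x. iexp (- (e * Ph j x)) * iexp (e * h (Suc j) y))"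
        by (simp add: exp_add[symmetric] algebra_simps)
      also have "\<dots> = iexp (- (e * Ph j x)) * (CLINT y|P j x. iexp (e * h (Suc j) y))"
        by (rule integral_mult_right_zero)
      finally show ?thesis by (simp add: twist_def kernel_app_def)
    qed
    have "norm (twist e j (\<lambda>_. 1) x - of_real (1 - e\<^sup>2 * cvar j x / 2))
      \<le> e\<^sup>2 / 6 * p.expectation (\<lambda>y. lindeberg e (?X y))"
      unfolding tw lindeberg_def
      using p.char_approx3'[OF Xm X1 X2 X0 var refl, of e] by simp
    also have "\<dots> \<le> e\<^sup>2 / 6 * (p.expectation (\<lambda>y. lindeberg e (2 * h (Suc j) y) + lindeberg e (2 * Ph j x)))"
      using elim(2) lindeberg_integrable[OF Xm X2, of e]
      by (intro mult_left_mono integral_mono lindeberg_diff) auto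
    also have "p.expectation (\<lambda>y. lindeberg e (2 * h (Suc j) y) + lindeberg e (2 * Ph j x))
       = kernel_app (P j) (\<lambda>y. lindeberg e (2 * h (Suc j) y)) x + lindeberg e (2 * Ph j x)"
      using elim(2) p.prob_space by (simp add: kernel_app_def)
    finally show ?case .
  qed
  have i1: "integrable \<pi> (\<lambda>x. norm (twist e j (\<lambda>_. 1) x - of_real (1 - e\<^sup>2 * cvar j x / 2)))"
    using cvar_integrable[of j] by (intro integrable_norm Bochner_Integration.integrable_diff twist_integrable integrable_of_real) auto
  have "(\<integral>x. norm (twist e j (\<lambda>_. 1) x - of_real (1 - e\<^sup>2 * cvar j x / 2)) \<partial>\<pi>)
    \<le> (\<integral>x. e\<^sup>2 / 6 * (kernel_app (P j) (\<lambda>y. lindeberg e (2 * h (Suc j) y)) x + lindeberg e (2 * Ph j x)) \<partial>\<pi>)"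
    by (intro integral_mono_AE i1 pt integrable_mult_right Bochner_Integration.integrable_add S.integrable_kernel_app L1 L2)
  also have "\<dots> = e\<^sup>2 / 6 * ((\<integral>x. lindeberg e (2 * h (Suc j) x) \<partial>\<pi>) + (\<integral>x. lindeberg e (2 * Ph j x) \<partial>\<pi>))"
    using S.integrable_kernel_app[OF L1, of j] L2 by simp
  finally show ?thesis .
qed

end

text \<open>A weak form of mixing: bounded functions, convergence in \<open>L\<^sup>1\<close> of
  \<open>\<pi>\<close>, whole sweeps. Functions that are merely integrable are reached by truncation
  in \<open>centred_near\<close>.\<close>

locale mixing_sweep = periodic_sweep +
  assumes mix: "\<And>j u B. u \<in> borel_measurable borel \<Longrightarrow> (\<And>x. \<bar>u x\<bar> \<le> B) \<Longrightarrow>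
    (\<lambda>q. \<integral>x. \<bar>iter j (K * q) u x - (\<integral>y. u y \<partial>\<pi>)\<bar> \<partial>\<pi>) \<longlonglongrightarrow> (0 :: real)"
begin

lemma h_bound: obtains H where "0 \<le> H" "\<And>j. (\<integral>x. \<bar>h j x\<bar> \<partial>\<pi>) \<le> H"
proof -
  let ?a = "\<lambda>j. \<integral>x. \<bar>h j x\<bar> \<partial>\<pi>"
  have per: "?a (r + K * q) = ?a r" for r q
  proof (induction q)
    case (Suc q)
    have "h (r + K * Suc q) = h (r + K * q)" using h_per[of "r + K * q"] by (simp add: ac_simps)
    then show ?case using Suc by simp
  qed simp
  have a0: "0 \<le> ?a j" for j by (intro integral_nonneg_AE) auto
  have "?a j \<le> (\<Sum>k<K. ?a k)" for j
  proof -
    have "?a j = ?a (j mod K)" using per[of "j mod K" "j div K"] by simp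
    also have "\<dots> \<le> (\<Sum>k<K. ?a k)" by (rule member_le_sum) (use K a0 in auto)
    finally show ?thesis .
  qed
  then show ?thesis by (intro that[of "\<Sum>k<K. ?a k"] sum_nonneg a0)
qed

text \<open>Truncating the centred conditional variance costs one \<open>\<eta>\<close>. The last
  \<open>K * q\<close> twists are then removed at a cost proportional to
  \<open>\<bar>e\<bar>\<close>. What remains is bounded by the mean of the truncated function and
  its mixing error, one \<open>\<eta>\<close> each. Times are grouped by phase so that
  \<open>A\<close> and \<open>m\<close> do not depend on the time itself.\<close>

lemma centred_near:
  assumes \<eta>: "0 < \<eta>"
  shows "\<exists>A\<ge>0. \<exists>m. \<forall>e i. i \<ge> m \<longrightarrow> i mod K = k mod K \<longrightarrow>
    norm (path_mean e i (\<lambda>x. of_real (cvar i x - mvar i))) \<le> A * \<bar>e\<bar> + 3 * \<eta>"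
proof -
  obtain H where H: "0 \<le> H" "\<And>j. (\<integral>x. \<bar>h j x\<bar> \<partial>\<pi>) \<le> H" using h_bound by blast
  define w where "w x = cvar k x - mvar k" for x
  have w: "integrable \<pi> w" unfolding w_def using cvar_integrable by auto
  have w0: "(\<integral>x. w x \<partial>\<pi>) = 0" unfolding w_def using cvar_integrable[of k] S.pi.prob_space by (simp add: mvar_def)
  define tr where "tr N x = max (- real N) (min (real N) (w x))" for N :: nat and x
  have wm: "w \<in> borel_measurable borel" using w by (rule pi_meas)
  have trm: "tr N \<in> borel_measurable borel" for N
    unfolding tr_def using wm by (intro borel_measurable_max borel_measurable_min) auto
  have trb: "\<bar>tr N x\<bar> \<le> real N" for N x by (auto simp: tr_def)
  have tri: "integrable \<pi> (tr N)" for N using trm by (rule bounded_integrable[of _ "real N"]) (simp add: trb)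
  have "(\<lambda>N. \<integral>x. \<bar>w x - tr N x\<bar> \<partial>\<pi>) \<longlonglongrightarrow> (\<integral>x. 0 \<partial>\<pi>)"
  proof (rule integral_dominated_convergence)
    show "integrable \<pi> (\<lambda>x. \<bar>w x\<bar>)" using w by auto
    show "(\<lambda>x. \<bar>w x - tr N x\<bar>) \<in> borel_measurable \<pi>" for N using w tri[of N] by auto
    show "AE x in \<pi>. norm \<bar>w x - tr N x\<bar> \<le> \<bar>w x\<bar>" for N by (intro AE_I2) (auto simp: tr_def)
    show "AE x in \<pi>. (\<lambda>N. \<bar>w x - tr N x\<bar>) \<longlonglongrightarrow> 0"
    proof (rule AE_I2)
      fix x
      have "eventually (\<lambda>N. \<bar>w x\<bar> \<le> real N) sequentially"
        using filterlim_real_sequentially by (simp add: filterlim_at_top)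
      then have "eventually (\<lambda>N. \<bar>w x - tr N x\<bar> = 0) sequentially"
        by eventually_elim (auto simp: tr_def)
      then show "(\<lambda>N. \<bar>w x - tr N x\<bar>) \<longlonglongrightarrow> 0" by (rule tendsto_eventually)
    qed
  qed simp
  then have "(\<lambda>N. \<integral>x. \<bar>w x - tr N x\<bar> \<partial>\<pi>) \<longlonglongrightarrow> 0" by simp
  then have "eventually (\<lambda>N. (\<integral>x. \<bar>w x - tr N x\<bar> \<partial>\<pi>) < \<eta>) sequentially" using \<eta> by (rule order_tendstoD)
  then obtain N where N: "(\<integral>x. \<bar>w x - tr N x\<bar> \<partial>\<pi>) < \<eta>" by (auto simp: eventually_sequentially)
  have mean: "\<bar>\<integral>x. tr N x \<partial>\<pi>\<bar> \<le> \<eta>"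
  proof -
    have "\<bar>\<integral>x. tr N x \<partial>\<pi>\<bar> = \<bar>\<integral>x. w x - tr N x \<partial>\<pi>\<bar>" using w tri[of N] w0 by simp
    also have "\<dots> \<le> (\<integral>x. \<bar>w x - tr N x\<bar> \<partial>\<pi>)" by (rule integral_abs_bound)
    finally show ?thesis using N by simp
  qed
  have "eventually (\<lambda>q. (\<integral>x. \<bar>iter k (K * q) (tr N) x - (\<integral>y. tr N y \<partial>\<pi>)\<bar> \<partial>\<pi>) < \<eta>) sequentially"
    using mix[where u="tr N" and j=k, OF trm trb] \<eta> by (rule order_tendstoD)
  then obtain q where q: "(\<integral>x. \<bar>iter k (K * q) (tr N) x - (\<integral>y. tr N y \<partial>\<pi>)\<bar> \<partial>\<pi>) < \<eta>" by (auto simp: eventually_sequentially)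
  let ?m = "K * q"
  have it: "iter k ?m (tr N) \<in> borel_measurable borel" "\<And>x. \<bar>iter k ?m (tr N) x\<bar> \<le> real N"
    using iter_bound[OF trm[of N], of "real N"] trb by auto
  have iti: "integrable \<pi> (iter k ?m (tr N))" using it by (intro bounded_integrable[of _ "real N"]) auto
  have itN: "(\<integral>x. \<bar>iter k ?m (tr N) x\<bar> \<partial>\<pi>) \<le> 2 * \<eta>"
  proof -
    let ?c = "\<integral>y. tr N y \<partial>\<pi>"
    have "(\<integral>x. \<bar>iter k ?m (tr N) x\<bar> \<partial>\<pi>) \<le> (\<integral>x. \<bar>iter k ?m (tr N) x - ?c\<bar> + \<bar>?c\<bar> \<partial>\<pi>)"
      using iti by (intro integral_mono) auto
    also have "\<dots> = (\<integral>x. \<bar>iter k ?m (tr N) x - ?c\<bar> \<partial>\<pi>) + \<bar>?c\<bar>" using iti S.pi.prob_space by simp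
    finally show ?thesis using q mean by simp
  qed
  have iter_perq: "iter (j + K * r) m u = iter j m u" for j r m and u :: "'a \<Rightarrow> real"
  proof (induction r)
    case (Suc r)
    then show ?case using iter_per[of "j + K * r" m u] by (simp add: ac_simps)
  qed simp
  have "iter j m u = iter (j mod K) m u" for j m and u :: "'a \<Rightarrow> real"
    using iter_perq[of "j mod K" "j div K" m u] by simp
  then have iter_mod: "iter j m u = iter k m u" if "j mod K = k mod K" for j m and u :: "'a \<Rightarrow> real"
    using that by metis
  have w_perq: "cvar (j + K * r) = cvar j \<and> mvar (j + K * r) = mvar j" for j r
  proof (induction r)
    case (Suc r)
    then show ?case using cvar_per[of "j + K * r"] mvar_per[of "j + K * r"] by (simp add: ac_simps)
  qed simp
  have "cvar i = cvar (i mod K) \<and> mvar i = mvar (i mod K)" for i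
    using w_perq[of "i mod K" "i div K"] by simp
  then have w_mod: "cvar i = cvar k" "mvar i = mvar k" if "i mod K = k mod K" for i
    using that by metis+
  have main: "norm (path_mean e i (\<lambda>x. of_real (cvar i x - mvar i))) \<le> (real ?m * (real N * (2 * H))) * \<bar>e\<bar> + 3 * \<eta>"
    if i: "i \<ge> ?m" "i mod K = k mod K" for e i
  proof -
    define j where "j = i - ?m"
    have ij: "i = j + ?m" using i by (simp add: j_def)
    have jk: "j mod K = k mod K" using i(2) ij by simp
    let ?t = "\<lambda>x. complex_of_real (tr N x)"
    have wi: "(\<lambda>x. complex_of_real (cvar i x - mvar i)) = (\<lambda>x. of_real (w x))"
      unfolding w_mod[OF i(2)] w_def ..
    have 1: "norm (path_mean e i (\<lambda>x. of_real (w x)) - path_mean e i ?t) \<le> \<eta>"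
    proof -
      have "path_mean e i (\<lambda>x. of_real (w x)) - path_mean e i ?t = path_mean e i (\<lambda>x. of_real (w x) - of_real (tr N x))"
        using w tri by (intro path_mean_diff[symmetric]) auto
      also have "norm \<dots> \<le> (\<integral>x. norm (complex_of_real (w x) - of_real (tr N x)) \<partial>\<pi>)"
        using w tri[of N] by (intro norm_path_mean_le) auto
      also have "\<dots> = (\<integral>x. \<bar>w x - tr N x\<bar> \<partial>\<pi>)" unfolding of_real_diff[symmetric] norm_of_real ..
      finally show ?thesis using N by simp
    qed
    have 2: "norm (path_mean e i ?t - path_mean e j (iter j ?m ?t)) \<le> real ?m * (real N * \<bar>e\<bar> * (2 * H))"
      unfolding ij by (rule path_mean_near[OF H(2)]) (use trm[of N] trb in auto)
    have 3: "norm (path_mean e j (iter j ?m ?t)) \<le> 2 * \<eta>"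
    proof -
      have "norm (path_mean e j (iter j ?m ?t)) \<le> (\<integral>x. norm (complex_of_real (iter k ?m (tr N) x)) \<partial>\<pi>)"
        unfolding iter_of_real iter_mod[OF jk] using iti by (intro norm_path_mean_le) auto
      then show ?thesis using itN by simp
    qed
    have "path_mean e i (\<lambda>x. of_real (w x)) = (path_mean e i (\<lambda>x. of_real (w x)) - path_mean e i ?t)
      + (path_mean e i ?t - path_mean e j (iter j ?m ?t)) + path_mean e j (iter j ?m ?t)" by simp
    then have "norm (path_mean e i (\<lambda>x. of_real (w x))) \<le> \<eta> + real ?m * (real N * \<bar>e\<bar> * (2 * H)) + 2 * \<eta>"
      using 1 2 3 norm_triangle_ineq by (smt (verit, best) norm_triangle_mono)
    then show ?thesis unfolding wi by (simp add: algebra_simps)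
  qed
  show ?thesis
  proof (intro exI[of _ "real ?m * (real N * (2 * H))"] exI[of _ ?m] conjI)
    show "0 \<le> real ?m * (real N * (2 * H))" using H by simp
  qed (use main in blast)
qed

section \<open>Lindeberg replacement for the product of twists\<close>

definition asym_var :: real where "asym_var = (\<Sum>k<K. mvar k) / real K"

lemma exp_minus_approx: "0 \<le> z \<Longrightarrow> \<bar>exp (- z) - 1 + z\<bar> \<le> (z::real)\<^sup>2"
proof -
  assume z: "0 \<le> z"
  have 1: "1 - z \<le> exp (- z)" using exp_ge_add_one_self[of "- z"] by simp
  have "exp (- z) * (1 + z) \<le> exp (- z) * exp z" by (intro mult_left_mono exp_ge_add_one_self) auto
  also have "\<dots> = 1" by (simp add: exp_minus)
  finally have "exp (- z) \<le> 1 / (1 + z)" using z by (simp add: field_simps)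
  also have "\<dots> \<le> 1 - z + z\<^sup>2"
  proof -
    have "1 \<le> (1 - z + z\<^sup>2) * (1 + z)" using z by (simp add: algebra_simps power2_eq_square)
    then show ?thesis using z by (simp add: field_simps)
  qed
  finally show ?thesis using 1 by simp
qed

text \<open>The errors of step \<open>j\<close> that are small without mixing: the Lindeberg
  remainder of the conditional characteristic function and the second order error of
  \<open>1 - z\<close> as a substitute for \<open>exp (- z)\<close>.\<close>

definition err :: "real \<Rightarrow> nat \<Rightarrow> real" where
  "err e j = e\<^sup>2 / 6 * ((\<integral>x. lindeberg e (2 * h (Suc j) x) \<partial>\<pi>) + (\<integral>x. lindeberg e (2 * Ph j x) \<partial>\<pi>))
     + (e\<^sup>2 * mvar j / 2)\<^sup>2"

lemma err_nonneg: "0 \<le> err e j"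
  unfolding err_def by (intro add_nonneg_nonneg mult_nonneg_nonneg integral_nonneg_AE) (auto simp: lindeberg_nonneg)

text \<open>Splits the replacement error into expansion errors, estimated in
  \<open>L\<^sup>1\<close>, and the fluctuation \<open>cvar j - mvar j\<close>. The latter must stay
  under \<open>path_mean\<close>: its \<open>L\<^sup>1\<close> norm is not small, only its average
  along the path is.\<close>

lemma step_bound:
  "norm (path_mean e j (\<lambda>x. twist e j (\<lambda>_. 1) x - of_real (exp (- (e\<^sup>2 * mvar j / 2)))))
    \<le> err e j + e\<^sup>2 / 2 * norm (path_mean e j (\<lambda>x. of_real (cvar j x - mvar j)))"
proof -
  let ?q = "exp (- (e\<^sup>2 * mvar j / 2))"
  let ?R = "\<lambda>x. twist e j (\<lambda>_. 1) x - of_real (1 - e\<^sup>2 * cvar j x / 2)"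
  let ?c = "?q - 1 + e\<^sup>2 * mvar j / 2"
  let ?w = "\<lambda>x. complex_of_real (cvar j x - mvar j)"
  have eq: "(\<lambda>x. twist e j (\<lambda>_. 1) x - of_real ?q) = (\<lambda>x. (?R x - of_real ?c) - of_real (e\<^sup>2 / 2) * ?w x)"
    by (rule ext) (simp add: algebra_simps add_divide_distrib diff_divide_distrib)
  have "integrable \<pi> (\<lambda>x. 1 - e\<^sup>2 * cvar j x / 2)" using cvar_integrable[of j] by simp
  then have R: "integrable \<pi> ?R"
    by (intro Bochner_Integration.integrable_diff[OF twist_integrable(1)] integrable_of_real) simp
  then have Rc: "integrable \<pi> (\<lambda>x. ?R x - of_real ?c)" by (rule Bochner_Integration.integrable_diff) simp
  have w: "integrable \<pi> ?w" using cvar_integrable[of j] by (intro integrable_of_real) auto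
  have "path_mean e j (\<lambda>x. twist e j (\<lambda>_. 1) x - of_real ?q)
    = path_mean e j (\<lambda>x. ?R x - of_real ?c) - of_real (e\<^sup>2 / 2) * path_mean e j ?w"
    unfolding eq using Rc w by (subst path_mean_diff) (auto simp only: path_mean_cmult intro: integrable_mult_right)
  then have tri: "norm (path_mean e j (\<lambda>x. twist e j (\<lambda>_. 1) x - of_real ?q))
    \<le> norm (path_mean e j (\<lambda>x. ?R x - of_real ?c)) + norm (of_real (e\<^sup>2 / 2) * path_mean e j ?w)"
    by (simp only: norm_triangle_ineq4)
  have "norm (path_mean e j (\<lambda>x. ?R x - of_real ?c)) \<le> (\<integral>x. norm (?R x - of_real ?c) \<partial>\<pi>)"
    by (rule norm_path_mean_le[OF Rc])
  also have "(\<integral>x. norm (?R x - of_real ?c) \<partial>\<pi>) \<le> (\<integral>x. norm (?R x) + \<bar>?c\<bar> \<partial>\<pi>)"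
  proof (rule integral_mono)
    show "norm (?R x - of_real ?c) \<le> norm (?R x) + \<bar>?c\<bar>" for x
      using norm_triangle_ineq4[of "?R x" "of_real ?c"] by (simp only: norm_of_real)
  qed (use R Rc in auto)
  also have "\<dots> = (\<integral>x. norm (?R x) \<partial>\<pi>) + \<bar>?c\<bar>" using R S.pi.prob_space by simp
  also have "\<dots> \<le> err e j"
    unfolding err_def using mvar_nonneg[of j] by (intro add_mono twist_1_approx exp_minus_approx) auto
  finally have le: "norm (path_mean e j (\<lambda>x. ?R x - of_real ?c)) \<le> err e j" .
  have "norm (of_real (e\<^sup>2 / 2) * path_mean e j ?w) = e\<^sup>2 / 2 * norm (path_mean e j ?w)"
    unfolding norm_mult norm_of_real by simp
  then show ?thesis using tri le by linarith
qed

lemma err_per: "err e (j + K) = err e j"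
  unfolding err_def mvar_per P_per using h_per[of "Suc j"] by simp

lemma err_le_sum: "err e j \<le> (\<Sum>k<K. err e k)"
proof -
  have per: "err e (r + K * q) = err e r" for r q
  proof (induction q)
    case (Suc q)
    then show ?case using err_per[of e "r + K * q"] by (simp add: ac_simps)
  qed simp
  have "err e j = err e (j mod K)" using per[of "j mod K" "j div K"] by simp
  also have "\<dots> \<le> (\<Sum>k<K. err e k)" by (rule member_le_sum) (use K err_nonneg in auto)
  finally show ?thesis .
qed

text \<open>The factor of the last step is exchanged for its deterministic counterpart, which is
  then pulled out of the remaining operators. Factors pulled out are at most 1, so the errors of the
  single steps just add up.\<close>

lemma product_bound:
  "norm (path_mean e n (\<lambda>_. 1) - of_real (exp (- (e\<^sup>2 / 2 * (\<Sum>j<n. mvar j)))))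
    \<le> (\<Sum>j<n. norm (path_mean e j (\<lambda>x. twist e j (\<lambda>_. 1) x - of_real (exp (- (e\<^sup>2 * mvar j / 2))))))"
proof (induction n)
  case 0
  then show ?case using S.pi.prob_space by simp
next
  case (Suc n)
  let ?q = "exp (- (e\<^sup>2 * mvar n / 2))" and ?Q = "exp (- (e\<^sup>2 / 2 * (\<Sum>j<n. mvar j)))"
  have Q: "exp (- (e\<^sup>2 / 2 * (\<Sum>j<Suc n. mvar j))) = ?q * ?Q"
    by (simp add: exp_add[symmetric] algebra_simps)
  have "path_mean e n (\<lambda>x. twist e n (\<lambda>_. 1) x - of_real ?q) = path_mean e n (twist e n (\<lambda>_. 1)) - path_mean e n (\<lambda>_. of_real ?q * 1)"
    by (subst path_mean_diff) (auto intro: twist_integrable)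
  also have "path_mean e n (\<lambda>_. of_real ?q * 1) = of_real ?q * path_mean e n (\<lambda>_. 1)" by (rule path_mean_cmult)
  finally have eq: "path_mean e (Suc n) (\<lambda>_. 1) - of_real (?q * ?Q) =
     path_mean e n (\<lambda>x. twist e n (\<lambda>_. 1) x - of_real ?q) + of_real ?q * (path_mean e n (\<lambda>_. 1) - of_real ?Q)"
    by (simp add: algebra_simps)
  have "?q * norm (path_mean e n (\<lambda>_. 1) - of_real ?Q) \<le> 1 * norm (path_mean e n (\<lambda>_. 1) - of_real ?Q)"
    using mvar_nonneg[of n] by (intro mult_right_mono) auto
  then have "norm (of_real ?q * (path_mean e n (\<lambda>_. 1) - of_real ?Q)) \<le> norm (path_mean e n (\<lambda>_. 1) - of_real ?Q)"
    by (simp add: norm_mult)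
  then have "norm (path_mean e (Suc n) (\<lambda>_. 1) - of_real (?q * ?Q))
    \<le> norm (path_mean e n (\<lambda>x. twist e n (\<lambda>_. 1) x - of_real ?q)) + norm (path_mean e n (\<lambda>_. 1) - of_real ?Q)"
    unfolding eq by (intro norm_triangle_le add_left_mono)
  then show ?case unfolding Q using Suc.IH unfolding sum.lessThan_Suc by linarith
qed

text \<open>An error per step must be small against \<open>e\<^sup>2\<close>, because the number of
  steps is of order \<open>1 / e\<^sup>2\<close>.\<close>

lemma err_tendsto:
  assumes "e \<longlonglongrightarrow> 0"
  shows "(\<lambda>n. err (e n) j / (e n)\<^sup>2) \<longlonglongrightarrow> 0"
proof -
  have L: "(\<lambda>n. \<integral>x. lindeberg (e n) (2 * h (Suc j) x) \<partial>\<pi>) \<longlonglongrightarrow> 0"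
    using h2 assms by (intro lindeberg_tendsto meas_pi) (auto simp: power_mult_distrib intro: borel_measurable_times h)
  have L': "(\<lambda>n. \<integral>x. lindeberg (e n) (2 * Ph j x) \<partial>\<pi>) \<longlonglongrightarrow> 0"
    using Ph2 assms by (intro lindeberg_tendsto meas_pi) (auto simp: power_mult_distrib intro: borel_measurable_times Ph)
  have "(\<lambda>n. 1 / 6 * ((\<integral>x. lindeberg (e n) (2 * h (Suc j) x) \<partial>\<pi>) + (\<integral>x. lindeberg (e n) (2 * Ph j x) \<partial>\<pi>))
     + (e n)\<^sup>2 * (mvar j / 2)\<^sup>2) \<longlonglongrightarrow> 1 / 6 * (0 + 0) + 0\<^sup>2 * (mvar j / 2)\<^sup>2"
    by (intro tendsto_intros L L' assms)
  then have lim: "(\<lambda>n. 1 / 6 * ((\<integral>x. lindeberg (e n) (2 * h (Suc j) x) \<partial>\<pi>) + (\<integral>x. lindeberg (e n) (2 * Ph j x) \<partial>\<pi>))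
     + (e n)\<^sup>2 * (mvar j / 2)\<^sup>2) \<longlonglongrightarrow> 0" by simp
  have le: "norm (err (e n) j / (e n)\<^sup>2) \<le> 1 / 6 * ((\<integral>x. lindeberg (e n) (2 * h (Suc j) x) \<partial>\<pi>) + (\<integral>x. lindeberg (e n) (2 * Ph j x) \<partial>\<pi>))
     + (e n)\<^sup>2 * (mvar j / 2)\<^sup>2" (is "_ \<le> ?r") for n
  proof (cases "e n = 0")
    case True
    then show ?thesis by (auto intro!: integral_nonneg_AE add_nonneg_nonneg simp: lindeberg_nonneg)
  next
    case False
    have "err (e n) j = (e n)\<^sup>2 * ?r" unfolding err_def by (simp add: power2_eq_square algebra_simps add_divide_distrib)
    then have "err (e n) j / (e n)\<^sup>2 = ?r" using False by (simp add: divide_eq_eq)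
    then show ?thesis using err_nonneg[of "e n" j] by (metis abs_of_nonneg divide_nonneg_nonneg order_refl real_norm_def zero_le_power2)
  qed
  show ?thesis by (rule Lim_null_comparison[OF always_eventually[OF allI[OF le]] lim])
qed

lemma path_mean_tendsto:
  "(\<lambda>n. path_mean (\<theta> / sqrt (real n)) n (\<lambda>_. 1)) \<longlonglongrightarrow> of_real (exp (- (\<theta>\<^sup>2 * asym_var / 2)))"
proof -
  define e where "e n = \<theta> / sqrt (real n)" for n :: nat
  have e0: "e \<longlonglongrightarrow> 0" unfolding e_def
    by (rule tendsto_divide_0[OF tendsto_const])
       (intro filterlim_at_top_imp_at_infinity filterlim_compose[OF sqrt_at_top filterlim_real_sequentially])
  have e2: "(e n)\<^sup>2 = \<theta>\<^sup>2 / real n" for n by (simp add: e_def power_divide)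
  define \<delta> where "\<delta> n j = norm (path_mean (e n) j (\<lambda>x. twist (e n) j (\<lambda>_. 1) x - of_real (exp (- ((e n)\<^sup>2 * mvar j / 2)))))" for n j
  have "(\<lambda>n. \<Sum>j<n. \<delta> n j) \<longlonglongrightarrow> 0"
  proof (rule LIMSEQ_I)
    fix r :: real assume r: "0 < r"
    \<comment> \<open>The mixing error contributes \<open>3 * \<eta> * \<theta>\<^sup>2 / 2\<close>
      in the limit; this choice keeps it at most \<open>r / 4\<close>.\<close>
    define \<eta> where "\<eta> = r / (6 * (\<theta>\<^sup>2 + 1))"
    have \<eta>: "0 < \<eta>" unfolding \<eta>_def using r by (intro divide_pos_pos) (auto simp: add_nonneg_pos)
    have "\<forall>k. \<exists>A m. A \<ge> 0 \<and> (\<forall>e i. i \<ge> m \<longrightarrow> i mod K = k mod K \<longrightarrow>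
      norm (path_mean e i (\<lambda>x. of_real (cvar i x - mvar i))) \<le> A * \<bar>e\<bar> + 3 * \<eta>)"
      using centred_near[OF \<eta>] by blast
    then obtain A m where A: "\<And>k. A k \<ge> 0" and near: "\<And>k e i. i \<ge> m k \<Longrightarrow> i mod K = k mod K \<Longrightarrow>
      norm (path_mean e i (\<lambda>x. of_real (cvar i x - mvar i))) \<le> A k * \<bar>e\<bar> + 3 * \<eta>"
      by metis
    \<comment> \<open>Sums over the phases stand in for maxima.\<close>
    define A' where "A' = (\<Sum>k<K. A k)"
    define m' where "m' = (\<Sum>k<K. m k)"
    have near': "norm (path_mean e i (\<lambda>x. of_real (cvar i x - mvar i))) \<le> A' * \<bar>e\<bar> + 3 * \<eta>" if "i \<ge> m'" for e i
    proof -
      have k: "i mod K < K" using K by simp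
      have "m (i mod K) \<le> m'" unfolding m'_def by (rule member_le_sum) (use k in auto)
      then have "norm (path_mean e i (\<lambda>x. of_real (cvar i x - mvar i))) \<le> A (i mod K) * \<bar>e\<bar> + 3 * \<eta>"
        using that by (intro near) auto
      moreover have "A (i mod K) \<le> A'" unfolding A'_def by (rule member_le_sum) (use k A in auto)
      ultimately show ?thesis using mult_right_mono[of "A (i mod K)" A' "\<bar>e\<bar>"] by simp
    qed
    \<comment> \<open>The first \<open>m'\<close> steps come too early for mixing. They get the
      crude bound \<open>2 * mvar\<close>, whose total \<open>B\<close> does not grow with
      \<open>n\<close> and is multiplied by \<open>e\<^sup>2\<close>.\<close>
    define B where "B = (\<Sum>j<m'. 2 * mvar j)"
    have far: "norm (path_mean e i (\<lambda>x. of_real (cvar i x - mvar i))) \<le> 2 * mvar i" for e i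
    proof -
      have c: "integrable \<pi> (\<lambda>x. cvar i x - mvar i)" using cvar_integrable[of i] by auto
      have "norm (path_mean e i (\<lambda>x. of_real (cvar i x - mvar i))) \<le> (\<integral>x. norm (complex_of_real (cvar i x - mvar i)) \<partial>\<pi>)"
        using c by (intro norm_path_mean_le integrable_of_real)
      also have "\<dots> \<le> (\<integral>x. cvar i x + mvar i \<partial>\<pi>)"
        unfolding norm_of_real
      proof (rule integral_mono_AE)
        show "AE x in \<pi>. \<bar>cvar i x - mvar i\<bar> \<le> cvar i x + mvar i"
          using cvar_nonneg[of i] by eventually_elim (use mvar_nonneg[of i] in auto)
      qed (use c cvar_integrable[of i] in auto)
      also have "\<dots> = 2 * mvar i" using cvar_integrable[of i] S.pi.prob_space by (simp add: mvar_def)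
      finally show ?thesis .
    qed
    define rhs where "rhs n = \<theta>\<^sup>2 * (\<Sum>k<K. err (e n) k / (e n)\<^sup>2)
      + \<theta>\<^sup>2 / 2 * (B * inverse (real n) + A' * \<bar>e n\<bar> + 3 * \<eta>)" for n
    have bound: "(\<Sum>j<n. \<delta> n j) \<le> rhs n" if n: "n > 0" and \<theta>: "\<theta> \<noteq> 0" for n
    proof -
      let ?G = "\<lambda>j. norm (path_mean (e n) j (\<lambda>x. of_real (cvar j x - mvar j)))"
      have en: "(e n)\<^sup>2 \<noteq> 0" unfolding e2 using n \<theta> by simp
      have G: "?G j \<le> (if j < m' then 2 * mvar j else 0) + (A' * \<bar>e n\<bar> + 3 * \<eta>)" for j
      proof (cases "j < m'")
        case True
        have "0 \<le> A' * \<bar>e n\<bar>" unfolding A'_def using A by (intro mult_nonneg_nonneg sum_nonneg) auto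
        then show ?thesis using far[of "e n" j] True \<eta> by simp
      qed (use near'[of j "e n"] in simp)
      have "(\<Sum>j<n. \<delta> n j) \<le> (\<Sum>j<n. (\<Sum>k<K. err (e n) k) + (e n)\<^sup>2 / 2 * ((if j < m' then 2 * mvar j else 0) + (A' * \<bar>e n\<bar> + 3 * \<eta>)))"
      proof (rule sum_mono)
        fix j
        have "\<delta> n j \<le> err (e n) j + (e n)\<^sup>2 / 2 * ?G j" unfolding \<delta>_def by (rule step_bound)
        also have "\<dots> \<le> (\<Sum>k<K. err (e n) k) + (e n)\<^sup>2 / 2 * ((if j < m' then 2 * mvar j else 0) + (A' * \<bar>e n\<bar> + 3 * \<eta>))"
          by (intro add_mono err_le_sum mult_left_mono G) simp
        finally show "\<delta> n j \<le> \<dots>" .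
      qed
      also have "\<dots> = real n * (\<Sum>k<K. err (e n) k) + (e n)\<^sup>2 / 2 * ((\<Sum>j<n. if j < m' then 2 * mvar j else 0) + real n * (A' * \<bar>e n\<bar> + 3 * \<eta>))"
        by (simp only: sum.distrib sum_distrib_left[symmetric] sum_constant card_lessThan) (simp add: distrib_left mult_ac)
      also have "\<dots> \<le> real n * (\<Sum>k<K. err (e n) k) + (e n)\<^sup>2 / 2 * (B + real n * (A' * \<bar>e n\<bar> + 3 * \<eta>))"
      proof -
        have "(\<Sum>j<n. if j < m' then 2 * mvar j else 0) = (\<Sum>j\<in>{..<n} \<inter> {j. j < m'}. 2 * mvar j)"
          by (subst sum.inter_restrict) auto
        also have "\<dots> \<le> B" unfolding B_def using mvar_nonneg by (intro sum_mono2) auto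
        finally show ?thesis by (intro add_left_mono mult_left_mono add_right_mono) simp_all
      qed
      also have "\<dots> = rhs n"
      proof -
        have n2: "real n * (e n)\<^sup>2 = \<theta>\<^sup>2" unfolding e2 using n by simp
        have "\<theta>\<^sup>2 * (\<Sum>k<K. err (e n) k / (e n)\<^sup>2) = real n * (\<Sum>k<K. err (e n) k)"
          unfolding n2[symmetric] using en by (simp add: sum_divide_distrib[symmetric])
        moreover have "(e n)\<^sup>2 / 2 * (B + real n * (A' * \<bar>e n\<bar> + 3 * \<eta>)) = \<theta>\<^sup>2 / 2 * (B * inverse (real n) + A' * \<bar>e n\<bar> + 3 * \<eta>)"
          unfolding n2[symmetric] using n by (simp add: field_simps)
        ultimately show ?thesis unfolding rhs_def by simp
      qed
      finally show ?thesis .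
    qed
    have "rhs \<longlonglongrightarrow> \<theta>\<^sup>2 * (\<Sum>k<K. 0) + \<theta>\<^sup>2 / 2 * (B * 0 + A' * \<bar>0\<bar> + 3 * \<eta>)"
      unfolding rhs_def by (intro tendsto_intros err_tendsto e0 lim_inverse_n)
    moreover have "\<theta>\<^sup>2 * (\<Sum>k<K. 0) + \<theta>\<^sup>2 / 2 * (B * 0 + A' * \<bar>0\<bar> + 3 * \<eta>) < r"
    proof -
      have "0 < \<theta>\<^sup>2 + 1" by (simp add: add_nonneg_pos)
      then have "\<eta> * (6 * (\<theta>\<^sup>2 + 1)) = r" unfolding \<eta>_def by simp
      then have "6 * (\<theta>\<^sup>2 * \<eta>) + 6 * \<eta> = r" by (simp add: algebra_simps)
      then have "\<theta>\<^sup>2 * \<eta> \<le> r / 6" using \<eta> by linarith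
      then show ?thesis using r by simp
    qed
    ultimately have "eventually (\<lambda>n. rhs n < r) sequentially" by (rule order_tendstoD)
    then have ev: "eventually (\<lambda>n. norm ((\<Sum>j<n. \<delta> n j) - 0) < r) sequentially"
      using eventually_gt_at_top[of 0]
    proof eventually_elim
      case (elim n)
      have pos: "0 \<le> (\<Sum>j<n. \<delta> n j)" unfolding \<delta>_def by (intro sum_nonneg) simp
      show ?case
      \<comment> \<open>The estimate \<open>bound\<close> divides by \<open>(e n)\<^sup>2\<close>,
        so frequency 0 is treated apart.\<close>
      proof (cases "\<theta> = 0")
        case True
        then have en: "e n = 0" by (simp add: e_def)
        have "\<delta> n j = 0" for j
        proof -
          have "\<delta> n j \<le> 0" unfolding \<delta>_def en by (rule order_trans[OF step_bound]) (simp add: err_def)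
          then show ?thesis unfolding \<delta>_def by simp
        qed
        then show ?thesis using r by simp
      next
        case False
        then show ?thesis using bound[OF _ False, of n] elim pos by simp
      qed
    qed
    then show "\<exists>no. \<forall>n\<ge>no. norm ((\<Sum>j<n. \<delta> n j) - 0) < r" unfolding eventually_sequentially .
  qed
  moreover have bound: "norm (path_mean (e n) n (\<lambda>_. 1) - of_real (exp (- ((e n)\<^sup>2 / 2 * (\<Sum>j<n. mvar j))))) \<le> (\<Sum>j<n. \<delta> n j)" for n
    unfolding \<delta>_def by (rule product_bound)
  ultimately have "(\<lambda>n. path_mean (e n) n (\<lambda>_. 1) - of_real (exp (- ((e n)\<^sup>2 / 2 * (\<Sum>j<n. mvar j))))) \<longlonglongrightarrow> 0"
    by (intro Lim_null_comparison[OF always_eventually[OF allI[OF bound]]])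
  moreover have "(\<lambda>n. complex_of_real (exp (- ((e n)\<^sup>2 / 2 * (\<Sum>j<n. mvar j))))) \<longlonglongrightarrow> of_real (exp (- (\<theta>\<^sup>2 / 2 * asym_var)))"
  proof -
    have "(e n)\<^sup>2 / 2 * (\<Sum>j<n. mvar j) = \<theta>\<^sup>2 / 2 * ((\<Sum>j<n. mvar j) / real n)" for n
      unfolding e2 by simp
    then show ?thesis unfolding asym_var_def
      by (simp only:) (intro tendsto_intros periodic_mean_tendsto K mvar_per)
  qed
  ultimately have "(\<lambda>n. path_mean (e n) n (\<lambda>_. 1)) \<longlonglongrightarrow> of_real (exp (- (\<theta>\<^sup>2 / 2 * asym_var)))"
    by (rule Lim_transform[rotated])
  then show ?thesis by (simp add: e_def mult_ac)
qed

end

section \<open>Characteristic functions along the chain\<close>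

text \<open>\<open>s\<close> is the observed summand, defined at every point, while its
  representation through \<open>h\<close> holds only \<open>\<pi>\<close>-almost everywhere.
  Quantities built from \<open>s\<close> make sense under any initial law.\<close>

locale observed_sweep = mixing_sweep +
  fixes s :: "nat \<Rightarrow> 'a \<Rightarrow> real"
  assumes s: "s j \<in> borel_measurable borel" and s_eq: "AE x in \<pi>. s j x = h j x - Ph j x"
begin

text \<open>The conditional characteristic function, given the point at time \<open>j\<close>, of
  the sum of the \<open>l\<close> summands with indices \<open>j\<close> to \<open>j + l - 1\<close>
  along the chain.\<close>

primrec charfun :: "real \<Rightarrow> nat \<Rightarrow> nat \<Rightarrow> 'a \<Rightarrow> complex" where
  "charfun e 0 j = (\<lambda>_. 1)"
| "charfun e (Suc l) j = (\<lambda>x. iexp (e * s j x) * kernel_app (P j) (charfun e l (Suc j)) x)"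

lemma charfun_bounded: "charfun e l j \<in> borel_measurable borel \<and> (\<forall>x. norm (charfun e l j x) \<le> 1)"
proof (induction l arbitrary: j)
  case (Suc l)
  have "kernel_app (P j) (charfun e l (Suc j)) \<in> borel_measurable borel"
    using Suc by (intro kernel_app_measurable S.P) auto
  moreover have "norm (kernel_app (P j) (charfun e l (Suc j)) x) \<le> 1" for x
    using Suc by (intro norm_kernel_app_bound S.P) auto
  ultimately show ?case using iexp_meas[OF s] by (auto simp: norm_mult intro!: borel_measurable_times)
qed simp

lemma charfun_meas: "charfun e l j \<in> borel_measurable borel"
  and norm_charfun: "norm (charfun e l j x) \<le> 1"
  using charfun_bounded by auto

lemma charfun_integrable: "integrable \<pi> (charfun e l j)"
  by (rule bounded_integrable[OF charfun_meas norm_charfun])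

lemma boundary_meas: "(\<lambda>x. iexp (- e * h j x) * charfun e l j x) \<in> borel_measurable borel"
  by (intro borel_measurable_times iexp_meas h charfun_meas)

text \<open>Along the path \<open>s\<^sub>j\<close> equals the increment \<open>d\<^sub>j\<close>
  plus \<open>h\<^sub>j\<close> at time \<open>j\<close> minus
  \<open>h\<^sub>j\<^sub>+\<^sub>1\<close> at time \<open>j + 1\<close>. So the boundary factor
  moves on by one time unit while one twist is split off.\<close>

lemma path_mean_charfun_step:
  "path_mean e j (\<lambda>x. iexp (- e * h j x) * charfun e (Suc l) j x)
   = path_mean e (Suc j) (\<lambda>x. iexp (- e * h (Suc j) x) * charfun e l (Suc j) x)"
proof -
  let ?u = "\<lambda>x. iexp (- e * h (Suc j) x) * charfun e l (Suc j) x"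
  have inv: "iexp (e * h (Suc j) y) * iexp (- e * h (Suc j) y) = 1" for y
    by (simp add: exp_add[symmetric])
  have "(\<lambda>y. iexp (e * h (Suc j) y) * ?u y) = charfun e l (Suc j)"
    by (rule ext) (simp only: mult.assoc[symmetric] inv mult_1_left)
  then have tw: "twist e j ?u x = iexp (- (e * Ph j x)) * kernel_app (P j) (charfun e l (Suc j)) x" for x
    by (simp only: twist_def)
  have "AE x in \<pi>. iexp (- e * h j x) * charfun e (Suc l) j x = twist e j ?u x"
    using s_eq[of j]
  proof eventually_elim
    case (elim x)
    have "iexp (- e * h j x) * iexp (e * s j x) = iexp (- (e * Ph j x))"
      unfolding elim by (simp add: exp_add[symmetric] algebra_simps)
    then show ?case unfolding tw by (simp add: mult.assoc[symmetric])
  qed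
  then show ?thesis
    unfolding path_mean.simps by (intro path_mean_cong twist_measurable boundary_meas)
qed

lemma path_mean_charfun:
  "(\<integral>x. iexp (- e * h 0 x) * charfun e n 0 x \<partial>\<pi>) = path_mean e n (\<lambda>x. iexp (- e * h n x))"
proof -
  have "(\<integral>x. iexp (- e * h 0 x) * charfun e (l + k) 0 x \<partial>\<pi>) = path_mean e k (\<lambda>x. iexp (- e * h k x) * charfun e l k x)" for k l
  proof (induction k arbitrary: l)
    case (Suc k)
    show ?case using Suc[of "Suc l"] path_mean_charfun_step[of e k l] by simp
  qed simp
  from this[of 0 n] show ?thesis by simp
qed

lemma integral_iexp_minus_1:
  assumes u: "integrable \<pi> u" and w: "w \<in> borel_measurable borel" "\<And>x. norm (w x) \<le> 1"
  shows "norm ((\<integral>x. iexp (e * u x) * w x \<partial>\<pi>) - (\<integral>x. w x \<partial>\<pi>)) \<le> \<bar>e\<bar> * (\<integral>x. \<bar>u x\<bar> \<partial>\<pi>)"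
proof -
  have um: "u \<in> borel_measurable borel" using u by (rule pi_meas)
  have wi: "integrable \<pi> w" using w by (rule bounded_integrable)
  have wi': "integrable \<pi> (\<lambda>x. iexp (e * u x) * w x)" by (rule integrable_iexp_mult[OF wi um])
  have "(\<integral>x. iexp (e * u x) * w x \<partial>\<pi>) - (\<integral>x. w x \<partial>\<pi>) = (\<integral>x. iexp (e * u x) * w x - w x \<partial>\<pi>)"
    using wi wi' by simp
  also have "norm \<dots> \<le> (\<integral>x. norm (iexp (e * u x) * w x - w x) \<partial>\<pi>)" by (rule integral_norm_bound)
  also have "\<dots> \<le> (\<integral>x. \<bar>e\<bar> * \<bar>u x\<bar> \<partial>\<pi>)"
  proof (rule integral_mono)
    fix x
    have "norm (iexp (e * u x) * w x - w x) = norm (iexp (e * u x) - 1) * norm (w x)"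
      by (simp add: norm_mult[symmetric] algebra_simps)
    also have "\<dots> \<le> \<bar>e * u x\<bar> * 1" by (intro mult_mono norm_iexp_minus_1 w) auto
    finally show "norm (iexp (e * u x) * w x - w x) \<le> \<bar>e\<bar> * \<bar>u x\<bar>" by (simp add: abs_mult)
  qed (use u wi wi' in auto)
  finally show ?thesis by simp
qed

lemma s_integrable: "integrable \<pi> (s j)"
proof -
  have "integrable \<pi> (\<lambda>x. h j x - Ph j x)" using h1 Ph1 by auto
  then show ?thesis using s_eq[of j] meas_pi[OF s] by (subst integrable_cong_AE) auto
qed

text \<open>By stationarity a kernel may be put in front of the integrand for free; giving this step
  its factor \<open>iexp (e * s m x)\<close> costs at most \<open>\<bar>e\<bar>\<close> times the
  mean of \<open>\<bar>s m\<bar>\<close>. The \<open>m\<close> missing summands are restored in this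
  way one at a time.\<close>

lemma charfun_shift:
  "norm ((\<integral>x. charfun e l m x \<partial>\<pi>) - (\<integral>x. charfun e (l + m) 0 x \<partial>\<pi>)) \<le> \<bar>e\<bar> * (\<Sum>j<m. \<integral>x. \<bar>s j x\<bar> \<partial>\<pi>)"
proof (induction m arbitrary: l)
  case (Suc m)
  let ?w = "kernel_app (P m) (charfun e l (Suc m))"
  have w: "?w \<in> borel_measurable borel" "\<And>x. norm (?w x) \<le> 1"
    by (auto intro!: kernel_app_measurable norm_kernel_app_bound S.P charfun_meas norm_charfun)
  have "norm ((\<integral>x. iexp (e * s m x) * ?w x \<partial>\<pi>) - (\<integral>x. ?w x \<partial>\<pi>)) \<le> \<bar>e\<bar> * (\<integral>x. \<bar>s m x\<bar> \<partial>\<pi>)"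
    by (rule integral_iexp_minus_1[OF s_integrable w])
  then have 1: "norm ((\<integral>x. charfun e l (Suc m) x \<partial>\<pi>) - (\<integral>x. charfun e (Suc l) m x \<partial>\<pi>)) \<le> \<bar>e\<bar> * (\<integral>x. \<bar>s m x\<bar> \<partial>\<pi>)"
    by (simp add: S.integrable_kernel_app(2)[OF charfun_integrable] norm_minus_commute)
  have "norm (((\<integral>x. charfun e l (Suc m) x \<partial>\<pi>) - (\<integral>x. charfun e (Suc l) m x \<partial>\<pi>))
      + ((\<integral>x. charfun e (Suc l) m x \<partial>\<pi>) - (\<integral>x. charfun e (Suc l + m) 0 x \<partial>\<pi>)))
    \<le> \<bar>e\<bar> * (\<integral>x. \<bar>s m x\<bar> \<partial>\<pi>) + \<bar>e\<bar> * (\<Sum>j<m. \<integral>x. \<bar>s j x\<bar> \<partial>\<pi>)"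
    by (intro norm_triangle_le add_mono 1 Suc.IH)
  then show ?case by (simp add: algebra_simps)
qed simp

text \<open>Sum and martingale differ by boundary terms in \<open>h\<close> at the times 0 and
  \<open>n\<close>; each changes the characteristic function by at most
  \<open>\<bar>e n\<bar> * H\<close>.\<close>

lemma charfun_tendsto:
  "(\<lambda>n. \<integral>x. charfun (\<theta> / sqrt (real n)) n 0 x \<partial>\<pi>) \<longlonglongrightarrow> of_real (exp (- (\<theta>\<^sup>2 * asym_var / 2)))"
proof (rule Lim_transform[OF path_mean_tendsto])
  obtain H where H: "0 \<le> H" "\<And>j. (\<integral>x. \<bar>h j x\<bar> \<partial>\<pi>) \<le> H" using h_bound by blast
  define e where "e n = \<theta> / sqrt (real n)" for n :: nat
  have e0: "e \<longlonglongrightarrow> 0" unfolding e_def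
    by (rule tendsto_divide_0[OF tendsto_const])
       (intro filterlim_at_top_imp_at_infinity filterlim_compose[OF sqrt_at_top filterlim_real_sequentially])
  have bound: "norm ((\<integral>x. charfun (e n) n 0 x \<partial>\<pi>) - path_mean (e n) n (\<lambda>_. 1)) \<le> \<bar>e n\<bar> * (2 * H)" for n
  proof -
    have 1: "norm (path_mean (e n) n (\<lambda>x. iexp (- e n * h n x)) - (\<integral>x. charfun (e n) n 0 x \<partial>\<pi>)) \<le> \<bar>e n\<bar> * H"
      using integral_iexp_minus_1[OF h1[of 0] charfun_meas[of "e n" n 0] norm_charfun, of "- e n"]
        H(2)[of 0] mult_left_mono[OF H(2)[of 0], of "\<bar>e n\<bar>"] unfolding path_mean_charfun abs_minus_cancel by linarith
    have hb: "(\<lambda>x. iexp (- e n * h n x)) \<in> borel_measurable borel" by (rule iexp_meas[OF h])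
    have hi: "integrable \<pi> (\<lambda>x. iexp (- e n * h n x))" by (rule bounded_integrable[OF hb, of 1]) simp
    have "path_mean (e n) n (\<lambda>x. iexp (- e n * h n x)) - path_mean (e n) n (\<lambda>_. 1) = path_mean (e n) n (\<lambda>x. iexp (- e n * h n x) - 1)"
      using hi by (intro path_mean_diff[symmetric]) auto
    also have "norm \<dots> \<le> (\<integral>x. norm (iexp (- e n * h n x) - 1) \<partial>\<pi>)"
      using hi by (intro norm_path_mean_le) auto
    also have "\<dots> \<le> (\<integral>x. \<bar>e n\<bar> * \<bar>h n x\<bar> \<partial>\<pi>)"
    proof (rule integral_mono)
      show "norm (iexp (- e n * h n x) - 1) \<le> \<bar>e n\<bar> * \<bar>h n x\<bar>" for x
        using norm_iexp_minus_1[of "- e n * h n x"] by (simp add: abs_mult)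
    qed (use hi h1 in auto)
    also have "\<dots> \<le> \<bar>e n\<bar> * H" using H(2)[of n] by (simp add: mult_left_mono)
    finally have 2: "norm (path_mean (e n) n (\<lambda>x. iexp (- e n * h n x)) - path_mean (e n) n (\<lambda>_. 1)) \<le> \<bar>e n\<bar> * H" .
    let ?a = "path_mean (e n) n (\<lambda>x. iexp (- e n * h n x))"
    have "norm ((?a - path_mean (e n) n (\<lambda>_. 1)) - (?a - (\<integral>x. charfun (e n) n 0 x \<partial>\<pi>))) \<le> \<bar>e n\<bar> * H + \<bar>e n\<bar> * H"
      by (rule order_trans[OF norm_triangle_ineq4 add_mono[OF 2 1]])
    then show ?thesis by (simp add: algebra_simps)
  qed
  have "(\<lambda>n. \<bar>e n\<bar> * (2 * H)) \<longlonglongrightarrow> \<bar>0\<bar> * (2 * H)" by (intro tendsto_intros e0)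
  then have "(\<lambda>n. \<bar>e n\<bar> * (2 * H)) \<longlonglongrightarrow> 0" by simp
  then have "(\<lambda>n. (\<integral>x. charfun (e n) n 0 x \<partial>\<pi>) - path_mean (e n) n (\<lambda>_. 1)) \<longlonglongrightarrow> 0"
    by (rule Lim_null_comparison[OF always_eventually[OF allI[OF bound]]])
  then show "(\<lambda>n. (\<integral>x. charfun (\<theta> / sqrt (real n)) n 0 x \<partial>\<pi>) - path_mean (\<theta> / sqrt (real n)) n (\<lambda>_. 1)) \<longlonglongrightarrow> 0"
    by (simp add: e_def)
qed

end

section \<open>The Markov property against bounded functionals of the past\<close>

locale sweep_path =
  fixes M :: "'w measure" and X :: "nat \<Rightarrow> 'w \<Rightarrow> 'a::topological_space" and P :: "nat \<Rightarrow> 'a \<Rightarrow> 'a measure"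
  assumes prob_M: "prob_space M" and X: "X t \<in> borel_measurable M" and kerP: "pkernel (P t)"
    and cond: "B \<in> sets borel \<Longrightarrow> AE w in M.
        real_cond_exp M (history M X t) (\<lambda>w. indicator B (X (Suc t) w)) w = measure (P t (X t w)) B"
begin

interpretation M: prob_space M by (rule prob_M)

lemma history_map: "(\<lambda>w. \<lambda>i\<in>{..t}. X i w) \<in> M \<rightarrow>\<^sub>M Pi\<^sub>M {..t} (\<lambda>_. borel)"
  by (rule measurable_restrict) (rule X)

lemma subalgebra_history: "subalgebra M (history M X t)"
proof -
  have "(\<lambda>w. \<lambda>i\<in>{..t}. X i w) \<in> space M \<rightarrow> space (Pi\<^sub>M {..t} (\<lambda>_. borel))"
    using measurable_space[OF history_map] by auto
  then show ?thesis unfolding subalgebra_def history_def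
    using measurable_sets[OF history_map] by (auto simp: sets_vimage_algebra2)
qed

lemma X_history:
  assumes "i \<le> t"
  shows "X i \<in> borel_measurable (history M X t)"
proof -
  have "(\<lambda>w. \<lambda>i\<in>{..t}. X i w) \<in> history M X t \<rightarrow>\<^sub>M Pi\<^sub>M {..t} (\<lambda>_. borel)"
    unfolding history_def using measurable_space[OF history_map] by (intro measurable_vimage_algebra1) auto
  from measurable_compose[OF this measurable_component_singleton[of i]] assms
  show ?thesis by simp
qed

text \<open>Restricting \<open>M\<close> to the event \<open>A\<close> turns the claim into an
  equality of two laws: that of \<open>X (Suc t)\<close>, and that of \<open>X t\<close> followed by
  the kernel. The hypothesis \<open>cond\<close> gives it on Borel sets, and all bounded functions
  follow at once.\<close>

lemma set_integral_transition:
  fixes u :: "'a \<Rightarrow> real"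
  assumes A: "A \<in> sets (history M X t)" and u: "u \<in> borel_measurable borel" "\<And>x. \<bar>u x\<bar> \<le> B"
  shows "(\<integral>w\<in>A. u (X (Suc t) w) \<partial>M) = (\<integral>w\<in>A. kernel_app (P t) u (X t w) \<partial>M)"
proof -
  interpret sub: finite_measure_subalgebra M "history M X t"
    by unfold_locales (rule subalgebra_history)
  have AM: "A \<in> sets M" using A subalgebra_history by (auto simp: subalgebra_def)
  define R where "R = density M (\<lambda>w. ennreal (indicator A w))"
  have Rs: "sets R = sets M" by (simp add: R_def)
  interpret R: finite_measure R
    using AM by (intro finite_measureI) (simp add: R_def ennreal_indicator emeasure_restricted)
  have XR: "X i \<in> borel_measurable R" for i using X[of i] Rs by (simp cong: measurable_cong_sets)
  define \<mu> where "\<mu> = distr R borel (X t)"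
  interpret kb: kernel_bind \<mu> "P t" using kerP by unfold_locales (simp_all add: \<mu>_def)
  have eq: "distr R borel (X (Suc t)) = \<mu> \<bind> P t"
  proof (rule measure_eqI)
    show "sets (distr R borel (X (Suc t))) = sets (\<mu> \<bind> P t)" by (simp add: kb.sets_bind_N)
    fix B assume "B \<in> sets (distr R borel (X (Suc t)))"
    then have B: "B \<in> sets borel" by simp
    have mB: "(\<lambda>x. measure (P t x) B) \<in> borel_measurable borel"
      using pkernel_emeasure_measurable[OF kerP B] by (simp add: measure_def)
    have e: "ennreal (measure (P t x) B) = emeasure (P t x) B" for x
      using prob_space.finite_measure[OF pkernel_prob_space[OF kerP]]
      by (simp add: finite_measure.emeasure_eq_measure)
    have iB: "integrable M (\<lambda>w. indicator B (X (Suc t) w) :: real)"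
      by (rule M.integrable_const_bound[of _ 1]) (use B X[of "Suc t"] in \<open>auto intro!: borel_measurable_indicator' measurable_sets\<close>)
    have im: "integrable M (\<lambda>w. measure (P t (X t w)) B)"
      by (rule M.integrable_const_bound[of _ 1])
         (use measurable_compose[OF X mB] prob_space.prob_le_1[OF pkernel_prob_space[OF kerP]] in auto)
    have "(\<integral>w\<in>A. indicator B (X (Suc t) w) \<partial>M) = (\<integral>w\<in>A. real_cond_exp M (history M X t) (\<lambda>w. indicator B (X (Suc t) w)) w \<partial>M)"
      by (rule sub.real_cond_exp_intA[OF iB A])
    also have "\<dots> = (\<integral>w\<in>A. measure (P t (X t w)) B \<partial>M)"
      using cond[OF B, of t] AM im unfolding set_lebesgue_integral_def
      by (intro integral_cong_AE) (auto intro!: borel_measurable_scaleR)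
    finally have int_eq: "(\<integral>w. indicator A w * indicator B (X (Suc t) w) \<partial>M) = (\<integral>w. indicator A w * measure (P t (X t w)) B \<partial>M)"
      by (simp add: set_lebesgue_integral_def)
    have "emeasure (distr R borel (X (Suc t))) B = (\<integral>\<^sup>+x. indicator B x \<partial>distr R borel (X (Suc t)))"
      using B by simp
    also have "\<dots> = (\<integral>\<^sup>+w. indicator B (X (Suc t) w) \<partial>R)"
      by (rule nn_integral_distr[OF XR]) (use B in simp)
    also have "\<dots> = (\<integral>\<^sup>+w. ennreal (indicator A w * indicator B (X (Suc t) w)) \<partial>M)"
      unfolding R_def using AM B X[of "Suc t"]
      by (subst nn_integral_density) (auto intro!: nn_integral_cong borel_measurable_indicator' measurable_sets split: split_indicator)
    also have "\<dots> = ennreal (\<integral>w. indicator A w * indicator B (X (Suc t) w) \<partial>M)"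
      using iB AM integrable_mult_indicator[OF AM iB] by (intro nn_integral_eq_integral) auto
    also have "\<dots> = (\<integral>\<^sup>+w. ennreal (indicator A w * measure (P t (X t w)) B) \<partial>M)"
      unfolding int_eq using im AM integrable_mult_indicator[OF AM im] by (intro nn_integral_eq_integral[symmetric]) auto
    also have "\<dots> = (\<integral>\<^sup>+w. emeasure (P t (X t w)) B \<partial>R)"
      unfolding R_def using AM measurable_compose[OF X pkernel_emeasure_measurable[OF kerP B]]
      by (subst nn_integral_density) (auto intro!: nn_integral_cong simp: e split: split_indicator)
    also have "\<dots> = emeasure (\<mu> \<bind> P t) B"
      using kb.nn_integral_bind_N[of "indicator B"] B XR pkernel_emeasure_measurable[OF kerP B]
      by (simp add: kb.sets_bind_N pkernel_sets[OF kerP] \<mu>_def nn_integral_distr)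
    finally show "emeasure (distr R borel (X (Suc t))) B = emeasure (\<mu> \<bind> P t) B" .
  qed
  interpret fd: finite_measure "distr R borel (X (Suc t))" by (rule R.finite_measure_distr[OF XR])
  have ui: "integrable (\<mu> \<bind> P t) u" unfolding eq[symmetric]
    by (rule fd.integrable_const_bound[of _ B]) (use u in auto)
  have "(\<integral>w\<in>A. u (X (Suc t) w) \<partial>M) = (\<integral>w. u (X (Suc t) w) \<partial>R)"
    unfolding R_def set_lebesgue_integral_def
    using AM measurable_compose[OF X u(1)] by (subst integral_density) auto
  also have "\<dots> = (\<integral>x. u x \<partial>distr R borel (X (Suc t)))" using XR u by (simp add: integral_distr)
  also have "\<dots> = (\<integral>x. kernel_app (P t) u x \<partial>\<mu>)" unfolding eq using kb.integral_bind_N[OF ui] by simp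
  also have "\<dots> = (\<integral>w. kernel_app (P t) u (X t w) \<partial>R)"
    unfolding \<mu>_def using XR kernel_app_measurable[OF kerP u(1)] by (simp add: integral_distr)
  also have "\<dots> = (\<integral>w\<in>A. kernel_app (P t) u (X t w) \<partial>M)"
    unfolding R_def set_lebesgue_integral_def
    using AM measurable_compose[OF X kernel_app_measurable[OF kerP u(1)]]
    by (subst integral_density) auto
  finally show ?thesis .
qed

text \<open>The preceding lemma identifies the conditional expectation of
  \<open>u (X (Suc t))\<close> given the past, which then admits the weight
  \<open>Y\<close>.\<close>

lemma transition_real:
  fixes u :: "'a \<Rightarrow> real" and Y :: "'w \<Rightarrow> real"
  assumes Y: "Y \<in> borel_measurable (history M X t)" "\<And>w. \<bar>Y w\<bar> \<le> C"
    and u: "u \<in> borel_measurable borel" "\<And>x. \<bar>u x\<bar> \<le> B"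
  shows "(\<integral>w. Y w * u (X (Suc t) w) \<partial>M) = (\<integral>w. Y w * kernel_app (P t) u (X t w) \<partial>M)"
proof -
  interpret sub: finite_measure_subalgebra M "history M X t"
    by unfold_locales (rule subalgebra_history)
  have k: "kernel_app (P t) u \<in> borel_measurable borel" "\<And>x. \<bar>kernel_app (P t) u x\<bar> \<le> B"
    using kernel_app_measurable[OF kerP u(1)] norm_kernel_app_bound[OF kerP, of u B] u(2) by auto
  have B: "0 \<le> B" using order_trans[OF abs_ge_zero u(2)] .
  have YM: "Y \<in> borel_measurable M" by (rule measurable_from_subalg[OF subalgebra_history Y(1)])
  have 1: "integrable M (\<lambda>w. u (X (Suc t) w))"
    by (rule M.integrable_const_bound[of _ B]) (use u measurable_compose[OF X u(1)] in auto)
  have 2: "integrable M (\<lambda>w. kernel_app (P t) u (X t w))"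
    by (rule M.integrable_const_bound[of _ B]) (use k measurable_compose[OF X k(1)] in auto)
  have 3: "integrable M (\<lambda>w. Y w * u (X (Suc t) w))"
    by (rule M.integrable_const_bound[of _ "C * B"])
       (use YM Y(2) u measurable_compose[OF X u(1)] B in \<open>auto simp: abs_mult intro!: mult_mono order_trans[OF abs_ge_zero Y(2)]\<close>)
  have "AE w in M. real_cond_exp M (history M X t) (\<lambda>w. u (X (Suc t) w)) w = kernel_app (P t) u (X t w)"
    by (rule sub.real_cond_exp_charact[OF set_integral_transition[OF _ u] 1 2 measurable_compose[OF X_history[OF order_refl] k(1)]])
  then have "(\<integral>w. Y w * real_cond_exp M (history M X t) (\<lambda>w. u (X (Suc t) w)) w \<partial>M) = (\<integral>w. Y w * kernel_app (P t) u (X t w) \<partial>M)"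
    using YM 2 by (intro integral_cong_AE) (auto intro!: borel_measurable_times)
  moreover have "(\<integral>w. Y w * real_cond_exp M (history M X t) (\<lambda>w. u (X (Suc t) w)) w \<partial>M) = (\<integral>w. Y w * u (X (Suc t) w) \<partial>M)"
    using 1 by (intro sub.real_cond_exp_intg(2) 3 Y) auto
  ultimately show ?thesis by simp
qed

lemma transition:
  fixes u :: "'a \<Rightarrow> complex" and Y :: "'w \<Rightarrow> complex"
  assumes Y: "Y \<in> borel_measurable (history M X t)" "\<And>w. norm (Y w) \<le> C"
    and u: "u \<in> borel_measurable borel" "\<And>x. norm (u x) \<le> B"
  shows "(\<integral>w. Y w * u (X (Suc t) w) \<partial>M) = (\<integral>w. Y w * kernel_app (P t) u (X t w) \<partial>M)"
proof -
  have B: "0 \<le> B" "0 \<le> C" using order_trans[OF norm_ge_zero u(2)] order_trans[OF norm_ge_zero Y(2)] by auto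
  have k: "kernel_app (P t) u \<in> borel_measurable borel" "\<And>x. norm (kernel_app (P t) u x) \<le> B"
    using kernel_app_measurable[OF kerP u(1)] norm_kernel_app_bound[OF kerP, of u B] u(2) by auto
  have YM: "Y \<in> borel_measurable M" by (rule measurable_from_subalg[OF subalgebra_history Y(1)])
  have Yc: "(\<lambda>w. Re (Y w)) \<in> borel_measurable (history M X t)" "\<And>w. \<bar>Re (Y w)\<bar> \<le> C"
    "(\<lambda>w. Im (Y w)) \<in> borel_measurable (history M X t)" "\<And>w. \<bar>Im (Y w)\<bar> \<le> C"
    using Y(1) by (auto intro!: order_trans[OF abs_Re_le_cmod Y(2)] order_trans[OF abs_Im_le_cmod Y(2)])
  have uc: "(\<lambda>w. Re (u w)) \<in> borel_measurable borel" "\<And>w. \<bar>Re (u w)\<bar> \<le> B"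
    "(\<lambda>w. Im (u w)) \<in> borel_measurable borel" "\<And>w. \<bar>Im (u w)\<bar> \<le> B"
    using u(1) by (auto intro!: order_trans[OF abs_Re_le_cmod u(2)] order_trans[OF abs_Im_le_cmod u(2)])
  have kc: "Re (kernel_app (P t) u x) = kernel_app (P t) (\<lambda>y. Re (u y)) x"
     "Im (kernel_app (P t) u x) = kernel_app (P t) (\<lambda>y. Im (u y)) x" for x
    using pkernel_bounded_integrable[OF kerP u] by (simp_all add: kernel_app_def)
  have i1: "integrable M (\<lambda>w. Y w * v (X i w))" if "v \<in> borel_measurable borel" "\<And>x. norm (v x) \<le> B" for v i
    by (rule M.integrable_const_bound[of _ "C * B"])
       (use YM Y(2) that measurable_compose[OF X that(1)] B in \<open>auto simp: norm_mult intro!: mult_mono\<close>)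
  have ir: "integrable M (\<lambda>w. a w * v (X i w))"
    if "a \<in> borel_measurable M" "\<And>w. \<bar>a w\<bar> \<le> C" "v \<in> borel_measurable borel" "\<And>x. \<bar>v x\<bar> \<le> B" for a :: "'w \<Rightarrow> real" and v i
    by (rule M.integrable_const_bound[of _ "C * B"])
       (use that measurable_compose[OF X that(3)] B in \<open>auto simp: abs_mult intro!: mult_mono\<close>)
  note from_sub = measurable_from_subalg[OF subalgebra_history]
  note I = ir[OF from_sub[OF Yc(1)] Yc(2) uc(1,2)] ir[OF from_sub[OF Yc(1)] Yc(2) uc(3,4)]
     ir[OF from_sub[OF Yc(3)] Yc(4) uc(1,2)] ir[OF from_sub[OF Yc(3)] Yc(4) uc(3,4)]
  have kb: "(\<lambda>x. kernel_app (P t) (\<lambda>y. Re (u y)) x) \<in> borel_measurable borel" "\<And>x. \<bar>kernel_app (P t) (\<lambda>y. Re (u y)) x\<bar> \<le> B"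
    "(\<lambda>x. kernel_app (P t) (\<lambda>y. Im (u y)) x) \<in> borel_measurable borel" "\<And>x. \<bar>kernel_app (P t) (\<lambda>y. Im (u y)) x\<bar> \<le> B"
    using kernel_app_measurable[OF kerP uc(1)] kernel_app_measurable[OF kerP uc(3)]
      norm_kernel_app_bound[OF kerP, of "\<lambda>y. Re (u y)" B] norm_kernel_app_bound[OF kerP, of "\<lambda>y. Im (u y)" B] uc(2,4) by auto
  note J = ir[OF from_sub[OF Yc(1)] Yc(2) kb(1,2)] ir[OF from_sub[OF Yc(1)] Yc(2) kb(3,4)]
     ir[OF from_sub[OF Yc(3)] Yc(4) kb(1,2)] ir[OF from_sub[OF Yc(3)] Yc(4) kb(3,4)]
  note T = transition_real[OF Yc(1,2) uc(1,2)] transition_real[OF Yc(1,2) uc(3,4)]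
    transition_real[OF Yc(3,4) uc(1,2)] transition_real[OF Yc(3,4) uc(3,4)]
  show ?thesis
  proof (rule complex_eqI)
    show "Re (\<integral>w. Y w * u (X (Suc t) w) \<partial>M) = Re (\<integral>w. Y w * kernel_app (P t) u (X t w) \<partial>M)"
      using I J T by (simp add: integral_Re[symmetric] i1[OF u] i1[OF k] kc)
    show "Im (\<integral>w. Y w * u (X (Suc t) w) \<partial>M) = Im (\<integral>w. Y w * kernel_app (P t) u (X t w) \<partial>M)"
      using I J T by (simp add: integral_Im[symmetric] i1[OF u] i1[OF k] kc)
  qed
qed

end

text \<open>\<open>tv\<close> bounds, at each starting point, the distance from stationarity after
  \<open>q\<close> sweeps, for all functions bounded by 1 simultaneously. It will be applied to
  characteristic functions that vary with \<open>n\<close>.\<close>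

locale sweep_clt = observed_sweep \<pi> P h K s + sweep_path M X P
  for \<pi> :: "'a::topological_space measure" and P h K s and M :: "'w measure" and X +
  fixes \<nu> :: "'a measure" and c :: "nat \<Rightarrow> real" and V :: "'a \<Rightarrow> real"
  assumes law0: "distr M borel (X 0) = \<nu>"
    and c: "c \<longlonglongrightarrow> 0" and V: "V \<in> borel_measurable borel"
    and tv: "u \<in> borel_measurable borel \<Longrightarrow> (\<And>x. \<bar>u x\<bar> \<le> 1) \<Longrightarrow>
      \<bar>iter 0 (K * q) u x - (\<integral>y. u y \<partial>\<pi>)\<bar> \<le> c q * V x"
begin

interpretation M: prob_space M by (rule prob_M)

lemma mean_iter:
  fixes u :: "'a \<Rightarrow> complex"
  shows "u \<in> borel_measurable borel \<Longrightarrow> (\<And>x. norm (u x) \<le> B) \<Longrightarrow> (\<integral>w. u (X m w) \<partial>M) = (\<integral>x. iter 0 m u x \<partial>\<nu>)"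
proof (induction m arbitrary: u)
  case 0
  then show ?case using X[of 0] by (simp add: law0[symmetric] integral_distr)
next
  case (Suc m)
  have "(\<integral>w. u (X (Suc m) w) \<partial>M) = (\<integral>w. kernel_app (P m) u (X m w) \<partial>M)"
    using transition[of "\<lambda>_. 1" m 1 u B] Suc.prems by simp
  also have "\<dots> = (\<integral>x. iter 0 m (kernel_app (P m) u) x \<partial>\<nu>)"
    by (rule Suc.IH) (auto intro!: kernel_app_measurable norm_kernel_app_bound S.P Suc.prems)
  finally show ?case by simp
qed

lemma nu: "prob_space \<nu>" "sets \<nu> = sets borel"
  using M.prob_space_distr[OF X[of 0]] by (auto simp: law0[symmetric])

text \<open>\<open>V\<close> may have infinite mean under \<open>\<nu>\<close>; capping at a trivial
  bound makes dominated convergence available. The factor 2 in front accounts for real and imaginary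
  parts.\<close>

definition tvb :: "nat \<Rightarrow> real" where "tvb q = (\<integral>x. 2 * min 2 (\<bar>c q * V x\<bar>) \<partial>\<nu>)"

lemma tvb_tendsto: "tvb \<longlonglongrightarrow> 0"
proof -
  interpret n: prob_space \<nu> by (rule nu)
  have Vn: "V \<in> borel_measurable \<nu>" using V nu(2) by (simp cong: measurable_cong_sets)
  have "tvb \<longlonglongrightarrow> (\<integral>x. 0 \<partial>\<nu>)" unfolding tvb_def
  proof (rule integral_dominated_convergence)
    show "AE x in \<nu>. (\<lambda>q. 2 * min 2 \<bar>c q * V x\<bar>) \<longlonglongrightarrow> 0"
    proof (rule AE_I2)
      fix x
      have "(\<lambda>q. 2 * min 2 \<bar>c q * V x\<bar>) \<longlonglongrightarrow> 2 * min 2 \<bar>0 * V x\<bar>" by (intro tendsto_intros c)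
      then show "(\<lambda>q. 2 * min 2 \<bar>c q * V x\<bar>) \<longlonglongrightarrow> 0" by simp
    qed
    show "AE x in \<nu>. norm (2 * min 2 \<bar>c q * V x\<bar>) \<le> 4" for q by (intro AE_I2) auto
  qed (use Vn in auto)
  then show ?thesis by simp
qed

lemma mean_tv:
  fixes u :: "'a \<Rightarrow> complex"
  assumes u: "u \<in> borel_measurable borel" "\<And>x. norm (u x) \<le> 1"
  shows "norm ((\<integral>w. u (X (K * q) w) \<partial>M) - (\<integral>x. u x \<partial>\<pi>)) \<le> tvb q"
proof -
  interpret n: prob_space \<nu> by (rule nu)
  have Vn: "V \<in> borel_measurable \<nu>" using V nu(2) by (simp cong: measurable_cong_sets)
  let ?I = "iter 0 (K * q)"
  have ui: "integrable \<pi> u" by (rule bounded_integrable[OF u])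
  have it: "?I u \<in> borel_measurable borel" "\<And>x. norm (?I u x) \<le> 1" using iter_bound[OF u] by auto
  have iti: "integrable \<nu> (?I u)"
    by (rule n.integrable_const_bound[of _ 1]) (use it nu(2) in \<open>auto cong: measurable_cong_sets\<close>)
  have split: "?I u x = complex_of_real (?I (\<lambda>x. Re (u x)) x) + \<i> * of_real (?I (\<lambda>x. Im (u x)) x)" for x
  proof -
    have "iter 0 m v x = Complex (iter 0 m (\<lambda>x. Re (v x)) x) (iter 0 m (\<lambda>x. Im (v x)) x)"
      if "v \<in> borel_measurable borel" "\<And>x. norm (v x) \<le> 1" for m v x
      using that
    proof (induction m arbitrary: v)
      case (Suc m)
      have k: "kernel_app (P m) v \<in> borel_measurable borel" "\<And>x. norm (kernel_app (P m) v x) \<le> 1"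
        by (auto intro!: kernel_app_measurable norm_kernel_app_bound S.P Suc.prems)
      have vi: "integrable (P m x) v" for x by (rule pkernel_bounded_integrable[OF S.P Suc.prems])
      have "(\<lambda>x. Re (kernel_app (P m) v x)) = kernel_app (P m) (\<lambda>x. Re (v x))"
        "(\<lambda>x. Im (kernel_app (P m) v x)) = kernel_app (P m) (\<lambda>x. Im (v x))"
        using vi by (simp_all add: kernel_app_def fun_eq_iff)
      then show ?case using Suc.IH[OF k] by simp
    qed simp
    from this[OF u] show ?thesis by (simp add: Complex_eq)
  qed
  have pt: "norm (?I u x - (\<integral>y. u y \<partial>\<pi>)) \<le> 2 * min 2 (\<bar>c q * V x\<bar>)" for x
  proof -
    have RI: "(\<lambda>x. Re (u x)) \<in> borel_measurable borel" "(\<lambda>x. Im (u x)) \<in> borel_measurable borel"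
      "\<And>x. \<bar>Re (u x)\<bar> \<le> 1" "\<And>x. \<bar>Im (u x)\<bar> \<le> 1"
      using u(1) by (auto intro!: order_trans[OF abs_Re_le_cmod u(2)] order_trans[OF abs_Im_le_cmod u(2)])
    have eq: "?I u x - (\<integral>y. u y \<partial>\<pi>) = of_real (?I (\<lambda>x. Re (u x)) x - (\<integral>x. Re (u x) \<partial>\<pi>)) + \<i> * of_real (?I (\<lambda>x. Im (u x)) x - (\<integral>x. Im (u x) \<partial>\<pi>))"
      unfolding split using ui by (intro complex_eqI) (simp_all add: integral_Re integral_Im)
    have "norm (?I u x - (\<integral>y. u y \<partial>\<pi>)) \<le> c q * V x + c q * V x"
      unfolding eq by (intro norm_triangle_le add_mono) (use tv[OF RI(1,3)] tv[OF RI(2,4)] in \<open>simp_all only: norm_mult norm_of_real norm_ii mult_1_left\<close>)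
    moreover have "norm (?I u x - (\<integral>y. u y \<partial>\<pi>)) \<le> 1 + 1"
    proof (intro order_trans[OF norm_triangle_ineq4] add_mono it)
      have "norm (\<integral>y. u y \<partial>\<pi>) \<le> (\<integral>y. norm (u y) \<partial>\<pi>)" by (rule integral_norm_bound)
      also have "\<dots> \<le> (\<integral>y. 1 \<partial>\<pi>)" using ui u by (intro integral_mono) auto
      finally show "norm (\<integral>y. u y \<partial>\<pi>) \<le> 1" using S.pi.prob_space by simp
    qed
    ultimately show ?thesis using abs_ge_self[of "c q * V x"] by linarith
  qed
  have "(\<integral>w. u (X (K * q) w) \<partial>M) - (\<integral>x. u x \<partial>\<pi>) = (\<integral>x. ?I u x - (\<integral>y. u y \<partial>\<pi>) \<partial>\<nu>)"
    unfolding mean_iter[OF u] using iti n.prob_space by simp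
  also have "norm \<dots> \<le> (\<integral>x. norm (?I u x - (\<integral>y. u y \<partial>\<pi>)) \<partial>\<nu>)" by (rule integral_norm_bound)
  also have "\<dots> \<le> tvb q" unfolding tvb_def
  proof (rule integral_mono)
    show "integrable \<nu> (\<lambda>x. norm (?I u x - (\<integral>y. u y \<partial>\<pi>)))" using iti by simp
    show "integrable \<nu> (\<lambda>x. 2 * min 2 \<bar>c q * V x\<bar>)"
      by (rule n.integrable_const_bound[of _ 4]) (use Vn in auto)
  qed (rule pt)
  finally show ?thesis .
qed

abbreviation S where "S m n w \<equiv> (\<Sum>t\<in>{m..<n}. s t (X t w))"

lemma S_meas: "S m n \<in> borel_measurable M"
  by (intro borel_measurable_sum measurable_compose[OF X s])

text \<open>\<open>Y\<close> carries the factors already collected. It is measurable with respect to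
  the past, so the transition property peels off one step of the recursion at a time.\<close>

lemma charfun_path_aux:
  "Y \<in> borel_measurable (history M X t) \<Longrightarrow> (\<And>w. norm (Y w) \<le> 1) \<Longrightarrow>
    (\<integral>w. Y w * charfun e l t (X t w) \<partial>M) = (\<integral>w. Y w * iexp (e * S t (t + l) w) \<partial>M)"
proof (induction l arbitrary: t Y)
  case (Suc l)
  let ?Y = "\<lambda>w. Y w * iexp (e * s t (X t w))"
  have "?Y \<in> borel_measurable (history M X t)"
    using measurable_compose[OF X_history[OF order_refl] iexp_meas[OF s, of e t]] Suc.prems
    by (intro borel_measurable_times) auto
  then have Yt: "?Y \<in> borel_measurable (history M X t)" .
  have Yb: "norm (?Y w) \<le> 1" for w using Suc.prems by (simp add: norm_mult)
  have YS: "?Y \<in> borel_measurable (history M X (Suc t))"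
  proof -
    have "(\<lambda>w. \<lambda>i\<in>{..t}. X i w) \<in> history M X (Suc t) \<rightarrow>\<^sub>M Pi\<^sub>M {..t} (\<lambda>_. borel)"
      by (rule measurable_restrict) (rule X_history, simp)
    moreover have "space (history M X (Suc t)) = space M" by (simp add: history_def)
    ultimately have "(\<lambda>w. w) \<in> history M X (Suc t) \<rightarrow>\<^sub>M history M X t"
      unfolding history_def[of M X t] by (intro measurable_vimage_algebra2) auto
    from measurable_compose[OF this Yt] show ?thesis .
  qed
  have "(\<integral>w. Y w * charfun e (Suc l) t (X t w) \<partial>M) = (\<integral>w. ?Y w * kernel_app (P t) (charfun e l (Suc t)) (X t w) \<partial>M)"
    by (simp add: mult.assoc)
  also have "\<dots> = (\<integral>w. ?Y w * charfun e l (Suc t) (X (Suc t) w) \<partial>M)"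
    by (rule transition[OF Yt Yb charfun_meas norm_charfun, symmetric])
  also have "\<dots> = (\<integral>w. ?Y w * iexp (e * S (Suc t) (Suc t + l) w) \<partial>M)"
    by (rule Suc.IH[OF YS Yb])
  also have "\<dots> = (\<integral>w. Y w * iexp (e * S t (t + Suc l) w) \<partial>M)"
  proof (rule Bochner_Integration.integral_cong[OF refl])
    fix w
    have "S t (t + Suc l) w = s t (X t w) + S (Suc t) (Suc t + l) w"
      by (subst sum.atLeast_Suc_lessThan) auto
    then show "?Y w * iexp (e * S (Suc t) (Suc t + l) w) = Y w * iexp (e * S t (t + Suc l) w)"
      by (simp add: exp_add[symmetric] algebra_simps)
  qed
  finally show ?case .
qed simp

lemma charfun_path: "(\<integral>w. charfun e l t (X t w) \<partial>M) = (\<integral>w. iexp (e * S t (t + l) w) \<partial>M)"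
  using charfun_path_aux[of "\<lambda>_. 1" t e l] by simp

theorem characteristic_function_tendsto:
  "(\<lambda>n. \<integral>w. iexp (\<theta> / sqrt (real n) * S 0 n w) \<partial>M) \<longlonglongrightarrow> of_real (exp (- (\<theta>\<^sup>2 * asym_var / 2)))"
proof -
  define e where "e n = \<theta> / sqrt (real n)" for n :: nat
  have e0: "e \<longlonglongrightarrow> 0" unfolding e_def
    by (rule tendsto_divide_0[OF tendsto_const])
       (intro filterlim_at_top_imp_at_infinity filterlim_compose[OF sqrt_at_top filterlim_real_sequentially])
  let ?L = "complex_of_real (exp (- (\<theta>\<^sup>2 * asym_var / 2)))"
  let ?A = "\<lambda>n. \<integral>w. iexp (e n * S 0 n w) \<partial>M"
  have "?A \<longlonglongrightarrow> ?L"
  proof (rule LIMSEQ_I)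
    fix r :: real assume r: "0 < r"
    have "eventually (\<lambda>q. tvb q < r / 4) sequentially" using tvb_tendsto r by (intro order_tendstoD) auto
    then obtain q where q: "tvb q < r / 4" by (auto simp: eventually_sequentially)
    define m where "m = K * q"
    \<comment> \<open>The effect of dropping the first \<open>m\<close> summands. For fixed
      \<open>m\<close> their sum is a finite random variable, so dominated convergence makes it
      negligible whatever its moments are.\<close>
    define B where "B n = (\<integral>w. norm (iexp (e n * S 0 m w) - 1) \<partial>M)" for n
    have "B \<longlonglongrightarrow> (\<integral>w. 0 \<partial>M)" unfolding B_def
    proof (rule integral_dominated_convergence)
      show "AE w in M. (\<lambda>n. norm (iexp (e n * S 0 m w) - 1)) \<longlonglongrightarrow> 0"
      proof (rule AE_I2)
        fix w
        have "(\<lambda>n. norm (iexp (e n * S 0 m w) - 1)) \<longlonglongrightarrow> norm (iexp (0 * S 0 m w) - 1)"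
          by (intro tendsto_intros e0)
        then show "(\<lambda>n. norm (iexp (e n * S 0 m w) - 1)) \<longlonglongrightarrow> 0" by simp
      qed
      show "AE w in M. norm (norm (iexp (e n * S 0 m w) - 1)) \<le> 2" for n
      proof (rule AE_I2)
        fix w
        show "norm (norm (iexp (e n * S 0 m w) - 1)) \<le> 2"
          using norm_triangle_ineq4[of "iexp (e n * S 0 m w)" 1] by simp
      qed
      show "(\<lambda>w. norm (iexp (e n * S 0 m w) - 1)) \<in> borel_measurable M" for n
        using S_meas[of 0 m] by measurable
    qed auto
    then have B0: "B \<longlonglongrightarrow> 0" by simp
    let ?s = "\<Sum>j<m. \<integral>x. \<bar>s j x\<bar> \<partial>\<pi>"
    have "(\<lambda>n. B n + \<bar>e n\<bar> * ?s + norm ((\<integral>x. charfun (e n) n 0 x \<partial>\<pi>) - ?L)) \<longlonglongrightarrow> 0 + \<bar>0\<bar> * ?s + norm (?L - ?L)"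
      using charfun_tendsto[of \<theta>] unfolding e_def[symmetric] by (intro tendsto_intros B0 e0)
    then have "eventually (\<lambda>n. B n + \<bar>e n\<bar> * ?s + norm ((\<integral>x. charfun (e n) n 0 x \<partial>\<pi>) - ?L) < r / 2) sequentially"
      using r by (intro order_tendstoD) auto
    then have "eventually (\<lambda>n. norm (?A n - ?L) < r) sequentially"
      using eventually_ge_at_top[of m]
    proof eventually_elim
      case (elim n)
      let ?B = "\<integral>w. iexp (e n * S m n w) \<partial>M"
      have nm: "n = m + (n - m)" using elim by simp
      have i: "integrable M (\<lambda>w. iexp (e n * S a b w))" for a b
      proof (rule M.integrable_const_bound[of _ 1])
        have "(\<lambda>x. iexp (e n * x)) \<in> borel_measurable borel" by measurable
        then show "(\<lambda>w. iexp (e n * S a b w)) \<in> borel_measurable M"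
          by (rule measurable_compose[OF S_meas])
      qed simp
      have 1: "norm (?A n - ?B) \<le> B n"
      proof -
        have eq: "?A n - ?B = (\<integral>w. iexp (e n * S 0 n w) - iexp (e n * S m n w) \<partial>M)" using i by simp
        have "norm (?A n - ?B) \<le> (\<integral>w. norm (iexp (e n * S 0 n w) - iexp (e n * S m n w)) \<partial>M)"
          unfolding eq by (rule integral_norm_bound)
        also have "\<dots> = B n" unfolding B_def
        proof (rule Bochner_Integration.integral_cong[OF refl])
          fix w
          have "S 0 n w = S 0 m w + S m n w" using elim by (subst sum.atLeastLessThan_concat) auto
          then have "iexp (e n * S 0 n w) - iexp (e n * S m n w) = (iexp (e n * S 0 m w) - 1) * iexp (e n * S m n w)"
            by (simp add: exp_add[symmetric] algebra_simps)
          then show "norm (iexp (e n * S 0 n w) - iexp (e n * S m n w)) = norm (iexp (e n * S 0 m w) - 1)"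
            by (simp add: norm_mult)
        qed
        finally show ?thesis .
      qed
      have "?B = (\<integral>w. charfun (e n) (n - m) m (X m w) \<partial>M)"
        using charfun_path[of "e n" "n - m" m] nm by simp
      then have 2: "norm (?B - (\<integral>x. charfun (e n) (n - m) m x \<partial>\<pi>)) \<le> tvb q"
        using mean_tv[OF charfun_meas norm_charfun] unfolding m_def by simp
      have 3: "norm ((\<integral>x. charfun (e n) (n - m) m x \<partial>\<pi>) - (\<integral>x. charfun (e n) n 0 x \<partial>\<pi>)) \<le> \<bar>e n\<bar> * ?s"
        using charfun_shift[of "e n" "n - m" m] elim by simp
      have "norm (((?A n - ?B) + (?B - (\<integral>x. charfun (e n) (n - m) m x \<partial>\<pi>))) +
         (((\<integral>x. charfun (e n) (n - m) m x \<partial>\<pi>) - (\<integral>x. charfun (e n) n 0 x \<partial>\<pi>)) + ((\<integral>x. charfun (e n) n 0 x \<partial>\<pi>) - ?L)))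
         \<le> (B n + tvb q) + (\<bar>e n\<bar> * ?s + norm ((\<integral>x. charfun (e n) n 0 x \<partial>\<pi>) - ?L))"
        by (intro norm_triangle_le add_mono 1 2 3 order_refl)
      then have "norm (?A n - ?L) \<le> (B n + tvb q) + (\<bar>e n\<bar> * ?s + norm ((\<integral>x. charfun (e n) n 0 x \<partial>\<pi>) - ?L))" by simp
      then show ?case using elim q r by linarith
    qed
    then show "\<exists>no. \<forall>n\<ge>no. norm (?A n - ?L) < r" unfolding eventually_sequentially .
  qed
  then show ?thesis by (simp add: e_def)
qed

end

section \<open>Convergence in distribution on Euclidean space\<close>

text \<open>Real trigonometric polynomials with arbitrary frequencies: their integrals are linear in
  values of the characteristic function, and the product formula for cosines makes them an
  algebra.\<close>

inductive trig_sum :: "(real^'n \<Rightarrow> real) \<Rightarrow> bool" where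
  cos: "trig_sum (\<lambda>x. c * cos (t \<bullet> x + b))"
| add: "trig_sum f \<Longrightarrow> trig_sum g \<Longrightarrow> trig_sum (\<lambda>x. f x + g x)"

lemma trig_sum_cos_mult: "trig_sum g \<Longrightarrow> trig_sum (\<lambda>x. c * cos (t \<bullet> x + b) * g x)"
proof (induction rule: trig_sum.induct)
  case (cos c' t' b')
  have "trig_sum (\<lambda>x. (c * c' / 2) * cos ((t - t') \<bullet> x + (b - b')) + (c * c' / 2) * cos ((t + t') \<bullet> x + (b + b')))"
    by (intro trig_sum.intros)
  also have "(\<lambda>x. (c * c' / 2) * cos ((t - t') \<bullet> x + (b - b')) + (c * c' / 2) * cos ((t + t') \<bullet> x + (b + b')))
    = (\<lambda>x. c * cos (t \<bullet> x + b) * (c' * cos (t' \<bullet> x + b')))"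
  proof
    fix x
    have "c * cos (t \<bullet> x + b) * (c' * cos (t' \<bullet> x + b')) = (c * c') * (cos (t \<bullet> x + b) * cos (t' \<bullet> x + b'))" by simp
    also have "\<dots> = (c * c') * ((cos ((t \<bullet> x + b) - (t' \<bullet> x + b')) + cos ((t \<bullet> x + b) + (t' \<bullet> x + b'))) / 2)"
      by (simp only: cos_times_cos)
    also have "(t \<bullet> x + b) - (t' \<bullet> x + b') = (t - t') \<bullet> x + (b - b')" by (simp add: inner_diff_left)
    also have "(t \<bullet> x + b) + (t' \<bullet> x + b') = (t + t') \<bullet> x + (b + b')" by (simp add: inner_add_left)
    finally show "(c * c' / 2) * cos ((t - t') \<bullet> x + (b - b')) + (c * c' / 2) * cos ((t + t') \<bullet> x + (b + b'))
      = c * cos (t \<bullet> x + b) * (c' * cos (t' \<bullet> x + b'))" by (simp add: field_simps)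
  qed
  finally show ?case .
next
  case (add f g)
  then show ?case by (simp add: distrib_left trig_sum.add)
qed

lemma trig_sum_mult: "trig_sum f \<Longrightarrow> trig_sum g \<Longrightarrow> trig_sum (\<lambda>x. f x * g x)"
proof (induction rule: trig_sum.induct)
  case (cos c t b)
  then show ?case by (rule trig_sum_cos_mult)
next
  case (add f1 f2)
  then show ?case by (simp add: distrib_right trig_sum.add)
qed

lemma trig_sum_const: "trig_sum (\<lambda>_. c)"
  using trig_sum.cos[of c 0 0] by simp

lemma trig_sum_sum: "finite I \<Longrightarrow> (\<And>i. i \<in> I \<Longrightarrow> trig_sum (f i)) \<Longrightarrow> trig_sum (\<lambda>x. \<Sum>i\<in>I. f i x)"
  by (induction rule: finite_induct) (auto intro: trig_sum_const trig_sum.add)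

lemma trig_sum_sin: "trig_sum (\<lambda>x. c * sin (x $ i / L))"
proof -
  have "trig_sum (\<lambda>x. c * cos (axis i (1 / L) \<bullet> x + (- (pi / 2))))" by (rule trig_sum.cos)
  moreover have "cos (axis i (1 / L) \<bullet> x + (- (pi / 2))) = sin (x $ i / L)" for x
    using minus_sin_cos_eq[of "x $ i / L - pi"] cos_sin_eq
    by (simp add: inner_axis' cos_diff flip: diff_conv_add_uminus)
  ultimately show ?thesis by simp
qed

lemma real_polynomial_sin_trig_sum:
  fixes p :: "real^'n \<Rightarrow> real"
  shows "real_polynomial_function p \<Longrightarrow> trig_sum (\<lambda>x. p (\<chi> i. sin (x $ i / L)))"
proof (induction rule: real_polynomial_function.induct)
  case (linear f)
  interpret bounded_linear f by fact
  have "f (\<chi> i. sin (x $ i / L)) = (\<Sum>i\<in>UNIV. f (axis i 1) * sin (x $ i / L))" for x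
  proof -
    have "(\<chi> i. sin (x $ i / L)) = (\<Sum>i\<in>UNIV. sin (x $ i / L) *\<^sub>R axis i 1)"
      using basis_expansion[of "\<chi> i. sin (x $ i / L)"] by (simp add: scalar_mult_eq_scaleR)
    then show ?thesis by (simp add: sum scaleR mult.commute)
  qed
  then show ?case by (simp add: trig_sum_sum trig_sum_sin)
qed (simp_all add: trig_sum_const trig_sum.add trig_sum_mult)

lemma trig_sum_integral_tendsto:
  fixes \<mu> :: "(real^'n) measure"
  assumes \<mu>s: "\<And>n. prob_space (\<mu>s n)" "\<And>n. sets (\<mu>s n) = sets borel"
    and \<mu>: "prob_space \<mu>" "sets \<mu> = sets borel"
    and char: "\<And>t. (\<lambda>n. vec_char (\<mu>s n) t) \<longlonglongrightarrow> vec_char \<mu> t"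
    and f: "trig_sum f"
  shows "(\<lambda>n. \<integral>x. f x \<partial>\<mu>s n) \<longlonglongrightarrow> (\<integral>x. f x \<partial>\<mu>) \<and> (\<forall>n. integrable (\<mu>s n) f) \<and> integrable \<mu> f"
  using f
proof (induction rule: trig_sum.induct)
  case (cos c t b)
  have *: "integrable N (\<lambda>x. c * cos (t \<bullet> x + b)) \<and> (\<integral>x. c * cos (t \<bullet> x + b) \<partial>N) = c * Re (iexp b * vec_char N t)"
    if N: "prob_space N" "sets N = sets borel" for N :: "(real^'n) measure"
  proof -
    interpret prob_space N by fact
    have m: "(\<lambda>x. t \<bullet> x) \<in> borel_measurable N" using N(2) by (simp cong: measurable_cong_sets)
    have i: "integrable N (\<lambda>x. iexp (t \<bullet> x))"
      by (rule integrable_const_bound[of _ 1]) (use m in auto)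
    have i': "integrable N (\<lambda>x. c * cos (t \<bullet> x + b))"
      by (rule integrable_const_bound[of _ "\<bar>c\<bar>"]) (use m in \<open>auto simp: abs_mult mult_left_le\<close>)
    have "cos (t \<bullet> x + b) = Re (iexp b * iexp (t \<bullet> x))" for x
      by (simp add: exp_add[symmetric] Re_exp add.commute)
    then have "(\<integral>x. c * cos (t \<bullet> x + b) \<partial>N) = c * (\<integral>x. Re (iexp b * iexp (t \<bullet> x)) \<partial>N)" by (simp only: integral_mult_right_zero)
    also have "(\<integral>x. Re (iexp b * iexp (t \<bullet> x)) \<partial>N) = Re (\<integral>x. iexp b * iexp (t \<bullet> x) \<partial>N)"
      using i by (intro integral_Re integrable_mult_right)
    also have "(\<integral>x. iexp b * iexp (t \<bullet> x) \<partial>N) = iexp b * vec_char N t" unfolding vec_char_def by (rule integral_mult_right_zero)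
    finally show ?thesis using i' by simp
  qed
  have "(\<lambda>n. c * Re (iexp b * vec_char (\<mu>s n) t)) \<longlonglongrightarrow> c * Re (iexp b * vec_char \<mu> t)"
    by (intro tendsto_intros char)
  then have "(\<lambda>n. \<integral>x. c * cos (t \<bullet> x + b) \<partial>\<mu>s n) \<longlonglongrightarrow> (\<integral>x. c * cos (t \<bullet> x + b) \<partial>\<mu>)"
    unfolding *[OF \<mu>s, THEN conjunct2] *[OF \<mu>, THEN conjunct2] .
  then show ?case using *[OF \<mu>] *[OF \<mu>s] by blast
next
  case (add f g)
  then show ?case by (auto intro!: tendsto_add)
qed

text \<open>A continuous substitute for the indicator of the complement of a cube. As a sum of
  functions of single coordinates it reduces tightness to one-dimensional marginals.\<close>

definition cutoff :: "real \<Rightarrow> real^'n \<Rightarrow> real" where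
  "cutoff R x = (\<Sum>i\<in>UNIV. min 1 (max 0 (\<bar>x $ i\<bar> - R)))"

lemma cutoff_nonneg: "0 \<le> cutoff R x"
  unfolding cutoff_def by (intro sum_nonneg) auto

lemma cutoff_le: "cutoff R (x::real^'n) \<le> CARD('n)"
proof -
  have "cutoff R x \<le> (\<Sum>i\<in>(UNIV::'n set). 1)" unfolding cutoff_def by (intro sum_mono) auto
  then show ?thesis by simp
qed

lemma cutoff_ge_1: "\<bar>x $ i\<bar> > R + 1 \<Longrightarrow> 1 \<le> cutoff R x"
proof -
  assume "\<bar>x $ i\<bar> > R + 1"
  then have "1 = min 1 (max 0 (\<bar>x $ i\<bar> - R))" by auto
  also have "\<dots> \<le> cutoff R x" unfolding cutoff_def by (rule member_le_sum) auto
  finally show ?thesis .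
qed

lemma cutoff_measurable: "sets N = sets borel \<Longrightarrow> cutoff R \<in> borel_measurable N"
proof -
  assume N: "sets N = sets borel"
  have "cutoff R \<in> borel_measurable borel"
    unfolding cutoff_def by (intro borel_measurable_continuous_onI continuous_intros)
  then show ?thesis using N by (simp cong: measurable_cong_sets)
qed

lemma cutoff_integrable:
  "prob_space N \<Longrightarrow> sets N = sets borel \<Longrightarrow> integrable N (cutoff R :: real^'n \<Rightarrow> real)"
  by (rule finite_measure.integrable_const_bound[of _ _ "CARD('n)"])
     (auto simp: prob_space.finite_measure cutoff_nonneg cutoff_le cutoff_measurable)

lemma cutoff_tendsto_0:
  assumes "prob_space N" "sets N = sets borel"
  shows "(\<lambda>R. \<integral>x. cutoff (real R) (x::real^'n) \<partial>N) \<longlonglongrightarrow> 0"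
proof -
  interpret prob_space N by fact
  have "(\<lambda>R. \<integral>x. cutoff (real R) x \<partial>N) \<longlonglongrightarrow> (\<integral>x. 0 \<partial>N)"
  proof (rule integral_dominated_convergence[where w = "\<lambda>_. real CARD('n)"])
    show "AE x in N. (\<lambda>R. cutoff (real R) x) \<longlonglongrightarrow> 0"
    proof (rule AE_I2)
      fix x :: "real^'n"
      have "eventually (\<lambda>R. \<bar>x $ i\<bar> \<le> real R) sequentially" for i
        using filterlim_real_sequentially by (simp add: filterlim_at_top)
      then have "eventually (\<lambda>R. \<forall>i. \<bar>x $ i\<bar> \<le> real R) sequentially" by (simp add: eventually_all_finite)
      then have "eventually (\<lambda>R. cutoff (real R) x = 0) sequentially"
        by eventually_elim (auto simp: cutoff_def intro!: sum.neutral)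
      then show "(\<lambda>R. cutoff (real R) x) \<longlonglongrightarrow> 0" by (rule tendsto_eventually)
    qed
  qed (auto simp: cutoff_measurable assms cutoff_nonneg cutoff_le)
  then show ?thesis by simp
qed

text \<open>The tightness part of the continuity theorem: the marginals converge weakly by the
  one-dimensional theorem of Levy, and each summand of \<open>cutoff\<close> is a bounded continuous
  function of one coordinate.\<close>

lemma cutoff_integral_tendsto:
  fixes \<mu> :: "(real^'n) measure"
  assumes \<mu>s: "\<And>n. prob_space (\<mu>s n)" "\<And>n. sets (\<mu>s n) = sets borel"
    and \<mu>: "prob_space \<mu>" "sets \<mu> = sets borel"
    and char: "\<And>t. (\<lambda>n. vec_char (\<mu>s n) t) \<longlonglongrightarrow> vec_char \<mu> t"
  shows "(\<lambda>n. \<integral>x. cutoff R x \<partial>\<mu>s n) \<longlonglongrightarrow> (\<integral>x. cutoff R x \<partial>\<mu>)"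
proof -
  let ?p = "\<lambda>y. min 1 (max 0 (\<bar>y\<bar> - R))"
  have coord: "(\<lambda>n. \<integral>x. ?p (x $ i) \<partial>\<mu>s n) \<longlonglongrightarrow> (\<integral>x. ?p (x $ i) \<partial>\<mu>)" for i
  proof -
    have m: "(\<lambda>x. x $ i) \<in> borel_measurable N" if "sets N = sets borel" for N :: "(real^'n) measure"
    proof -
      have "(\<lambda>x::real^'n. x $ i) \<in> borel_measurable borel" by (intro borel_measurable_continuous_onI continuous_intros)
      then show ?thesis using that by (simp cong: measurable_cong_sets)
    qed
    have rd: "real_distribution (distr N borel (\<lambda>x. x $ i))" if "prob_space N" "sets N = sets borel" for N :: "(real^'n) measure"
      using prob_space.prob_space_distr[OF that(1) m[OF that(2)]]
      by (simp add: real_distribution_def real_distribution_axioms_def)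
    have ch: "char (distr N borel (\<lambda>x. x $ i)) \<theta> = vec_char N (\<theta> *\<^sub>R axis i 1)" if "sets N = sets borel" for \<theta> and N :: "(real^'n) measure"
      unfolding char_def vec_char_def using m[OF that] by (subst integral_distr) (auto simp: inner_axis')
    have "weak_conv_m (\<lambda>n. distr (\<mu>s n) borel (\<lambda>x. x $ i)) (distr \<mu> borel (\<lambda>x. x $ i))"
      by (intro levy_continuity rd \<mu>s \<mu>) (simp add: ch \<mu>s \<mu> char)
    then have "(\<lambda>n. \<integral>y. ?p y \<partial>distr (\<mu>s n) borel (\<lambda>x. x $ i)) \<longlonglongrightarrow> (\<integral>y. ?p y \<partial>distr \<mu> borel (\<lambda>x. x $ i))"
      by (intro weak_conv_imp_integral_bdd_continuous_conv[where B = 1] rd \<mu>s \<mu>) (auto intro!: continuous_intros)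
    moreover have "(\<integral>y. ?p y \<partial>distr N borel (\<lambda>x. x $ i)) = (\<integral>x. ?p (x $ i) \<partial>N)" if "sets N = sets borel" for N :: "(real^'n) measure"
      using m[OF that] by (subst integral_distr) auto
    ultimately show ?thesis by (simp add: \<mu>s \<mu>)
  qed
  have sum: "(\<integral>x. cutoff R x \<partial>N) = (\<Sum>i\<in>UNIV. \<integral>x. ?p (x $ i) \<partial>N)"
    if N: "prob_space N" "sets N = sets borel" for N :: "(real^'n) measure"
    unfolding cutoff_def
  proof (rule Bochner_Integration.integral_sum)
    fix i
    have "(\<lambda>x::real^'n. ?p (x $ i)) \<in> borel_measurable borel" by (intro borel_measurable_continuous_onI continuous_intros)
    then show "integrable N (\<lambda>x. ?p (x $ i))"
      using N by (intro finite_measure.integrable_const_bound[of _ _ 1])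
        (auto simp: prob_space.finite_measure cong: measurable_cong_sets)
  qed
  show ?thesis using \<mu>s \<mu> by (simp add: sum) (intro tendsto_sum coord)
qed

text \<open>On the cube \<open>\<bar>x\<^sub>i\<bar> \<le> R + 1\<close> the values \<open>sin (x\<^sub>i / (R + 1))\<close> determine \<open>x\<close>, so \<open>h\<close> is
  approximated there by a polynomial in these sines, which is bounded everywhere.\<close>

lemma trig_sum_approx:
  fixes h :: "real^'n \<Rightarrow> real"
  assumes h: "continuous_on UNIV h" "\<And>x. \<bar>h x\<bar> \<le> B" and R: "0 \<le> R" and e: "0 < e"
  obtains f where "trig_sum f" "\<And>x. \<bar>h x - f x\<bar> \<le> e + (2 * B + e) * cutoff R x"
proof -
  have B: "0 \<le> B" using order_trans[OF abs_ge_zero h(2)] .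
  define L where "L = R + 1"
  have L: "0 < L" using R by (simp add: L_def)
  define S where "S = cbox (\<chi> i. - 1) (\<chi> i. 1) \<inter> (UNIV :: (real^'n) set)"
  have S_iff: "y \<in> S \<longleftrightarrow> (\<forall>i. - 1 \<le> y $ i \<and> y $ i \<le> 1)" for y by (simp add: S_def mem_box_cart)
  have cS: "compact S" by (simp add: S_def)
  define F where "F y = h (\<chi> i. L * arcsin (y $ i))" for y
  have "continuous_on S (\<lambda>y. \<chi> i. L * arcsin (y $ i))"
    by (intro continuous_on_vec_lambda continuous_intros continuous_on_arcsin) (auto simp: S_iff)
  then have cF: "continuous_on S F" unfolding F_def by (rule continuous_on_compose2[OF h(1)]) auto
  \<comment> \<open>Since \<open>F\<close> is bounded by \<open>B\<close>, the polynomial is bounded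
    by \<open>B + e\<close> on all of \<open>S\<close>, where the sines always lie; hence the
    constant \<open>2 * B + e\<close> outside the large cube.\<close>
  obtain p where p: "real_polynomial_function p" "\<And>y. y \<in> S \<Longrightarrow> \<bar>F y - p y\<bar> < e"
    using Stone_Weierstrass_real_polynomial_function[OF cS cF e] by blast
  define f where "f x = p (\<chi> i. sin (x $ i / L))" for x
  have inS: "(\<chi> i. sin (x $ i / L)) \<in> S" for x by (simp add: S_iff)
  show ?thesis
  proof (rule that[of f])
    show "trig_sum f" unfolding f_def by (rule real_polynomial_sin_trig_sum[OF p(1)])
    fix x :: "real^'n"
    let ?y = "\<chi> i. sin (x $ i / L)"
    show "\<bar>h x - f x\<bar> \<le> e + (2 * B + e) * cutoff R x"
    proof (cases "\<forall>i. \<bar>x $ i\<bar> \<le> R + 1")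
      case True
      have "arcsin (sin (x $ i / L)) = x $ i / L" for i
      proof (rule arcsin_sin)
        have "\<bar>x $ i / L\<bar> \<le> 1" using True L by (simp add: L_def)
        then show "- (pi / 2) \<le> x $ i / L" "x $ i / L \<le> pi / 2" using pi_ge_two by linarith+
      qed
      then have "F ?y = h x" unfolding F_def using L by (simp add: vec_lambda_eta)
      then have "\<bar>h x - f x\<bar> \<le> e" using p(2)[OF inS[of x]] by (simp add: f_def)
      then show ?thesis using B e cutoff_nonneg[of R x] mult_nonneg_nonneg[of "2 * B + e" "cutoff R x"] by linarith
    next
      case False
      then have "1 \<le> cutoff R x" using cutoff_ge_1[of R x] by (auto simp: not_le)
      then have "2 * B + e \<le> (2 * B + e) * cutoff R x" using B e mult_left_mono[of 1 "cutoff R x" "2 * B + e"] by simp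
      moreover have "\<bar>F ?y\<bar> \<le> B" unfolding F_def by (rule h(2))
      ultimately show ?thesis using p(2)[OF inS[of x]] h(2)[of x] e unfolding f_def by linarith
    qed
  qed
qed

text \<open>A test function is within \<open>e\<close> of a trigonometric sum on a large cube and
  within a constant of it elsewhere. The mass elsewhere is controlled by \<open>cutoff\<close>,
  whose integrals under \<open>\<mu>s n\<close> are eventually as small as under
  \<open>\<mu>\<close>.\<close>

theorem vec_levy_continuity:
  fixes \<mu> :: "(real^'n) measure"
  assumes \<mu>s: "\<And>n. prob_space (\<mu>s n)" "\<And>n. sets (\<mu>s n) = sets borel"
    and \<mu>: "prob_space \<mu>" "sets \<mu> = sets borel"
    and char: "\<And>t. (\<lambda>n. vec_char (\<mu>s n) t) \<longlonglongrightarrow> vec_char \<mu> t"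
  shows "weakly_converges \<mu>s \<mu>"
  unfolding weakly_converges_def
proof (intro allI impI)
  fix h :: "real^'n \<Rightarrow> real"
  assume "continuous_on UNIV h \<and> bounded (range h)"
  then obtain B where h: "continuous_on UNIV h" and B: "\<And>x. \<bar>h x\<bar> \<le> B"
    by (auto simp: bounded_iff)
  have B0: "0 \<le> B" using order_trans[OF abs_ge_zero B] .
  have hi: "integrable N h" if "prob_space N" "sets N = sets borel" for N
    using that borel_measurable_continuous_onI[OF h] B
    by (intro finite_measure.integrable_const_bound[of _ _ B]) (auto simp: prob_space.finite_measure cong: measurable_cong_sets)
  show "(\<lambda>n. \<integral>x. h x \<partial>\<mu>s n) \<longlonglongrightarrow> (\<integral>x. h x \<partial>\<mu>)"
  proof (rule LIMSEQ_I)
    fix r :: real assume r: "0 < r"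
    define e where "e = r / 8"
    have e: "0 < e" using r by (simp add: e_def)
    have "(\<lambda>R. (2 * B + e) * (\<integral>x. cutoff (real R) x \<partial>\<mu>)) \<longlonglongrightarrow> (2 * B + e) * 0"
      by (intro tendsto_intros cutoff_tendsto_0 \<mu>)
    then have "eventually (\<lambda>R. (2 * B + e) * (\<integral>x. cutoff (real R) x \<partial>\<mu>) < e) sequentially"
      using e by (intro order_tendstoD) auto
    then obtain R where R: "(2 * B + e) * (\<integral>x. cutoff (real R) x \<partial>\<mu>) < e" by (auto simp: eventually_sequentially)
    obtain f where f: "trig_sum f" "\<And>x. \<bar>h x - f x\<bar> \<le> e + (2 * B + e) * cutoff (real R) x"
      using trig_sum_approx[OF h B _ e, of "real R"] by auto
    note ft = trig_sum_integral_tendsto[OF \<mu>s \<mu> char f(1)]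
    have near: "\<bar>(\<integral>x. h x \<partial>N) - (\<integral>x. f x \<partial>N)\<bar> \<le> e + (2 * B + e) * (\<integral>x. cutoff (real R) x \<partial>N)"
      if N: "prob_space N" "sets N = sets borel" and fi: "integrable N f" for N
    proof -
      interpret prob_space N by fact
      have "\<bar>(\<integral>x. h x \<partial>N) - (\<integral>x. f x \<partial>N)\<bar> = \<bar>\<integral>x. h x - f x \<partial>N\<bar>" using hi[OF N] fi by simp
      also have "\<dots> \<le> (\<integral>x. \<bar>h x - f x\<bar> \<partial>N)" by (rule integral_abs_bound)
      also have "\<dots> \<le> (\<integral>x. e + (2 * B + e) * cutoff (real R) x \<partial>N)"
        using hi[OF N] fi f(2) cutoff_integrable[OF N] by (intro integral_mono) auto
      also have "\<dots> = e + (2 * B + e) * (\<integral>x. cutoff (real R) x \<partial>N)"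
        using cutoff_integrable[OF N, of "real R"] prob_space by simp
      finally show ?thesis .
    qed
    have "(\<lambda>n. (2 * B + e) * (\<integral>x. cutoff (real R) x \<partial>\<mu>s n)) \<longlonglongrightarrow> (2 * B + e) * (\<integral>x. cutoff (real R) x \<partial>\<mu>)"
      by (intro tendsto_intros cutoff_integral_tendsto \<mu>s \<mu> char)
    then have ev1: "eventually (\<lambda>n. (2 * B + e) * (\<integral>x. cutoff (real R) x \<partial>\<mu>s n) < e) sequentially"
      using R by (rule order_tendstoD)
    have "eventually (\<lambda>n. dist (\<integral>x. f x \<partial>\<mu>s n) (\<integral>x. f x \<partial>\<mu>) < e) sequentially"
      using ft e by (intro tendstoD) auto
    with ev1 have "eventually (\<lambda>n. norm ((\<integral>x. h x \<partial>\<mu>s n) - (\<integral>x. h x \<partial>\<mu>)) < r) sequentially"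
    proof eventually_elim
      case (elim n)
      have "\<bar>(\<integral>x. h x \<partial>\<mu>s n) - (\<integral>x. f x \<partial>\<mu>s n)\<bar> \<le> e + (2 * B + e) * (\<integral>x. cutoff (real R) x \<partial>\<mu>s n)"
        using ft by (intro near \<mu>s) auto
      moreover have "\<bar>(\<integral>x. h x \<partial>\<mu>) - (\<integral>x. f x \<partial>\<mu>)\<bar> \<le> e + (2 * B + e) * (\<integral>x. cutoff (real R) x \<partial>\<mu>)"
        using ft by (intro near \<mu>) auto
      moreover have "r = 8 * e" by (simp add: e_def)
      ultimately show ?case using elim R e unfolding dist_real_def real_norm_def by linarith
    qed
    then show "\<exists>no. \<forall>n\<ge>no. norm ((\<integral>x. h x \<partial>\<mu>s n) - (\<integral>x. h x \<partial>\<mu>)) < r" unfolding eventually_sequentially .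
  qed
qed

section \<open>Gaussian measures and pseudoinverses\<close>

lemma inner_matrix_vector:
  fixes A :: "real^'n^'m"
  shows "x \<bullet> (A *v y) = (transpose A *v x) \<bullet> y"
  by (metis dot_lmul_matrix transpose_matrix_vector)

lemma outer_vector_mult: "outer u v *v y = (v \<bullet> y) *\<^sub>R u"
  by (simp add: outer_def vec_eq_iff matrix_vector_mult_def inner_vec_def sum_distrib_left sum_distrib_right mult_ac)

lemma transpose_outer: "transpose (outer u v) = outer v u"
  by (simp add: outer_def transpose_def vec_eq_iff mult.commute)

text \<open>Completing the square: with \<open>x0\<close> a direction of positive form, subtracting
  the rank one matrix \<open>outer a a\<close> keeps the form nonnegative and adds \<open>x0\<close>
  to the null space, so the induction runs on its codimension.\<close>

lemma pos_semidef_form_decomposition: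
  fixes A :: "real^'n^'n"
  assumes "pos_semidef A"
  shows "\<exists>as. \<forall>x. x \<bullet> (A *v x) = (\<Sum>a\<leftarrow>as. (a \<bullet> x)\<^sup>2)"
  using assms
proof (induction "CARD('n) - dim {x. A *v x = 0}" arbitrary: A rule: less_induct)
  case less
  have sym: "transpose A = A" and nn: "\<And>x. 0 \<le> x \<bullet> (A *v x)" using less.prems by (auto simp: pos_semidef_def)
  have comm: "x \<bullet> (A *v y) = y \<bullet> (A *v x)" for x y
    using inner_matrix_vector[of x A y] by (simp add: sym inner_commute)
  show ?case
  proof (cases "\<forall>x. x \<bullet> (A *v x) = 0")
    case True
    then show ?thesis by (intro exI[of _ "[]"]) simp
  next
    case False
    then obtain x0 where x0: "0 < x0 \<bullet> (A *v x0)" using nn by (metis less_le)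
    define q where "q = x0 \<bullet> (A *v x0)"
    define a where "a = (1 / sqrt q) *\<^sub>R (A *v x0)"
    have q: "0 < q" using x0 by (simp add: q_def)
    have ax: "(a \<bullet> x)\<^sup>2 = (x \<bullet> (A *v x0))\<^sup>2 / q" for x
      using q by (simp add: a_def power_divide inner_commute)
    define A' where "A' = A - outer a a"
    have A'x: "A' *v x = A *v x - (a \<bullet> x) *\<^sub>R a" for x
      by (simp add: A'_def matrix_vector_mult_diff_rdistrib outer_vector_mult)
    have form: "x \<bullet> (A' *v x) = x \<bullet> (A *v x) - (a \<bullet> x)\<^sup>2" for x
      by (simp add: A'x inner_diff_right inner_commute power2_eq_square)
    have psd: "pos_semidef A'"
      unfolding pos_semidef_def
    proof (intro conjI allI)
      show "transpose A' = A'" using sym transpose_outer[of a a] by (simp add: A'_def transpose_def vec_eq_iff)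
      fix x
      \<comment> \<open>The minimizer in \<open>t\<close> of the form of \<open>A\<close> at
        \<open>x - t *\<^sub>R x0\<close>; the minimum is the form of \<open>A'\<close> at
        \<open>x\<close>.\<close>
      let ?t = "(x \<bullet> (A *v x0)) / q"
      have "0 \<le> (x - ?t *\<^sub>R x0) \<bullet> (A *v (x - ?t *\<^sub>R x0))" by (rule nn)
      also have "\<dots> = x \<bullet> (A *v x) - 2 * ?t * (x \<bullet> (A *v x0)) + ?t\<^sup>2 * q"
        by (simp add: matrix_vector_mult_diff_distrib matrix_vector_mult_scaleR inner_diff_left inner_diff_right
          comm[of x0 x] q_def power2_eq_square algebra_simps)
      also have "\<dots> = x \<bullet> (A' *v x)" unfolding form ax using q by (simp add: field_simps power2_eq_square)
      finally show "0 \<le> x \<bullet> (A' *v x)" .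
    qed
    have sub: "subspace {x. A *v x = 0}" "subspace {x. A' *v x = 0}"
      by (auto simp: subspace_def matrix_vector_right_distrib matrix_vector_mult_scaleR)
    have "x0 \<in> {x. A' *v x = 0}"
    proof -
      have "a \<bullet> x0 = q / sqrt q" by (simp add: a_def q_def inner_commute)
      then have "(a \<bullet> x0) *\<^sub>R a = A *v x0" using q by (simp add: a_def)
      then show ?thesis by (simp add: A'x)
    qed
    moreover have "x0 \<notin> {x. A *v x = 0}" using x0 by auto
    moreover have "{x. A *v x = 0} \<subseteq> {x. A' *v x = 0}"
    proof
      fix x assume x: "x \<in> {x. A *v x = 0}"
      then have "a \<bullet> x = 0" using comm[of x x0] by (simp add: a_def inner_commute)
      then show "x \<in> {x. A' *v x = 0}" using x by (simp add: A'x)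
    qed
    ultimately have "{x. A *v x = 0} \<subset> {x. A' *v x = 0}" by blast
    then have "dim {x. A *v x = 0} < dim {x. A' *v x = 0}"
      by (intro dim_psubset) (simp add: sub span_eq_iff[THEN iffD2])
    moreover have "dim {x. A' *v x = 0} \<le> CARD('n)" using dim_subset_UNIV[of "{x. A' *v x = 0}"] by simp
    ultimately have "CARD('n) - dim {x. A' *v x = 0} < CARD('n) - dim {x. A *v x = 0}" by linarith
    from less.hyps[OF this psd] obtain as where "\<And>x. x \<bullet> (A' *v x) = (\<Sum>a\<leftarrow>as. (a \<bullet> x)\<^sup>2)" by blast
    then have "\<forall>x. x \<bullet> (A *v x) = (\<Sum>a\<leftarrow>a # as. (a \<bullet> x)\<^sup>2)" using form by (simp add: algebra_simps)
    then show ?thesis by blast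
  qed
qed

text \<open>The law of a sum of the vectors in \<open>as\<close> with independent standard normal
  coefficients, built one vector at a time. This covers degenerate covariances, where no density
  exists.\<close>

lemma gaussian_measure_ex:
  fixes as :: "(real^'n) list"
  shows "\<exists>\<mu>. prob_space \<mu> \<and> sets \<mu> = sets borel \<and> (\<forall>t. vec_char \<mu> t = of_real (exp (- (\<Sum>a\<leftarrow>as. (a \<bullet> t)\<^sup>2) / 2)))"
proof (induction as)
  case Nil
  have "vec_char (return borel 0) t = 1" for t :: "real^'n"
    unfolding vec_char_def by (subst integral_return) auto
  then show ?case by (intro exI[of _ "return borel 0"]) (auto intro: prob_space_return)
next
  case (Cons a as)
  then obtain \<mu> where \<mu>: "prob_space \<mu>" "sets \<mu> = sets borel"
    "\<And>t. vec_char \<mu> t = of_real (exp (- (\<Sum>a\<leftarrow>as. (a \<bullet> t)\<^sup>2) / 2))" by blast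
  interpret m: prob_space \<mu> by fact
  interpret N: prob_space std_normal_distribution by (simp add: prob_space_normal_density)
  interpret P: pair_prob_space \<mu> std_normal_distribution ..
  let ?T = "\<lambda>z. fst z + snd z *\<^sub>R a"
  have "?T \<in> borel_measurable (borel \<Otimes>\<^sub>M borel)" by measurable
  then have T: "?T \<in> borel_measurable (\<mu> \<Otimes>\<^sub>M std_normal_distribution)"
    using \<mu>(2) sets_pair_measure_cong[of \<mu> borel std_normal_distribution borel]
    by (simp cong: measurable_cong_sets)
  let ?\<mu> = "distr (\<mu> \<Otimes>\<^sub>M std_normal_distribution) borel ?T"
  have "vec_char ?\<mu> t = of_real (exp (- (\<Sum>a\<leftarrow>a # as. (a \<bullet> t)\<^sup>2) / 2))" for t
  proof -
    have m: "(\<lambda>z. t \<bullet> ?T z) \<in> borel_measurable (\<mu> \<Otimes>\<^sub>M std_normal_distribution)"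
      by (rule measurable_compose[OF T]) (intro borel_measurable_continuous_onI continuous_intros)
    have i: "integrable (\<mu> \<Otimes>\<^sub>M std_normal_distribution) (\<lambda>z. iexp (t \<bullet> ?T z))"
      by (rule P.P.integrable_const_bound[of _ 1]) (use m in auto)
    have "vec_char ?\<mu> t = (CLINT z|\<mu> \<Otimes>\<^sub>M std_normal_distribution. iexp (t \<bullet> ?T z))"
      unfolding vec_char_def using T by (subst integral_distr) auto
    also have "\<dots> = (CLINT x|\<mu>. CLINT y|std_normal_distribution. iexp (t \<bullet> ?T (x, y)))"
      by (rule P.integral_fst'[OF i, symmetric])
    also have "\<dots> = (CLINT x|\<mu>. iexp (t \<bullet> x) * char std_normal_distribution (a \<bullet> t))"
    proof (rule Bochner_Integration.integral_cong[OF refl])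
      fix x
      have "iexp (t \<bullet> ?T (x, y)) = iexp (t \<bullet> x) * iexp ((a \<bullet> t) * y)" for y
        by (simp add: exp_add[symmetric] inner_add_right inner_commute algebra_simps)
      then show "(CLINT y|std_normal_distribution. iexp (t \<bullet> ?T (x, y))) = iexp (t \<bullet> x) * char std_normal_distribution (a \<bullet> t)"
        unfolding char_def by (simp only: integral_mult_right_zero)
    qed
    also have "\<dots> = vec_char \<mu> t * char std_normal_distribution (a \<bullet> t)"
      unfolding vec_char_def by (rule integral_mult_left_zero)
    also have "char std_normal_distribution (a \<bullet> t) = of_real (exp (- ((a \<bullet> t)\<^sup>2) / 2))"
      by (simp add: char_std_normal_distribution)
    also have "vec_char \<mu> t * of_real (exp (- ((a \<bullet> t)\<^sup>2) / 2)) = of_real (exp (- (\<Sum>a\<leftarrow>as. (a \<bullet> t)\<^sup>2) / 2) * exp (- ((a \<bullet> t)\<^sup>2) / 2))"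
      by (simp only: \<mu>(3) of_real_mult)
    also have "exp (- (\<Sum>a\<leftarrow>as. (a \<bullet> t)\<^sup>2) / 2) * exp (- ((a \<bullet> t)\<^sup>2) / 2) = exp (- (\<Sum>a\<leftarrow>a # as. (a \<bullet> t)\<^sup>2) / 2)"
      unfolding exp_add[symmetric] by (simp add: field_simps)
    finally show ?thesis .
  qed
  then show ?case using P.P.prob_space_distr[OF T] by (intro exI[of _ ?\<mu>]) auto
qed

lemma gaussian_ex:
  fixes A :: "real^'n^'n"
  assumes "pos_semidef A"
  shows "\<exists>\<mu>. prob_space \<mu> \<and> sets \<mu> = sets borel \<and> (\<forall>t. vec_char \<mu> t = of_real (exp (- (t \<bullet> (A *v t)) / 2)))"
  using pos_semidef_form_decomposition[OF assms] gaussian_measure_ex by metis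

text \<open>\<open>A ** B\<close> and \<open>A ** C\<close> are symmetric and each absorbs the
  other, so they agree; likewise \<open>B ** A\<close> and \<open>C ** A\<close>. Hence
  \<open>B = B ** A ** B = C ** A ** C = C\<close>.\<close>

lemma is_pseudoinverse_unique:
  assumes B: "is_pseudoinverse A B" and C: "is_pseudoinverse A C"
  shows "B = C"
proof -
  have 1: "A ** B = A ** C"
  proof -
    have "A ** B = transpose (A ** B)" using B by (simp add: is_pseudoinverse_def)
    also have "\<dots> = transpose ((A ** C) ** (A ** B))" using C by (simp add: is_pseudoinverse_def matrix_mul_assoc)
    also have "\<dots> = (A ** B) ** (A ** C)"
      using B C unfolding is_pseudoinverse_def by (simp add: matrix_transpose_mul)
    also have "\<dots> = A ** C" using B by (simp add: is_pseudoinverse_def matrix_mul_assoc)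
    finally show ?thesis .
  qed
  have 2: "B ** A = C ** A"
  proof -
    have "B ** A = transpose (B ** A)" using B by (simp add: is_pseudoinverse_def)
    also have "\<dots> = transpose ((B ** A) ** (C ** A))" using C by (simp add: is_pseudoinverse_def flip: matrix_mul_assoc)
    also have "\<dots> = (C ** A) ** (B ** A)"
      using B C unfolding is_pseudoinverse_def by (simp add: matrix_transpose_mul)
    also have "\<dots> = C ** A" using B by (simp add: is_pseudoinverse_def flip: matrix_mul_assoc)
    finally show ?thesis .
  qed
  have "B = B ** A ** B" using B by (simp add: is_pseudoinverse_def)
  also have "\<dots> = C ** (A ** B)" using 2 by (simp add: matrix_mul_assoc)
  also have "\<dots> = C ** A ** C" using 1 by (simp add: matrix_mul_assoc)
  also have "\<dots> = C" using C by (simp add: is_pseudoinverse_def)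
  finally show ?thesis .
qed

text \<open>For symmetric \<open>U\<close> with orthogonal projection \<open>N\<close> onto its kernel, \<open>(U + N)\<inverse> - N\<close> is the pseudoinverse.\<close>

lemma symmetric_pseudoinverse_ex:
  fixes U :: "real^'n^'n"
  assumes sym: "transpose U = U"
  shows "\<exists>B. is_pseudoinverse U B"
proof -
  let ?Z = "{x. U *v x = 0}"
  have sub: "subspace ?Z" by (auto simp: subspace_def matrix_vector_right_distrib matrix_vector_mult_scaleR)
  obtain E where E: "E \<subseteq> ?Z" "pairwise orthogonal E" "\<And>x. x \<in> E \<Longrightarrow> norm x = 1" "independent E" "span E = ?Z"
    using orthonormal_basis_subspace[OF sub] by metis
  have finE: "finite E" using E(4) by (rule independent_imp_finite)
  define N where "N = (\<Sum>e\<in>E. outer e e)"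
  have Nx: "N *v x = (\<Sum>e\<in>E. (x \<bullet> e) *\<^sub>R e)" for x
    unfolding N_def using finE
  proof (induction rule: finite_induct)
    case (insert e F)
    then show ?case by (simp add: matrix_vector_mult_add_rdistrib outer_vector_mult inner_commute)
  qed simp
  have Nsym: "transpose N = N"
    unfolding N_def by (simp add: transpose_def vec_eq_iff outer_def mult.commute)
  have NZ: "N *v x = x" if "U *v x = 0" for x
    unfolding Nx using orthonormal_basis_expand[OF E(2,3) _ finE] E(5) that by auto
  have UN0: "U *v (N *v x) = 0" for x
  proof -
    have "N *v x \<in> span E" unfolding Nx by (intro span_sum span_scale span_base)
    then show ?thesis using E(5) by auto
  qed
  have UN: "U ** N = 0" using UN0 by (simp add: matrix_eq matrix_vector_mul_assoc[symmetric])
  have NU: "N ** U = 0"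
  proof -
    have "transpose (U ** N) = N ** U" by (simp add: matrix_transpose_mul sym Nsym)
    then show ?thesis using UN by (simp add: transpose_def vec_eq_iff)
  qed
  have NN: "N ** N = N" using NZ[OF UN0] by (simp add: matrix_eq matrix_vector_mul_assoc[symmetric])
  have "inj ((*v) (U + N))"
  proof (rule linear_injective_0[THEN iffD2, rule_format])
    show "linear ((*v) (U + N))" by simp
    fix x assume "(U + N) *v x = 0"
    then have s: "U *v x + N *v x = 0" by (simp add: matrix_vector_mult_add_rdistrib)
    have "N *v (U *v x + N *v x) = N *v x"
      using NU NN by (simp add: matrix_vector_right_distrib matrix_vector_mul_assoc)
    then have n: "N *v x = 0" using s by simp
    then have "U *v x = 0" using s by simp
    then show "x = 0" using NZ[of x] n by simp
  qed
  then have "invertible (U + N)" by (simp add: invertible_left_inverse matrix_left_invertible_injective)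
  then obtain V where V: "(U + N) ** V = mat 1" "V ** (U + N) = mat 1" by (auto simp: invertible_def)
  have ar: "(Y + Z) ** X = Y ** X + Z ** X" for X Y Z :: "real^'n^'n"
    by (simp add: matrix_matrix_mult_def vec_eq_iff sum.distrib distrib_right)
  have NV: "N ** V = N"
  proof -
    have "N ** (U + N) = N" using NU NN by (simp add: matrix_add_ldistrib)
    then have "N ** V = N ** (U + N) ** V" by simp
    also have "\<dots> = N" using V by (simp flip: matrix_mul_assoc)
    finally show ?thesis .
  qed
  have VN: "V ** N = N"
  proof -
    have "(U + N) ** N = N" using UN NN by (simp add: ar)
    then have "V ** N = V ** (U + N) ** N" by (simp flip: matrix_mul_assoc)
    also have "\<dots> = N" using V by simp
    finally show ?thesis .
  qed
  have UV: "U ** V = mat 1 - N" using V(1) NV by (simp add: ar algebra_simps eq_diff_eq)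
  have VU: "V ** U = mat 1 - N" using V(2) VN by (simp add: matrix_add_ldistrib algebra_simps eq_diff_eq)
  have dl: "X ** (Y - Z) = X ** Y - X ** Z" and dr: "(Y - Z) ** X = Y ** X - Z ** X" for X Y Z :: "real^'n^'n"
    by (simp_all add: matrix_matrix_mult_def vec_eq_iff sum_subtractf algebra_simps)
  have UB: "U ** (V - N) = mat 1 - N" and BU: "(V - N) ** U = mat 1 - N"
    by (simp_all add: dl dr UV VU UN NU)
  have tr: "transpose (mat 1 - N) = mat 1 - N"
    using Nsym by (simp add: transpose_def vec_eq_iff mat_def)
  have "is_pseudoinverse U (V - N)"
    unfolding is_pseudoinverse_def UB BU
    by (simp add: tr dl dr NU NV NN)
  then show ?thesis ..
qed

text \<open>Justifies the definite description in \<open>pseudoinverse\<close> for symmetric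
  matrices, the case of \<open>U_mat\<close>.\<close>

lemma pseudoinverse_is_pseudoinverse:
  fixes U :: "real^'n^'n"
  assumes "transpose U = U"
  shows "is_pseudoinverse U (pseudoinverse U)"
  unfolding pseudoinverse_def using symmetric_pseudoinverse_ex[OF assms] is_pseudoinverse_unique by (metis theI)

section \<open>Cyclic sweeps and the Poisson equation\<close>

lemma sweep_next_funpow:
  assumes "k \<in> {1..K}"
  shows "(sweep_next K ^^ t) k = (k - 1 + t) mod K + 1"
proof (induction t)
  case 0
  then show ?case using assms by auto
next
  case (Suc t)
  have K: "0 < K" using assms by auto
  let ?m = "(k - 1 + t) mod K"
  have "?m < K" using K by simp
  have "(sweep_next K ^^ Suc t) k = sweep_next K (?m + 1)" using Suc by simp
  also have "\<dots> = (?m + 1) mod K + 1"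
  proof (cases "?m + 1 < K")
    case False
    then have "?m + 1 = K" using \<open>?m < K\<close> by linarith
    then show ?thesis by (simp add: sweep_next_def)
  qed (simp add: sweep_next_def)
  also have "(?m + 1) mod K = (k - 1 + Suc t) mod K" by (simp add: mod_Suc_eq)
  finally show ?case .
qed

lemma sweep_next_funpow_in: "k \<in> {1..K} \<Longrightarrow> (sweep_next K ^^ t) k \<in> {1..K}"
  unfolding sweep_next_funpow by (auto simp: Suc_le_eq)

lemma sweep_next_in: "k \<in> {1..K} \<Longrightarrow> sweep_next K k \<in> {1..K}"
  by (auto simp: sweep_next_def)

lemma sweep_next_period: "k \<in> {1..K} \<Longrightarrow> (sweep_next K ^^ K) k = k"
  unfolding sweep_next_funpow mod_add_self2 by auto

lemma sweep_next_bij: "bij_betw (sweep_next K) {1..K} {1..K}"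
proof (rule bij_betwI[where g = "\<lambda>k. if k = 1 then K else k - 1"])
qed (auto simp: sweep_next_def)

lemma sum_sweep_next: "(\<Sum>k=1..K. F (sweep_next K k)) = (\<Sum>k=1..K. F k)"
  by (rule sum.reindex_bij_betw[OF sweep_next_bij])

text \<open>Each value of \<open>c\<close> is repeated \<open>K\<close> times, so sums over whole
  blocks are \<open>K\<close> times those of \<open>c\<close>.\<close>

lemma summable_div:
  fixes c :: "nat \<Rightarrow> real"
  assumes c: "summable c" "\<And>n. 0 \<le> c n" and K: "0 < K"
  shows "summable (\<lambda>t. c (t div K))"
proof (rule summableI_nonneg_bounded)
  fix n
  have block: "(\<Sum>t<K * m. c (t div K)) = real K * (\<Sum>q<m. c q)" for m
  proof (induction m)
    case (Suc m)
    have split: "(\<Sum>t<a + k. F t) = (\<Sum>t<a. F t) + (\<Sum>r<k. F (a + r))" for a k and F :: "nat \<Rightarrow> real"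
      by (induction k) auto
    have "(\<Sum>t<K * Suc m. c (t div K)) = (\<Sum>t<K * m. c (t div K)) + (\<Sum>r<K. c ((K * m + r) div K))"
      using split[of "\<lambda>t. c (t div K)" "K * m" K] by (simp add: add.commute)
    also have "(\<Sum>r<K. c ((K * m + r) div K)) = (\<Sum>r<K. c m)"
      using K by (intro sum.cong) auto
    finally show ?case using Suc by (simp add: algebra_simps)
  qed simp
  have "(\<Sum>t<n. c (t div K)) \<le> (\<Sum>t<K * n. c (t div K))" using K c by (intro sum_mono2) auto
  also have "\<dots> \<le> real K * suminf c" unfolding block using c by (intro mult_left_mono sum_le_suminf) auto
  finally show "(\<Sum>t<n. c (t div K)) \<le> real K * suminf c" .
qed (use c in auto)

locale sweep_setup =
  fixes \<pi> \<psi> :: "'a::topological_space measure" and K :: nat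
    and Q :: "nat \<Rightarrow> 'a \<Rightarrow> 'a measure" and g :: "'a \<Rightarrow> real^'d" and f :: "'a \<Rightarrow> real^'p"
    and D :: "nat \<Rightarrow> 'a set" and lam b :: "nat \<Rightarrow> real" and W :: "nat \<Rightarrow> 'a \<Rightarrow> real"
  assumes prob_pi: "prob_space \<pi>" and sets_pi: "sets \<pi> = sets borel" and K: "K \<ge> 1"
    and Q: "\<And>k. k \<in> {1..K} \<Longrightarrow> Q k \<in> borel \<rightarrow>\<^sub>M prob_algebra borel"
    and g: "g \<in> borel_measurable borel" and f: "f \<in> borel_measurable borel"
    and statQ: "\<And>k. k \<in> {1..K} \<Longrightarrow> stationary_kernel \<pi> (Q k)"
    and irr: "\<And>k A x. k \<in> {1..K} \<Longrightarrow> A \<in> sets borel \<Longrightarrow> emeasure \<psi> A > 0 \<Longrightarrow>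
           \<exists>t>0. emeasure (sweep_kernel K Q k (K * t) x) A > 0"
    and small: "\<And>k. k \<in> {1..K} \<Longrightarrow> small_set (sweep_kernel K Q k K) (D k)"
    and lam: "\<And>k. k \<in> {1..K} \<Longrightarrow> lam k < 1"
    and W: "\<And>k. k \<in> {1..K} \<Longrightarrow> W k \<in> borel_measurable borel"
    and W1: "\<And>k x. k \<in> {1..K} \<Longrightarrow> W k x \<ge> 1"
    and drift: "\<And>k x. k \<in> {1..K} \<Longrightarrow>
           (\<integral>\<^sup>+ y. ennreal (W k y) \<partial>(sweep_kernel K Q k K x))
             \<le> ennreal (lam k * W k x + b k * indicator (D k) x)"
    and aper: "\<And>k. k \<in> {1..K} \<Longrightarrow> aperiodic_kernel (sweep_kernel K Q k K) \<psi>"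
    and W2: "\<And>k. k \<in> {1..K} \<Longrightarrow> (\<integral>\<^sup>+ x. ennreal ((W k x)\<^sup>2) \<partial>\<pi>) < \<infinity>"
    and gW: "\<And>k x a. k \<in> {1..K} \<Longrightarrow> norm a \<le> 1 \<Longrightarrow> \<bar>a \<bullet> g x\<bar> \<le> W k x"
    and g0: "(\<integral>x. g x \<partial>\<pi>) = 0"
    and f2: "(\<integral>\<^sup>+ x. ennreal (f x \<bullet> f x) \<partial>\<pi>) < \<infinity>"
begin

abbreviation R where "R \<equiv> sweep_kernel K Q"

abbreviation nxt where "nxt t k \<equiv> (sweep_next K ^^ t) k"

interpretation pi: prob_space \<pi> by (rule prob_pi)

lemma meas_pi: "u \<in> borel_measurable borel \<Longrightarrow> u \<in> borel_measurable \<pi>"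
  using sets_pi by (simp cong: measurable_cong_sets)

lemma R_pkernel: "k \<in> {1..K} \<Longrightarrow> pkernel (R k t)"
  unfolding sweep_kernel_def by (rule kernel_prod_measurable) (use sweep_next_funpow_in[of k K] Q in auto)

lemma statR: "k \<in> {1..K} \<Longrightarrow> stationary \<pi> (R k t)"
  by (rule stationary.intro[OF prob_pi sets_pi R_pkernel])
     (auto simp: sweep_kernel_def intro!: stationary_kernel_prod prob_pi sets_pi Q statQ sweep_next_funpow_in[simplified])

lemma statQ': "k \<in> {1..K} \<Longrightarrow> stationary \<pi> (Q k)"
  by (rule stationary.intro[OF prob_pi sets_pi Q statQ])

lemma R_add:
  assumes k: "k \<in> {1..K}"
  shows "R k (s + t) x = R k s x \<bind> R (nxt s k) t"
proof -
  have "map (\<lambda>i. Q (nxt i k)) [0..<s + t] = map (\<lambda>i. Q (nxt i k)) [0..<s] @ map (\<lambda>i. Q (nxt i (nxt s k))) [0..<t]"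
    by (rule nth_equalityI) (auto simp: nth_append funpow_add[symmetric, THEN fun_cong, unfolded comp_def])
  then show ?thesis unfolding sweep_kernel_def
    using k sweep_next_funpow_in[of _ K]
    by (simp only:) (rule kernel_prod_append; auto intro!: Q simp del: atLeastAtMost_iff)
qed

lemma R_0: "R k 0 = return borel" by (simp add: sweep_kernel_def)

lemma R_1: "k \<in> {1..K} \<Longrightarrow> R k (Suc 0) = Q k"
  using pkernel_sets[OF Q] by (auto simp: sweep_kernel_def fun_eq_iff intro!: bind_return'')

lemma R_Suc: "k \<in> {1..K} \<Longrightarrow> R k (Suc t) x = Q k x \<bind> R (sweep_next K k) t"
  using R_add[of k 1 t x] R_1[of k] by simp

lemma R_snoc: "k \<in> {1..K} \<Longrightarrow> R k (Suc t) x = R k t x \<bind> Q (nxt t k)"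
  using R_add[of k t 1 x] R_1[OF sweep_next_funpow_in] by simp

text \<open>Makes the ergodic theory of a single kernel applicable to whole sweeps from phase
  \<open>k\<close>.\<close>

lemma R_pow: "k \<in> {1..K} \<Longrightarrow> R k (K * t) = kernel_pow (R k K) t"
proof (induction t)
  case (Suc t)
  show ?case
  proof
    fix x
    have "R k (K * Suc t) x = R k K x \<bind> R k (K * t)"
      using R_add[of k K "K * t" x] sweep_next_period[of k K] Suc.prems by simp
    then show "R k (K * Suc t) x = kernel_pow (R k K) (Suc t) x"
      using Suc by (simp add: kernel_pow_def)
  qed
qed (simp add: R_0 kernel_pow_def)

text \<open>\<open>lam k\<close> and \<open>b k\<close> may be negative; passing to positive parts
  weakens the inequality because \<open>W k\<close> is nonnegative.\<close>

lemma gd: "k \<in> {1..K} \<Longrightarrow> geometric_drift (R k K) (D k) (max (lam k) 0) (max (b k) 0) (W k)"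
proof (unfold_locales)
  fix x assume k: "k \<in> {1..K}"
  have "lam k * W k x + b k * indicator (D k) x \<le> max (lam k) 0 * W k x + max (b k) 0 * indicator (D k) x"
    using W1[OF k, of x] by (intro add_mono mult_right_mono) auto
  then show "(\<integral>\<^sup>+ y. ennreal (W k y) \<partial>R k K x) \<le> ennreal (max (lam k) 0 * W k x + max (b k) 0 * indicator (D k) x)"
    by (rule order_trans[OF drift[OF k] ennreal_leI])
qed (use lam small R_pkernel W W1 in \<open>auto simp: small_set_def\<close>)

lemma W_sq: "k \<in> {1..K} \<Longrightarrow> integrable \<pi> (\<lambda>x. (W k x)\<^sup>2)"
  using W2[of k] meas_pi[OF W[of k]] by (intro integrableI_bounded) auto

lemma W_int: "k \<in> {1..K} \<Longrightarrow> integrable \<pi> (W k)"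
  by (rule pi.square_integrable_imp_integrable[OF meas_pi[OF W] W_sq])

lemma ergodic:
  obtains c where "summable c" "\<And>n. 0 \<le> (c n :: real)"
    "\<And>k n u x. k \<in> {1..K} \<Longrightarrow> u \<in> borel_measurable borel \<Longrightarrow> (\<And>y. \<bar>u y\<bar> \<le> W k y) \<Longrightarrow>
       \<bar>kernel_app (R k (K * n)) u x - (\<integral>y. u y \<partial>\<pi>)\<bar> \<le> c n * W k x"
proof -
  have "\<exists>c. summable c \<and> (\<forall>n. 0 \<le> c n) \<and> (\<forall>n u x. u \<in> borel_measurable borel \<longrightarrow>
    (\<forall>y. \<bar>u y\<bar> \<le> W k y) \<longrightarrow> \<bar>kernel_app (R k (K * n)) u x - (\<integral>y. u y \<partial>\<pi>)\<bar> \<le> c n * W k x)"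
    if k: "k \<in> {1..K}" for k
  proof -
    interpret gd: geometric_drift "R k K" "D k" "max (lam k) 0" "max (b k) 0" "W k" by (rule gd[OF k])
    show ?thesis unfolding R_pow[OF k]
    proof (rule gd.geometric_ergodicity[OF _ aper[OF k] small[OF k] prob_pi sets_pi _ W_int[OF k]])
      show "stationary_kernel \<pi> (R k K)" using statR[OF k] by (rule stationary.stat)
    qed (use irr[OF k] R_pow[OF k] in auto)
  qed
  then obtain c where c: "\<And>k. k \<in> {1..K} \<Longrightarrow> summable (c k)" "\<And>k n. k \<in> {1..K} \<Longrightarrow> 0 \<le> (c k n :: real)"
    "\<And>k n u x. k \<in> {1..K} \<Longrightarrow> u \<in> borel_measurable borel \<Longrightarrow> (\<And>y. \<bar>u y\<bar> \<le> W k y) \<Longrightarrow>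
       \<bar>kernel_app (R k (K * n)) u x - (\<integral>y. u y \<partial>\<pi>)\<bar> \<le> c k n * W k x"
    by metis
  show ?thesis
  proof (rule that[of "\<lambda>n. \<Sum>k=1..K. c k n"])
    show "summable (\<lambda>n. \<Sum>k=1..K. c k n)" using c(1) by (rule summable_sum)
    show "0 \<le> (\<Sum>k=1..K. c k n)" for n using c(2) by (rule sum_nonneg)
    fix k n u x assume k: "k \<in> {1..K}" and u: "u \<in> borel_measurable borel" "\<And>y. \<bar>u y\<bar> \<le> W k y"
    have "c k n \<le> (\<Sum>k=1..K. c k n)" by (rule member_le_sum) (use k c(2) in auto)
    then have "c k n * W k x \<le> (\<Sum>k=1..K. c k n) * W k x" using W1[OF k, of x] by (intro mult_right_mono) auto
    then show "\<bar>kernel_app (R k (K * n)) u x - (\<integral>y. u y \<partial>\<pi>)\<bar> \<le> (\<Sum>k=1..K. c k n) * W k x"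
      using c(3)[OF k u, of n x] by linarith
  qed
qed

lemma W_growth:
  assumes k: "k \<in> {1..K}"
  shows "\<exists>C\<ge>0. \<forall>n x. (\<integral>\<^sup>+y. ennreal (W k y) \<partial>R k (K * n) x) \<le> ennreal (C * W k x)"
proof -
  interpret gd: geometric_drift "R k K" "D k" "max (lam k) 0" "max (b k) 0" "W k" by (rule gd[OF k])
  have "max (lam k) 0 ^ n * W k x + gd.bound \<le> (1 + gd.bound) * W k x" for n x
  proof -
    have "max (lam k) 0 ^ n * W k x \<le> 1 * W k x" using gd.lam(1,2) gd.W0[of x] by (intro mult_right_mono power_le_one) auto
    moreover have "gd.bound * 1 \<le> gd.bound * W k x" using gd.bound_nonneg W1[OF k, of x] by (intro mult_left_mono) auto
    ultimately show ?thesis by (simp add: distrib_right)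
  qed
  then show ?thesis using gd.bound_nonneg unfolding R_pow[OF k]
    by (intro exI[of _ "1 + gd.bound"]) (auto intro!: order_trans[OF gd.nn_pow_W] ennreal_leI)
qed

section \<open>Domination of the iterates of \<open>g\<close>\<close>

lemma norm_g: "k \<in> {1..K} \<Longrightarrow> norm (g x) \<le> W k x"
proof (cases "g x = 0")
  case False
  assume k: "k \<in> {1..K}"
  have "\<bar>sgn (g x) \<bullet> g x\<bar> \<le> W k x" by (rule gW[OF k]) (simp add: norm_sgn)
  moreover have "sgn (g x) \<bullet> g x = norm (g x)"
    using False by (simp add: sgn_div_norm power2_norm_eq_inner[symmetric] power2_eq_square)
  ultimately show ?thesis by simp
next
  case True
  assume "k \<in> {1..K}"
  then show ?thesis using W1[of k x] True by simp
qed

text \<open>The drift hypothesis controls \<open>W\<close> over whole sweeps. The means over the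
  \<open>r < K\<close> steps of an incomplete sweep therefore enter explicitly; their sum is square
  integrable by Jensen and stationarity, since each \<open>W\<close> is.\<close>

definition H :: "nat \<Rightarrow> 'a \<Rightarrow> real" where
  "H k x = (\<Sum>r<K. kernel_app (R k r) (W (nxt r k)) x)"

text \<open>The points where the summands of \<open>H k\<close> are genuine integrals and not
  default values.\<close>

definition good :: "nat \<Rightarrow> 'a \<Rightarrow> bool" where
  "good k x \<longleftrightarrow> (\<forall>r<K. integrable (R k r x) (W (nxt r k)))"

lemma W_nonneg: "k \<in> {1..K} \<Longrightarrow> 0 \<le> W k x" using W1[of k x] by simp

lemma good_AE: "k \<in> {1..K} \<Longrightarrow> AE x in \<pi>. good k x"
  unfolding good_def AE_all_countable
  using stationary.AE_integrable_kernel[OF statR W_int[OF sweep_next_funpow_in]] by (auto simp: eventually_mono)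

lemma H_meas: "k \<in> {1..K} \<Longrightarrow> H k \<in> borel_measurable borel"
  unfolding H_def by (intro borel_measurable_sum kernel_app_measurable R_pkernel W sweep_next_funpow_in)

lemma square_sum_integrable:
  fixes u w :: "'a \<Rightarrow> real"
  assumes "u \<in> borel_measurable \<pi>" "w \<in> borel_measurable \<pi>" "integrable \<pi> (\<lambda>x. (u x)\<^sup>2)" "integrable \<pi> (\<lambda>x. (w x)\<^sup>2)"
  shows "integrable \<pi> (\<lambda>x. u x * w x)" "integrable \<pi> (\<lambda>x. (u x + w x)\<^sup>2)"
proof -
  show uw: "integrable \<pi> (\<lambda>x. u x * w x)"
  proof (rule Bochner_Integration.integrable_bound)
    show "integrable \<pi> (\<lambda>x. (u x)\<^sup>2 + (w x)\<^sup>2)" using assms by simp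
    show "AE x in \<pi>. norm (u x * w x) \<le> norm ((u x)\<^sup>2 + (w x)\<^sup>2)"
    proof (rule AE_I2)
      fix x
      have "0 \<le> (\<bar>u x\<bar> - \<bar>w x\<bar>)\<^sup>2" by simp
      then have "2 * \<bar>u x * w x\<bar> \<le> (u x)\<^sup>2 + (w x)\<^sup>2" by (simp add: power2_diff abs_mult)
      then show "norm (u x * w x) \<le> norm ((u x)\<^sup>2 + (w x)\<^sup>2)" by simp
    qed
  qed (use assms in auto)
  show "integrable \<pi> (\<lambda>x. (u x + w x)\<^sup>2)" unfolding power2_sum using assms uw by (simp add: mult.assoc)
qed

lemma H_sq: "k \<in> {1..K} \<Longrightarrow> integrable \<pi> (\<lambda>x. (H k x)\<^sup>2)"
proof -
  assume k: "k \<in> {1..K}"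
  have "integrable \<pi> (\<lambda>x. (\<Sum>r<n. kernel_app (R k r) (W (nxt r k)) x)\<^sup>2)" for n
  proof (induction n)
    case (Suc n)
    show ?case unfolding sum.lessThan_Suc
      using k by (intro square_sum_integrable Suc meas_pi borel_measurable_sum kernel_app_measurable R_pkernel W sweep_next_funpow_in
         stationary.kernel_app_square(2)[OF statR] W_sq)
  qed simp
  then show ?thesis by (simp add: H_def)
qed

lemma H_int: "k \<in> {1..K} \<Longrightarrow> integrable \<pi> (H k)"
  by (rule pi.square_integrable_imp_integrable[OF meas_pi[OF H_meas] H_sq])

lemma good_integrable:
  assumes k: "k \<in> {1..K}" and x: "good k x"
  shows "integrable (R k t x) g"
proof -
  define r q where "r = t mod K" and "q = t div K"
  have t: "t = r + K * q" and r: "r < K" using K by (simp_all add: r_def q_def)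
  let ?k = "nxt r k"
  have k': "?k \<in> {1..K}" using k by (rule sweep_next_funpow_in)
  obtain C where C: "C \<ge> 0" "\<And>n x. (\<integral>\<^sup>+y. ennreal (W ?k y) \<partial>R ?k (K * n) x) \<le> ennreal (C * W ?k x)"
    using W_growth[OF k'] by blast
  interpret kb: kernel_bind "R k r x" "R ?k (K * q)"
    using pkernel_sets[OF R_pkernel[OF k]] R_pkernel[OF k'] by unfold_locales
  have eq: "R k t x = R k r x \<bind> R ?k (K * q)" unfolding t by (rule R_add[OF k])
  show ?thesis
  proof (rule integrableI_bounded)
    show "g \<in> borel_measurable (R k t x)" by (rule pkernel_borel_measurable[OF R_pkernel[OF k] g])
    have "(\<integral>\<^sup>+y. ennreal (norm (g y)) \<partial>R k t x) \<le> (\<integral>\<^sup>+y. ennreal (W ?k y) \<partial>R k t x)"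
      by (intro nn_integral_mono ennreal_leI norm_g k')
    also have "\<dots> = (\<integral>\<^sup>+z. \<integral>\<^sup>+y. ennreal (W ?k y) \<partial>R ?k (K * q) z \<partial>R k r x)"
      unfolding eq by (rule kb.nn_integral_bind_N) (use W[OF k'] in simp)
    also have "\<dots> \<le> (\<integral>\<^sup>+z. ennreal (norm (C * W ?k z)) \<partial>R k r x)"
      using C W_nonneg[OF k'] by (intro nn_integral_mono) simp
    also have "\<dots> < \<infinity>" using x r unfolding good_def by (subst integrable_iff_bounded[THEN iffD1, THEN conjunct2]) auto
    finally show "(\<integral>\<^sup>+y. ennreal (norm (g y)) \<partial>R k t x) < \<infinity>" .
  qed
qed

text \<open>One sequence for all phases, fixed by choice so that later statements can name
  it.\<close>

definition rate :: "nat \<Rightarrow> real" where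
  "rate = (SOME c. summable c \<and> (\<forall>n. 0 \<le> c n) \<and> (\<forall>k\<in>{1..K}. \<forall>n u x. u \<in> borel_measurable borel \<longrightarrow> (\<forall>y. \<bar>u y\<bar> \<le> W k y) \<longrightarrow>
       \<bar>kernel_app (R k (K * n)) u x - (\<integral>y. u y \<partial>\<pi>)\<bar> \<le> c n * W k x))"

lemma rate: "summable rate" "0 \<le> rate n"
  "k \<in> {1..K} \<Longrightarrow> u \<in> borel_measurable borel \<Longrightarrow> (\<And>y. \<bar>u y\<bar> \<le> W k y) \<Longrightarrow>
       \<bar>kernel_app (R k (K * n)) u x - (\<integral>y. u y \<partial>\<pi>)\<bar> \<le> rate n * W k x"
proof -
  have "\<exists>c. summable c \<and> (\<forall>n. 0 \<le> c n) \<and> (\<forall>k\<in>{1..K}. \<forall>n u x. u \<in> borel_measurable borel \<longrightarrow> (\<forall>y. \<bar>u y\<bar> \<le> W k y) \<longrightarrow>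
       \<bar>kernel_app (R k (K * n)) u x - (\<integral>y. u y \<partial>\<pi>)\<bar> \<le> c n * W k x)"
    using ergodic by metis
  from someI_ex[OF this] show "summable rate" "0 \<le> rate n"
    "k \<in> {1..K} \<Longrightarrow> u \<in> borel_measurable borel \<Longrightarrow> (\<And>y. \<bar>u y\<bar> \<le> W k y) \<Longrightarrow>
       \<bar>kernel_app (R k (K * n)) u x - (\<integral>y. u y \<partial>\<pi>)\<bar> \<le> rate n * W k x"
    unfolding rate_def[symmetric] by auto
qed

lemma g_int: "integrable \<pi> g"
proof (rule Bochner_Integration.integrable_bound)
  show "integrable \<pi> (W 1)" using K by (intro W_int) auto
  show "AE x in \<pi>. norm (g x) \<le> norm (W 1 x)"
    using norm_g[of 1] W_nonneg[of 1] K by (intro AE_I2) auto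
qed (rule meas_pi[OF g])

text \<open>Reduces to scalar functions by testing with the direction \<open>sgn ?v\<close> of the
  value itself, a fixed vector once \<open>x\<close> is fixed; its inner product with
  \<open>g\<close> is bounded by \<open>W k\<close> and has mean 0.\<close>

lemma norm_R_block:
  assumes k: "k \<in> {1..K}"
  shows "norm (kernel_app (R k (K * q)) g x) \<le> rate q * W k x"
proof -
  let ?v = "kernel_app (R k (K * q)) g x"
  have i: "integrable (R k (K * q) x) g"
  proof -
    obtain C where C: "C \<ge> 0" "\<And>n x. (\<integral>\<^sup>+y. ennreal (W k y) \<partial>R k (K * n) x) \<le> ennreal (C * W k x)"
      using W_growth[OF k] by blast
    show ?thesis
    proof (rule integrableI_bounded)
      show "g \<in> borel_measurable (R k (K * q) x)" by (rule pkernel_borel_measurable[OF R_pkernel[OF k] g])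
      have "(\<integral>\<^sup>+y. ennreal (norm (g y)) \<partial>R k (K * q) x) \<le> (\<integral>\<^sup>+y. ennreal (W k y) \<partial>R k (K * q) x)"
        by (intro nn_integral_mono ennreal_leI norm_g k)
      also have "\<dots> < \<infinity>" by (rule le_less_trans[OF C(2)]) simp
      finally show "(\<integral>\<^sup>+y. ennreal (norm (g y)) \<partial>R k (K * q) x) < \<infinity>" .
    qed
  qed
  let ?a = "sgn ?v"
  have na: "norm ?a \<le> 1" by (simp add: norm_sgn)
  have m: "(\<lambda>y. ?a \<bullet> g y) \<in> borel_measurable borel" using g by (intro borel_measurable_inner) auto
  have "\<bar>kernel_app (R k (K * q)) (\<lambda>y. ?a \<bullet> g y) x - (\<integral>y. ?a \<bullet> g y \<partial>\<pi>)\<bar> \<le> rate q * W k x"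
    by (rule rate(3)[OF k m gW[OF k na]])
  moreover have "(\<integral>y. ?a \<bullet> g y \<partial>\<pi>) = 0" using g_int g0 by simp
  moreover have "kernel_app (R k (K * q)) (\<lambda>y. ?a \<bullet> g y) x = ?a \<bullet> ?v" unfolding kernel_app_def using i by simp
  moreover have "?a \<bullet> ?v = norm ?v"
    by (cases "?v = 0") (simp_all add: sgn_div_norm power2_norm_eq_inner[symmetric] power2_eq_square)
  ultimately show ?thesis by simp
qed

text \<open>With \<open>t = r + K * q\<close>, the \<open>q\<close> whole sweeps that follow the
  first \<open>r\<close> steps give \<open>rate q\<close> times \<open>W\<close> of the phase
  reached; averaging over the first \<open>r\<close> steps turns this \<open>W\<close> into a
  summand of \<open>H k\<close>.\<close>

lemma norm_R:
  assumes k: "k \<in> {1..K}" and x: "good k x"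
  shows "norm (kernel_app (R k t) g x) \<le> rate (t div K) * H k x"
proof -
  define r q where "r = t mod K" and "q = t div K"
  have t: "t = r + K * q" and r: "r < K" using K by (simp_all add: r_def q_def)
  let ?k = "nxt r k" and ?W = "\<lambda>r. kernel_app (R k r) (W (nxt r k)) x"
  have k': "?k \<in> {1..K}" using k by (rule sweep_next_funpow_in)
  have eq: "R k t = (\<lambda>x. R k r x \<bind> R ?k (K * q))" unfolding t by (rule ext) (rule R_add[OF k])
  have Wi: "integrable (R k r x) (W ?k)" using x r by (simp add: good_def)
  have "kernel_app (R k t) g x = kernel_app (R k r) (kernel_app (R ?k (K * q)) g) x"
    unfolding eq using good_integrable[OF k x, of t] unfolding eq
    by (intro kernel_app_bind R_pkernel k k')
  then have "norm (kernel_app (R k t) g x) \<le> (\<integral>y. norm (kernel_app (R ?k (K * q)) g y) \<partial>R k r x)"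
    unfolding kernel_app_def[of "R k r"] by simp
  also have "\<dots> \<le> (\<integral>y. rate q * W ?k y \<partial>R k r x)"
  proof (rule integral_mono)
    show "integrable (R k r x) (\<lambda>y. norm (kernel_app (R ?k (K * q)) g y))"
      using kernel_app_bind(2)[of "R k r" "R ?k (K * q)" x g] good_integrable[OF k x, of t] R_pkernel k k' unfolding eq
      by (intro integrable_norm) auto
  qed (use Wi norm_R_block[OF k'] in auto)
  also have "\<dots> = rate q * ?W r" by (simp add: kernel_app_def)
  also have "?W r \<le> H k x" unfolding H_def
    by (rule member_le_sum) (use r k in \<open>auto simp: kernel_app_def intro!: integral_nonneg_AE AE_I2 W_nonneg sweep_next_funpow_in[simplified]\<close>)
  then have "rate q * ?W r \<le> rate q * H k x" by (rule mult_left_mono) (rule rate)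
  finally show ?thesis by (simp add: q_def)
qed

lemma summable_rate: "summable (\<lambda>t. rate (t div K))"
  using K by (intro summable_div rate) auto

definition total_rate :: real where "total_rate = (\<Sum>t. rate (t div K))"

lemma summable_R:
  assumes k: "k \<in> {1..K}" and x: "good k x"
  shows "summable (\<lambda>t. norm (kernel_app (R k t) g x))" "summable (\<lambda>t. kernel_app (R k t) g x)"
    "norm (ghat K Q g k x) \<le> total_rate * H k x"
proof -
  have s: "summable (\<lambda>t. rate (t div K) * H k x)" using summable_rate by (rule summable_mult2)
  show 1: "summable (\<lambda>t. norm (kernel_app (R k t) g x))"
    by (rule summable_comparison_test'[OF s, of 0]) (simp add: norm_R[OF k x])
  then show "summable (\<lambda>t. kernel_app (R k t) g x)" by (rule summable_norm_cancel)
  have "norm (ghat K Q g k x) \<le> (\<Sum>t. norm (kernel_app (R k t) g x))"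
    unfolding ghat_def by (rule summable_norm[OF 1])
  also have "\<dots> \<le> (\<Sum>t. rate (t div K) * H k x)" by (rule suminf_le[OF norm_R[OF k x] 1 s])
  also have "\<dots> = total_rate * H k x" unfolding total_rate_def by (rule suminf_mult2[OF summable_rate, symmetric])
  finally show "norm (ghat K Q g k x) \<le> total_rate * H k x" .
qed

lemma ghat_meas: "k \<in> {1..K} \<Longrightarrow> ghat K Q g k \<in> borel_measurable borel"
  unfolding ghat_def by (intro borel_measurable_suminf kernel_app_measurable R_pkernel g)

lemma ghat_sq: "k \<in> {1..K} \<Longrightarrow> integrable \<pi> (\<lambda>x. (norm (ghat K Q g k x))\<^sup>2)"
proof (rule Bochner_Integration.integrable_bound)
  assume k: "k \<in> {1..K}"
  show "integrable \<pi> (\<lambda>x. total_rate\<^sup>2 * (H k x)\<^sup>2)" using H_sq[OF k] by simp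
  show "(\<lambda>x. (norm (ghat K Q g k x))\<^sup>2) \<in> borel_measurable \<pi>"
    using meas_pi[OF ghat_meas[OF k]] by measurable
  show "AE x in \<pi>. norm ((norm (ghat K Q g k x))\<^sup>2) \<le> norm (total_rate\<^sup>2 * (H k x)\<^sup>2)"
    using good_AE[OF k]
  proof eventually_elim
    case (elim x)
    have "(norm (ghat K Q g k x))\<^sup>2 \<le> (total_rate * H k x)\<^sup>2" by (intro power_mono summable_R k elim) simp
    then show ?case by (simp add: power_mult_distrib)
  qed
qed

text \<open>\<open>Q k\<close> maps the term with index \<open>t\<close> of the series at the next
  phase to the term with index \<open>t + 1\<close> at phase \<open>k\<close>, so only the term 0,
  which is \<open>g\<close>, is missing. Kernel and series are interchanged with the bound
  \<open>rate (t div K) * H\<close>, valid where almost every successor is a good point.\<close>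

lemma poisson:
  assumes k: "k \<in> {1..K}"
  shows "AE x in \<pi>. ghat K Q g k x = g x + kernel_app (Q k) (ghat K Q g (sweep_next K k)) x"
proof -
  let ?k = "sweep_next K k"
  have k': "?k \<in> {1..K}" using k by (rule sweep_next_in)
  interpret Q: stationary \<pi> "Q k" by (rule statQ'[OF k])
  \<comment> \<open>\<open>good\<close> has to be a measurable predicate before its almost sure
    truth can be passed through \<open>Q k\<close>.\<close>
  have goodm: "Measurable.pred borel (good ?k)"
  proof -
    have "(\<lambda>x. integrable (R ?k r x) (W (nxt r ?k))) \<in> borel \<rightarrow>\<^sub>M count_space UNIV" for r
      by (rule measurable_compose[OF measurable_prob_algebraD[OF R_pkernel[OF k']] integrable_measurable_subprob_algebra])
         (rule W[OF sweep_next_funpow_in[OF k']])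
    then show ?thesis unfolding good_def by measurable
  qed
  have "AE x in \<pi>. AE y in Q k x. good ?k y" by (rule Q.AE_kernel[OF goodm good_AE[OF k']])
  moreover have "AE x in \<pi>. integrable (Q k x) (H ?k)" by (rule Q.AE_integrable_kernel[OF H_int[OF k']])
  ultimately show ?thesis using good_AE[OF k]
  proof eventually_elim
    case (elim x)
    let ?u = "\<lambda>t. kernel_app (R ?k t) g"
    have step: "kernel_app (R k (Suc t)) g x = kernel_app (Q k) (?u t) x" "integrable (Q k x) (?u t)" for t
    proof -
      have eq: "R k (Suc t) = (\<lambda>x. Q k x \<bind> R ?k t)" by (rule ext) (rule R_Suc[OF k])
      show "kernel_app (R k (Suc t)) g x = kernel_app (Q k) (?u t) x" "integrable (Q k x) (?u t)"
        unfolding eq using good_integrable[OF k elim(3), of "Suc t"] unfolding eq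
        by (auto intro!: kernel_app_bind Q R_pkernel k k' simp del: atLeastAtMost_iff)
    qed
    have bound: "AE y in Q k x. norm (?u t y) \<le> rate (t div K) * H ?k y" for t
      using elim(1) by eventually_elim (rule norm_R[OF k'])
    have "kernel_app (Q k) (ghat K Q g ?k) x = (\<Sum>t. kernel_app (Q k) (?u t) x)"
      unfolding kernel_app_def[of "Q k"] ghat_def
    proof (rule integral_suminf)
      show "AE y in Q k x. summable (\<lambda>t. norm (?u t y))"
        using elim(1) by eventually_elim (rule summable_R[OF k'])
      show "summable (\<lambda>t. \<integral>y. norm (?u t y) \<partial>Q k x)"
      proof (rule summable_comparison_test'[of _ 0])
        show "summable (\<lambda>t. rate (t div K) * (\<integral>y. H ?k y \<partial>Q k x))" using summable_rate by (rule summable_mult2)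
        fix t
        have "(\<integral>y. norm (?u t y) \<partial>Q k x) \<le> (\<integral>y. rate (t div K) * H ?k y \<partial>Q k x)"
          using step(2) elim(2) bound by (intro integral_mono_AE integrable_norm) auto
        then show "norm (\<integral>y. norm (?u t y) \<partial>Q k x) \<le> rate (t div K) * (\<integral>y. H ?k y \<partial>Q k x)" by simp
      qed
    qed (rule step)
    also have "\<dots> = (\<Sum>t. kernel_app (R k (Suc t)) g x)" by (simp only: step(1))
    also have "\<dots> = ghat K Q g k x - kernel_app (R k 0) g x"
      unfolding ghat_def by (rule suminf_split_head[OF summable_R(2)[OF k elim(3)]])
    also have "kernel_app (R k 0) g x = g x"
      unfolding R_0 kernel_app_def by (rule integral_return) (use g in auto)
    finally show ?case by simp
  qed
qed

end

section \<open>Covariance forms\<close>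

lemma norm_outer: "norm (outer u v) = norm u * norm v"
proof -
  have row: "outer u v $ i = (u $ i) *\<^sub>R v" for i by (simp add: outer_def vec_eq_iff)
  have "norm (outer u v) = L2_set (\<lambda>i. norm (u $ i) * norm v) UNIV"
    unfolding norm_vec_def[of "outer u v"] row by simp
  also have "\<dots> = norm u * norm v" by (simp add: norm_vec_def[of u] L2_set_left_distrib)
  finally show ?thesis .
qed

lemma outer_measurable:
  assumes "u \<in> borel_measurable M" "v \<in> borel_measurable M"
  shows "(\<lambda>x. outer (u x :: real^'n) (v x :: real^'m)) \<in> borel_measurable M"
proof (rule borel_measurable_continuous_Pair[OF assms])
  show "continuous_on UNIV (\<lambda>x. outer (fst x :: real^'n) (snd x :: real^'m))"
    unfolding outer_def by (intro continuous_on_vec_lambda continuous_intros)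
qed

lemma bounded_linear_matrix_form: "bounded_linear (\<lambda>M :: real^'n^'m. x \<bullet> (M *v y))"
  by (intro linear_conv_bounded_linear[THEN iffD1] linearI)
     (simp_all add: matrix_vector_mult_add_rdistrib inner_add_right scaleR_matrix_vector_assoc[symmetric])

text \<open>A parabola through 0 that never becomes negative has zero slope there. Dividing by
  \<open>b + 1\<close> instead of \<open>b\<close> avoids a separate case
  \<open>b = 0\<close>.\<close>

lemma quadratic_nonneg_imp_0:
  fixes a b :: real
  assumes "\<And>t. 0 \<le> 2 * t * a + t\<^sup>2 * b" and b: "0 \<le> b"
  shows "a = 0"
proof -
  define t where "t = - a / (b + 1)"
  have t: "t * (b + 1) = - a" unfolding t_def using b by simp
  have "0 \<le> (2 * t * a + t\<^sup>2 * b) * (b + 1)" using assms by (intro mult_nonneg_nonneg) auto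
  also have "\<dots> = 2 * a * (t * (b + 1)) + b * t * (t * (b + 1))" by (simp add: algebra_simps power2_eq_square)
  also have "\<dots> = - (2 * a\<^sup>2 + a * (b * t))" unfolding t by (simp add: algebra_simps power2_eq_square)
  also have "b * t = - a - t" using t by (simp add: algebra_simps)
  finally have 1: "a\<^sup>2 \<le> a * t" by (simp add: algebra_simps power2_eq_square)
  have "a * t * (b + 1) = - a\<^sup>2" using t by (simp add: power2_eq_square mult.assoc)
  then have "a * t \<le> 0" using b by (smt (verit) mult_pos_pos zero_le_power2)
  then show ?thesis using 1 by (smt (verit) zero_eq_power2 zero_le_power2)
qed

context sweep_setup
begin

interpretation pi: prob_space \<pi> by (rule prob_pi)

section \<open>Square integrable functions and the conditional covariance form\<close>

definition L2 :: "('a \<Rightarrow> 'b::{real_normed_vector, second_countable_topology}) \<Rightarrow> bool" where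
  "L2 u \<longleftrightarrow> u \<in> borel_measurable borel \<and> integrable \<pi> (\<lambda>x. (norm (u x))\<^sup>2)"

lemma L2_real: "L2 (u :: 'a \<Rightarrow> real) \<longleftrightarrow> u \<in> borel_measurable borel \<and> integrable \<pi> (\<lambda>x. (u x)\<^sup>2)"
  by (simp add: L2_def)

lemma L2_inner:
  fixes u :: "'a \<Rightarrow> real^'n"
  assumes "L2 u"
  shows "L2 (\<lambda>x. a \<bullet> u x)"
  unfolding L2_real
proof
  show m: "(\<lambda>x. a \<bullet> u x) \<in> borel_measurable borel" using assms by (auto simp: L2_def intro!: borel_measurable_inner)
  show "integrable \<pi> (\<lambda>x. (a \<bullet> u x)\<^sup>2)"
  proof (rule Bochner_Integration.integrable_bound)
    show "integrable \<pi> (\<lambda>x. (norm a)\<^sup>2 * (norm (u x))\<^sup>2)" using assms by (simp add: L2_def)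
    show "(\<lambda>x. (a \<bullet> u x)\<^sup>2) \<in> borel_measurable \<pi>" using meas_pi[OF m] by simp
    have "(a \<bullet> u x)\<^sup>2 \<le> (norm a * norm (u x))\<^sup>2" for x
      using Cauchy_Schwarz_ineq2[of a "u x"] by (subst abs_le_square_iff[symmetric]) simp
    then show "AE x in \<pi>. norm ((a \<bullet> u x)\<^sup>2) \<le> norm ((norm a)\<^sup>2 * (norm (u x))\<^sup>2)"
      by (simp add: power_mult_distrib)
  qed
qed

lemma L2_combine:
  fixes u w :: "'a \<Rightarrow> real"
  assumes "L2 u" "L2 w"
  shows "L2 (\<lambda>x. u x + c * w x)"
proof -
  have "integrable \<pi> (\<lambda>x. (u x + c * w x)\<^sup>2)"
    using assms by (intro square_sum_integrable) (auto simp: L2_real power_mult_distrib intro: meas_pi)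
  moreover have "(\<lambda>x. u x + c * w x) \<in> borel_measurable borel"
    using assms by (intro borel_measurable_add borel_measurable_times) (auto simp: L2_real)
  ultimately show ?thesis by (simp add: L2_real)
qed

lemma L2_norm: "L2 (u :: 'a \<Rightarrow> real^'n) \<Longrightarrow> L2 (\<lambda>x. norm (u x))"
proof -
  assume u: "L2 u"
  then have [measurable]: "u \<in> borel_measurable borel" by (simp add: L2_def)
  have "(\<lambda>x. norm (u x)) \<in> borel_measurable borel" by measurable
  then show ?thesis using u by (simp add: L2_def)
qed

lemma L2_mult: "L2 u \<Longrightarrow> L2 w \<Longrightarrow> integrable \<pi> (\<lambda>x. u x * w x :: real)"
  by (intro square_sum_integrable) (auto simp: L2_real intro: meas_pi)

lemma L2_int: "L2 (u :: 'a \<Rightarrow> real^'n) \<Longrightarrow> integrable \<pi> u"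
proof -
  assume u: "L2 u"
  have "integrable \<pi> (\<lambda>x. norm (u x))"
    by (rule pi.square_integrable_imp_integrable[OF meas_pi]) (use L2_norm[OF u] in \<open>simp_all add: L2_real\<close>)
  then show ?thesis using u by (subst (asm) integrable_norm_iff) (auto simp: L2_def intro: meas_pi)
qed

lemma L2_int_real: "L2 (u :: 'a \<Rightarrow> real) \<Longrightarrow> integrable \<pi> u"
  by (rule pi.square_integrable_imp_integrable[OF meas_pi]) (simp_all add: L2_real)

lemma L2_kernel_real: "k \<in> {1..K} \<Longrightarrow> L2 (u :: 'a \<Rightarrow> real) \<Longrightarrow> L2 (kernel_app (Q k) u)"
  unfolding L2_real using stationary.kernel_app_square(2)[OF statQ'] kernel_app_measurable[OF Q] by blast

lemma L2_kernel:
  fixes u :: "'a \<Rightarrow> real^'n"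
  assumes k: "k \<in> {1..K}" and u: "L2 u"
  shows "L2 (kernel_app (Q k) u)"
proof -
  have m: "kernel_app (Q k) u \<in> borel_measurable borel"
    by (rule kernel_app_measurable[OF Q[OF k]]) (use u in \<open>simp add: L2_def\<close>)
  have "L2 (kernel_app (Q k) (\<lambda>x. norm (u x)))" by (rule L2_kernel_real[OF k L2_norm[OF u]])
  then have i: "integrable \<pi> (\<lambda>x. (kernel_app (Q k) (\<lambda>x. norm (u x)) x)\<^sup>2)" by (simp add: L2_real)
  have "integrable \<pi> (\<lambda>x. (norm (kernel_app (Q k) u x))\<^sup>2)"
  proof (rule Bochner_Integration.integrable_bound[OF i])
    show "(\<lambda>x. (norm (kernel_app (Q k) u x))\<^sup>2) \<in> borel_measurable \<pi>" using meas_pi[OF m] by measurable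
    show "AE x in \<pi>. norm ((norm (kernel_app (Q k) u x))\<^sup>2) \<le> norm ((kernel_app (Q k) (\<lambda>x. norm (u x)) x)\<^sup>2)"
    proof (rule AE_I2)
      fix x
      show "norm ((norm (kernel_app (Q k) u x))\<^sup>2) \<le> norm ((kernel_app (Q k) (\<lambda>x. norm (u x)) x)\<^sup>2)"
        using power_mono[OF stationary.norm_kernel_app_le_kernel_app[OF statQ'[OF k], of u x] norm_ge_zero, of 2] by simp
    qed
  qed
  then show ?thesis using m by (simp add: L2_def)
qed

lemma kernel_inner_AE:
  fixes u :: "'a \<Rightarrow> real^'n"
  assumes k: "k \<in> {1..K}" and u: "L2 u"
  shows "AE x in \<pi>. a \<bullet> kernel_app (Q k) u x = kernel_app (Q k) (\<lambda>y. a \<bullet> u y) x"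
  using stationary.AE_integrable_kernel[OF statQ'[OF k] L2_int[OF u]]
  by eventually_elim (simp add: kernel_app_def)

lemma kernel_combine_AE:
  fixes u w :: "'a \<Rightarrow> real"
  assumes k: "k \<in> {1..K}" and u: "L2 u" "L2 w"
  shows "AE x in \<pi>. kernel_app (Q k) (\<lambda>y. u y + c * w y) x = kernel_app (Q k) u x + c * kernel_app (Q k) w x"
  using stationary.AE_integrable_kernel[OF statQ'[OF k] L2_int_real[OF u(1)]]
    stationary.AE_integrable_kernel[OF statQ'[OF k] L2_int_real[OF u(2)]]
  by eventually_elim (simp add: kernel_app_def)

text \<open>The expected conditional covariance of \<open>u\<close> and \<open>w\<close> one step of
  \<open>Q k\<close> after a start from \<open>\<pi>\<close>; stationarity has simplified the mean
  of the product to the first integral.\<close>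

definition cform :: "nat \<Rightarrow> ('a \<Rightarrow> real) \<Rightarrow> ('a \<Rightarrow> real) \<Rightarrow> real" where
  "cform k u w = (\<integral>x. u x * w x \<partial>\<pi>) - (\<integral>x. kernel_app (Q k) u x * kernel_app (Q k) w x \<partial>\<pi>)"

lemma cform_sym: "cform k u w = cform k w u"
  by (simp add: cform_def mult.commute)

lemma cform_nonneg: "k \<in> {1..K} \<Longrightarrow> L2 u \<Longrightarrow> 0 \<le> cform k u u"
  using stationary.kernel_app_square(4)[OF statQ', of k u] by (simp add: cform_def L2_real power2_eq_square)

lemma L2_meas: "L2 u \<Longrightarrow> u \<in> borel_measurable \<pi>"
  by (rule meas_pi) (simp add: L2_def)

lemma cform_combine:
  assumes k: "k \<in> {1..K}" and u: "L2 u" "L2 w" "L2 v"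
  shows "cform k (\<lambda>x. u x + c * w x) v = cform k u v + c * cform k w v"
proof -
  note P = L2_kernel_real[OF k]
  have 1: "(\<integral>x. (u x + c * w x) * v x \<partial>\<pi>) = (\<integral>x. u x * v x \<partial>\<pi>) + c * (\<integral>x. w x * v x \<partial>\<pi>)"
    using L2_mult[OF u(1,3)] L2_mult[OF u(2,3)] by (simp add: distrib_right mult.assoc)
  have "(\<integral>x. kernel_app (Q k) (\<lambda>x. u x + c * w x) x * kernel_app (Q k) v x \<partial>\<pi>)
    = (\<integral>x. (kernel_app (Q k) u x + c * kernel_app (Q k) w x) * kernel_app (Q k) v x \<partial>\<pi>)"
  proof (rule integral_cong_AE)
    show "AE x in \<pi>. kernel_app (Q k) (\<lambda>x. u x + c * w x) x * kernel_app (Q k) v x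
      = (kernel_app (Q k) u x + c * kernel_app (Q k) w x) * kernel_app (Q k) v x"
      using kernel_combine_AE[OF k u(1,2), of c] by eventually_elim simp
  qed (intro borel_measurable_times borel_measurable_add borel_measurable_const L2_meas P L2_combine u)+
  also have "\<dots> = (\<integral>x. kernel_app (Q k) u x * kernel_app (Q k) v x \<partial>\<pi>) + c * (\<integral>x. kernel_app (Q k) w x * kernel_app (Q k) v x \<partial>\<pi>)"
    using L2_mult[OF P[OF u(1)] P[OF u(3)]] L2_mult[OF P[OF u(2)] P[OF u(3)]] by (simp add: distrib_right mult.assoc)
  finally show ?thesis unfolding cform_def 1 by (simp add: algebra_simps)
qed

lemma cform_square:
  assumes k: "k \<in> {1..K}" and u: "L2 u" "L2 w"
  shows "cform k (\<lambda>x. u x + c * w x) (\<lambda>x. u x + c * w x) = cform k u u + 2 * c * cform k u w + c\<^sup>2 * cform k w w"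
proof -
  let ?v = "\<lambda>x. u x + c * w x"
  have 1: "cform k ?v ?v = cform k u ?v + c * cform k w ?v" by (rule cform_combine[OF k u L2_combine[OF u]])
  have 2: "cform k u ?v = cform k u u + c * cform k u w"
    by (simp only: cform_sym[of k u ?v] cform_combine[OF k u u(1)] cform_sym[of k w u])
  have 3: "cform k w ?v = cform k u w + c * cform k w w"
    by (simp only: cform_sym[of k w ?v] cform_combine[OF k u u(2)])
  show ?thesis unfolding 1 2 3 by (simp add: algebra_simps power2_eq_square)
qed

text \<open>The degenerate case of Cauchy-Schwarz: a form nonnegative at all
  \<open>u + t * w\<close> can have no cross term when its value at \<open>u\<close>
  vanishes.\<close>

lemma cform_degenerate:
  assumes k: "k \<in> {1..K}" and u: "L2 u" "L2 w" and z: "cform k u u = 0"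
  shows "cform k u w = 0"
proof (rule quadratic_nonneg_imp_0)
  show "0 \<le> 2 * t * cform k u w + t\<^sup>2 * cform k w w" for t
    using cform_nonneg[OF k L2_combine[OF u], of t] cform_square[OF k u, of t] z by simp
qed (rule cform_nonneg[OF k u(2)])

lemma outer_integrable:
  fixes u :: "'a \<Rightarrow> real^'n" and w :: "'a \<Rightarrow> real^'m"
  assumes "L2 u" "L2 w"
  shows "integrable \<pi> (\<lambda>x. outer (u x) (w x))"
proof (rule Bochner_Integration.integrable_bound)
  show "integrable \<pi> (\<lambda>x. norm (u x) * norm (w x))"
    using assms by (intro L2_mult) (auto simp: L2_def)
  show "AE x in \<pi>. norm (outer (u x) (w x)) \<le> norm (norm (u x) * norm (w x))"
    by (simp add: norm_outer)
qed (intro outer_measurable L2_meas assms)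

lemma inner_outer: "x \<bullet> (outer u w *v y) = (x \<bullet> u) * (y \<bullet> w)"
  by (simp add: outer_vector_mult inner_commute)

lemma outer_form:
  fixes u :: "'a \<Rightarrow> real^'n" and w :: "'a \<Rightarrow> real^'m"
  assumes k: "k \<in> {1..K}" and u: "L2 u" "L2 w"
  shows "x \<bullet> ((\<integral>z. (outer (u z) (w z) - outer (kernel_app (Q k) u z) (kernel_app (Q k) w z)) \<partial>\<pi>) *v y)
    = cform k (\<lambda>z. x \<bullet> u z) (\<lambda>z. y \<bullet> w z)"
proof -
  note P = L2_kernel[OF k u(1)] L2_kernel[OF k u(2)]
  have i: "integrable \<pi> (\<lambda>z. outer (u z) (w z))" "integrable \<pi> (\<lambda>z. outer (kernel_app (Q k) u z) (kernel_app (Q k) w z))"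
    by (intro outer_integrable u P)+
  note bl = bounded_linear_matrix_form[of x y]
  have ev: "x \<bullet> ((\<integral>z. F z \<partial>\<pi>) *v y) = (\<integral>z. x \<bullet> (F z *v y) \<partial>\<pi>)" if "integrable \<pi> F" for F :: "'a \<Rightarrow> real^'m^'n"
    by (rule integral_bounded_linear[OF bl that, symmetric])
  have "x \<bullet> ((\<integral>z. (outer (u z) (w z) - outer (kernel_app (Q k) u z) (kernel_app (Q k) w z)) \<partial>\<pi>) *v y)
    = x \<bullet> (((\<integral>z. outer (u z) (w z) \<partial>\<pi>) - (\<integral>z. outer (kernel_app (Q k) u z) (kernel_app (Q k) w z) \<partial>\<pi>)) *v y)"
    using i by simp
  also have "\<dots> = (\<integral>z. (x \<bullet> u z) * (y \<bullet> w z) \<partial>\<pi>) - (\<integral>z. (x \<bullet> kernel_app (Q k) u z) * (y \<bullet> kernel_app (Q k) w z) \<partial>\<pi>)"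
    by (simp only: matrix_vector_mult_diff_rdistrib inner_diff_right ev[OF i(1)] ev[OF i(2)] inner_outer)
  also have "(\<integral>z. (x \<bullet> kernel_app (Q k) u z) * (y \<bullet> kernel_app (Q k) w z) \<partial>\<pi>)
    = (\<integral>z. kernel_app (Q k) (\<lambda>z. x \<bullet> u z) z * kernel_app (Q k) (\<lambda>z. y \<bullet> w z) z \<partial>\<pi>)"
  proof (rule integral_cong_AE)
    show "AE z in \<pi>. (x \<bullet> kernel_app (Q k) u z) * (y \<bullet> kernel_app (Q k) w z) = kernel_app (Q k) (\<lambda>z. x \<bullet> u z) z * kernel_app (Q k) (\<lambda>z. y \<bullet> w z) z"
      using kernel_inner_AE[OF k u(1), of x] kernel_inner_AE[OF k u(2), of y] by eventually_elim simp
  qed (intro borel_measurable_times L2_meas L2_inner P L2_kernel_real k u)+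
  finally show ?thesis by (simp add: cform_def)
qed

lemma L2_f: "L2 f"
proof -
  have "(\<integral>\<^sup>+ x. ennreal (norm ((norm (f x))\<^sup>2)) \<partial>\<pi>) < \<infinity>" using f2 by (simp add: power2_norm_eq_inner)
  moreover have "(\<lambda>x. (norm (f x))\<^sup>2) \<in> borel_measurable \<pi>" using meas_pi[OF f] by measurable
  ultimately have "integrable \<pi> (\<lambda>x. (norm (f x))\<^sup>2)" by (intro integrableI_bounded)
  then show ?thesis using f by (simp add: L2_def)
qed

lemma L2_ghat: "k \<in> {1..K} \<Longrightarrow> L2 (ghat K Q g k)"
  using ghat_meas ghat_sq by (simp add: L2_def)

lemma L2_g: "L2 g"
proof -
  have 1: "(1::nat) \<in> {1..K}" using K by simp
  have "integrable \<pi> (\<lambda>x. (norm (g x))\<^sup>2)"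
  proof (rule Bochner_Integration.integrable_bound[OF W_sq[OF 1]])
    show "(\<lambda>x. (norm (g x))\<^sup>2) \<in> borel_measurable \<pi>" using meas_pi[OF g] by measurable
    show "AE x in \<pi>. norm ((norm (g x))\<^sup>2) \<le> norm ((W 1 x)\<^sup>2)"
      using norm_g[OF 1] by (intro AE_I2) (simp add: power_mono)
  qed
  then show ?thesis using g by (simp add: L2_def)
qed

lemma U_form: "k \<in> {1..K} \<Longrightarrow> x \<bullet> (U_mat \<pi> Q f k *v y) = cform k (\<lambda>z. x \<bullet> f z) (\<lambda>z. y \<bullet> f z)"
  unfolding U_mat_def by (rule outer_form[OF _ L2_f L2_f])

lemma V_form: "k \<in> {1..K} \<Longrightarrow> x \<bullet> (V_mat \<pi> K Q g f k *v y) = cform k (\<lambda>z. x \<bullet> f z) (\<lambda>z. y \<bullet> ghat K Q g (sweep_next K k) z)"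
  unfolding V_mat_def by (rule outer_form[OF _ L2_f L2_ghat[OF sweep_next_in]])

lemma U_sym: "k \<in> {1..K} \<Longrightarrow> transpose (U_mat \<pi> Q f k) = U_mat \<pi> Q f k"
proof -
  assume k: "k \<in> {1..K}"
  have "x \<bullet> (transpose (U_mat \<pi> Q f k) *v y) = x \<bullet> (U_mat \<pi> Q f k *v y)" for x y
    using inner_matrix_vector[of y "U_mat \<pi> Q f k" x] U_form[OF k, of x y] U_form[OF k, of y x]
      cform_sym[of k "\<lambda>z. x \<bullet> f z" "\<lambda>z. y \<bullet> f z"] by (simp add: inner_commute)
  then have "transpose (U_mat \<pi> Q f k) *v y = U_mat \<pi> Q f k *v y" for y
    by (metis vector_eq_ldot)
  then show ?thesis by (simp add: matrix_eq)
qed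

text \<open>\<open>T\<close> is the orthogonal projection onto the range of \<open>U\<close>. The
  component \<open>z\<close> of a vector orthogonal to that range lies in the kernel of
  \<open>U\<close>, so \<open>z \<bullet> f\<close> has vanishing form, hence vanishing cross term
  with \<open>ghat\<close>.\<close>

lemma pseudoinverse_solves:
  assumes k: "k \<in> {1..K}"
  shows "U_mat \<pi> Q f k ** (pseudoinverse (U_mat \<pi> Q f k) ** V_mat \<pi> K Q g f k) = V_mat \<pi> K Q g f k"
proof -
  let ?U = "U_mat \<pi> Q f k" and ?V = "V_mat \<pi> K Q g f k"
  have k': "sweep_next K k \<in> {1..K}" using k by (rule sweep_next_in)
  define T where "T = ?U ** pseudoinverse ?U"
  have pi: "is_pseudoinverse ?U (pseudoinverse ?U)" by (rule pseudoinverse_is_pseudoinverse[OF U_sym[OF k]])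
  have TU: "T ** ?U = ?U" and Tsym: "transpose T = T" using pi by (auto simp: T_def is_pseudoinverse_def)
  have UT: "?U ** T = ?U"
  proof -
    have "transpose (T ** ?U) = transpose ?U" using TU by simp
    then show ?thesis by (simp add: matrix_transpose_mul Tsym U_sym[OF k])
  qed
  have "x \<bullet> ((T ** ?V) *v y) = x \<bullet> (?V *v y)" for x y
  proof -
    let ?z = "x - T *v x"
    have "?U *v ?z = 0" by (simp add: matrix_vector_mult_diff_distrib matrix_vector_mul_assoc UT)
    then have "cform k (\<lambda>w. ?z \<bullet> f w) (\<lambda>w. ?z \<bullet> f w) = 0" using U_form[OF k, of ?z ?z] by simp
    then have "?z \<bullet> (?V *v y) = 0" unfolding V_form[OF k]
      by (rule cform_degenerate[OF k L2_inner[OF L2_f] L2_inner[OF L2_ghat[OF k']]])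
    then show ?thesis using inner_matrix_vector[of x T "?V *v y"]
      by (simp add: Tsym inner_diff_left matrix_vector_mul_assoc)
  qed
  then have "(T ** ?V) *v y = ?V *v y" for y by (metis vector_eq_ldot)
  then have "T ** ?V = ?V" by (simp add: matrix_eq)
  then show ?thesis by (simp add: T_def matrix_mul_assoc)
qed

section \<open>The quadratic form of the asymptotic covariance\<close>

lemma L2_R:
  assumes k: "k \<in> {1..K}"
  shows "L2 (kernel_app (R k t) g)"
proof -
  have m: "kernel_app (R k t) g \<in> borel_measurable borel" by (rule kernel_app_measurable[OF R_pkernel[OF k] g])
  have i: "integrable \<pi> (\<lambda>x. (rate (t div K) * H k x)\<^sup>2)" using H_sq[OF k] by (simp add: power_mult_distrib)
  have "integrable \<pi> (\<lambda>x. (norm (kernel_app (R k t) g x))\<^sup>2)"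
  proof (rule Bochner_Integration.integrable_bound[OF i])
    show "(\<lambda>x. (norm (kernel_app (R k t) g x))\<^sup>2) \<in> borel_measurable \<pi>" using meas_pi[OF m] by measurable
    show "AE x in \<pi>. norm ((norm (kernel_app (R k t) g x))\<^sup>2) \<le> norm ((rate (t div K) * H k x)\<^sup>2)"
      using good_AE[OF k]
    proof eventually_elim
      case (elim x)
      show ?case using power_mono[OF norm_R[OF k elim, of t] norm_ge_zero, of 2] by simp
    qed
  qed
  then show ?thesis using m by (simp add: L2_def)
qed

lemma L2_norm_g: "L2 (\<lambda>x. norm (g x))" by (rule L2_norm[OF L2_g])

lemma L2_H: "k \<in> {1..K} \<Longrightarrow> L2 (H k)" using H_meas H_sq by (simp add: L2_real)

lemma norm_autocov:
  assumes k: "k \<in> {1..K}"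
  shows "norm (autocov \<pi> K Q g k t) \<le> rate (t div K) * (2 * (\<integral>x. norm (g x) * H k x \<partial>\<pi>))"
proof -
  let ?r = "kernel_app (R k t) g"
  have i: "integrable \<pi> (\<lambda>x. outer (g x) (?r x) + outer (?r x) (g x))"
    by (intro Bochner_Integration.integrable_add outer_integrable L2_g L2_R k)
  have "norm (autocov \<pi> K Q g k t) \<le> (\<integral>x. norm (outer (g x) (?r x) + outer (?r x) (g x)) \<partial>\<pi>)"
    unfolding autocov_def by (rule integral_norm_bound)
  also have "\<dots> \<le> (\<integral>x. rate (t div K) * (2 * (norm (g x) * H k x)) \<partial>\<pi>)"
  proof (rule integral_mono_AE)
    show "AE x in \<pi>. norm (outer (g x) (?r x) + outer (?r x) (g x)) \<le> rate (t div K) * (2 * (norm (g x) * H k x))"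
      using good_AE[OF k]
    proof eventually_elim
      case (elim x)
      have "norm (outer (g x) (?r x) + outer (?r x) (g x)) \<le> norm (g x) * norm (?r x) + norm (?r x) * norm (g x)"
        by (rule order_trans[OF norm_triangle_ineq]) (simp add: norm_outer)
      also have "\<dots> = 2 * (norm (g x) * norm (?r x))" by simp
      also have "\<dots> \<le> 2 * (norm (g x) * (rate (t div K) * H k x))"
        by (intro mult_left_mono norm_R k elim) auto
      finally show ?case by (simp add: mult_ac)
    qed
  qed (use i L2_mult[OF L2_norm_g L2_H[OF k]] in auto)
  finally show ?thesis by simp
qed

lemma summable_autocov: "k \<in> {1..K} \<Longrightarrow> summable (\<lambda>t. autocov \<pi> K Q g k (Suc t))"
proof -
  assume k: "k \<in> {1..K}"
  have "summable (\<lambda>t. rate (t div K) * (2 * (\<integral>x. norm (g x) * H k x \<partial>\<pi>)))" using summable_rate by (rule summable_mult2)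
  then have "summable (autocov \<pi> K Q g k)"
    by (rule summable_comparison_test'[of _ 0]) (rule norm_autocov[OF k])
  then show ?thesis by (subst summable_Suc_iff)
qed

lemma autocov_form:
  assumes k: "k \<in> {1..K}"
  shows "a \<bullet> (autocov \<pi> K Q g k t *v a) = 2 * (\<integral>x. (a \<bullet> g x) * (a \<bullet> kernel_app (R k t) g x) \<partial>\<pi>)"
proof -
  let ?r = "kernel_app (R k t) g"
  have i: "integrable \<pi> (\<lambda>x. outer (g x) (?r x) + outer (?r x) (g x))"
    by (intro Bochner_Integration.integrable_add outer_integrable L2_g L2_R k)
  have "a \<bullet> (autocov \<pi> K Q g k t *v a) = (\<integral>x. a \<bullet> ((outer (g x) (?r x) + outer (?r x) (g x)) *v a) \<partial>\<pi>)"
    unfolding autocov_def by (rule integral_bounded_linear[OF bounded_linear_matrix_form i, symmetric])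
  also have "\<dots> = (\<integral>x. 2 * ((a \<bullet> g x) * (a \<bullet> ?r x)) \<partial>\<pi>)"
    by (intro Bochner_Integration.integral_cong refl) (simp add: matrix_vector_mult_add_rdistrib inner_add_right inner_outer)
  finally show ?thesis by simp
qed

text \<open>Integration term by term, dominated by \<open>rate (t div K)\<close> times a multiple of
  the integrable product of \<open>norm g\<close> and \<open>H k\<close>.\<close>

lemma integral_g_ghat:
  assumes k: "k \<in> {1..K}"
  shows "(\<integral>x. (a \<bullet> g x) * (a \<bullet> ghat K Q g k x) \<partial>\<pi>) = (\<integral>x. (a \<bullet> g x)\<^sup>2 \<partial>\<pi>) + (\<Sum>t. \<integral>x. (a \<bullet> g x) * (a \<bullet> kernel_app (R k (Suc t)) g x) \<partial>\<pi>)"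
proof -
  let ?F = "\<lambda>t x. (a \<bullet> g x) * (a \<bullet> kernel_app (R k t) g x)"
  let ?B = "\<lambda>x. (norm a)\<^sup>2 * (norm (g x) * H k x)"
  have Fi: "integrable \<pi> (?F t)" for t by (intro L2_mult L2_inner L2_g L2_R k)
  have Bi: "integrable \<pi> ?B" using L2_mult[OF L2_norm_g L2_H[OF k]] by simp
  have bound: "AE x in \<pi>. norm (?F t x) \<le> rate (t div K) * ?B x" for t
    using good_AE[OF k]
  proof eventually_elim
    case (elim x)
    have "norm (?F t x) = \<bar>a \<bullet> g x\<bar> * \<bar>a \<bullet> kernel_app (R k t) g x\<bar>" by (simp add: abs_mult)
    also have "\<dots> \<le> (norm a * norm (g x)) * (norm a * norm (kernel_app (R k t) g x))"
      by (intro mult_mono Cauchy_Schwarz_ineq2) auto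
    also have "\<dots> \<le> (norm a * norm (g x)) * (norm a * (rate (t div K) * H k x))"
      by (intro mult_left_mono norm_R k elim) auto
    finally show ?case by (simp add: power2_eq_square mult_ac)
  qed
  have sumI: "summable (\<lambda>t. \<integral>x. norm (?F t x) \<partial>\<pi>)"
  proof (rule summable_comparison_test'[of _ 0])
    show "summable (\<lambda>t. rate (t div K) * (\<integral>x. ?B x \<partial>\<pi>))" using summable_rate by (rule summable_mult2)
    fix t
    have "(\<integral>x. norm (?F t x) \<partial>\<pi>) \<le> (\<integral>x. rate (t div K) * ?B x \<partial>\<pi>)"
      by (rule integral_mono_AE[OF integrable_norm[OF Fi] integrable_mult_right[OF Bi] bound])
    then show "norm (\<integral>x. norm (?F t x) \<partial>\<pi>) \<le> rate (t div K) * (\<integral>x. ?B x \<partial>\<pi>)" by simp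
  qed
  have aeS: "AE x in \<pi>. summable (\<lambda>t. norm (?F t x))"
    using good_AE[OF k]
  proof eventually_elim
    case (elim x)
    have "summable (\<lambda>t. (norm a * norm (g x)) * (norm a * norm (kernel_app (R k t) g x)))"
      by (intro summable_mult summable_R k elim)
    then show ?case
      by (rule summable_comparison_test'[of _ 0]) (auto simp: abs_mult intro!: mult_mono Cauchy_Schwarz_ineq2)
  qed
  have "(\<integral>x. (a \<bullet> g x) * (a \<bullet> ghat K Q g k x) \<partial>\<pi>) = (\<integral>x. (\<Sum>t. ?F t x) \<partial>\<pi>)"
  proof (rule integral_cong_AE)
    show "AE x in \<pi>. (a \<bullet> g x) * (a \<bullet> ghat K Q g k x) = (\<Sum>t. ?F t x)"
      using good_AE[OF k]
    proof eventually_elim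
      case (elim x)
      have "a \<bullet> ghat K Q g k x = (\<Sum>t. a \<bullet> kernel_app (R k t) g x)"
        unfolding ghat_def by (rule bounded_linear.suminf[OF bounded_linear_inner_right summable_R(2)[OF k elim]])
      then show ?case
        using suminf_mult[OF bounded_linear.summable[OF bounded_linear_inner_right summable_R(2)[OF k elim]]] by simp
    qed
    show "(\<lambda>x. \<Sum>t. ?F t x) \<in> borel_measurable \<pi>" using Fi by (intro borel_measurable_suminf) auto
    show "(\<lambda>x. (a \<bullet> g x) * (a \<bullet> ghat K Q g k x)) \<in> borel_measurable \<pi>"
      by (intro borel_measurable_times L2_meas L2_inner L2_g L2_ghat k)
  qed
  also have "\<dots> = (\<Sum>t. \<integral>x. ?F t x \<partial>\<pi>)" by (rule integral_suminf[OF Fi aeS sumI])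
  also have "\<dots> = (\<Sum>t. \<integral>x. ?F (Suc t) x \<partial>\<pi>) + (\<integral>x. ?F 0 x \<partial>\<pi>)"
  proof -
    have "summable (\<lambda>t. \<integral>x. ?F t x \<partial>\<pi>)"
      by (rule summable_comparison_test'[OF sumI, of 0]) simp
    from suminf_split_head[OF this] show ?thesis by simp
  qed
  also have "(\<integral>x. ?F 0 x \<partial>\<pi>) = (\<integral>x. (a \<bullet> g x)\<^sup>2 \<partial>\<pi>)"
  proof -
    have "kernel_app (R k 0) g x = g x" for x unfolding R_0 kernel_app_def by (rule integral_return) (use g in auto)
    then show ?thesis by (simp add: power2_eq_square)
  qed
  finally show ?thesis by simp
qed

text \<open>The projection of \<open>h\<^sub>k = ghat\<^sub>k - C\<^sub>k\<^sup>T f\<close> on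
  \<open>a\<close>, with the matrix moved to the other side of the inner product.\<close>

definition hdir :: "(nat \<Rightarrow> real^'d^'p) \<Rightarrow> real^'d \<Rightarrow> nat \<Rightarrow> 'a \<Rightarrow> real" where
  "hdir C a k x = a \<bullet> ghat K Q g k x - (C k *v a) \<bullet> f x"

lemma L2_hdir: "k \<in> {1..K} \<Longrightarrow> L2 (hdir C a k)"
  using L2_combine[OF L2_inner[OF L2_ghat, of k a] L2_inner[OF L2_f, of "C k *v a"], of "- 1"]
  by (simp add: hdir_def[abs_def])

text \<open>By the Poisson equation \<open>Q k\<close> maps \<open>ghat\<close> at the next phase to
  \<open>ghat\<close> at phase \<open>k\<close> minus \<open>g\<close>. Summed over the cycle the
  squares of \<open>ghat\<close> cancel by reindexing, leaving twice the mean of \<open>g\<close>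
  times \<open>ghat\<close> minus that of the square of \<open>g\<close>; the series for
  \<open>ghat\<close> turns this into autocovariances.\<close>

lemma cform_ghat_sum:
  "(\<Sum>k=1..K. cform k (\<lambda>x. a \<bullet> ghat K Q g (sweep_next K k) x) (\<lambda>x. a \<bullet> ghat K Q g (sweep_next K k) x))
   = (\<Sum>k=1..K. (\<integral>x. (a \<bullet> g x)\<^sup>2 \<partial>\<pi>) + (\<Sum>t. a \<bullet> (autocov \<pi> K Q g k (Suc t) *v a)))"
proof -
  let ?G = "\<lambda>k x. a \<bullet> ghat K Q g k x" and ?g = "\<lambda>x. a \<bullet> g x"
  have "cform k (?G (sweep_next K k)) (?G (sweep_next K k)) = (\<integral>x. (?G (sweep_next K k) x)\<^sup>2 \<partial>\<pi>) - (\<integral>x. (?G k x - ?g x)\<^sup>2 \<partial>\<pi>)"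
    if k: "k \<in> {1..K}" for k
  proof -
    have k': "sweep_next K k \<in> {1..K}" using k by (rule sweep_next_in)
    have "AE x in \<pi>. kernel_app (Q k) (?G (sweep_next K k)) x = ?G k x - ?g x"
      using poisson[OF k] kernel_inner_AE[OF k L2_ghat[OF k'], of a]
      by eventually_elim (simp add: inner_add_right)
    then have "AE x in \<pi>. kernel_app (Q k) (?G (sweep_next K k)) x * kernel_app (Q k) (?G (sweep_next K k)) x = (?G k x - ?g x)\<^sup>2"
      by eventually_elim (simp add: power2_eq_square)
    moreover have "(\<lambda>x. kernel_app (Q k) (?G (sweep_next K k)) x * kernel_app (Q k) (?G (sweep_next K k)) x) \<in> borel_measurable \<pi>"
      by (intro borel_measurable_times L2_meas L2_kernel_real k L2_inner L2_ghat k')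
    moreover have "(\<lambda>x. (?G k x - ?g x)\<^sup>2) \<in> borel_measurable \<pi>"
      by (intro borel_measurable_power borel_measurable_diff L2_meas L2_inner L2_ghat L2_g k)
    ultimately show ?thesis unfolding cform_def
      by (subst integral_cong_AE) (simp_all add: power2_eq_square)
  qed
  then have "(\<Sum>k=1..K. cform k (?G (sweep_next K k)) (?G (sweep_next K k)))
    = (\<Sum>k=1..K. (\<integral>x. (?G (sweep_next K k) x)\<^sup>2 \<partial>\<pi>)) - (\<Sum>k=1..K. \<integral>x. (?G k x - ?g x)\<^sup>2 \<partial>\<pi>)"
    by (simp add: sum_subtractf)
  also have "(\<Sum>k=1..K. (\<integral>x. (?G (sweep_next K k) x)\<^sup>2 \<partial>\<pi>)) = (\<Sum>k=1..K. (\<integral>x. (?G k x)\<^sup>2 \<partial>\<pi>))"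
    by (rule sum_sweep_next)
  also have "(\<Sum>k=1..K. (\<integral>x. (?G k x)\<^sup>2 \<partial>\<pi>)) - (\<Sum>k=1..K. \<integral>x. (?G k x - ?g x)\<^sup>2 \<partial>\<pi>)
    = (\<Sum>k=1..K. (\<integral>x. (a \<bullet> g x)\<^sup>2 \<partial>\<pi>) + (\<Sum>t. a \<bullet> (autocov \<pi> K Q g k (Suc t) *v a)))"
    unfolding sum_subtractf[symmetric]
  proof (rule sum.cong[OF refl])
    fix k assume k: "k \<in> {1..K}"
    have i: "integrable \<pi> (\<lambda>x. (?G k x)\<^sup>2)" "integrable \<pi> (\<lambda>x. (?g x)\<^sup>2)" "integrable \<pi> (\<lambda>x. ?g x * ?G k x)"
      using L2_mult[OF L2_inner[OF L2_ghat[OF k]] L2_inner[OF L2_ghat[OF k]], of a a]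
        L2_mult[OF L2_inner[OF L2_g] L2_inner[OF L2_g], of a a]
        L2_mult[OF L2_inner[OF L2_g] L2_inner[OF L2_ghat[OF k]], of a a] by (simp_all add: power2_eq_square)
    have "(\<integral>x. (?G k x - ?g x)\<^sup>2 \<partial>\<pi>) = (\<integral>x. (?G k x)\<^sup>2 + (?g x)\<^sup>2 - 2 * (?g x * ?G k x) \<partial>\<pi>)"
      by (simp add: power2_diff mult_ac)
    also have "\<dots> = (\<integral>x. (?G k x)\<^sup>2 \<partial>\<pi>) + (\<integral>x. (?g x)\<^sup>2 \<partial>\<pi>) - 2 * (\<integral>x. ?g x * ?G k x \<partial>\<pi>)"
      using i by simp
    finally have e: "(\<integral>x. (?G k x)\<^sup>2 \<partial>\<pi>) - (\<integral>x. (?G k x - ?g x)\<^sup>2 \<partial>\<pi>) = 2 * (\<integral>x. ?g x * ?G k x \<partial>\<pi>) - (\<integral>x. (?g x)\<^sup>2 \<partial>\<pi>)" by simp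
    have s: "summable (\<lambda>t. a \<bullet> (autocov \<pi> K Q g k (Suc t) *v a))"
      by (rule bounded_linear.summable[OF bounded_linear_matrix_form summable_autocov[OF k]])
    have "2 * (\<Sum>t. \<integral>x. (a \<bullet> g x) * (a \<bullet> kernel_app (R k (Suc t)) g x) \<partial>\<pi>) = (\<Sum>t. a \<bullet> (autocov \<pi> K Q g k (Suc t) *v a))"
    proof -
      have "(\<integral>x. (a \<bullet> g x) * (a \<bullet> kernel_app (R k (Suc t)) g x) \<partial>\<pi>) = (1 / 2) * (a \<bullet> (autocov \<pi> K Q g k (Suc t) *v a))" for t
        unfolding autocov_form[OF k] by simp
      then have "(\<Sum>t. \<integral>x. (a \<bullet> g x) * (a \<bullet> kernel_app (R k (Suc t)) g x) \<partial>\<pi>) = (\<Sum>t. (1 / 2) * (a \<bullet> (autocov \<pi> K Q g k (Suc t) *v a)))"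
        by (simp only:)
      also have "\<dots> = (1 / 2) * (\<Sum>t. a \<bullet> (autocov \<pi> K Q g k (Suc t) *v a))" by (rule suminf_mult[OF s])
      finally show ?thesis by simp
    qed
    then show "(\<integral>x. (?G k x)\<^sup>2 \<partial>\<pi>) - (\<integral>x. (?G k x - ?g x)\<^sup>2 \<partial>\<pi>) = (\<integral>x. (a \<bullet> g x)\<^sup>2 \<partial>\<pi>) + (\<Sum>t. a \<bullet> (autocov \<pi> K Q g k (Suc t) *v a))"
      unfolding e integral_g_ghat[OF k] by simp
  qed
  finally show ?thesis .
qed

text \<open>Identifies the formula for the covariance with the mean variance of the martingale
  increments over one cycle. \<open>cform_ghat_sum\<close> is the case without control variates;
  expanding the form at the difference of \<open>?G\<close> and \<open>?F\<close> supplies the terms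
  with \<open>U\<close> and \<open>V\<close>.\<close>

lemma asymp_cov_form:
  "a \<bullet> (asymp_cov \<pi> K Q g f C *v a) = (\<Sum>k=1..K. cform k (hdir C a (sweep_next K k)) (hdir C a (sweep_next K k))) / real K"
proof -
  interpret bl: bounded_linear "\<lambda>M :: real^'d^'d. a \<bullet> (M *v a)" by (rule bounded_linear_matrix_form)
  let ?U = "U_mat \<pi> Q f" and ?V = "V_mat \<pi> K Q g f" and ?C = "\<lambda>k. C (sweep_next K k)"
  let ?G = "\<lambda>k x. a \<bullet> ghat K Q g (sweep_next K k) x" and ?F = "\<lambda>k x. (?C k *v a) \<bullet> f x"
  have gg: "a \<bullet> ((\<integral>x. outer (g x) (g x) \<partial>\<pi>) *v a) = (\<integral>x. (a \<bullet> g x)\<^sup>2 \<partial>\<pi>)"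
    using integral_bounded_linear[OF bounded_linear_matrix_form[of a a] outer_integrable[OF L2_g L2_g]]
    by (simp add: inner_outer power2_eq_square)
  have ac: "a \<bullet> ((\<Sum>t. autocov \<pi> K Q g k (Suc t)) *v a) = (\<Sum>t. a \<bullet> (autocov \<pi> K Q g k (Suc t) *v a))" if "k \<in> {1..K}" for k
    by (rule bounded_linear.suminf[OF bounded_linear_matrix_form summable_autocov[OF that]])
  have cv: "a \<bullet> ((transpose (?C k) ** ?U k ** ?C k - transpose (?C k) ** ?V k - transpose (?V k) ** ?C k) *v a)
     = cform k (hdir C a (sweep_next K k)) (hdir C a (sweep_next K k)) - cform k (?G k) (?G k)" if k: "k \<in> {1..K}" for k
  proof -
    have k': "sweep_next K k \<in> {1..K}" using k by (rule sweep_next_in)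
    have 1: "a \<bullet> ((transpose (?C k) ** ?U k ** ?C k) *v a) = cform k (?F k) (?F k)"
      unfolding U_form[OF k, symmetric] matrix_vector_mul_assoc[symmetric]
      by (simp only: inner_matrix_vector[of a "transpose (?C k)"] transpose_transpose)
    have 2: "a \<bullet> ((transpose (?C k) ** ?V k) *v a) = cform k (?F k) (?G k)"
      unfolding V_form[OF k, symmetric] matrix_vector_mul_assoc[symmetric]
      by (simp only: inner_matrix_vector[of a "transpose (?C k)"] transpose_transpose)
    have 3: "a \<bullet> ((transpose (?V k) ** ?C k) *v a) = cform k (?F k) (?G k)"
      unfolding V_form[OF k, symmetric] matrix_vector_mul_assoc[symmetric]
      by (simp only: inner_matrix_vector[of a "transpose (?V k)"] transpose_transpose) (rule inner_commute)
    have "hdir C a (sweep_next K k) = (\<lambda>x. ?G k x + (- 1) * ?F k x)" by (simp add: hdir_def fun_eq_iff)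
    then have "cform k (hdir C a (sweep_next K k)) (hdir C a (sweep_next K k)) = cform k (?G k) (?G k) - 2 * cform k (?G k) (?F k) + cform k (?F k) (?F k)"
      using cform_square[OF k L2_inner[OF L2_ghat[OF k'], of a] L2_inner[OF L2_f, of "?C k *v a"], of "- 1"] by simp
    then show ?thesis unfolding bl.diff 1 2 3 by (simp add: cform_sym)
  qed
  have "a \<bullet> (asymp_cov \<pi> K Q g f C *v a) = (\<integral>x. (a \<bullet> g x)\<^sup>2 \<partial>\<pi>)
     + (1 / real K) * (\<Sum>k=1..K. \<Sum>t. a \<bullet> (autocov \<pi> K Q g k (Suc t) *v a))
     + (1 / real K) * (\<Sum>k=1..K. cform k (hdir C a (sweep_next K k)) (hdir C a (sweep_next K k)) - cform k (?G k) (?G k))"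
    unfolding asymp_cov_def bl.add bl.scaleR bl.sum gg using ac cv by simp
  also have "(\<Sum>k=1..K. cform k (hdir C a (sweep_next K k)) (hdir C a (sweep_next K k)) - cform k (?G k) (?G k))
    = (\<Sum>k=1..K. cform k (hdir C a (sweep_next K k)) (hdir C a (sweep_next K k)))
      - (real K * (\<integral>x. (a \<bullet> g x)\<^sup>2 \<partial>\<pi>) + (\<Sum>k=1..K. \<Sum>t. a \<bullet> (autocov \<pi> K Q g k (Suc t) *v a)))"
    unfolding sum_subtractf cform_ghat_sum by (simp add: sum.distrib)
  finally show ?thesis using K by (simp add: field_simps)
qed

lemma transpose_linear: "bounded_linear (transpose :: real^'n^'m \<Rightarrow> real^'m^'n)"
  by (intro linear_conv_bounded_linear[THEN iffD1] linearI) (simp_all add: transpose_def vec_eq_iff)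

lemma asymp_cov_sym: "transpose (asymp_cov \<pi> K Q g f C) = asymp_cov \<pi> K Q g f C"
proof -
  interpret tr: bounded_linear "transpose :: real^'d^'d \<Rightarrow> real^'d^'d" by (rule transpose_linear)
  have 1: "transpose (\<integral>x. outer (g x) (g x) \<partial>\<pi>) = (\<integral>x. outer (g x) (g x) \<partial>\<pi>)"
    using integral_bounded_linear[OF tr.bounded_linear_axioms outer_integrable[OF L2_g L2_g]] by (simp add: transpose_outer)
  have 2: "transpose (\<Sum>t. autocov \<pi> K Q g k (Suc t)) = (\<Sum>t. autocov \<pi> K Q g k (Suc t))" if k: "k \<in> {1..K}" for k
  proof -
    have "transpose (autocov \<pi> K Q g k t) = autocov \<pi> K Q g k t" for t
    proof -
      have i: "integrable \<pi> (\<lambda>x. outer (g x) (kernel_app (R k t) g x) + outer (kernel_app (R k t) g x) (g x))"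
        by (intro Bochner_Integration.integrable_add outer_integrable L2_g L2_R k)
      show ?thesis unfolding autocov_def
        using integral_bounded_linear[OF tr.bounded_linear_axioms i] by (simp add: tr.add transpose_outer add.commute)
    qed
    then show ?thesis using bounded_linear.suminf[OF tr.bounded_linear_axioms summable_autocov[OF k]] by simp
  qed
  show ?thesis unfolding asymp_cov_def tr.add tr.scaleR tr.sum tr.diff 1
    by (simp add: 2 U_sym matrix_transpose_mul transpose_transpose matrix_mul_assoc add.commute algebra_simps)
qed

lemma asymp_cov_psd: "pos_semidef (asymp_cov \<pi> K Q g f C)"
  unfolding pos_semidef_def asymp_cov_form
  by (intro conjI allI asymp_cov_sym divide_nonneg_nonneg sum_nonneg cform_nonneg L2_hdir sweep_next_in) auto

text \<open>The phases separate, each carrying its own matrix. The normal equations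
  \<open>U ** Ct = V\<close> make \<open>hdir\<close> for \<open>Ct\<close> orthogonal, with respect
  to \<open>cform k\<close>, to every linear combination of \<open>f\<close>, so any other choice
  adds a nonnegative square.\<close>

lemma asymp_cov_minimal:
  assumes Ct: "\<And>k. k \<in> {1..K} \<Longrightarrow> Ct (sweep_next K k) = pseudoinverse (U_mat \<pi> Q f k) ** V_mat \<pi> K Q g f k"
  shows "loewner_le (asymp_cov \<pi> K Q g f Ct) (asymp_cov \<pi> K Q g f C')"
  unfolding loewner_le_def pos_semidef_def
proof (intro conjI allI)
  let ?U = "U_mat \<pi> Q f" and ?V = "V_mat \<pi> K Q g f"
  show "transpose (asymp_cov \<pi> K Q g f C' - asymp_cov \<pi> K Q g f Ct) = asymp_cov \<pi> K Q g f C' - asymp_cov \<pi> K Q g f Ct"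
    using linear_diff[OF bounded_linear.linear[OF transpose_linear], of "asymp_cov \<pi> K Q g f C'" "asymp_cov \<pi> K Q g f Ct"] by (simp add: asymp_cov_sym)
  fix a
  have "cform k (hdir Ct a (sweep_next K k)) (hdir Ct a (sweep_next K k)) \<le> cform k (hdir C' a (sweep_next K k)) (hdir C' a (sweep_next K k))"
    if k: "k \<in> {1..K}" for k
  proof -
    have k': "sweep_next K k \<in> {1..K}" using k by (rule sweep_next_in)
    let ?h = "hdir Ct a (sweep_next K k)" and ?ct = "Ct (sweep_next K k) *v a" and ?c = "C' (sweep_next K k) *v a"
    let ?e = "?c - ?ct" and ?G = "\<lambda>x. a \<bullet> ghat K Q g (sweep_next K k) x"
    have h': "hdir C' a (sweep_next K k) = (\<lambda>x. ?h x + (- 1) * (?e \<bullet> f x))" by (simp add: hdir_def fun_eq_iff inner_diff_left)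
    have "?U k *v ?ct = ?V k *v a" unfolding Ct[OF k] using pseudoinverse_solves[OF k] by (simp add: matrix_vector_mul_assoc)
    then have eq: "cform k (\<lambda>x. ?e \<bullet> f x) (\<lambda>x. ?ct \<bullet> f x) = cform k (\<lambda>x. ?e \<bullet> f x) ?G"
      unfolding U_form[OF k, symmetric] V_form[OF k, symmetric] by simp
    have "?h = (\<lambda>x. ?G x + (- 1) * (?ct \<bullet> f x))" by (simp add: hdir_def fun_eq_iff)
    then have "cform k ?h (\<lambda>x. ?e \<bullet> f x) = cform k ?G (\<lambda>x. ?e \<bullet> f x) + (- 1) * cform k (\<lambda>x. ?ct \<bullet> f x) (\<lambda>x. ?e \<bullet> f x)"
      using cform_combine[OF k L2_inner[OF L2_ghat[OF k'], of a] L2_inner[OF L2_f, of ?ct] L2_inner[OF L2_f, of ?e], of "- 1"] by simp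
    then have "cform k ?h (\<lambda>x. ?e \<bullet> f x) = 0" using eq by (simp add: cform_sym)
    then show ?thesis unfolding h'
      using cform_square[OF k L2_hdir[OF k', of Ct a] L2_inner[OF L2_f, of ?e], of "- 1"] cform_nonneg[OF k L2_inner[OF L2_f], of ?e] by simp
  qed
  then have "a \<bullet> (asymp_cov \<pi> K Q g f Ct *v a) \<le> a \<bullet> (asymp_cov \<pi> K Q g f C' *v a)"
    unfolding asymp_cov_form using K by (intro divide_right_mono sum_mono) auto
  then show "0 \<le> a \<bullet> ((asymp_cov \<pi> K Q g f C' - asymp_cov \<pi> K Q g f Ct) *v a)"
    by (simp add: matrix_vector_mult_diff_rdistrib inner_diff_right)
qed

end

section \<open>Limit law of the sweep chain\<close>

context sweep_setup
begin

interpretation pi: prob_space \<pi> by (rule prob_pi)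

section \<open>Time indices and phases of the chain\<close>

lemma one_in: "(1::nat) \<in> {1..K}" using K by simp

abbreviation phase where "phase j \<equiv> nxt j 1"

lemma phase_in: "phase j \<in> {1..K}" by (rule sweep_next_funpow_in[OF one_in])

lemma phase_period: "phase (j + K) = phase j"
  unfolding sweep_next_funpow[OF one_in] by simp

lemma sum_phase: "(\<Sum>j<K. F (phase j)) = (\<Sum>k=1..K. F k)"
proof -
  have "phase j = Suc j" if "j < K" for j
    using sweep_next_funpow[OF one_in, of j] that by simp
  then have "(\<Sum>j<K. F (phase j)) = (\<Sum>j<K. F (Suc j))"
    by (intro sum.cong refl) (simp only: lessThan_iff)
  also have "\<dots> = (\<Sum>k=1..K. F k)" by (simp add: sum.atLeast_Suc_atMost_Suc_shift atLeast0LessThan[symmetric] sum.shift_bounds_Suc_ivl[symmetric] atLeastLessThanSuc_atLeastAtMost)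
  finally show ?thesis .
qed

definition increment :: "(nat \<Rightarrow> real^'d^'p) \<Rightarrow> real^'d \<Rightarrow> nat \<Rightarrow> 'a \<Rightarrow> real" where
  "increment C a j x = a \<bullet> (g x - transpose (C (phase j)) *v f x
        + transpose (C (phase (j + 1))) *v kernel_app (Q (phase j)) f x)"

lemma increment_eq:
  "increment C a j x = a \<bullet> g x - (C (phase j) *v a) \<bullet> f x + (C (phase (Suc j)) *v a) \<bullet> kernel_app (Q (phase j)) f x"
  unfolding increment_def inner_add_right inner_diff_right inner_matrix_vector transpose_transpose by simp

lemma increment_measurable: "increment C a j \<in> borel_measurable borel"
  unfolding increment_eq[abs_def]
  by (intro borel_measurable_add borel_measurable_diff borel_measurable_inner borel_measurable_const g f
      kernel_app_measurable[OF Q[OF phase_in]])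

text \<open>In the difference of \<open>hdir\<close> and its one-step forecast the two values of
  \<open>ghat\<close> combine to \<open>g\<close> by the Poisson equation, and the terms in
  \<open>f\<close> reproduce the control variate.\<close>

lemma increment_AE:
  "AE x in \<pi>. increment C a j x = hdir C a (phase j) x - kernel_app (Q (phase j)) (hdir C a (phase (Suc j))) x"
proof -
  let ?k = "phase j"
  have k: "?k \<in> {1..K}" and k': "sweep_next K ?k \<in> {1..K}" using phase_in sweep_next_in by blast+
  let ?c = "C (sweep_next K ?k) *v a"
  have h: "hdir C a (sweep_next K ?k) = (\<lambda>x. a \<bullet> ghat K Q g (sweep_next K ?k) x + (- 1) * (?c \<bullet> f x))"
    by (simp add: hdir_def fun_eq_iff)
  show ?thesis
    using poisson[OF k] kernel_inner_AE[OF k L2_ghat[OF k'], of a] kernel_inner_AE[OF k L2_f, of ?c]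
      kernel_combine_AE[OF k L2_inner[OF L2_ghat[OF k'], of a] L2_inner[OF L2_f, of ?c], of "- 1"]
  proof eventually_elim
    case (elim x)
    have "kernel_app (Q ?k) (hdir C a (phase (Suc j))) x = a \<bullet> kernel_app (Q ?k) (ghat K Q g (sweep_next K ?k)) x - ?c \<bullet> kernel_app (Q ?k) f x"
    proof -
      have "phase (Suc j) = sweep_next K ?k" by (simp only: funpow.simps comp_apply)
      then show ?thesis unfolding elim(2,3) by (simp only: h elim(4))
    qed
    then show ?case unfolding increment_eq hdir_def[of C a ?k] elim(1) by (simp add: inner_add_right)
  qed
qed

lemma scalar_clt:
  assumes chain: "sweep_chain M K Q \<nu> X"
  shows "(\<lambda>n. \<integral>w. iexp (1 / sqrt (real n) * (\<Sum>t\<in>{0..<n}. increment C a t (X t w))) \<partial>M)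
    \<longlonglongrightarrow> of_real (exp (- (a \<bullet> (asymp_cov \<pi> K Q g f C *v a)) / 2))"
proof -
  let ?P = "\<lambda>j. Q (phase j)" and ?h = "\<lambda>j. hdir C a (phase j)"
  interpret ps: periodic_sweep \<pi> ?P ?h K
  proof (rule periodic_sweep.intro)
    fix j
    show "stationary \<pi> (Q (phase j))" by (rule statQ'[OF phase_in])
    show "Q (phase (j + K)) = Q (phase j)" "hdir C a (phase (j + K)) = hdir C a (phase j)"
      unfolding phase_period by (rule refl)+
    show "hdir C a (phase j) \<in> borel_measurable borel" "integrable \<pi> (\<lambda>x. (hdir C a (phase j) x)\<^sup>2)"
      using L2_hdir[OF phase_in] by (simp_all add: L2_real)
  qed (use K in simp)
  \<comment> \<open>The abstract iteration agrees with the sweep kernels on bounded functions, the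
    class for which mixing and total variation are stated.\<close>
  have iter: "u \<in> borel_measurable borel \<Longrightarrow> (\<And>x. \<bar>u x\<bar> \<le> B) \<Longrightarrow> ps.iter j m u = kernel_app (R (phase j) m) u" for j m B and u :: "'a \<Rightarrow> real"
  proof (induction m arbitrary: u)
    case 0
    have "kernel_app (R (phase j) 0) u x = u x" for x
      unfolding R_0 kernel_app_def by (rule integral_return) (use 0 in auto)
    then show ?case by (intro ext) (simp only: ps.iter.simps)
  next
    case (Suc m)
    have nx: "nxt m (phase j) = phase (j + m)" by (simp add: funpow_add[symmetric, THEN fun_cong, unfolded comp_def] add.commute)
    have ub: "norm (u x) \<le> B" for x using Suc.prems by simp
    have eq: "R (phase j) (Suc m) = (\<lambda>x. R (phase j) m x \<bind> Q (phase (j + m)))"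
      by (rule ext) (simp only: R_snoc[OF phase_in] nx)
    have "kernel_app (R (phase j) (Suc m)) u x = kernel_app (R (phase j) m) (kernel_app (Q (phase (j + m))) u) x" for x
      using pkernel_bounded_integrable[OF R_pkernel[OF phase_in] Suc.prems(1) ub, of j "Suc m" x]
      unfolding eq by (intro kernel_app_bind R_pkernel phase_in Q)
    moreover have "ps.iter j m (kernel_app (Q (phase (j + m))) u) = kernel_app (R (phase j) m) (kernel_app (Q (phase (j + m))) u)"
    proof (rule Suc.IH)
      show "kernel_app (Q (phase (j + m))) u \<in> borel_measurable borel" by (rule kernel_app_measurable[OF Q[OF phase_in] Suc.prems(1)])
      show "\<bar>kernel_app (Q (phase (j + m))) u x\<bar> \<le> B" for x using norm_kernel_app_bound[OF Q[OF phase_in] ub] by simp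
    qed
    ultimately show ?case by (intro ext) (simp only: ps.iter.simps)
  qed
  interpret mx: mixing_sweep \<pi> ?P ?h K
  proof
    fix j and u :: "'a \<Rightarrow> real" and B :: real
    assume u: "u \<in> borel_measurable borel" "\<And>x. \<bar>u x\<bar> \<le> B"
    \<comment> \<open>Rescaling by \<open>B'\<close> brings \<open>u\<close> below 1, hence below
      \<open>W\<close>, where the ergodic bound applies; the added 1 keeps \<open>B'\<close>
      positive when \<open>B = 0\<close>.\<close>
    define B' where "B' = \<bar>B\<bar> + 1"
    have B': "0 < B'" by (simp add: B'_def)
    let ?k = "phase j"
    have bound: "norm (\<integral>x. \<bar>ps.iter j (K * q) u x - (\<integral>y. u y \<partial>\<pi>)\<bar> \<partial>\<pi>) \<le> rate q * (B' * (\<integral>x. W ?k x \<partial>\<pi>))" for q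
    proof -
      let ?r = "kernel_app (R ?k (K * q)) u" and ?v = "\<lambda>x. (1 / B') * u x"
      have ui: "integrable \<pi> u" using u by (intro ps.bounded_integrable[of _ B]) auto
      have ri: "integrable \<pi> ?r" by (rule stationary.integrable_kernel_app(1)[OF statR[OF phase_in] ui])
      have pt: "\<bar>?r x - (\<integral>y. u y \<partial>\<pi>)\<bar> \<le> rate q * (B' * W ?k x)" for x
      proof -
        have vW: "\<bar>?v y\<bar> \<le> W ?k y" for y
        proof -
          have "\<bar>u y\<bar> \<le> B'" using u(2)[of y] by (simp add: B'_def)
          then have "\<bar>?v y\<bar> \<le> 1" using B' by (simp add: abs_mult)
          then show ?thesis using W1[OF phase_in[of j], of y] by linarith
        qed
        have "\<bar>kernel_app (R ?k (K * q)) ?v x - (\<integral>y. ?v y \<partial>\<pi>)\<bar> \<le> rate q * W ?k x"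
          by (rule rate(3)[OF phase_in _ vW]) (use u in simp)
        moreover have "kernel_app (R ?k (K * q)) ?v x = (1 / B') * ?r x"
          unfolding kernel_app_def by (rule integral_mult_right_zero)
        moreover have "(\<integral>y. ?v y \<partial>\<pi>) = (1 / B') * (\<integral>y. u y \<partial>\<pi>)" by (rule integral_mult_right_zero)
        ultimately have "\<bar>(1 / B') * (?r x - (\<integral>y. u y \<partial>\<pi>))\<bar> \<le> rate q * W ?k x" by (simp add: right_diff_distrib)
        then have "\<bar>?r x - (\<integral>y. u y \<partial>\<pi>)\<bar> / B' \<le> rate q * W ?k x" using B' by (simp add: abs_mult)
        then show ?thesis using B' by (simp add: pos_divide_le_eq mult_ac)
      qed
      have "(\<integral>x. \<bar>?r x - (\<integral>y. u y \<partial>\<pi>)\<bar> \<partial>\<pi>) \<le> (\<integral>x. rate q * (B' * W ?k x) \<partial>\<pi>)"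
        using ri W_int[OF phase_in] pt by (intro integral_mono) auto
      then show ?thesis unfolding iter[OF u] by simp
    qed
    have "(\<lambda>q. rate q * (B' * (\<integral>x. W ?k x \<partial>\<pi>))) \<longlonglongrightarrow> 0 * (B' * (\<integral>x. W ?k x \<partial>\<pi>))"
      by (intro tendsto_mult_right summable_LIMSEQ_zero rate)
    then have lim: "(\<lambda>q. rate q * (B' * (\<integral>x. W ?k x \<partial>\<pi>))) \<longlonglongrightarrow> 0" by simp
    show "(\<lambda>q. \<integral>x. \<bar>ps.iter j (K * q) u x - (\<integral>y. u y \<partial>\<pi>)\<bar> \<partial>\<pi>) \<longlonglongrightarrow> 0"
      by (rule Lim_null_comparison[OF always_eventually[OF allI[OF bound]] lim])
  qed
  interpret ob: observed_sweep \<pi> ?P ?h K "increment C a"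
    by unfold_locales (rule increment_measurable, rule increment_AE)
  interpret pa: sweep_path M X ?P
  proof (rule sweep_path.intro)
    show "prob_space M" using chain by (simp add: sweep_chain_def)
    show "X j \<in> borel_measurable M" for j using chain by (simp add: sweep_chain_def)
    show "pkernel (?P j)" for j by (rule Q[OF phase_in])
    show "AE w in M. real_cond_exp M (history M X j) (\<lambda>w. indicator B (X (Suc j) w)) w = measure (?P j (X j w)) B"
      if "B \<in> sets borel" for B j
      using chain that by (simp add: sweep_chain_def)
  qed
  \<comment> \<open>The chain starts at phase 1, so its distance from stationarity is governed by
    \<open>W 1\<close>.\<close>
  interpret sc: sweep_clt \<pi> ?P ?h K "increment C a" M X \<nu> rate "W 1"
  proof
    show "distr M borel (X 0) = \<nu>" using chain by (simp add: sweep_chain_def)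
    show "rate \<longlonglongrightarrow> 0" by (rule summable_LIMSEQ_zero[OF rate(1)])
    show "W 1 \<in> borel_measurable borel" by (rule W[OF one_in])
    fix u :: "'a \<Rightarrow> real" and q x
    assume u: "u \<in> borel_measurable borel" "\<And>x. \<bar>u x\<bar> \<le> 1"
    have "\<bar>kernel_app (R 1 (K * q)) u x - (\<integral>y. u y \<partial>\<pi>)\<bar> \<le> rate q * W 1 x"
      by (rule rate(3)[OF one_in u(1) order_trans[OF u(2) W1[OF one_in]]])
    then show "\<bar>ps.iter 0 (K * q) u x - (\<integral>y. u y \<partial>\<pi>)\<bar> \<le> rate q * W 1 x"
      unfolding iter[OF u] by simp
  qed
  have "mx.asym_var = (\<Sum>j<K. cform (phase j) (hdir C a (sweep_next K (phase j))) (hdir C a (sweep_next K (phase j)))) / real K"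
    unfolding mx.asym_var_def ps.mvar_eq cform_def power2_eq_square by simp
  also have "\<dots> = a \<bullet> (asymp_cov \<pi> K Q g f C *v a)"
    unfolding asymp_cov_form
    by (subst sum_phase[of "\<lambda>k. cform k (hdir C a (sweep_next K k)) (hdir C a (sweep_next K k))"]) (rule refl)
  \<comment> \<open>The vector \<open>a\<close> already carries the scale, so frequency 1
    suffices.\<close>
  finally show ?thesis using sc.characteristic_function_tendsto[of 1] by simp
qed

text \<open>Cramer-Wold: the characteristic function of the vector at \<open>t\<close> is the scalar
  one for the direction \<open>a = t\<close>, and the multivariate continuity theorem turns its
  pointwise convergence into weak convergence.\<close>

lemma sweep_weak_limit:
  assumes chain: "sweep_chain M K Q \<nu> X"
  shows "\<exists>\<mu>. prob_space \<mu> \<and> sets \<mu> = sets borel \<and>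
        (\<forall>t. vec_char \<mu> t = of_real (exp (- (t \<bullet> (asymp_cov \<pi> K Q g f C *v t)) / 2))) \<and>
        weakly_converges
          (\<lambda>n. distr M borel (\<lambda>w. (1 / sqrt (real n)) *\<^sub>R cv_sum K Q g f C X n w)) \<mu>"
proof -
  interpret M: prob_space M using chain by (simp add: sweep_chain_def)
  have X: "X t \<in> borel_measurable M" for t using chain by (simp add: sweep_chain_def)
  obtain \<mu> where \<mu>: "prob_space \<mu>" "sets \<mu> = sets borel"
    "\<And>t. vec_char \<mu> t = of_real (exp (- (t \<bullet> (asymp_cov \<pi> K Q g f C *v t)) / 2))"
    using gaussian_ex[OF asymp_cov_psd] by blast
  let ?S = "\<lambda>n w. (1 / sqrt (real n)) *\<^sub>R cv_sum K Q g f C X n w"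
  have mult: "(\<lambda>x. A *v u x) \<in> borel_measurable borel" if "u \<in> borel_measurable borel" for A :: "real^'p^'d" and u :: "'a \<Rightarrow> real^'p"
    by (rule measurable_compose[OF that]) (intro borel_measurable_continuous_onI matrix_vector_mult_linear_continuous_on)
  have "cv_sum K Q g f C X n \<in> borel_measurable M" for n
    unfolding cv_sum_def
    by (intro borel_measurable_sum borel_measurable_add borel_measurable_diff measurable_compose[OF X g]
        measurable_compose[OF X mult[OF f]] measurable_compose[OF X mult[OF kernel_app_measurable[OF Q[OF phase_in] f]]])
  then have Sm: "?S n \<in> borel_measurable M" for n by (intro borel_measurable_scaleR) auto
  have "weakly_converges (\<lambda>n. distr M borel (?S n)) \<mu>"
  proof (rule vec_levy_continuity)
    fix t
    have tS: "t \<bullet> ?S n w = 1 / sqrt (real n) * (\<Sum>j\<in>{0..<n}. increment C t j (X j w))" for n w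
      unfolding cv_sum_def inner_scaleR_right inner_sum_right increment_def atLeast0LessThan ..
    have "vec_char (distr M borel (?S n)) t = (\<integral>w. iexp (t \<bullet> ?S n w) \<partial>M)" for n
      unfolding vec_char_def
      by (rule integral_distr[OF Sm]) (intro borel_measurable_continuous_onI continuous_intros)
    then show "(\<lambda>n. vec_char (distr M borel (?S n)) t) \<longlonglongrightarrow> vec_char \<mu> t"
      unfolding \<mu>(3) using scalar_clt[OF chain, of C t] by (simp only: tS)
  qed (simp_all add: M.prob_space_distr Sm \<mu>)
  then show ?thesis using \<mu> by blast
qed

end

text \<open>The first clause certifies that the series behind \<open>ghat\<close> and
  \<open>asymp_cov\<close> converge, and that the kernel integrals of \<open>g\<close> exist almost
  everywhere, so that these are not default values. In the last clause every phase in
  \<open>{1..K}\<close> is constrained, because \<open>sweep_next K\<close> permutes this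
  set.\<close>

theorem theorem1:
  fixes \<pi> \<psi> \<nu> :: "'a::polish_space measure"
    and K :: nat
    and Q :: "nat \<Rightarrow> 'a \<Rightarrow> 'a measure"
    and g :: "'a \<Rightarrow> real^'d"
    and f :: "'a \<Rightarrow> real^'p"
    and D :: "nat \<Rightarrow> 'a set"
    and lam b :: "nat \<Rightarrow> real"
    and W :: "nat \<Rightarrow> 'a \<Rightarrow> real"
    and C :: "nat \<Rightarrow> real^'d^'p"
    and M :: "'w measure"
    and X :: "nat \<Rightarrow> 'w \<Rightarrow> 'a"
  assumes "prob_space \<pi>" and "sets \<pi> = sets borel"
    and "K \<ge> 1"
    and "\<And>k. k \<in> {1..K} \<Longrightarrow> Q k \<in> borel \<rightarrow>\<^sub>M prob_algebra borel"
    and "g \<in> borel_measurable borel" and "f \<in> borel_measurable borel"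
    and "\<And>k. k \<in> {1..K} \<Longrightarrow> stationary_kernel \<pi> (Q k)"
    and "prob_space \<psi>" and "sets \<psi> = sets borel"
    and "\<And>k A x. k \<in> {1..K} \<Longrightarrow> A \<in> sets borel \<Longrightarrow> emeasure \<psi> A > 0 \<Longrightarrow>
           \<exists>t>0. emeasure (sweep_kernel K Q k (K * t) x) A > 0"
    and "\<And>k. k \<in> {1..K} \<Longrightarrow> small_set (sweep_kernel K Q k K) (D k)"
    and "\<And>k. k \<in> {1..K} \<Longrightarrow> lam k < 1"
    and "\<And>k. k \<in> {1..K} \<Longrightarrow> W k \<in> borel_measurable borel"
    and "\<And>k x. k \<in> {1..K} \<Longrightarrow> W k x \<ge> 1"
    and "\<And>k x. k \<in> {1..K} \<Longrightarrow>
           (\<integral>\<^sup>+ y. ennreal (W k y) \<partial>(sweep_kernel K Q k K x))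
             \<le> ennreal (lam k * W k x + b k * indicator (D k) x)"
    and "\<And>k. k \<in> {1..K} \<Longrightarrow> aperiodic_kernel (sweep_kernel K Q k K) \<psi>"
    and "\<And>k. k \<in> {1..K} \<Longrightarrow> (\<integral>\<^sup>+ x. ennreal ((W k x)\<^sup>2) \<partial>\<pi>) < \<infinity>"
    and "\<And>k x a. k \<in> {1..K} \<Longrightarrow> norm a \<le> 1 \<Longrightarrow> \<bar>a \<bullet> g x\<bar> \<le> W k x"
    and "(\<integral>x. g x \<partial>\<pi>) = 0"
    and "(\<integral>\<^sup>+ x. ennreal (f x \<bullet> f x) \<partial>\<pi>) < \<infinity>"
    and "prob_space \<nu>" and "sets \<nu> = sets borel"
    and "sweep_chain M K Q \<nu> X"
  shows
    "(\<forall>k\<in>{1..K}.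
        (AE x in \<pi>. (\<forall>t. integrable (sweep_kernel K Q k t x) g) \<and>
                     summable (\<lambda>t. kernel_app (sweep_kernel K Q k t) g x)) \<and>
        integrable \<pi> (\<lambda>x. (norm (ghat K Q g k x))\<^sup>2) \<and>
        summable (\<lambda>t. autocov \<pi> K Q g k (Suc t))) \<and>
     (\<exists>\<mu>. prob_space \<mu> \<and> sets \<mu> = sets borel \<and>
        (\<forall>t. vec_char \<mu> t = of_real (exp (- (t \<bullet> (asymp_cov \<pi> K Q g f C *v t)) / 2))) \<and>
        weakly_converges
          (\<lambda>n. distr M borel (\<lambda>w. (1 / sqrt (real n)) *\<^sub>R cv_sum K Q g f C X n w)) \<mu>) \<and>
     (\<forall>Ct. (\<forall>k\<in>{1..K}. Ct (sweep_next K k) = pseudoinverse (U_mat \<pi> Q f k) ** V_mat \<pi> K Q g f k) \<longrightarrow>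
        (\<forall>C'. loewner_le (asymp_cov \<pi> K Q g f Ct) (asymp_cov \<pi> K Q g f C')))"
proof -
  interpret sweep_setup \<pi> \<psi> K Q g f D lam b W
    by (rule sweep_setup.intro) (fact assms)+
  show ?thesis
  proof (intro conjI ballI allI impI)
    fix k assume k: "k \<in> {1..K}"
    show "AE x in \<pi>. (\<forall>t. integrable (sweep_kernel K Q k t x) g) \<and> summable (\<lambda>t. kernel_app (sweep_kernel K Q k t) g x)"
      using good_AE[OF k] by eventually_elim (use good_integrable[OF k] summable_R(2)[OF k] in blast)
    show "integrable \<pi> (\<lambda>x. (norm (ghat K Q g k x))\<^sup>2)" by (rule ghat_sq[OF k])
    show "summable (\<lambda>t. autocov \<pi> K Q g k (Suc t))" by (rule summable_autocov[OF k])
  next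
    show "\<exists>\<mu>. prob_space \<mu> \<and> sets \<mu> = sets borel \<and>
        (\<forall>t. vec_char \<mu> t = of_real (exp (- (t \<bullet> (asymp_cov \<pi> K Q g f C *v t)) / 2))) \<and>
        weakly_converges
          (\<lambda>n. distr M borel (\<lambda>w. (1 / sqrt (real n)) *\<^sub>R cv_sum K Q g f C X n w)) \<mu>"
      by (rule sweep_weak_limit[OF assms(23)])
  next
    fix Ct C' :: "nat \<Rightarrow> real^'d^'p"
    assume "\<forall>k\<in>{1..K}. Ct (sweep_next K k) = pseudoinverse (U_mat \<pi> Q f k) ** V_mat \<pi> K Q g f k"
    then show "loewner_le (asymp_cov \<pi> K Q g f Ct) (asymp_cov \<pi> K Q g f C')"
      by (intro asymp_cov_minimal) blast
  qed
qed

end
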